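(* Let $H$ be a semisimple Hopf algebra of dimension $54$ over $k$. Then $H$ is not simple, that is, $H$ contains a proper normal Hopf subalgebra.
   Context: $k$ is an algebraically closed field of characteristic zero. A Hopf subalgebra $A\subseteq H$ is normal if $h_1A\mathcal S(h_2)\subseteq A$ for all $h\in H$. Proper means different from $k1$ and from $H$. *)

theory Defs
  imports
    "HOL-Computational_Algebra.Polynomial"
    "HOL-Library.Poly_Mapping"
begin

section \<open>Tensor squares and cubes\<close>

text \<open>
  The free vector space on a set \<open>'x\<close> is \<open>'x \<Rightarrow>\<^sub>0 'k\<close>. For a vector space \<open>V\<close> with
  scalar multiplication \<open>scale\<close>, the spaces \<open>V \<otimes> V\<close> and \<open>V \<otimes> V \<otimes> V\<close> are the quotients of the
  free vector spaces on \<open>V \<times> V\<close> and \<open>V \<times> V \<times> V\<close> by the span of the multilinearity relations.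
  The quotient depends on the term \<open>scale\<close>, hence it cannot be a type. Elements of a tensor
  power are therefore given by formal sums of pure tensors, and equality in the tensor power
  is the congruence \<open>tensor2_eq\<close> or \<open>tensor3_eq\<close>.
\<close>

definition free_scale :: "'k \<Rightarrow> ('x \<Rightarrow>\<^sub>0 'k) \<Rightarrow> ('x \<Rightarrow>\<^sub>0 'k::field)" where
  "free_scale c t = Poly_Mapping.map (\<lambda>a. c * a) t"

lemma lookup_free_scale [simp]:
  "Poly_Mapping.lookup (free_scale c t) x = c * Poly_Mapping.lookup t x"
  unfolding free_scale_def by transfer (auto simp: when_def)

lemma vector_space_free_scale: "vector_space (free_scale :: 'k::field \<Rightarrow> ('x \<Rightarrow>\<^sub>0 'k) \<Rightarrow> _)"
  by unfold_locales (auto intro!: poly_mapping_eqI simp: lookup_add algebra_simps)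

text \<open>The linear map from the free vector space that extends a function on the generators.\<close>

definition lin_ext :: "('k::field \<Rightarrow> 'v \<Rightarrow> 'v::ab_group_add) \<Rightarrow> ('x \<Rightarrow> 'v) \<Rightarrow> ('x \<Rightarrow>\<^sub>0 'k) \<Rightarrow> 'v" where
  "lin_ext scale f t =
     (\<Sum>x\<in>Poly_Mapping.keys t. scale (Poly_Mapping.lookup t x) (f x))"

definition pure2 :: "'v \<Rightarrow> 'v \<Rightarrow> ('v \<times> 'v \<Rightarrow>\<^sub>0 'k::field)" where
  "pure2 x y = Poly_Mapping.single (x, y) 1"

definition pure3 :: "'v \<Rightarrow> 'v \<Rightarrow> 'v \<Rightarrow> ('v \<times> 'v \<times> 'v \<Rightarrow>\<^sub>0 'k::field)" where
  "pure3 x y z = Poly_Mapping.single (x, y, z) 1"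

definition tensor2_rels :: "('k::field \<Rightarrow> 'v \<Rightarrow> 'v::ab_group_add) \<Rightarrow> ('v \<times> 'v \<Rightarrow>\<^sub>0 'k) set" where
  "tensor2_rels scale =
     {pure2 (x + x') y - (pure2 x y + pure2 x' y) | x x' y. True} \<union>
     {pure2 x (y + y') - (pure2 x y + pure2 x y') | x y y'. True} \<union>
     {pure2 (scale c x) y - free_scale c (pure2 x y) | c x y. True} \<union>
     {pure2 x (scale c y) - free_scale c (pure2 x y) | c x y. True}"

definition tensor3_rels :: "('k::field \<Rightarrow> 'v \<Rightarrow> 'v::ab_group_add) \<Rightarrow> ('v \<times> 'v \<times> 'v \<Rightarrow>\<^sub>0 'k) set" where
  "tensor3_rels scale =
     {pure3 (x + x') y z - (pure3 x y z + pure3 x' y z) | x x' y z. True} \<union>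
     {pure3 x (y + y') z - (pure3 x y z + pure3 x y' z) | x y y' z. True} \<union>
     {pure3 x y (z + z') - (pure3 x y z + pure3 x y z') | x y z z'. True} \<union>
     {pure3 (scale c x) y z - free_scale c (pure3 x y z) | c x y z. True} \<union>
     {pure3 x (scale c y) z - free_scale c (pure3 x y z) | c x y z. True} \<union>
     {pure3 x y (scale c z) - free_scale c (pure3 x y z) | c x y z. True}"

definition tensor2_eq ::
    "('k::field \<Rightarrow> 'v \<Rightarrow> 'v::ab_group_add) \<Rightarrow> ('v \<times> 'v \<Rightarrow>\<^sub>0 'k) \<Rightarrow> ('v \<times> 'v \<Rightarrow>\<^sub>0 'k) \<Rightarrow> bool" where
  "tensor2_eq scale t u \<longleftrightarrow> t - u \<in> module.span free_scale (tensor2_rels scale)"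

definition tensor3_eq ::
    "('k::field \<Rightarrow> 'v \<Rightarrow> 'v::ab_group_add) \<Rightarrow>
     ('v \<times> 'v \<times> 'v \<Rightarrow>\<^sub>0 'k) \<Rightarrow> ('v \<times> 'v \<times> 'v \<Rightarrow>\<^sub>0 'k) \<Rightarrow> bool" where
  "tensor3_eq scale t u \<longleftrightarrow> t - u \<in> module.span free_scale (tensor3_rels scale)"

text \<open>The multiplication \<open>(a \<otimes> b) (c \<otimes> d) = a c \<otimes> b d\<close>.\<close>

definition tensor2_mult ::
    "('v::ring_1 \<times> 'v \<Rightarrow>\<^sub>0 'k::field) \<Rightarrow> ('v \<times> 'v \<Rightarrow>\<^sub>0 'k) \<Rightarrow> ('v \<times> 'v \<Rightarrow>\<^sub>0 'k)" where
  "tensor2_mult t u =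
     lin_ext free_scale (\<lambda>(a, b). lin_ext free_scale (\<lambda>(c, d). pure2 (a * c) (b * d)) u) t"

text \<open>
  The map \<open>lin_ext scale (\<lambda>(x, y). f x y)\<close> descends to the tensor square whenever \<open>f\<close> is bilinear.
\<close>

lemma lin_ext_superset:
  assumes "vector_space scale" "finite X" "Poly_Mapping.keys t \<subseteq> X"
  shows "lin_ext scale f t = (\<Sum>x\<in>X. scale (Poly_Mapping.lookup t x) (f x))"
proof -
  interpret vector_space scale by fact
  show ?thesis
    unfolding lin_ext_def using assms(2,3)
    by (intro sum.mono_neutral_left) (auto simp: in_keys_iff)
qed

lemma linear_lin_ext:
  assumes "vector_space scale"
  shows "Vector_Spaces.linear free_scale scale (lin_ext scale f)"
proof -
  interpret vector_space scale by fact
  show ?thesis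
  proof (rule Vector_Spaces.linear.intro)
    show "vector_space (free_scale :: 'a \<Rightarrow> ('c \<Rightarrow>\<^sub>0 'a) \<Rightarrow> _)"
      by (rule vector_space_free_scale)
    show "vector_space scale" by fact
    show "module_hom free_scale scale (lin_ext scale f)"
    proof (intro module_hom.intro module_hom_axioms.intro)
      show "module (free_scale :: 'a \<Rightarrow> ('c \<Rightarrow>\<^sub>0 'a) \<Rightarrow> _)"
        using vector_space_free_scale by (simp add: module_iff_vector_space)
      show "module scale" ..
      fix t u :: "'c \<Rightarrow>\<^sub>0 'a" and c :: 'a
      let ?X = "Poly_Mapping.keys t \<union> Poly_Mapping.keys u"
      have "lin_ext scale f (t + u) =
          (\<Sum>x\<in>?X. scale (Poly_Mapping.lookup (t + u) x) (f x))"
        using Poly_Mapping.keys_add[of t u] by (intro lin_ext_superset assms) auto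
      also have "\<dots> = (\<Sum>x\<in>?X. scale (Poly_Mapping.lookup t x) (f x)) +
          (\<Sum>x\<in>?X. scale (Poly_Mapping.lookup u x) (f x))"
        by (simp add: lookup_add scale_left_distrib sum.distrib)
      also have "\<dots> = lin_ext scale f t + lin_ext scale f u"
        by (simp add: lin_ext_superset[OF assms, of ?X])
      finally show "lin_ext scale f (t + u) = lin_ext scale f t + lin_ext scale f u" .
      have "lin_ext scale f (free_scale c t) =
          (\<Sum>x\<in>Poly_Mapping.keys t. scale (Poly_Mapping.lookup (free_scale c t) x) (f x))"
        by (intro lin_ext_superset assms) (auto simp: in_keys_iff)
      also have "\<dots> = scale c (lin_ext scale f t)"
        by (simp add: lin_ext_def scale_sum_right)
      finally show "lin_ext scale f (free_scale c t) = scale c (lin_ext scale f t)" .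
    qed
  qed
qed

lemma lin_ext_single:
  assumes "vector_space scale"
  shows "lin_ext scale f (Poly_Mapping.single x 1) = f x"
proof -
  interpret vector_space scale by fact
  show ?thesis by (simp add: lin_ext_def)
qed

lemma lin_ext_tensor2_cong:
  fixes scale :: "'k::field \<Rightarrow> 'v::ab_group_add \<Rightarrow> 'v"
    and scale' :: "'k \<Rightarrow> 'w::ab_group_add \<Rightarrow> 'w"
  assumes "\<And>y. Vector_Spaces.linear scale scale' (\<lambda>x. f x y)"
    and "\<And>x. Vector_Spaces.linear scale scale' (f x)"
    and "tensor2_eq scale t u"
  shows "lin_ext scale' (\<lambda>(x, y). f x y) t = lin_ext scale' (\<lambda>(x, y). f x y) u"
proof -
  let ?L = "lin_ext scale' (\<lambda>(x, y). f x y)"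
  have vs: "vector_space scale'"
    using assms(2) by (simp add: Vector_Spaces.linear_def)
  interpret L: Vector_Spaces.linear free_scale scale' ?L
    by (rule linear_lin_ext[OF vs])
  have *: "f (x + x') y = f x y + f x' y" "f x (y + y') = f x y + f x y'"
    "f (scale c x) y = scale' c (f x y)" "f x (scale c y) = scale' c (f x y)" for x x' y y' c
    using module_hom.add[OF Vector_Spaces.linear.axioms(3)[OF assms(1)]]
      module_hom.scale[OF Vector_Spaces.linear.axioms(3)[OF assms(1)]]
      module_hom.add[OF Vector_Spaces.linear.axioms(3)[OF assms(2)]]
      module_hom.scale[OF Vector_Spaces.linear.axioms(3)[OF assms(2)]] by auto
  have "?L r = 0" if "r \<in> tensor2_rels scale" for r
    using that unfolding tensor2_rels_def
    by (auto simp: L.add L.diff L.scale pure2_def lin_ext_single[OF vs] *)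
  then have "?L (t - u) = 0"
    using L.eq_0_on_span assms(3) unfolding tensor2_eq_def by blast
  then show ?thesis by (simp add: L.diff)
qed

section \<open>Hopf algebras\<close>

locale algebra_over =
  vector_space scale
  for scale :: "'k::field \<Rightarrow> 'h::ring_1 \<Rightarrow> 'h" +
  assumes scale_mult_left: "scale c (x * y) = scale c x * y"
    and scale_mult_right: "scale c (x * y) = x * scale c y"

text \<open>
  An algebra is semisimple if its left regular module is semisimple, that is, if every
  left ideal is a direct summand.
\<close>

context algebra_over
begin

definition left_ideal :: "'h set \<Rightarrow> bool" where
  "left_ideal I \<longleftrightarrow> subspace I \<and> (\<forall>h. \<forall>x\<in>I. h * x \<in> I)"

definition semisimple_algebra :: bool where
  "semisimple_algebra \<longleftrightarrow>
     (\<forall>I. left_ideal I \<longrightarrow>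
       (\<exists>J. left_ideal J \<and> I \<inter> J = {0} \<and> {x + y | x y. x \<in> I \<and> y \<in> J} = UNIV))"

end

text \<open>
  \<open>comult x\<close> is a formal sum representing \<open>\<Delta>(x) = x\<^sub>1 \<otimes> x\<^sub>2\<close>; only its class modulo
  \<open>tensor2_eq scale\<close> is meaningful, so the laws for \<open>comult\<close> are congruences.
\<close>

locale hopf_algebra =
  algebra_over scale
  for scale :: "'k::field \<Rightarrow> 'h::ring_1 \<Rightarrow> 'h" +
  fixes comult :: "'h \<Rightarrow> ('h \<times> 'h \<Rightarrow>\<^sub>0 'k)"
    and counit :: "'h \<Rightarrow> 'k"
    and antipode :: "'h \<Rightarrow> 'h"
  assumes comult_add: "tensor2_eq scale (comult (x + y)) (comult x + comult y)"
    and comult_scale: "tensor2_eq scale (comult (scale c x)) (free_scale c (comult x))"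
    and counit_linear: "Vector_Spaces.linear scale (*) counit"
    and coassoc:
      "tensor3_eq scale
         (lin_ext free_scale (\<lambda>(x, y). lin_ext free_scale (\<lambda>(x1, x2). pure3 x1 x2 y) (comult x)) (comult h))
         (lin_ext free_scale (\<lambda>(x, y). lin_ext free_scale (\<lambda>(y1, y2). pure3 x y1 y2) (comult y)) (comult h))"
    and counit_left: "lin_ext scale (\<lambda>(x, y). scale (counit x) y) (comult h) = h"
    and counit_right: "lin_ext scale (\<lambda>(x, y). scale (counit y) x) (comult h) = h"
    and comult_mult: "tensor2_eq scale (comult (x * y)) (tensor2_mult (comult x) (comult y))"
    and comult_one: "tensor2_eq scale (comult 1) (pure2 1 1)"
    and counit_mult: "counit (x * y) = counit x * counit y"
    and counit_one: "counit 1 = 1"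
    and antipode_linear: "Vector_Spaces.linear scale scale antipode"
    and antipode_left:
      "lin_ext scale (\<lambda>(x, y). antipode x * y) (comult h) = scale (counit h) 1"
    and antipode_right:
      "lin_ext scale (\<lambda>(x, y). x * antipode y) (comult h) = scale (counit h) 1"
begin

text \<open>The condition on \<open>comult\<close> says that \<open>\<Delta>(A)\<close> lies in the image of \<open>A \<otimes> A\<close> in \<open>H \<otimes> H\<close>.\<close>

definition hopf_subalgebra :: "'h set \<Rightarrow> bool" where
  "hopf_subalgebra A \<longleftrightarrow>
     subspace A \<and> 1 \<in> A \<and> (\<forall>a\<in>A. \<forall>b\<in>A. a * b \<in> A) \<and>
     (\<forall>a\<in>A. \<exists>t. Poly_Mapping.keys t \<subseteq> A \<times> A \<and> tensor2_eq scale (comult a) t) \<and>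
     (\<forall>a\<in>A. antipode a \<in> A)"

text \<open>\<open>h\<^sub>1 a S(h\<^sub>2)\<close>\<close>

definition adjoint_action :: "'h \<Rightarrow> 'h \<Rightarrow> 'h" where
  "adjoint_action h a = lin_ext scale (\<lambda>(x, y). x * a * antipode y) (comult h)"

definition normal_hopf_subalgebra :: "'h set \<Rightarrow> bool" where
  "normal_hopf_subalgebra A \<longleftrightarrow>
     hopf_subalgebra A \<and> (\<forall>h. \<forall>a\<in>A. adjoint_action h a \<in> A)"

definition proper_hopf_subalgebra :: "'h set \<Rightarrow> bool" where
  "proper_hopf_subalgebra A \<longleftrightarrow>
     hopf_subalgebra A \<and> A \<noteq> range (\<lambda>c. scale c 1) \<and> A \<noteq> UNIV"

end

end

theory Submission
  imports Defs "HOL-Algebra.Sylow" "HOL-Computational_Algebra.Computational_Algebra"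
begin

text \<open>
  Writing \<open>S\<^sup>2\<close> as the inner automorphism of an element \<open>u\<close>, the trace of \<open>S\<^sup>2\<close> becomes a sum of ratios of
  roots of unity, a positive integer; a comparison with the regular character forces \<open>S\<^sup>2 = id\<close>. The class
  equation then says that a simple Yetter--Drinfeld submodule of a Hopf subalgebra \<open>B\<close> has dimension
  dividing \<open>dim B\<close>. The kernel of the regular character is a Yetter--Drinfeld submodule of \<open>H\<close> of dimension 53,
  so it contains a simple \<open>V\<close> whose dimension divides 54 and is prime to 3, that is, 1 or 2.

  In dimension 1, \<open>V\<close> is spanned by a central grouplike element. In dimension 2, if \<open>V\<close> contains a
  grouplike element, then \<open>V\<close> is spanned by two commuting ones. Otherwise \<open>V\<close> has a basis \<open>z, w\<close> with \<open>z\<close>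
  central and \<open>w\<close> an eigenvector of \<open>ad\<close> with eigencharacter \<open>\<alpha>\<close>; unless \<open>H\<close> has a nontrivial central
  grouplike element, the coefficients of \<open>V\<close> generate a commutative Hopf subalgebra \<open>B\<close> on which \<open>\<alpha>\<close> is
  trivial. The product of \<open>dim B\<close> and the order of \<open>\<alpha>\<close>
  divides 54 and \<open>dim B\<close> is even, which leaves few cases; in each of them \<open>B\<close> is normal. If
  \<open>H\<close> itself is commutative, a subgroup of index 2 of its character group gives a central grouplike element.
\<close>

section \<open>Traces and finite-dimensional linear algebra\<close>

text \<open>A tensor square is a quotient by a congruence, not a type. Coideals, grouplike elements
  and Hopf subalgebras are therefore described by the operators x_1 f(x_2) and f(x_1) x_2 for
  functionals f, and many facts about them come from evaluating one trace in two ways; a rank is the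
  trace of an idempotent, and characteristic zero turns equations of traces into equations of
  dimensions. The character \<alpha> is controlled by the identity x = ad(x_1)(x_2), which S^2 = id
  makes available: applied to V and to products of its coefficients, it yields decisive values of
  \<alpha>. If d is the order of \<alpha>, translation by \<alpha> acts on the right ideal generated
  by the integral of B, of dimension 54 / dim B, and its fixed part is exactly one d-th of it; hence
  d dim B divides 54. If the product is 54, B is the whole fixed algebra of the translation, which
  ad preserves. Otherwise d = 3 and dim B = 6, and B is too small for its two-dimensional coideals:
  all coefficients of V are forced into an ad-stable subspace of B.\<close>

definition lin :: "('k \<Rightarrow> 'v::ab_group_add \<Rightarrow> 'v) \<Rightarrow> ('k \<Rightarrow> 'w::ab_group_add \<Rightarrow> 'w) \<Rightarrow> ('v \<Rightarrow> 'w) \<Rightarrow> bool" where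
  "lin s s' f \<longleftrightarrow> (\<forall>x y. f (x + y) = f x + f y) \<and> (\<forall>c x. f (s c x) = s' c (f x))"

lemma linI: "(\<And>x y. f (x + y) = f x + f y) \<Longrightarrow> (\<And>c x. f (s c x) = s' c (f x)) \<Longrightarrow> lin s s' f"
  by (simp add: lin_def)

lemma lin_add: "lin s s' f \<Longrightarrow> f (x + y) = f x + f y"
  and lin_scale: "lin s s' f \<Longrightarrow> f (s c x) = s' c (f x)"
  by (simp_all add: lin_def)

lemma lin_zero: "lin s s' f \<Longrightarrow> f 0 = 0"
  using lin_add[of s s' f 0 0] by simp

lemma lin_minus: "lin s s' f \<Longrightarrow> f (- x) = - f x"
  using lin_add[of s s' f x "- x"] lin_zero[of s s' f] by (simp add: eq_neg_iff_add_eq_0 add.commute)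

lemma lin_diff: "lin s s' f \<Longrightarrow> f (x - y) = f x - f y"
  using lin_add[of s s' f x "- y"] lin_minus[of s s' f y] by simp

lemma lin_sum: "lin s s' f \<Longrightarrow> f (sum g A) = (\<Sum>x\<in>A. f (g x))"
  by (induction A rule: infinite_finite_induct) (simp_all add: lin_zero lin_add)

lemma lin_comp: "lin s' s'' g \<Longrightarrow> lin s s' f \<Longrightarrow> lin s s'' (\<lambda>x. g (f x))"
  by (simp add: lin_def)

lemma lin_ident: "lin s s (\<lambda>x. x)"
  by (simp add: lin_def)

lemma (in vector_space) linear_iff_lin: "Vector_Spaces.linear scale scale f \<longleftrightarrow> lin scale scale f"
  using vector_space_axioms by (auto simp: Vector_Spaces.linear_iff lin_def)

locale vec_space = vector_space scale for scale :: "'a::field \<Rightarrow> 'b::ab_group_add \<Rightarrow> 'b"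
begin

abbreviation linE where "linE f \<equiv> lin scale scale f"
abbreviation linF where "linF f \<equiv> lin scale (*) f"

lemma lin_funpow: "linE f \<Longrightarrow> linE (f ^^ k)"
  by (induction k) (auto simp: lin_def)

lemma lin_span:
  assumes "linE f" "f ` B \<subseteq> W" "subspace W" "x \<in> span B"
  shows "f x \<in> W"
  using assms(4)
proof (induction x rule: span_induct_alt)
  case base
  show ?case using assms by (simp add: lin_zero[OF assms(1)] subspace_0)
next
  case (step c x y)
  then show ?case using assms
    by (auto simp: lin_add[OF assms(1)] lin_scale[OF assms(1)] intro!: subspace_add subspace_scale)
qed

lemma lin_eq_on_span:
  assumes "lin scale s f" "lin scale s g" "\<And>b. b \<in> B \<Longrightarrow> f b = g b" "x \<in> span B"
  shows "f x = g x"
  using assms(4)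
proof (induction x rule: span_induct_alt)
  case base
  show ?case by (simp add: lin_zero[OF assms(1)] lin_zero[OF assms(2)])
next
  case (step c x y)
  then show ?case using assms(3)
    by (simp add: lin_add[OF assms(1)] lin_scale[OF assms(1)] lin_add[OF assms(2)] lin_scale[OF assms(2)])
qed

lemma subspace_image_lin:
  assumes "linE f" "subspace W"
  shows "subspace (f ` W)"
proof (rule subspaceI)
  show "0 \<in> f ` W" using subspace_0[OF assms(2)] lin_zero[OF assms(1)] by force
  fix x y c assume "x \<in> f ` W" "y \<in> f ` W"
  then obtain a b where ab: "a \<in> W" "b \<in> W" "x = f a" "y = f b" by auto
  show "x + y \<in> f ` W" unfolding ab(3,4) lin_add[OF assms(1), symmetric]
    using subspace_add[OF assms(2)] ab by blast
  show "scale c x \<in> f ` W" unfolding ab(3,4) lin_scale[OF assms(1), symmetric]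
    using subspace_scale[OF assms(2)] ab by blast
qed

lemma lin_kernel_subspace: "lin scale s f \<Longrightarrow> (\<And>c. s c 0 = 0) \<Longrightarrow> subspace W \<Longrightarrow> subspace {x \<in> W. f x = 0}"
  by (rule subspaceI) (auto simp: lin_zero lin_add lin_scale subspace_0 subspace_add subspace_scale)

definition fdim :: "'b set \<Rightarrow> bool" where
  "fdim W \<longleftrightarrow> subspace W \<and> (\<exists>B. finite B \<and> W \<subseteq> span B)"

lemma fdim_subspace: "fdim W \<Longrightarrow> subspace W"
  by (simp add: fdim_def)

lemma fdim_subset: "fdim W \<Longrightarrow> subspace V \<Longrightarrow> V \<subseteq> W \<Longrightarrow> fdim V"
  by (auto simp: fdim_def)

definition bas :: "'b set \<Rightarrow> 'b set" where
  "bas W = (SOME B. B \<subseteq> W \<and> independent B \<and> W \<subseteq> span B \<and> card B = dim W)"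

lemma bas: "bas W \<subseteq> W" "independent (bas W)" "W \<subseteq> span (bas W)" "card (bas W) = dim W"
proof -
  have "\<exists>B. B \<subseteq> W \<and> independent B \<and> W \<subseteq> span B \<and> card B = dim W"
    using basis_exists[of W] by metis
  from someI_ex[OF this, folded bas_def]
  show "bas W \<subseteq> W" "independent (bas W)" "W \<subseteq> span (bas W)" "card (bas W) = dim W" by auto
qed

lemma span_bas: "subspace W \<Longrightarrow> span (bas W) = W"
  by (rule span_subspace) (use bas[of W] in auto)

lemma finite_bas: "fdim W \<Longrightarrow> finite (bas W)"
  by (meson fdim_def bas independent_span_bound order_trans span_mono)

text \<open>The basis of \<open>W\<close> is extended to the whole space, so that a coordinate is a
  functional everywhere and not only on \<open>W\<close>.\<close>

definition crd :: "'b set \<Rightarrow> 'b \<Rightarrow> 'b \<Rightarrow> 'a" where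
  "crd W b x = representation (extend_basis (bas W)) x b"

text \<open>The \<open>u k\<close> need not be independent and the functionals \<open>f k\<close> are defined on the whole space, so that
  a trace on \<open>W\<close> can be computed from a dual pair given by an integral.\<close>

definition frame :: "'b set \<Rightarrow> 'i set \<Rightarrow> ('i \<Rightarrow> 'b \<Rightarrow> 'a) \<Rightarrow> ('i \<Rightarrow> 'b) \<Rightarrow> bool" where
  "frame W K f u \<longleftrightarrow> finite K \<and> (\<forall>k\<in>K. linF (f k) \<and> u k \<in> W) \<and>
     (\<forall>x\<in>W. (\<Sum>k\<in>K. scale (f k x) (u k)) = x)"

definition trace :: "'b set \<Rightarrow> ('b \<Rightarrow> 'b) \<Rightarrow> 'a" where
  "trace W F = (\<Sum>b\<in>bas W. crd W b (F b))"

lemma lin_crd: "linF (crd W b)"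
  unfolding crd_def
  by (rule linI)
    (simp_all add: representation_add representation_scale span_extend_basis[OF bas(2)]
      independent_extend_basis[OF bas(2)])

lemma crd_expand:
  assumes "fdim W" "x \<in> W"
  shows "(\<Sum>b\<in>bas W. scale (crd W b x) b) = x"
proof -
  let ?E = "extend_basis (bas W)"
  have E: "independent ?E" "span ?E = UNIV" "bas W \<subseteq> ?E"
    using independent_extend_basis[OF bas(2)] span_extend_basis[OF bas(2)]
      extend_basis_superset[OF bas(2)] by auto
  have x: "x \<in> span (bas W)" using assms bas(3) by auto
  have "crd W b x = representation (bas W) x b" for b
    unfolding crd_def using representation_extend[OF E(1) x E(3)] by simp
  then show ?thesis
    using sum_representation_eq[OF bas(2) x finite_bas[OF assms(1)] order_refl] by simp
qed

lemma crd_bas: "b \<in> bas W \<Longrightarrow> c \<in> bas W \<Longrightarrow> crd W b c = (if b = c then 1 else 0)"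
  unfolding crd_def
  using representation_basis[OF independent_extend_basis[OF bas(2)], of c W]
    extend_basis_superset[OF bas(2), of W] by auto

lemma frame_bas: "fdim W \<Longrightarrow> frame W (bas W) (crd W) (\<lambda>b. b)"
  unfolding frame_def using finite_bas lin_crd bas(1) crd_expand by blast

lemma frame_expand:
  assumes "frame W K f u" "x \<in> W" "lin scale s F"
  shows "F x = (\<Sum>k\<in>K. s (f k x) (F (u k)))"
proof -
  have "F x = F (\<Sum>k\<in>K. scale (f k x) (u k))" using assms by (simp add: frame_def)
  also have "\<dots> = (\<Sum>k\<in>K. s (f k x) (F (u k)))" by (simp add: lin_sum[OF assms(3)] lin_scale[OF assms(3)])
  finally show ?thesis .
qed

text \<open>Expanding \<open>u k\<close> in the basis and swapping the sums leaves the coordinates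
  of \<open>F b\<close> taken through the frame, which reproduces them. An overcomplete family given
  by an integral can thus compute a trace.\<close>

lemma trace_frame:
  assumes "frame W K f u" "fdim W" "linE F" "F ` W \<subseteq> W"
  shows "trace W F = (\<Sum>k\<in>K. f k (F (u k)))"
proof -
  have "(\<Sum>k\<in>K. f k (F (u k))) = (\<Sum>k\<in>K. \<Sum>b\<in>bas W. crd W b (u k) * f k (F b))"
  proof (rule sum.cong[OF refl])
    fix k assume k: "k \<in> K"
    have "linF (\<lambda>x. f k (F x))" using assms(1,3) k lin_comp[of scale "(*)" "f k"] by (simp add: frame_def)
    then show "f k (F (u k)) = (\<Sum>b\<in>bas W. crd W b (u k) * f k (F b))"
      by (rule frame_expand[OF frame_bas[OF assms(2)], rotated]) (use assms(1) k in \<open>simp add: frame_def\<close>)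
  qed
  also have "\<dots> = (\<Sum>b\<in>bas W. \<Sum>k\<in>K. f k (F b) * crd W b (u k))"
    by (subst sum.swap) (simp add: mult.commute)
  also have "\<dots> = (\<Sum>b\<in>bas W. crd W b (F b))"
  proof (rule sum.cong[OF refl])
    fix b assume "b \<in> bas W"
    then have "F b \<in> W" using assms(4) bas(1) by auto
    from frame_expand[OF assms(1) this lin_crd, of W b]
    show "(\<Sum>k\<in>K. f k (F b) * crd W b (u k)) = crd W b (F b)" by simp
  qed
  finally show ?thesis by (simp add: trace_def)
qed

lemma trace_cong: "(\<And>x. x \<in> W \<Longrightarrow> F x = G x) \<Longrightarrow> trace W F = trace W G"
  unfolding trace_def using bas(1)[of W] by (intro sum.cong) auto

lemma trace_add: "trace W (\<lambda>x. F x + G x) = trace W F + trace W G"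
  by (simp add: trace_def lin_add[OF lin_crd] sum.distrib)

lemma trace_diff: "trace W (\<lambda>x. F x - G x) = trace W F - trace W G"
  by (simp add: trace_def lin_diff[OF lin_crd] sum_subtractf)

lemma trace_scale: "trace W (\<lambda>x. scale c (F x)) = c * trace W F"
  by (simp add: trace_def lin_scale[OF lin_crd] sum_distrib_left)

lemma trace_sum: "trace W (\<lambda>x. \<Sum>i\<in>I. F i x) = (\<Sum>i\<in>I. trace W (F i))"
  unfolding trace_def lin_sum[OF lin_crd] by (rule sum.swap)

lemma trace_cyc:
  assumes "fdim W" "linE F" "F ` W \<subseteq> W" "linE G" "G ` W \<subseteq> W"
  shows "trace W (\<lambda>x. F (G x)) = trace W (\<lambda>x. G (F x))"
proof -
  let ?B = "bas W"
  have *: "trace W (\<lambda>x. F (G x)) = (\<Sum>b\<in>?B. \<Sum>c\<in>?B. crd W c (G b) * crd W b (F c))"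
    if "linE F" "F ` W \<subseteq> W" "G ` W \<subseteq> W" for F G
    unfolding trace_def
  proof (rule sum.cong[OF refl])
    fix b assume "b \<in> ?B"
    then have "G b \<in> W" using that(3) bas(1) by auto
    from frame_expand[OF frame_bas[OF assms(1)] this lin_comp[OF lin_crd that(1)]]
    show "crd W b (F (G b)) = (\<Sum>c\<in>?B. crd W c (G b) * crd W b (F c))" .
  qed
  show ?thesis
    by (subst *[OF assms(2,3,5)], subst *[OF assms(4,5,3)], subst sum.swap) (simp add: mult.commute)
qed

lemma trace_id: "fdim W \<Longrightarrow> trace W (\<lambda>x. x) = of_nat (dim W)"
  by (simp add: trace_def crd_bas bas(4))

lemma trace_rank1:
  assumes "fdim W" "linF f" "v \<in> W"
  shows "trace W (\<lambda>x. scale (f x) v) = f v"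
proof -
  have "trace W (\<lambda>x. scale (f x) v) = (\<Sum>b\<in>bas W. crd W b v * f b)"
    by (simp add: trace_def lin_scale[OF lin_crd] mult.commute)
  also have "\<dots> = f v" using frame_expand[OF frame_bas[OF assms(1)] assms(3,2)] by simp
  finally show ?thesis .
qed

text \<open>The basis of \<open>V\<close> is expanded in that of \<open>W\<close>; after swapping
  the sums, \<open>F\<close> is applied to basis vectors of \<open>W\<close>, whose images already
  lie in \<open>V\<close>.\<close>

lemma trace_subspace:
  assumes "fdim W" "linE F" "subspace V" "V \<subseteq> W" "F ` W \<subseteq> V"
  shows "trace W F = trace V F"
proof -
  have V: "fdim V" using fdim_subset assms by blast
  have "trace V F = (\<Sum>b\<in>bas V. \<Sum>c\<in>bas W. crd W c b * crd V b (F c))"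
    unfolding trace_def
  proof (rule sum.cong[OF refl])
    fix b assume "b \<in> bas V"
    then have "b \<in> W" using bas(1) assms(4) by auto
    from frame_expand[OF frame_bas[OF assms(1)] this lin_comp[OF lin_crd assms(2)]]
    show "crd V b (F b) = (\<Sum>c\<in>bas W. crd W c b * crd V b (F c))" .
  qed
  also have "\<dots> = (\<Sum>c\<in>bas W. \<Sum>b\<in>bas V. crd V b (F c) * crd W c b)"
    by (subst sum.swap) (simp add: mult.commute)
  also have "\<dots> = trace W F"
    unfolding trace_def
  proof (rule sum.cong[OF refl])
    fix c assume "c \<in> bas W"
    then have "F c \<in> V" using assms(5) bas(1) by auto
    from frame_expand[OF frame_bas[OF V] this lin_crd, of W c]
    show "(\<Sum>b\<in>bas V. crd V b (F c) * crd W c b) = crd W c (F c)" by simp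
  qed
  finally show ?thesis by simp
qed

lemma trace_idem:
  assumes "fdim W" "linE F" "F ` W \<subseteq> W" "\<And>x. x \<in> W \<Longrightarrow> F (F x) = F x"
  shows "trace W F = of_nat (dim (F ` W))"
proof -
  have s: "subspace (F ` W)" using subspace_image_lin[OF assms(2)] fdim_subspace[OF assms(1)] by simp
  have "trace W F = trace (F ` W) F" using trace_subspace[OF assms(1,2) s assms(3)] by simp
  also have "\<dots> = trace (F ` W) (\<lambda>x. x)" by (rule trace_cong) (use assms(4) in auto)
  also have "\<dots> = of_nat (dim (F ` W))" by (rule trace_id) (use fdim_subset assms(1,3) s in blast)
  finally show ?thesis .
qed

lemma fdim_dim_0:
  assumes "fdim W" "dim W = 0"
  shows "W = {0}"
proof -
  have "bas W = {}" using assms finite_bas bas(4)[of W] by auto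
  then show ?thesis using span_bas[OF fdim_subspace[OF assms(1)]] by simp
qed

lemma fdim_dim_eq:
  assumes "fdim W" "subspace V" "V \<subseteq> W" "dim W \<le> dim V"
  shows "V = W"
proof (rule ccontr)
  assume "V \<noteq> W"
  then obtain x where x: "x \<in> W" "x \<notin> V" using assms(3) by auto
  have V: "fdim V" using fdim_subset assms by blast
  have i: "independent (insert x (bas V))"
    using x span_bas[OF assms(2)] bas(2)[of V] by (intro independent_insertI) auto
  have "card (insert x (bas V)) \<le> card (bas W)"
    by (rule independent_span_bound[OF finite_bas[OF assms(1)] i, THEN conjunct2])
      (use x(1) assms(3) bas(1)[of V] bas(3)[of W] in blast)
  moreover have "x \<notin> bas V" using x bas(1) by auto
  ultimately show False using assms(4) bas(4)[of V] bas(4)[of W] finite_bas[OF V] by simp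
qed

text \<open>The complementary projection has the kernel of \<open>F\<close> as its image, and the
  two traces add up to that of the identity. The equation lives in the field; characteristic zero
  brings it down to natural numbers in \<open>dim_direct_sum\<close>.\<close>

lemma dim_direct_sum_of_nat:
  assumes "fdim W" "linE F" "F ` W \<subseteq> W" "\<And>x. x \<in> W \<Longrightarrow> F (F x) = F x"
  shows "(of_nat (dim W) :: 'a) = of_nat (dim (F ` W) + dim {x \<in> W. F x = 0})"
proof -
  have G: "linE (\<lambda>x. x - F x)" by (rule linI) (simp_all add: lin_add[OF assms(2)] lin_scale[OF assms(2)] scale_right_diff_distrib)
  have sW: "subspace W" using assms(1) fdim_subspace by blast
  have im: "(\<lambda>x. x - F x) ` W = {x \<in> W. F x = 0}"
  proof (intro equalityI subsetI)
    fix y assume "y \<in> (\<lambda>x. x - F x) ` W"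
    then obtain x where x: "x \<in> W" "y = x - F x" by auto
    then have "F x \<in> W" using assms(3) by auto
    then show "y \<in> {x \<in> W. F x = 0}" using x assms(4) subspace_diff[OF sW] by (simp add: lin_diff[OF assms(2)])
  next
    fix y assume "y \<in> {x \<in> W. F x = 0}"
    then show "y \<in> (\<lambda>x. x - F x) ` W" by (intro image_eqI[of _ _ y]) auto
  qed
  have "trace W (\<lambda>x. x - F x) = of_nat (dim ((\<lambda>x. x - F x) ` W))"
  proof (rule trace_idem[OF assms(1) G])
    show "(\<lambda>x. x - F x) ` W \<subseteq> W" unfolding im by auto
    show "x - F x - F (x - F x) = x - F x" if "x \<in> W" for x
      using assms(4)[OF that] by (simp add: lin_diff[OF assms(2)])
  qed
  then have "of_nat (dim W) - trace W F = of_nat (dim {x \<in> W. F x = 0})"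
    unfolding im trace_diff trace_id[OF assms(1)] .
  then show ?thesis using trace_idem[OF assms] by (simp add: algebra_simps)
qed

section \<open>Polynomials in an endomorphism, and eigenvectors\<close>

definition pev :: "'a poly \<Rightarrow> ('b \<Rightarrow> 'b) \<Rightarrow> 'b \<Rightarrow> 'b" where
  "pev p F x = (\<Sum>i\<le>degree p. scale (coeff p i) ((F ^^ i) x))"

lemma pev_superset: "degree p \<le> N \<Longrightarrow> pev p F x = (\<Sum>i\<le>N. scale (coeff p i) ((F ^^ i) x))"
  unfolding pev_def by (rule sum.mono_neutral_left) (auto simp: coeff_eq_0)

lemma pev_linear_factor:
  assumes "linE F"
  shows "pev ([:- r, 1:] * q) F x = F (pev q F x) - scale r (pev q F x)"
proof -
  let ?N = "Suc (degree q)"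
  have d: "degree ([:- r, 1:] * q) \<le> ?N" using degree_mult_le[of "[:- r, 1:]" q] by simp
  have c: "coeff ([:- r, 1:] * q) i = (case i of 0 \<Rightarrow> 0 | Suc j \<Rightarrow> coeff q j) - r * coeff q i" for i
    by (simp add: coeff_pCons split: nat.splits)
  have "pev ([:- r, 1:] * q) F x = (\<Sum>i\<le>?N. scale (case i of 0 \<Rightarrow> 0 | Suc j \<Rightarrow> coeff q j) ((F ^^ i) x))
      - (\<Sum>i\<le>?N. scale (r * coeff q i) ((F ^^ i) x))"
    unfolding pev_superset[OF d] c by (simp add: scale_left_diff_distrib sum_subtractf)
  also have "(\<Sum>i\<le>?N. scale (case i of 0 \<Rightarrow> 0 | Suc j \<Rightarrow> coeff q j) ((F ^^ i) x)) = F (pev q F x)"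
    unfolding pev_def by (simp add: sum.atMost_Suc_shift lin_sum[OF assms] lin_scale[OF assms] del: sum.atMost_Suc)
  also have "(\<Sum>i\<le>?N. scale (r * coeff q i) ((F ^^ i) x)) = scale r (pev q F x)"
    unfolding pev_superset[of q ?N, OF le_SucI[OF order_refl]] by (simp add: scale_sum_right del: sum.atMost_Suc)
  finally show ?thesis .
qed

lemma pev_in:
  assumes "subspace W" "F ` W \<subseteq> W" "x \<in> W"
  shows "pev p F x \<in> W"
proof -
  have "(F ^^ i) x \<in> W" for i by (induction i) (use assms in auto)
  then show ?thesis unfolding pev_def using assms(1) by (intro subspace_sum subspace_scale)
qed

end

text \<open>More than \<open>dim W\<close> iterates of \<open>F\<close> at \<open>x\<close> cannot
  be independent. As dependence is a property of sets, a repetition among the iterates is treated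
  apart and gives a difference of two monomials.\<close>

lemma (in vec_space) pev_annihilator:
  assumes "fdim W" "F ` W \<subseteq> W" "x \<in> W"
  shows "\<exists>p. p \<noteq> 0 \<and> pev p F x = 0"
proof -
  let ?d = "dim W"
  have pw: "(F ^^ i) x \<in> W" for i by (induction i) (use assms in auto)
  show ?thesis
  proof (cases "inj_on (\<lambda>i. (F ^^ i) x) {..?d}")
    case False
    then obtain i j where ij: "i < j" "(F ^^ i) x = (F ^^ j) x"
      unfolding inj_on_def by (metis linorder_neqE_nat)
    let ?p = "monom 1 j - monom 1 i :: 'a poly"
    have "coeff ?p j = 1" using ij by simp
    then have "?p \<noteq> 0" by force
    moreover have "pev ?p F x = (\<Sum>k\<le>j. scale (coeff ?p k) ((F ^^ k) x))"
      by (rule pev_superset) (use ij in \<open>auto intro!: degree_diff_le degree_monom_le order_trans[OF degree_monom_le]\<close>)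
    moreover have "\<dots> = (\<Sum>k\<in>{i, j}. scale (coeff ?p k) ((F ^^ k) x))"
      by (rule sum.mono_neutral_right) (use ij in auto)
    ultimately show ?thesis using ij by (intro exI[of _ ?p]) simp
  next
    case True
    let ?S = "(\<lambda>i. (F ^^ i) x) ` {..?d}"
    have "dependent ?S"
    proof (rule ccontr)
      assume "independent ?S"
      from independent_span_bound[OF finite_bas[OF assms(1)] this]
      have "card ?S \<le> ?d" using pw bas(3)[of W] bas(4)[of W] by auto
      then show False using card_image[OF True] by simp
    qed
    then obtain u v where u: "v \<in> ?S" "u v \<noteq> 0" "(\<Sum>v\<in>?S. scale (u v) v) = 0"
      using dependent_finite[of ?S] by auto
    have s: "(\<Sum>i\<le>?d. scale (u ((F ^^ i) x)) ((F ^^ i) x)) = 0"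
      using u(3) sum.reindex[OF True, of "\<lambda>v. scale (u v) v"] by simp
    let ?p = "\<Sum>i\<le>?d. monom (u ((F ^^ i) x)) i"
    have c: "coeff ?p i = (if i \<le> ?d then u ((F ^^ i) x) else 0)" for i
      by (simp add: coeff_sum)
    obtain i where "v = (F ^^ i) x" "i \<le> ?d" using u(1) by auto
    then have "coeff ?p i \<noteq> 0" using u(2) by (simp add: c)
    then have "?p \<noteq> 0" by force
    moreover have "pev ?p F x = (\<Sum>i\<le>?d. scale (coeff ?p i) ((F ^^ i) x))"
      by (rule pev_superset) (use degree_le[of ?d ?p] c in auto)
    ultimately show ?thesis using s using c by (intro exI[of _ ?p]) simp
  qed
qed

lemma dim_direct_sum:
  fixes s :: "'k::field_char_0 \<Rightarrow> 'v::ab_group_add \<Rightarrow> 'v"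
  assumes "vector_space s" "vec_space.fdim s W" "lin s s F" "F ` W \<subseteq> W" "\<And>x. x \<in> W \<Longrightarrow> F (F x) = F x"
  shows "vector_space.dim s (F ` W) + vector_space.dim s {x \<in> W. F x = 0} = vector_space.dim s W"
proof -
  interpret vec_space s by (intro vec_space.intro assms(1))
  show ?thesis using dim_direct_sum_of_nat[OF assms(2-5)] by (metis of_nat_eq_iff)
qed

text \<open>Split off a root r of \<open>p\<close>, so that p = (X - r) q. Either q(F) x vanishes
  and the degree has dropped, or q(F) x is an eigenvector for r.\<close>

lemma pev_eigen:
  fixes s :: "'k::alg_closed_field \<Rightarrow> 'v::ab_group_add \<Rightarrow> 'v"
  assumes "vector_space s" "lin s s F" "F ` W \<subseteq> W" "module.subspace s W"
  shows "p \<noteq> 0 \<Longrightarrow> x \<in> W \<Longrightarrow> x \<noteq> 0 \<Longrightarrow> vec_space.pev s p F x = 0 \<Longrightarrow> \<exists>c. \<exists>y\<in>W. y \<noteq> 0 \<and> F y = s c y"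
proof (induction "degree p" arbitrary: p)
  case 0
  interpret vec_space s by (intro vec_space.intro assms(1))
  obtain c where "p = [:c:]" using 0(1) by (metis degree_eq_zeroE)
  then show ?case using 0 by (auto simp: pev_def)
next
  case (Suc d)
  interpret vec_space s by (intro vec_space.intro assms(1))
  obtain r where "poly p r = 0" using alg_closed_imp_poly_has_root[of p] Suc(2) by auto
  then obtain q where q: "p = [:- r, 1:] * q" by (metis poly_eq_0_iff_dvd dvdE)
  then have q0: "q \<noteq> 0" using Suc(3) by auto
  then have d: "degree p = Suc (degree q)" unfolding q by (subst degree_mult_eq) auto
  have e: "F (pev q F x) = s r (pev q F x)" using pev_linear_factor[OF assms(2), of r q x] Suc(6) q by simp
  show ?case
  proof (cases "pev q F x = 0")
    case True
    then show ?thesis using Suc(1)[of q] d Suc(2,4,5) q0 by simp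
  next
    case False
    then show ?thesis using e pev_in[OF assms(4,3) Suc(4)] by blast
  qed
qed

lemma eigenvector_exists:
  fixes s :: "'k::alg_closed_field \<Rightarrow> 'v::ab_group_add \<Rightarrow> 'v"
  assumes "vector_space s" "vec_space.fdim s W" "lin s s F" "F ` W \<subseteq> W" "x \<in> W" "x \<noteq> 0"
  shows "\<exists>c. \<exists>y\<in>W. y \<noteq> 0 \<and> F y = s c y"
proof -
  interpret vec_space s by (intro vec_space.intro assms(1))
  show ?thesis
    using pev_annihilator[OF assms(2,4,5)] pev_eigen[OF assms(1,3,4) fdim_subspace[OF assms(2)]] assms(5,6) by blast
qed

section \<open>Sweedler sums\<close>

lemma lin_ext_image:
  assumes "Vector_Spaces.linear s s' L"
  shows "L (lin_ext s f t) = lin_ext s' (\<lambda>x. L (f x)) t"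
proof -
  interpret L: Vector_Spaces.linear s s' L by fact
  show ?thesis by (simp add: lin_ext_def L.sum L.scale)
qed

lemma lin_ext_tensor3_cong:
  fixes s :: "'k::field \<Rightarrow> 'v::ab_group_add \<Rightarrow> 'v" and s' :: "'k \<Rightarrow> 'w::ab_group_add \<Rightarrow> 'w"
  assumes vs: "vector_space s'"
    and "\<And>y z. lin s s' (\<lambda>x. F x y z)" "\<And>x z. lin s s' (\<lambda>y. F x y z)" "\<And>x y. lin s s' (\<lambda>z. F x y z)"
    and "tensor3_eq s t u"
  shows "lin_ext s' (\<lambda>(x, y, z). F x y z) t = lin_ext s' (\<lambda>(x, y, z). F x y z) u"
proof -
  let ?L = "lin_ext s' (\<lambda>(x, y, z). F x y z)"
  interpret L: Vector_Spaces.linear free_scale s' ?L by (rule linear_lin_ext[OF vs])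
  note * = lin_add[OF assms(2)] lin_add[OF assms(3)] lin_add[OF assms(4)]
    lin_scale[OF assms(2)] lin_scale[OF assms(3)] lin_scale[OF assms(4)]
  have "?L r = 0" if "r \<in> tensor3_rels s" for r
    using that unfolding tensor3_rels_def
    by (auto simp: L.add L.diff L.scale pure3_def lin_ext_single[OF vs] *)
  then have "?L (t - u) = 0"
    using L.eq_0_on_span assms(5) unfolding tensor3_eq_def by blast
  then show ?thesis by (simp add: L.diff)
qed

lemma vector_space_mult: "vector_space ((*) :: 'k::field \<Rightarrow> 'k \<Rightarrow> 'k)"
  by unfold_locales (simp_all add: algebra_simps)

locale fd_hopf =
  hopf_algebra scale comult counit antipode + finite_dimensional_vector_space scale Basis
  for scale :: "'k::field \<Rightarrow> 'h::ring_1 \<Rightarrow> 'h"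
    and comult counit antipode and Basis :: "'h set"
begin

sublocale vec_space scale ..

abbreviation S where "S \<equiv> antipode"
abbreviation \<epsilon> where "\<epsilon> \<equiv> counit"

text \<open>With \<open>b\<^sup>*\<close> ranging over the dual basis, \<open>del b h = h\<^sub>1 b\<^sup>*(h\<^sub>2)\<close>, so that
  \<open>\<Delta>(h)\<close> is the sum of the \<open>del b h \<otimes> b\<close>; this gives a Sweedler sum with a fixed finite index set.\<close>

definition del :: "'h \<Rightarrow> 'h \<Rightarrow> 'h" where
  "del b h = lin_ext scale (\<lambda>(x, y). scale (representation Basis y b) x) (comult h)"

definition sw :: "'h \<Rightarrow> ('h \<Rightarrow> 'h \<Rightarrow> 'w::ab_group_add) \<Rightarrow> 'w" where
  "sw h F = (\<Sum>b\<in>Basis. F (del b h) b)"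

definition bil :: "('k \<Rightarrow> 'w::ab_group_add \<Rightarrow> 'w) \<Rightarrow> ('h \<Rightarrow> 'h \<Rightarrow> 'w) \<Rightarrow> bool" where
  "bil s' F \<longleftrightarrow> vector_space s' \<and> (\<forall>y. lin scale s' (\<lambda>x. F x y)) \<and> (\<forall>x. lin scale s' (\<lambda>y. F x y))"

lemma bilI: "vector_space s' \<Longrightarrow> (\<And>y. lin scale s' (\<lambda>x. F x y)) \<Longrightarrow> (\<And>x. lin scale s' (\<lambda>y. F x y)) \<Longrightarrow> bil s' F"
  by (simp add: bil_def)

lemma lin_rep: "linF (\<lambda>y. representation Basis y b)"
  by (rule linI) (simp_all add: representation_add representation_scale span_Basis independent_Basis)

lemma rep_sum: "(\<Sum>b\<in>Basis. scale (representation Basis y b) b) = y"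
  by (rule sum_representation_eq) (simp_all add: span_Basis independent_Basis finite_Basis)

lemma frame_Basis: "frame UNIV Basis (\<lambda>b y. representation Basis y b) (\<lambda>b. b)"
  unfolding frame_def using finite_Basis lin_rep rep_sum by simp

lemma lin_expand: "lin scale s' f \<Longrightarrow> f y = (\<Sum>b\<in>Basis. s' (representation Basis y b) (f b))"
  using frame_expand[OF frame_Basis] by blast

lemma lin_linear: "vector_space s' \<Longrightarrow> lin scale s' f \<Longrightarrow> Vector_Spaces.linear scale s' f"
  using vector_space_axioms by (simp add: Vector_Spaces.linear_iff lin_def)

lemma linear_lin: "Vector_Spaces.linear scale s' f \<Longrightarrow> lin scale s' f"
  by (simp add: Vector_Spaces.linear_iff lin_def)

text \<open>Expanding every second leg of \<open>comult h\<close> in \<open>Basis\<close> and moving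
  the coefficients to the first leg gives \<open>del b h\<close>. This is the bridge from formal
  sums to sums over \<open>Basis\<close>.\<close>

lemma lin_ext_sw:
  assumes "bil s' F"
  shows "lin_ext s' (\<lambda>(x, y). F x y) (comult h) = sw h F"
proof -
  interpret w: vector_space s' using assms by (simp add: bil_def)
  have l: "lin scale s' (\<lambda>x. F x y)" "lin scale s' (\<lambda>y. F x y)" for x y using assms by (auto simp: bil_def)
  let ?t = "comult h"
  have "sw h F = (\<Sum>b\<in>Basis. \<Sum>p\<in>Poly_Mapping.keys ?t. s' (Poly_Mapping.lookup ?t p)
      (F (scale (representation Basis (snd p) b) (fst p)) b))"
    unfolding sw_def del_def lin_ext_def
    by (simp add: lin_sum[OF l(1)] lin_scale[OF l(1)] case_prod_unfold)
  also have "\<dots> = (\<Sum>p\<in>Poly_Mapping.keys ?t. s' (Poly_Mapping.lookup ?t p)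
      (\<Sum>b\<in>Basis. s' (representation Basis (snd p) b) (F (fst p) b)))"
    by (subst sum.swap) (simp add: w.scale_sum_right lin_scale[OF l(1)])
  also have "\<dots> = lin_ext s' (\<lambda>(x, y). F x y) ?t"
    unfolding lin_ext_def lin_expand[OF l(2), symmetric] by (simp add: case_prod_unfold)
  finally show ?thesis by simp
qed

lemma tensor2_eqD:
  assumes "tensor2_eq scale t u" "bil s' F"
  shows "lin_ext s' (\<lambda>(x, y). F x y) t = lin_ext s' (\<lambda>(x, y). F x y) u"
  by (rule lin_ext_tensor2_cong[OF _ _ assms(1)]) (use assms(2) lin_linear in \<open>auto simp: bil_def\<close>)

lemma sw_linear:
  assumes "bil s' F"
  shows "lin scale s' (\<lambda>h. sw h F)"
proof -
  have vs: "vector_space s'" using assms by (simp add: bil_def)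
  interpret L: Vector_Spaces.linear free_scale s' "lin_ext s' (\<lambda>(x, y). F x y)"
    by (rule linear_lin_ext[OF vs])
  show ?thesis
    by (rule linI) (simp_all add: lin_ext_sw[OF assms, symmetric] tensor2_eqD[OF comult_add assms]
      tensor2_eqD[OF comult_scale assms] L.add L.scale)
qed

lemma sw_comp: "lin s s' f \<Longrightarrow> f (sw h F) = sw h (\<lambda>a b. f (F a b))"
  by (simp add: sw_def lin_sum)

lemma sw_add: "sw h (\<lambda>a b. F a b + G a b) = sw h F + sw h G"
  by (simp add: sw_def sum.distrib)

lemma sw_diff: "sw h (\<lambda>a b. F a b - G a b) = sw h F - sw h G"
  by (simp add: sw_def sum_subtractf)

lemma sw_sum: "sw h (\<lambda>a b. \<Sum>i\<in>I. F i a b) = (\<Sum>i\<in>I. sw h (F i))"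
  unfolding sw_def by (rule sum.swap)

lemma sw_swap: "sw h (\<lambda>a b. sw k (\<lambda>c d. F a b c d)) = sw k (\<lambda>c d. sw h (\<lambda>a b. F a b c d))"
  unfolding sw_def by (rule sum.swap)

lemma lin_sw_comult: "lin scale scale f \<Longrightarrow> bil s' F \<Longrightarrow> lin scale s' (\<lambda>x. sw (f x) F)"
  by (rule lin_comp[OF sw_linear])

lemma lin_mult_right: "linE f \<Longrightarrow> linE (\<lambda>x. f x * c)"
  by (simp add: lin_def distrib_right scale_mult_left)

lemma lin_mult_left: "linE f \<Longrightarrow> linE (\<lambda>x. c * f x)"
  by (simp add: lin_def distrib_left scale_mult_right)

lemma linS: "linE S"
  by (rule linear_lin[OF antipode_linear])

lemma lin\<epsilon>: "linF \<epsilon>"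
  by (rule linear_lin[OF counit_linear])

lemma lin_k_right: "linF f \<Longrightarrow> linF (\<lambda>x. f x * c)"
  by (simp add: lin_def distrib_right)

lemma lin_k_left: "linF f \<Longrightarrow> linF (\<lambda>x. c * f x)"
  by (simp add: lin_def distrib_left)

lemma lin_scale_left: "linF f \<Longrightarrow> linE (\<lambda>x. scale (f x) v)"
  by (simp add: lin_def scale_left_distrib)

lemma lin_scale_gen: "vector_space s' \<Longrightarrow> linF f \<Longrightarrow> lin scale s' (\<lambda>x. s' (f x) v)"
  by (simp add: lin_def vector_space_def)

lemma lin_scale_right: "vector_space s' \<Longrightarrow> lin scale s' f \<Longrightarrow> lin scale s' (\<lambda>x. s' c (f x))"
  by (simp add: lin_def vector_space_def mult.commute)

lemma lin_plus: "vector_space s' \<Longrightarrow> lin scale s' f \<Longrightarrow> lin scale s' g \<Longrightarrow> lin scale s' (\<lambda>x. f x + g x)"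
  by (simp add: lin_def vector_space_def)

lemma lin_neg: "vector_space s' \<Longrightarrow> lin scale s' f \<Longrightarrow> lin scale s' (\<lambda>x. - f x)"
  by (simp add: lin_def module.scale_minus_right module_iff_vector_space)

lemma lin_minus': "vector_space s' \<Longrightarrow> lin scale s' f \<Longrightarrow> lin scale s' g \<Longrightarrow> lin scale s' (\<lambda>x. f x - g x)"
  using lin_plus[of s' f "\<lambda>x. - g x"] lin_neg[of s' g] by simp

lemma lin_SUM:
  assumes "vector_space s'" "\<And>i. i \<in> I \<Longrightarrow> lin scale s' (f i)"
  shows "lin scale s' (\<lambda>x. \<Sum>i\<in>I. f i x)"
proof -
  interpret w: vector_space s' by fact
  show ?thesis by (rule linI) (simp_all add: lin_add[OF assms(2)] lin_scale[OF assms(2)] sum.distrib w.scale_sum_right)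
qed

lemma lin_sw_arg: "vector_space s' \<Longrightarrow> (\<And>a b. lin scale s' (\<lambda>x. F x a b)) \<Longrightarrow> lin scale s' (\<lambda>x. sw h (F x))"
  unfolding sw_def by (rule lin_SUM) auto

lemma bil_vs: "bil s' F \<Longrightarrow> vector_space s'"
  by (simp add: bil_def)

lemmas lin_intros = vector_space_axioms vector_space_mult lin_ident linS lin\<epsilon> lin_sw_arg lin_sw_comult
  lin_comp[OF linS] lin_comp[OF lin\<epsilon>] lin_mult_right lin_mult_left lin_k_right lin_k_left
  lin_scale_left lin_scale_right lin_plus lin_minus' lin_neg

section \<open>The Hopf algebra axioms for Sweedler sums\<close>

lemma sw_coassoc:
  assumes "vector_space s'" "\<And>y z. lin scale s' (\<lambda>x. F x y z)" "\<And>x z. lin scale s' (\<lambda>y. F x y z)"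
    "\<And>x y. lin scale s' (\<lambda>z. F x y z)"
  shows "sw h (\<lambda>x y. sw x (\<lambda>a b. F a b y)) = sw h (\<lambda>x y. sw y (\<lambda>a b. F x a b))"
proof -
  note vs = assms(1)
  let ?E = "lin_ext s' (\<lambda>(x, y, z). F x y z)"
  have L: "Vector_Spaces.linear free_scale s' ?E" by (rule linear_lin_ext[OF vs])
  have b: "bil s' (\<lambda>a b. F a b y)" "bil s' (F x)" "bil s' (\<lambda>a. F a y)"
    "bil s' (\<lambda>x y. sw x (\<lambda>a b. F a b y))" "bil s' (\<lambda>x y. sw y (F x))" for x y
    using assms by (auto intro!: bilI lin_sw_arg lin_sw_comult lin_ident)
  have *: "?E (lin_ext free_scale (\<lambda>(x, y). lin_ext free_scale (\<lambda>(a, b). pure3 (u x y a b) (v x y a b) (w x y a b)) (comult (k x y))) (comult h))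
      = lin_ext s' (\<lambda>(x, y). lin_ext s' (\<lambda>(a, b). F (u x y a b) (v x y a b) (w x y a b)) (comult (k x y))) (comult h)" for u v w k
    by (simp add: lin_ext_image[OF L[unfolded case_prod_unfold]] pure3_def lin_ext_single[OF vs] case_prod_unfold)
  have "sw h (\<lambda>x y. sw x (\<lambda>a b. F a b y)) = lin_ext s' (\<lambda>(x, y). lin_ext s' (\<lambda>(a, b). F a b y) (comult x)) (comult h)"
    by (simp add: lin_ext_sw b)
  also have "\<dots> = lin_ext s' (\<lambda>(x, y). lin_ext s' (\<lambda>(a, b). F x a b) (comult y)) (comult h)"
    unfolding *[of "\<lambda>_ _ a _. a" "\<lambda>_ _ _ b. b" "\<lambda>_ y _ _. y" "\<lambda>x _. x", symmetric]
      *[of "\<lambda>x _ _ _. x" "\<lambda>_ _ a _. a" "\<lambda>_ _ _ b. b" "\<lambda>_ y. y", symmetric]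
    by (rule lin_ext_tensor3_cong[OF vs assms(2-4) coassoc])
  also have "\<dots> = sw h (\<lambda>x y. sw y (F x))"
    by (simp add: lin_ext_sw b)
  finally show ?thesis .
qed

lemma sw_mult:
  assumes "bil s' F"
  shows "sw (x * y) F = sw x (\<lambda>a b. sw y (\<lambda>c d. F (a * c) (b * d)))"
proof -
  have l: "lin scale s' (\<lambda>x. F x y)" "lin scale s' (\<lambda>y. F x y)" and vs: "vector_space s'" for x y using assms by (auto simp: bil_def)
  have b: "bil s' (\<lambda>c d. F (a * c) (b * d))" "bil s' (\<lambda>a b. sw y (\<lambda>c d. F (a * c) (b * d)))" for a b
    by (rule bilI; intro vs lin_sw_arg lin_comp[OF l(1)] lin_comp[OF l(2)] lin_intros)+
  let ?E = "lin_ext s' (\<lambda>(x, y). F x y)"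
  have L: "Vector_Spaces.linear free_scale s' ?E" by (rule linear_lin_ext[OF vs])
  have "sw (x * y) F = ?E (tensor2_mult (comult x) (comult y))"
    unfolding lin_ext_sw[OF assms, symmetric] by (rule tensor2_eqD[OF comult_mult assms])
  also have "\<dots> = lin_ext s' (\<lambda>(a, b). lin_ext s' (\<lambda>(c, d). F (a * c) (b * d)) (comult y)) (comult x)"
    by (simp add: tensor2_mult_def lin_ext_image[OF L[unfolded case_prod_unfold]] pure2_def lin_ext_single[OF vs] case_prod_unfold)
  also have "\<dots> = sw x (\<lambda>a b. sw y (\<lambda>c d. F (a * c) (b * d)))"
    by (simp add: lin_ext_sw b)
  finally show ?thesis .
qed

lemma sw_one: "bil s' F \<Longrightarrow> sw 1 F = F 1 1"
  using tensor2_eqD[OF comult_one, of s' F] lin_ext_sw[of s' F 1]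
  by (simp add: pure2_def lin_ext_single[OF bil_vs])

lemma sw_counit_left:
  assumes "vector_space s'" "lin scale s' f"
  shows "sw h (\<lambda>x y. s' (\<epsilon> x) (f y)) = f h"
proof -
  have "bil scale (\<lambda>x y. scale (\<epsilon> x) y)" by (rule bilI; intro lin_intros)
  from lin_ext_sw[OF this, of h] have "f h = f (sw h (\<lambda>x y. scale (\<epsilon> x) y))" by (simp add: counit_left)
  then show ?thesis by (simp add: sw_comp[OF assms(2)] lin_scale[OF assms(2)])
qed

lemma sw_counit_right:
  assumes "vector_space s'" "lin scale s' f"
  shows "sw h (\<lambda>x y. s' (\<epsilon> y) (f x)) = f h"
proof -
  have "bil scale (\<lambda>x y. scale (\<epsilon> y) x)" by (rule bilI; intro lin_intros)
  from lin_ext_sw[OF this, of h] have "f h = f (sw h (\<lambda>x y. scale (\<epsilon> y) x))" by (simp add: counit_right)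
  then show ?thesis by (simp add: sw_comp[OF assms(2)] lin_scale[OF assms(2)])
qed

lemma sw_antipode_left:
  assumes "lin scale s' f"
  shows "sw h (\<lambda>x y. f (S x * y)) = s' (\<epsilon> h) (f 1)"
proof -
  have "bil scale (\<lambda>x y. S x * y)" by (rule bilI; intro lin_intros)
  from lin_ext_sw[OF this, of h] have "f (scale (\<epsilon> h) 1) = f (sw h (\<lambda>x y. S x * y))" by (simp add: antipode_left)
  then show ?thesis by (simp add: sw_comp[OF assms] lin_scale[OF assms])
qed

lemma sw_antipode_right:
  assumes "lin scale s' f"
  shows "sw h (\<lambda>x y. f (x * S y)) = s' (\<epsilon> h) (f 1)"
proof -
  have "bil scale (\<lambda>x y. x * S y)" by (rule bilI; intro lin_intros)
  from lin_ext_sw[OF this, of h] have "f (scale (\<epsilon> h) 1) = f (sw h (\<lambda>x y. x * S y))" by (simp add: antipode_right)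
  then show ?thesis by (simp add: sw_comp[OF assms] lin_scale[OF assms])
qed

lemma lin_smul: "vector_space s' \<Longrightarrow> lin s' s' (s' c)"
  by (simp add: lin_def vector_space_def mult.commute)

lemma sw_smul: "vector_space s' \<Longrightarrow> sw h (\<lambda>a b. s' c (F a b)) = s' c (sw h F)"
  by (rule sw_comp[OF lin_smul, symmetric])

lemmas sw_counit_simps =
  sw_counit_left[of scale, OF vector_space_axioms] sw_counit_right[of scale, OF vector_space_axioms]
  sw_counit_left[of "(*)", OF vector_space_mult] sw_counit_right[of "(*)", OF vector_space_mult]

lemmas coassocE = sw_coassoc[of scale, OF vector_space_axioms]
lemmas coassocF = sw_coassoc[of "(*)", OF vector_space_mult]

lemma sw_cong: "(\<And>a b. F a b = G a b) \<Longrightarrow> sw h F = sw h G"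
  by (simp add: sw_def)

lemma sw_cancel23:
  assumes "bil s' F"
  shows "sw h (\<lambda>x y. sw y (\<lambda>a b. F x (S a * b))) = F h 1"
    and "sw h (\<lambda>x y. sw y (\<lambda>a b. F x (a * S b))) = F h 1"
proof -
  have l: "lin scale s' (\<lambda>x. F x y)" "lin scale s' (\<lambda>y. F x y)" and vs: "vector_space s'" for x y
    using assms by (auto simp: bil_def)
  show "sw h (\<lambda>x y. sw y (\<lambda>a b. F x (S a * b))) = F h 1" "sw h (\<lambda>x y. sw y (\<lambda>a b. F x (a * S b))) = F h 1"
    unfolding sw_antipode_left[OF l(2)] sw_antipode_right[OF l(2)]
    by (rule sw_counit_right[OF vs l(1)])+
qed

lemma sw_cancel12:
  assumes "bil s' F"
  shows "sw h (\<lambda>x y. sw y (\<lambda>a b. F (S x * a) b)) = F 1 h"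
    and "sw h (\<lambda>x y. sw y (\<lambda>a b. F (x * S a) b)) = F 1 h"
proof -
  have l: "lin scale s' (\<lambda>x. F x y)" "lin scale s' (\<lambda>y. F x y)" and vs: "vector_space s'" for x y
    using assms by (auto simp: bil_def)
  have "sw h (\<lambda>x y. sw y (\<lambda>a b. F (S x * a) b)) = sw h (\<lambda>x y. sw x (\<lambda>a b. F (S a * b) y))"
    by (rule sw_coassoc[of s' "\<lambda>p q r. F (S p * q) r", symmetric]; intro vs lin_comp[OF l(1)] lin_comp[OF l(2)] lin_intros)
  then show "sw h (\<lambda>x y. sw y (\<lambda>a b. F (S x * a) b)) = F 1 h"
    unfolding sw_antipode_left[OF l(1)] sw_counit_left[OF vs l(2)] .
  have "sw h (\<lambda>x y. sw y (\<lambda>a b. F (x * S a) b)) = sw h (\<lambda>x y. sw x (\<lambda>a b. F (a * S b) y))"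
    by (rule sw_coassoc[of s' "\<lambda>p q r. F (p * S q) r", symmetric]; intro vs lin_comp[OF l(1)] lin_comp[OF l(2)] lin_intros)
  then show "sw h (\<lambda>x y. sw y (\<lambda>a b. F (x * S a) b)) = F 1 h"
    unfolding sw_antipode_right[OF l(1)] sw_counit_left[OF vs l(2)] .
qed

section \<open>The antipode reverses products and coproducts\<close>

lemma S_one: "S 1 = 1"
proof -
  have "sw 1 (\<lambda>x y. S x * y) = S 1 * 1"
    by (rule sw_one[of scale]; rule bilI; intro lin_intros)
  then show ?thesis using sw_antipode_left[OF lin_ident, of 1] by (simp add: counit_one)
qed

lemma S_mult: "S (x * y) = S y * S x"
proof -
  \<comment> \<open>The sum S(x_1 y_1) x_2 y_2 S(y_3) S(x_3): contracting from the right leaves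
    S(xy), contracting from the left leaves S(y) S(x).\<close>
  define T where "T = sw x (\<lambda>x1 x'. sw y (\<lambda>y1 y'. sw x' (\<lambda>x2 x3. sw y' (\<lambda>y2 y3. S (x1 * y1) * (x2 * (y2 * S y3) * S x3)))))"
  have "T = sw x (\<lambda>x1 x'. sw y (\<lambda>y1 y'. sw x' (\<lambda>x2 x3. scale (\<epsilon> y') (S (x1 * y1) * (x2 * 1 * S x3)))))"
    unfolding T_def by (intro sw_cong sw_antipode_right lin_intros)
  also have "\<dots> = sw x (\<lambda>x1 x'. sw y (\<lambda>y1 y'. scale (\<epsilon> x') (scale (\<epsilon> y') (S (x1 * y1) * 1))))"
    by (intro sw_cong) (simp add: sw_antipode_right[of scale "\<lambda>t. scale c (d * t)" for c d] lin_intros)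
  also have "\<dots> = sw x (\<lambda>x1 x'. scale (\<epsilon> x') (S (x1 * y)))"
    by (simp add: sw_smul[of scale, OF vector_space_axioms] sw_counit_simps lin_intros del: scale_scale)
  also have "\<dots> = S (x * y)" by (rule sw_counit_right; intro lin_intros)
  finally have 1: "T = S (x * y)" .
  have "T = sw y (\<lambda>y1 y'. sw x (\<lambda>x1 x'. sw x' (\<lambda>x2 x3. sw y' (\<lambda>y2 y3. S (x1 * y1) * (x2 * (y2 * S y3) * S x3)))))"
    unfolding T_def by (rule sw_swap)
  also have "\<dots> = sw y (\<lambda>y1 y'. sw x (\<lambda>u x3. sw u (\<lambda>x1 x2. sw y' (\<lambda>y2 y3. S (x1 * y1) * (x2 * (y2 * S y3) * S x3)))))"
    by (rule sw_cong, rule coassocE[symmetric]; intro lin_intros)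
  also have "\<dots> = sw x (\<lambda>u x3. sw u (\<lambda>x1 x2. sw y (\<lambda>y1 y'. sw y' (\<lambda>y2 y3. S (x1 * y1) * (x2 * (y2 * S y3) * S x3)))))"
    unfolding sw_swap[of y] ..
  also have "\<dots> = sw x (\<lambda>u x3. sw u (\<lambda>x1 x2. sw y (\<lambda>v y3. sw v (\<lambda>y1 y2. S (x1 * y1) * (x2 * (y2 * S y3) * S x3)))))"
    by (rule sw_cong, rule sw_cong, rule coassocE[symmetric]; intro lin_intros)
  also have "\<dots> = sw x (\<lambda>u x3. sw y (\<lambda>v y3. sw u (\<lambda>x1 x2. sw v (\<lambda>y1 y2. S (x1 * y1) * (x2 * y2) * (S y3 * S x3)))))"
    unfolding sw_swap[of y] by (simp add: mult.assoc)
  also have "\<dots> = sw x (\<lambda>u x3. sw y (\<lambda>v y3. sw (u * v) (\<lambda>a b. S a * b * (S y3 * S x3))))"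
    by (intro sw_cong sw_mult[of scale, symmetric] bilI lin_intros)
  also have "\<dots> = sw x (\<lambda>u x3. sw y (\<lambda>v y3. scale (\<epsilon> (u * v)) (1 * (S y3 * S x3))))"
    by (intro sw_cong sw_antipode_left lin_intros)
  also have "\<dots> = sw x (\<lambda>u x3. scale (\<epsilon> u) (sw y (\<lambda>v y3. scale (\<epsilon> v) (S y3 * S x3))))"
    by (simp add: counit_mult sw_smul[of scale, OF vector_space_axioms, symmetric])
  also have "\<dots> = S y * S x"
    by (simp add: sw_counit_simps lin_intros)
  finally show ?thesis using 1 by simp
qed

lemma counit_S: "\<epsilon> (S h) = \<epsilon> h"
proof -
  have "\<epsilon> h = sw h (\<lambda>x y. \<epsilon> (S x * y))"
    using sw_antipode_left[OF lin\<epsilon>, of h] by (simp add: counit_one)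
  also have "\<dots> = \<epsilon> (S h)"
    unfolding counit_mult using sw_counit_right[of "(*)" "\<lambda>x. \<epsilon> (S x)" h] by (simp add: mult.commute lin_intros)
  finally show ?thesis by simp
qed

lemma sw_S:
  assumes "bil s' F"
  shows "sw (S h) F = sw h (\<lambda>x y. F (S y) (S x))"
proof -
  have l: "lin scale s' (\<lambda>x. F x y)" "lin scale s' (\<lambda>y. F x y)" and vs: "vector_space s'" for x y
    using assms by (auto simp: bil_def)
  note li = vs lin_intros lin_comp[OF l(1)] lin_comp[OF l(2)]
  define G where "G v m n = sw v (\<lambda>e f. F (m * S f) (n * S e))" for v m n
  have G: "bil s' (G v)" "lin scale s' (\<lambda>v. G v m n)" for v m n
    unfolding G_def by (intro bilI li)+
  \<comment> \<open>\<open>F\<close> at the product of \<Delta>(S(h_1) h_2) with S(h_4) \<otimes>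
    S(h_3). Contracting S(h_1) h_2 leaves the right side; expanding the coproduct of the product and
    cancelling the inner factors leaves the left side.\<close>
  define U where "U = sw h (\<lambda>u v. sw u (\<lambda>x a. sw (S x * a) (G v)))"
  have "U = sw h (\<lambda>u v. s' (\<epsilon> u) (G v 1 1))"
    unfolding U_def sw_antipode_left[OF sw_linear[OF G(1)]] sw_one[OF G(1)] ..
  also have "\<dots> = sw h (\<lambda>x y. F (S y) (S x))"
    unfolding sw_counit_left[OF vs G(2)] by (simp add: G_def)
  finally have 1: "U = sw h (\<lambda>x y. F (S y) (S x))" .
  have "U = sw h (\<lambda>x y. sw y (\<lambda>a v. sw (S x * a) (G v)))"
    unfolding U_def by (rule sw_coassoc[of s' "\<lambda>x a v. sw (S x * a) (G v)"]; intro li lin_comp[OF G(2)] G)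
  also have "\<dots> = sw h (\<lambda>x y. sw y (\<lambda>a v. sw (S x) (\<lambda>p q. sw a (\<lambda>c d. G v (p * c) (q * d)))))"
    unfolding sw_mult[OF G(1)] ..
  also have "\<dots> = sw h (\<lambda>x y. sw (S x) (\<lambda>p q. sw y (\<lambda>a v. sw a (\<lambda>c d. G v (p * c) (q * d)))))"
    by (intro sw_cong sw_swap)
  also have "\<dots> = sw h (\<lambda>x y. sw (S x) (\<lambda>p q. sw y (\<lambda>c w. sw w (\<lambda>d v. sw v (\<lambda>e f. F (p * c * S f) (q * (d * S e)))))))"
    unfolding G_def mult.assoc[symmetric] by (intro sw_cong sw_coassoc[of s' "\<lambda>c d v. sw v (\<lambda>e f. F (p * c * S f) (q * d * S e))" for p q] li bilI)
  also have "\<dots> = sw h (\<lambda>x y. sw (S x) (\<lambda>p q. sw y (\<lambda>c w. F (p * c * S w) (q * 1))))"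
    by (intro sw_cong sw_cancel12(2)[of s' "\<lambda>m f. F (p * c * S f) (q * m)" for p c q] bilI li)
  also have "\<dots> = sw h (\<lambda>x y. sw (S x) (\<lambda>p q. s' (\<epsilon> y) (F (p * 1) (q * 1))))"
    unfolding mult.assoc by (intro sw_cong sw_antipode_right li)
  also have "\<dots> = sw h (\<lambda>x y. s' (\<epsilon> y) (sw (S x) F))"
    by (simp add: sw_smul[OF vs])
  also have "\<dots> = sw (S h) F"
    by (rule sw_counit_right; intro li assms)
  finally show ?thesis using 1 by simp
qed

lemmas bilE = bilI[of scale, OF vector_space_axioms]
lemmas bilF = bilI[of "(*)", OF vector_space_mult]
lemmas smulE = sw_smul[of scale, OF vector_space_axioms]
lemmas smulF = sw_smul[of "(*)", OF vector_space_mult]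

lemma lin_eta: "linE (scale c)" "linE ((*) h)"
  by (simp_all add: lin_def scale_left_commute distrib_left scale_mult_right scale_right_distrib)

lemmas lin_intros' = lin_intros lin_eta(1,2)

lemma fdim_UNIV: "fdim UNIV"
  unfolding fdim_def using finite_Basis span_Basis by auto

lemma fdimI: "subspace W \<Longrightarrow> fdim W"
  by (rule fdim_subset[OF fdim_UNIV]) auto

lemma functional_eqI:
  assumes "\<And>f. linF f \<Longrightarrow> f x = f y"
  shows "x = y"
proof -
  have "(\<Sum>b\<in>Basis. scale (representation Basis x b) b) = (\<Sum>b\<in>Basis. scale (representation Basis y b) b)"
    by (intro sum.cong refl arg_cong2[of _ _ _ _ scale] assms lin_rep)
  then show ?thesis unfolding rep_sum .
qed

lemma rep_split:
  assumes "linF g"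
  shows "(\<Sum>c\<in>Basis. representation Basis a c * g (c * m)) = g (a * m)"
  using lin_expand[OF lin_comp[OF assms lin_mult_right[OF lin_ident]], of a m] by simp

text \<open>The hit action of the dual algebra on \<open>H\<close>. Subspaces stable under
  \<open>T\<close> or \<open>T'\<close> are coideals, so comodule arguments can be phrased with
  functionals and operators alone.\<close>

definition T :: "('h \<Rightarrow> 'k) \<Rightarrow> 'h \<Rightarrow> 'h" where
  "T f x = sw x (\<lambda>a b. scale (f b) a)"

definition T' :: "('h \<Rightarrow> 'k) \<Rightarrow> 'h \<Rightarrow> 'h" where
  "T' f x = sw x (\<lambda>a b. scale (f a) b)"

lemma linT: "linF f \<Longrightarrow> linE (T f)"
  unfolding T_def by (rule lin_sw_comult[OF lin_ident], rule bilE) (intro lin_intros' | assumption)+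

lemma linT': "linF f \<Longrightarrow> linE (T' f)"
  unfolding T'_def by (rule lin_sw_comult[OF lin_ident], rule bilE) (intro lin_intros' | assumption)+

text \<open>The two actions use opposite ends of the threefold coproduct.\<close>

lemma T_T': 
  assumes "linF f" "linF g"
  shows "T f (T' g x) = T' g (T f x)"
proof -
  have "T f (T' g x) = sw x (\<lambda>u v. sw v (\<lambda>a b. scale (g u) (scale (f b) a)))"
    unfolding T'_def[of g] sw_comp[OF linT[OF assms(1)]] lin_scale[OF linT[OF assms(1)]]
    by (simp only: T_def smulE)
  also have "\<dots> = sw x (\<lambda>v b. sw v (\<lambda>u a. scale (g u) (scale (f b) a)))"
    by (rule coassocE[symmetric]; intro lin_intros assms)
  also have "\<dots> = sw x (\<lambda>v b. sw v (\<lambda>u a. scale (f b) (scale (g u) a)))"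
    by (simp add: mult.commute)
  also have "\<dots> = T' g (T f x)"
    unfolding T_def[of f] sw_comp[OF linT'[OF assms(2)]] lin_scale[OF linT'[OF assms(2)]]
    by (simp only: T'_def smulE)
  finally show ?thesis .
qed

lemma T'_T':
  assumes "linF f" "linF g"
  shows "T' f (T' g x) = sw x (\<lambda>a y. sw y (\<lambda>b z. scale (g a * f b) z))"
  unfolding T'_def[of g] sw_comp[OF linT'[OF assms(1)]] lin_scale[OF linT'[OF assms(1)]] 
  by (simp add: T'_def smulE[symmetric])

text \<open>Inserting \<open>S\<^sup>2(y\<^sub>2) S(y\<^sub>1) = \<epsilon>(y)\<close> and moving the resulting left-coideal operators around the
  trace by cyclicity.\<close>

lemma trace_left_integral:
  assumes Q: "linE Q" "\<And>\<phi> z. linF \<phi> \<Longrightarrow> Q (T' \<phi> z) = T' \<phi> (Q z)" and g: "linF g"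
  shows "sw x (\<lambda>a b. g a * trace UNIV (\<lambda>y. Q (b * S (S y)))) = g 1 * trace UNIV (\<lambda>y. Q (x * S (S y)))"
proof -
  let ?r = "\<lambda>c p. representation Basis p c"
  let ?U = "\<lambda>c. T' (\<lambda>p. g (c * S p))"
  have lg: "linF (\<lambda>p. g (c * S p))" for c by (rule lin_comp[OF g]) (intro lin_intros)
  note linU = linT'[OF lg] and linR = linT'[OF lin_rep]
  have lxS: "linE (\<lambda>y. x * S (S y))" for x by (intro lin_intros)
  \<comment> \<open>Placed between \<open>T' (?r c)\<close> and \<open>?U c\<close>, multiplication
    by x becomes multiplication by x_2 weighted with g(x_1); in the opposite order the two operators
    compose to the scalar g(1).\<close>
  have 1: "(\<Sum>c\<in>Basis. T' (?r c) (x * S (S (?U c y)))) = sw x (\<lambda>a b. scale (g a) (b * S (S y)))" for y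
  proof -
    have "(\<Sum>c\<in>Basis. T' (?r c) (x * S (S (?U c y)))) =
        (\<Sum>c\<in>Basis. sw y (\<lambda>p q. scale (g (c * S p)) (T' (?r c) (x * S (S q)))))"
      unfolding T'_def[of "\<lambda>p. g (c * S p)" for c] sw_comp[OF lin_comp[OF linR lxS]] lin_scale[OF lin_comp[OF linR lxS]] ..
    also have "\<dots> = sw y (\<lambda>p q. \<Sum>c\<in>Basis. sw (x * S (S q)) (\<lambda>m n. scale (?r c m * g (c * S p)) n))"
      unfolding sw_sum[symmetric] T'_def smulE[symmetric] by (simp add: mult.commute)
    also have "\<dots> = sw y (\<lambda>p q. sw (x * S (S q)) (\<lambda>m n. scale (g (m * S p)) n))"
      unfolding sw_sum[symmetric] scale_sum_left[symmetric] rep_split[OF g] ..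
    also have "\<dots> = sw y (\<lambda>p q. sw x (\<lambda>a b. sw (S (S q)) (\<lambda>c d. scale (g (a * c * S p)) (b * d))))"
      by (intro sw_cong sw_mult[of scale] bilE lin_intros lin_comp[OF g])
    also have "\<dots> = sw y (\<lambda>p q. sw x (\<lambda>a b. sw q (\<lambda>c d. scale (g (a * S (p * S c))) (b * S (S d)))))"
    proof (rule sw_cong, rule sw_cong)
      fix p q a b
      show "sw (S (S q)) (\<lambda>c d. scale (g (a * c * S p)) (b * d)) = sw q (\<lambda>c d. scale (g (a * S (p * S c))) (b * S (S d)))"
        by (subst sw_S[of scale], (intro bilE lin_intros lin_comp[OF g]), subst sw_S[of scale], (intro bilE lin_intros lin_comp[OF g]))
          (simp add: S_mult mult.assoc)
    qed
    also have "\<dots> = sw x (\<lambda>a b. sw y (\<lambda>p q. sw q (\<lambda>c d. scale (g (a * S (p * S c))) (b * S (S d)))))"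
      by (rule sw_swap)
    also have "\<dots> = sw x (\<lambda>a b. scale (g (a * S 1)) (b * S (S y)))"
      by (intro sw_cong sw_cancel12(2)[of scale "\<lambda>m d. scale (g (a * S m)) (b * S (S d))" for a b] bilE lin_intros lin_comp[OF g])
    finally show ?thesis by (simp add: S_one)
  qed
  have 2: "(\<Sum>c\<in>Basis. ?U c (T' (?r c) z)) = scale (g 1) z" for z
  proof -
    have "(\<Sum>c\<in>Basis. ?U c (T' (?r c) z)) = sw z (\<lambda>a y. sw y (\<lambda>b w. \<Sum>c\<in>Basis. scale (?r c a * g (c * S b)) w))"
      unfolding T'_T'[OF lg lin_rep] sw_sum[symmetric] ..
    also have "\<dots> = sw z (\<lambda>a y. sw y (\<lambda>b w. scale (g (a * S b)) w))"
      unfolding scale_sum_left[symmetric] rep_split[OF g] ..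
    also have "\<dots> = scale (g 1) z"
      by (rule sw_cancel12(2)[of scale "\<lambda>m w. scale (g m) w"]) (intro bilE lin_intros g)
    finally show ?thesis .
  qed
  have "sw x (\<lambda>a b. g a * trace UNIV (\<lambda>y. Q (b * S (S y)))) = trace UNIV (\<lambda>y. sw x (\<lambda>a b. scale (g a) (Q (b * S (S y)))))"
    by (simp add: sw_def trace_sum trace_scale)
  also have "\<dots> = trace UNIV (\<lambda>y. \<Sum>c\<in>Basis. Q (T' (?r c) (x * S (S (?U c y)))))"
    by (rule trace_cong) (simp only: lin_sum[OF Q(1), symmetric] 1 sw_comp[OF Q(1)] lin_scale[OF Q(1)])
  also have "\<dots> = (\<Sum>c\<in>Basis. trace UNIV (\<lambda>y. Q (T' (?r c) (x * S (S (?U c y))))))"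
    by (rule trace_sum)
  also have "\<dots> = (\<Sum>c\<in>Basis. trace UNIV (\<lambda>y. ?U c (Q (T' (?r c) (x * S (S y))))))"
    by (intro sum.cong refl trace_cyc[of UNIV "\<lambda>y. Q (T' (?r c) (x * S (S y)))" for c] fdim_UNIV linU
        lin_comp[OF Q(1)] lin_comp[OF linR] lxS) auto
  also have "\<dots> = trace UNIV (\<lambda>y. Q (\<Sum>c\<in>Basis. ?U c (T' (?r c) (x * S (S y)))))"
    unfolding trace_sum[symmetric] lin_sum[OF Q(1)] Q(2)[OF lg] ..
  also have "\<dots> = g 1 * trace UNIV (\<lambda>y. Q (x * S (S y)))"
    unfolding 2 lin_scale[OF Q(1)] trace_scale ..
  finally show ?thesis .
qed

text \<open>The same cyclic move with the other action. What remains inside the trace is z_1 g(z_3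
  S(z_2)), which reduces to g(1) z when g is a trace form or when S^2 = id.\<close>

lemma trace_right_leg:
  assumes g: "linF g"
  shows "sw x (\<lambda>a b. g b * trace UNIV (\<lambda>y. a * y)) =
    trace UNIV (\<lambda>z. x * sw z (\<lambda>p q. sw q (\<lambda>r s. scale (g (s * S r)) p)))"
proof -
  let ?r = "\<lambda>c p. representation Basis p c"
  let ?U = "\<lambda>c. T (\<lambda>p. g (c * S p))"
  have lg: "linF (\<lambda>p. g (c * S p))" for c by (rule lin_comp[OF g]) (intro lin_intros)
  note linU = linT[OF lg] and linR = linT[OF lin_rep]
  have lx: "linE (\<lambda>y. x * y)" for x by (intro lin_intros)
  have 1: "(\<Sum>c\<in>Basis. T (?r c) (x * ?U c y)) = sw x (\<lambda>a b. scale (g b) (a * y))" for y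
  proof -
    have "(\<Sum>c\<in>Basis. T (?r c) (x * ?U c y)) =
        (\<Sum>c\<in>Basis. sw y (\<lambda>p q. scale (g (c * S q)) (T (?r c) (x * p))))"
      unfolding T_def[of "\<lambda>p. g (c * S p)" for c] sw_comp[OF lin_comp[OF linR lx]] lin_scale[OF lin_comp[OF linR lx]] ..
    also have "\<dots> = sw y (\<lambda>p q. \<Sum>c\<in>Basis. sw (x * p) (\<lambda>m n. scale (?r c n * g (c * S q)) m))"
      unfolding sw_sum[symmetric] T_def smulE[symmetric] by (simp add: mult.commute)
    also have "\<dots> = sw y (\<lambda>p q. sw (x * p) (\<lambda>m n. scale (g (n * S q)) m))"
      unfolding sw_sum[symmetric] scale_sum_left[symmetric] rep_split[OF g] ..
    also have "\<dots> = sw y (\<lambda>p q. sw x (\<lambda>a b. sw p (\<lambda>c d. scale (g (b * d * S q)) (a * c))))"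
      by (intro sw_cong sw_mult[of scale] bilE lin_intros lin_comp[OF g])
    also have "\<dots> = sw x (\<lambda>a b. sw y (\<lambda>p q. sw p (\<lambda>c d. scale (g (b * d * S q)) (a * c))))"
      by (rule sw_swap)
    also have "\<dots> = sw x (\<lambda>a b. sw y (\<lambda>c p. sw p (\<lambda>d q. scale (g (b * (d * S q))) (a * c))))"
      unfolding mult.assoc[symmetric] by (rule sw_cong, rule coassocE; intro lin_intros lin_comp[OF g])
    also have "\<dots> = sw x (\<lambda>a b. scale (g (b * 1)) (a * y))"
      by (intro sw_cong sw_cancel23(2)[of scale "\<lambda>c m. scale (g (b * m)) (a * c)" for a b] bilE lin_intros lin_comp[OF g])
    finally show ?thesis by simp
  qed
  have 2: "(\<Sum>c\<in>Basis. ?U c (T (?r c) z)) = sw z (\<lambda>p q. sw q (\<lambda>r s. scale (g (s * S r)) p))" for z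
  proof -
    have "(\<Sum>c\<in>Basis. ?U c (T (?r c) z)) = (\<Sum>c\<in>Basis. sw z (\<lambda>a b. sw a (\<lambda>p r. scale (?r c b * g (c * S r)) p)))"
      unfolding T_def[of "?r c" for c] sw_comp[OF linU] lin_scale[OF linU] by (simp add: T_def smulE[symmetric])
    also have "\<dots> = sw z (\<lambda>a b. sw a (\<lambda>p r. scale (g (b * S r)) p))"
      unfolding sw_sum[symmetric] scale_sum_left[symmetric] rep_split[OF g] ..
    also have "\<dots> = sw z (\<lambda>p q. sw q (\<lambda>r s. scale (g (s * S r)) p))"
      by (rule coassocE; intro lin_intros lin_comp[OF g])
    finally show ?thesis .
  qed
  have "sw x (\<lambda>a b. g b * trace UNIV (\<lambda>y. a * y)) = trace UNIV (\<lambda>y. sw x (\<lambda>a b. scale (g b) (a * y)))"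
    by (simp add: sw_def trace_sum trace_scale)
  also have "\<dots> = trace UNIV (\<lambda>y. \<Sum>c\<in>Basis. T (?r c) (x * ?U c y))"
    by (rule trace_cong) (simp only: 1)
  also have "\<dots> = (\<Sum>c\<in>Basis. trace UNIV (\<lambda>y. T (?r c) (x * ?U c y)))"
    by (rule trace_sum)
  also have "\<dots> = (\<Sum>c\<in>Basis. trace UNIV (\<lambda>y. x * ?U c (T (?r c) y)))"
    by (intro sum.cong refl trace_cyc[of UNIV "T (?r c)" "\<lambda>y. x * ?U c y" for c] fdim_UNIV
        linR lin_comp[OF lx] linU) auto
  also have "\<dots> = trace UNIV (\<lambda>y. x * (\<Sum>c\<in>Basis. ?U c (T (?r c) y)))"
    unfolding trace_sum[symmetric] sum_distrib_left ..
  finally show ?thesis unfolding 2 .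
qed

end

section \<open>Integrals and the square of the antipode\<close>

locale ss_hopf = fd_hopf scale comult counit antipode Basis
  for scale :: "'k::{alg_closed_field, field_char_0} \<Rightarrow> 'h::ring_1 \<Rightarrow> 'h"
    and comult counit antipode and Basis :: "'h set" +
  assumes ss: semisimple_algebra
begin

section \<open>Consequences of semisimplicity: regularity, a two-sided integral, bijectivity of the
  antipode\<close>

lemma left_ideal_split:
  assumes "left_ideal I"
  obtains J e f where "left_ideal J" "I \<inter> J = {0}" "1 = e + f" "e \<in> I" "f \<in> J"
proof -
  obtain J where J: "left_ideal J" "I \<inter> J = {0}" "{x + y | x y. x \<in> I \<and> y \<in> J} = UNIV"
    using ss[unfolded semisimple_algebra_def, rule_format, OF assms] by (elim exE conjE)
  have "1 \<in> {x + y | x y. x \<in> I \<and> y \<in> J}" unfolding J(3) by simp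
  then show ?thesis using J(1,2) that by blast
qed

text \<open>A complement of the left ideal H x splits 1 as e + f with e = y x; then x f = x - x e
  lies both in H x and in the complement, so x = x e.\<close>

lemma von_neumann_regular: "\<exists>y. (x::'h) = x * y * x"
proof -
  let ?I = "range (\<lambda>y. y * x)"
  have "left_ideal ?I" unfolding left_ideal_def
  proof (intro conjI allI ballI)
    show "subspace ?I" by (rule subspace_image_lin[of "\<lambda>y. y * x"]) (intro lin_intros subspace_UNIV)+
    fix h z assume "z \<in> ?I"
    then show "h * z \<in> ?I" by (auto simp: mult.assoc[symmetric])
  qed
  then obtain J e f where J: "left_ideal J" "?I \<inter> J = {0}" and ef: "1 = e + f" "e \<in> ?I" "f \<in> J"
    by (rule left_ideal_split)
  then obtain y where y: "e = y * x" by auto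
  have x: "x * e + x * f = x" unfolding distrib_left[symmetric] ef(1)[symmetric] by simp
  then have "x * f = x - x * e" by (metis add_diff_cancel_left')
  also have "\<dots> = (1 - x * y) * x" unfolding y by (simp add: left_diff_distrib mult.assoc)
  finally have "x * f \<in> ?I" by blast
  moreover have "x * f \<in> J" using J(1) ef(3) unfolding left_ideal_def by blast
  ultimately have "x * f = 0" using J(2) by blast
  then have "x = x * y * x" using x unfolding y by (simp add: mult.assoc)
  then show ?thesis by blast
qed

text \<open>The component \<open>y\<close> of 1 in a complement of the kernel of
  \<open>\<epsilon>\<close> has counit 1, and h y - \<epsilon>(h) y lies both in the complement and
  in the kernel.\<close>

lemma integral_exists: "\<exists>L. (\<forall>h. h * L = scale (\<epsilon> h) L) \<and> \<epsilon> L = 1"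
proof -
  let ?I = "{x. \<epsilon> x = 0}"
  have "left_ideal ?I" unfolding left_ideal_def
    using lin_kernel_subspace[OF lin\<epsilon> _ subspace_UNIV] by (auto simp: counit_mult)
  then obtain J x y where J: "left_ideal J" "?I \<inter> J = {0}" and xy': "1 = x + y" "x \<in> ?I" "y \<in> J"
    by (rule left_ideal_split)
  have xy: "1 = x + y" "\<epsilon> x = 0" "y \<in> J" using xy' by simp_all
  have y: "\<epsilon> y = 1" using lin_add[OF lin\<epsilon>, of x y] unfolding xy(1)[symmetric] xy(2) counit_one by simp
  have "h * y = scale (\<epsilon> h) y" for h
  proof -
    have "h * y - scale (\<epsilon> h) y \<in> J"
      using J(1) xy(3) by (auto simp: left_ideal_def intro!: subspace_diff subspace_scale)
    moreover have "\<epsilon> (h * y - scale (\<epsilon> h) y) = 0"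
      by (simp add: lin_diff[OF lin\<epsilon>] lin_scale[OF lin\<epsilon>] counit_mult y)
    ultimately have "h * y - scale (\<epsilon> h) y = 0" using J(2) by blast
    then show ?thesis by simp
  qed
  then show ?thesis using y by blast
qed

definition \<Lambda> where "\<Lambda> = (SOME L. (\<forall>h. h * L = scale (\<epsilon> h) L) \<and> \<epsilon> L = 1)"

lemma \<Lambda>_left: "h * \<Lambda> = scale (\<epsilon> h) \<Lambda>" and \<epsilon>_\<Lambda>: "\<epsilon> \<Lambda> = 1"
proof -
  have "(\<forall>h. h * \<Lambda> = scale (\<epsilon> h) \<Lambda>) \<and> \<epsilon> \<Lambda> = 1"
    unfolding \<Lambda>_def by (rule someI_ex[OF integral_exists])
  then show "h * \<Lambda> = scale (\<epsilon> h) \<Lambda>" "\<epsilon> \<Lambda> = 1" by blast+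
qed

text \<open>The defect \<open>y\<close> is a left integral of counit 0. Regularity gives y = y x y,
  and left integrality turns this into y = \<epsilon>(y x) y = 0.\<close>

lemma \<Lambda>_right: "\<Lambda> * h = scale (\<epsilon> h) \<Lambda>"
proof -
  define y where "y = \<Lambda> * h - scale (\<epsilon> h) \<Lambda>"
  have l: "x * y = scale (\<epsilon> x) y" for x
    unfolding y_def right_diff_distrib
    by (simp add: mult.assoc[symmetric] \<Lambda>_left scale_mult_left[symmetric] scale_mult_right[symmetric]
        scale_right_diff_distrib mult.commute)
  have e: "\<epsilon> y = 0" by (simp add: y_def lin_diff[OF lin\<epsilon>] lin_scale[OF lin\<epsilon>] counit_mult \<epsilon>_\<Lambda>)
  obtain x where "y = y * x * y" using von_neumann_regular by blast
  then have "y = scale (\<epsilon> (y * x)) y" using l by metis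
  then have "y = 0" using e by (simp add: counit_mult)
  then show ?thesis by (simp add: y_def)
qed

text \<open>Insert h_2 S(h_3) into the second leg: the factors h_1 and h_2 then belong to the
  coproduct of a multiple of the integral, which absorbs them.\<close>

lemma sw_\<Lambda>_right:
  assumes "bil s' F"
  shows "sw \<Lambda> (\<lambda>a b. F (a * h) b) = sw \<Lambda> (\<lambda>a b. F a (b * S h))"
proof -
  have l: "lin scale s' (\<lambda>x. F x y)" "lin scale s' (\<lambda>y. F x y)" and vs: "vector_space s'" for x y
    using assms by (auto simp: bil_def)
  note li = vs lin_intros lin_comp[OF l(1)] lin_comp[OF l(2)]
  define G where "G x m = sw \<Lambda> (\<lambda>a b. F (a * x) (b * m))" for x m
  have G: "bil s' G" unfolding G_def by (intro bilI li)
  have "sw \<Lambda> (\<lambda>a b. F (a * h) b) = G h 1" by (simp add: G_def)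
  also have "\<dots> = sw h (\<lambda>x y. sw y (\<lambda>c d. G x (c * S d)))"
    by (rule sw_cancel23(2)[OF G, symmetric])
  also have "\<dots> = sw h (\<lambda>u d. sw u (\<lambda>x c. sw \<Lambda> (\<lambda>a b. F (a * x) (b * c * S d))))"
    unfolding G_def mult.assoc[symmetric]
    by (rule sw_coassoc[of s' "\<lambda>x c d. sw \<Lambda> (\<lambda>a b. F (a * x) (b * c * S d))", symmetric]; intro li)
  also have "\<dots> = sw h (\<lambda>u d. sw (\<Lambda> * u) (\<lambda>a b. F a (b * S d)))"
  proof (rule sw_cong)
    fix u d
    show "sw u (\<lambda>x c. sw \<Lambda> (\<lambda>a b. F (a * x) (b * c * S d))) = sw (\<Lambda> * u) (\<lambda>a b. F a (b * S d))"
      unfolding sw_swap[of u] by (rule sw_mult[of s', symmetric]) (intro bilI li l)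
  qed
  also have "\<dots> = sw h (\<lambda>u d. s' (\<epsilon> u) (sw \<Lambda> (\<lambda>a b. F a (b * S d))))"
  proof (rule sw_cong)
    fix u d
    have L: "lin scale s' (\<lambda>t. sw t (\<lambda>a b. F a (b * S d)))" by (intro li bilI l)
    show "sw (\<Lambda> * u) (\<lambda>a b. F a (b * S d)) = s' (\<epsilon> u) (sw \<Lambda> (\<lambda>a b. F a (b * S d)))"
      unfolding \<Lambda>_right by (rule lin_scale[OF L])
  qed
  also have "\<dots> = sw \<Lambda> (\<lambda>a b. F a (b * S h))"
    by (rule sw_counit_left; intro li)
  finally show ?thesis .
qed

lemma sw_\<Lambda>_left:
  assumes "bil s' F"
  shows "sw \<Lambda> (\<lambda>a b. F a (x * b)) = sw \<Lambda> (\<lambda>a b. F (S x * a) b)"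
proof -
  have l: "lin scale s' (\<lambda>x. F x y)" "lin scale s' (\<lambda>y. F x y)" and vs: "vector_space s'" for x y
    using assms by (auto simp: bil_def)
  note li = vs lin_intros lin_comp[OF l(1)] lin_comp[OF l(2)]
  define G where "G m d = sw \<Lambda> (\<lambda>a b. F (m * a) (d * b))" for m d
  have G: "bil s' G" unfolding G_def by (intro bilI li)
  have "sw \<Lambda> (\<lambda>a b. F a (x * b)) = G 1 x" by (simp add: G_def)
  also have "\<dots> = sw x (\<lambda>p q. sw q (\<lambda>c d. G (S p * c) d))"
    by (rule sw_cancel12(1)[OF G, symmetric])
  also have "\<dots> = sw x (\<lambda>p q. sw (q * \<Lambda>) (\<lambda>a b. F (S p * a) b))"
  proof (rule sw_cong)
    fix p q
    show "sw q (\<lambda>c d. G (S p * c) d) = sw (q * \<Lambda>) (\<lambda>a b. F (S p * a) b)"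
      unfolding G_def mult.assoc by (rule sw_mult[of s', symmetric]) (intro bilI li l)
  qed
  also have "\<dots> = sw x (\<lambda>p q. s' (\<epsilon> q) (sw \<Lambda> (\<lambda>a b. F (S p * a) b)))"
  proof (rule sw_cong)
    fix p q
    have L: "lin scale s' (\<lambda>t. sw t (\<lambda>a b. F (S p * a) b))" by (intro li bilI l)
    show "sw (q * \<Lambda>) (\<lambda>a b. F (S p * a) b) = s' (\<epsilon> q) (sw \<Lambda> (\<lambda>a b. F (S p * a) b))"
      unfolding \<Lambda>_left by (rule lin_scale[OF L])
  qed
  also have "\<dots> = sw \<Lambda> (\<lambda>a b. F (S x * a) b)"
    by (rule sw_counit_right; intro li)
  finally show ?thesis .
qed

text \<open>The antipode axiom reads 1 = \<Lambda>_1 S(\<Lambda>_2). Expanding the second leg in a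
  basis, each S(c) moves from the first leg to the second across the integral, and only a scalar is
  left there.\<close>

lemma one_from_\<Lambda>: "\<exists>f. linF f \<and> sw \<Lambda> (\<lambda>a b. scale (f b) a) = 1"
proof -
  \<comment> \<open>The trace of the map sending c to y S(S c), which is \<open>lam y\<close> in the
    later notation.\<close>
  define f where "f y = (\<Sum>c\<in>Basis. representation Basis (y * S (S c)) c)" for y
  have f: "linF f" unfolding f_def by (rule lin_SUM[OF vector_space_mult], rule lin_comp[OF lin_rep]) (intro lin_intros)
  have "1 = sw \<Lambda> (\<lambda>a b. a * S b)"
    using sw_antipode_right[OF lin_ident, of \<Lambda>] by (simp add: \<epsilon>_\<Lambda>)
  also have "\<dots> = sw \<Lambda> (\<lambda>a b. \<Sum>c\<in>Basis. scale (representation Basis b c) (a * S c))"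
    by (rule sw_cong, rule lin_expand[of scale "\<lambda>b. a * S b" for a]) (intro lin_intros)
  also have "\<dots> = (\<Sum>c\<in>Basis. sw \<Lambda> (\<lambda>a b. scale (representation Basis b c) (a * S c)))"
    by (rule sw_sum)
  also have "\<dots> = (\<Sum>c\<in>Basis. sw \<Lambda> (\<lambda>a b. scale (representation Basis (b * S (S c)) c) a))"
  proof (rule sum.cong[OF refl])
    fix c
    have "bil scale (\<lambda>a b. scale (representation Basis b c) a)" by (intro bilE lin_intros' lin_rep)
    from sw_\<Lambda>_right[OF this, of "S c"]
    show "sw \<Lambda> (\<lambda>a b. scale (representation Basis b c) (a * S c)) =
        sw \<Lambda> (\<lambda>a b. scale (representation Basis (b * S (S c)) c) a)" .
  qed
  also have "\<dots> = sw \<Lambda> (\<lambda>a b. scale (f b) a)"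
    unfolding f_def scale_sum_left sw_sum ..
  finally show ?thesis using f by metis
qed

text \<open>If S h = 0, multiply the expression of 1 by h on the first leg and move h to the second
  leg as S h; this gives h = 0.\<close>

lemma inj_S: "inj S"
proof -
  obtain f where f: "linF f" "sw \<Lambda> (\<lambda>a b. scale (f b) a) = 1" using one_from_\<Lambda> by blast
  have z: "h = 0" if "S h = 0" for h
  proof -
    have "h = sw \<Lambda> (\<lambda>a b. scale (f b) a) * h" using f by simp
    also have "\<dots> = sw \<Lambda> (\<lambda>a b. scale (f b) (a * h))"
      by (simp add: sw_comp[OF lin_mult_right[OF lin_ident]] scale_mult_left)
    also have "\<dots> = sw \<Lambda> (\<lambda>a b. scale (f (b * S h)) a)"
      by (rule sw_\<Lambda>_right[of scale "\<lambda>a b. scale (f b) a"]) (intro bilE lin_intros' f)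
    also have "\<dots> = 0" using that lin_zero[OF f(1)] by (simp add: sw_def)
    finally show ?thesis .
  qed
  show ?thesis
  proof (rule injI)
    fix x y assume "S x = S y"
    then have "S (x - y) = 0" by (simp add: lin_diff[OF linS])
    from z[OF this] show "x = y" by simp
  qed
qed

lemma surj_S: "surj S"
  using linear_inj_imp_surj[OF antipode_linear inj_S] .

lemma S_\<Lambda>: "S \<Lambda> = \<Lambda>"
proof -
  have "\<Lambda> * S \<Lambda> = S \<Lambda>"
  proof -
    obtain k where "\<Lambda> = S k" using surj_S by (metis surjD)
    then show ?thesis using S_mult[of \<Lambda> k, symmetric] \<Lambda>_right[of k] counit_S[of k] \<epsilon>_\<Lambda> by simp
  qed
  then show ?thesis by (simp add: \<Lambda>_right counit_S \<epsilon>_\<Lambda>)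
qed

lemma one_from_\<Lambda>': "\<exists>g. linF g \<and> sw \<Lambda> (\<lambda>a b. scale (g a) b) = 1"
proof -
  obtain f where f: "linF f" "sw \<Lambda> (\<lambda>a b. scale (f b) a) = 1" using one_from_\<Lambda> by blast
  have "sw \<Lambda> (\<lambda>a b. scale (f b) a) = sw (S \<Lambda>) (\<lambda>a b. scale (f b) a)" by (simp add: S_\<Lambda>)
  also have "\<dots> = sw \<Lambda> (\<lambda>x y. scale (f (S x)) (S y))"
    by (rule sw_S[of scale]) (intro bilE lin_intros' f)
  also have "\<dots> = S (sw \<Lambda> (\<lambda>x y. scale (f (S x)) y))"
    by (simp add: sw_comp[OF linS] lin_scale[OF linS])
  finally have "sw \<Lambda> (\<lambda>x y. scale (f (S x)) y) = 1" using f(2) S_one inj_S by (metis injD)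
  then show ?thesis using lin_comp[OF f(1) linS] by blast
qed

section \<open>Integrals on \<open>H\<close>, that is, integrals of the dual algebra\<close>

definition left_int :: "('h \<Rightarrow> 'k) \<Rightarrow> bool" where
  "left_int \<mu> \<longleftrightarrow> linF \<mu> \<and> (\<forall>x. sw x (\<lambda>a b. scale (\<mu> b) a) = scale (\<mu> x) 1)"

definition right_int :: "('h \<Rightarrow> 'k) \<Rightarrow> bool" where
  "right_int \<mu> \<longleftrightarrow> linF \<mu> \<and> (\<forall>x. sw x (\<lambda>a b. scale (\<mu> a) b) = scale (\<mu> x) 1)"

lemma left_int_lin: "left_int \<mu> \<Longrightarrow> linF \<mu>"
  and left_int_sw: "left_int \<mu> \<Longrightarrow> sw x (\<lambda>a b. scale (\<mu> b) a) = scale (\<mu> x) 1"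
  unfolding left_int_def by (elim conjE, assumption) (elim conjE, erule spec)

text \<open>Multiplication by x passes to the first leg as S(x), and \<mu> then absorbs the second
  leg. When \<mu>(\<Lambda>) is nonzero, the two legs of \<Lambda> thus give dual bases for
  \<mu>.\<close>

lemma left_int_\<Lambda>:
  assumes "left_int \<mu>"
  shows "sw \<Lambda> (\<lambda>a b. scale (\<mu> (x * b)) a) = scale (\<mu> \<Lambda>) (S x)"
proof -
  have l: "linF \<mu>" by (rule left_int_lin[OF assms(1)])
  have "sw \<Lambda> (\<lambda>a b. scale (\<mu> (x * b)) a) = sw \<Lambda> (\<lambda>a b. scale (\<mu> b) (S x * a))"
    by (rule sw_\<Lambda>_left[of scale "\<lambda>a b. scale (\<mu> b) a"]) (intro bilE lin_intros' l)
  also have "\<dots> = S x * sw \<Lambda> (\<lambda>a b. scale (\<mu> b) a)"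
    by (simp add: sw_comp[OF lin_mult_left[OF lin_ident]] scale_mult_right)
  also have "sw \<Lambda> (\<lambda>a b. scale (\<mu> b) a) = scale (\<mu> \<Lambda>) 1" by (rule left_int_sw[OF assms])
  also have "S x * scale (\<mu> \<Lambda>) 1 = scale (\<mu> \<Lambda>) (S x)"
    using scale_mult_right[of "\<mu> \<Lambda>" "S x" 1] by simp
  finally show ?thesis .
qed

text \<open>Writing 1 as g(\<Lambda>_1) \<Lambda>_2 expresses \<mu>(x) through \<Lambda>_1 \<mu>(x
  \<Lambda>_2), a multiple of \<mu>(\<Lambda>). With \<open>left_int_diff\<close> this is the
  uniqueness of integrals.\<close>

lemma left_int_zero:
  assumes "left_int \<mu>" "\<mu> \<Lambda> = 0"
  shows "\<mu> x = 0"
proof -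
  have l: "linF \<mu>" by (rule left_int_lin[OF assms(1)])
  obtain g where g: "linF g" "sw \<Lambda> (\<lambda>a b. scale (g a) b) = 1" by (rule exE[OF one_from_\<Lambda>']) auto
  have "\<mu> x = \<mu> (x * sw \<Lambda> (\<lambda>a b. scale (g a) b))" by (simp only: g(2) mult_1_right)
  also have "\<dots> = sw \<Lambda> (\<lambda>a b. g a * \<mu> (x * b))"
    by (simp only: sw_comp[OF lin_comp[OF l lin_mult_left[OF lin_ident]]] lin_scale[OF lin_comp[OF l lin_mult_left[OF lin_ident]]])
  also have "\<dots> = g (sw \<Lambda> (\<lambda>a b. scale (\<mu> (x * b)) a))"
    by (simp add: sw_comp[OF g(1)] lin_scale[OF g(1)] mult.commute)
  also have "\<dots> = 0" by (simp add: left_int_\<Lambda>[OF assms(1)] assms(2) lin_zero[OF g(1)])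
  finally show ?thesis .
qed

lemma left_int_diff:
  assumes "left_int \<mu>" "left_int \<nu>"
  shows "left_int (\<lambda>x. \<mu> x - c * \<nu> x)"
  unfolding left_int_def
proof (intro conjI allI)
  note l = left_int_lin[OF assms(1)] left_int_lin[OF assms(2)]
  show "linF (\<lambda>x. \<mu> x - c * \<nu> x)" by (intro lin_minus' lin_k_left vector_space_mult l)
  fix x
  have "sw x (\<lambda>a b. scale (\<mu> b - c * \<nu> b) a) =
      sw x (\<lambda>a b. scale (\<mu> b) a) - scale c (sw x (\<lambda>a b. scale (\<nu> b) a))"
    unfolding smulE[symmetric] sw_diff[symmetric] by (simp add: scale_left_diff_distrib)
  then show "sw x (\<lambda>a b. scale (\<mu> b - c * \<nu> b) a) = scale (\<mu> x - c * \<nu> x) 1"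
    unfolding left_int_sw[OF assms(1)] left_int_sw[OF assms(2)] by (simp add: scale_left_diff_distrib)
qed

text \<open>Twisting the regular character by S^2 makes it an integral before S^2 = id is known. Its
  value at \<Lambda> is 1 because \<Lambda> acts with rank one.\<close>

definition lam where "lam x = trace UNIV (\<lambda>y. x * S (S y))"

lemma lin_trace: "(\<And>y. linE (\<lambda>x. F x y)) \<Longrightarrow> linF (\<lambda>x. trace UNIV (F x))"
  unfolding trace_def by (intro lin_SUM vector_space_mult lin_comp[OF lin_crd])

lemma lin_lam: "linF lam"
  unfolding lam_def by (intro lin_trace lin_intros)

lemma lam_\<Lambda>: "lam \<Lambda> = 1"
  unfolding lam_def \<Lambda>_right counit_S using trace_rank1[OF fdim_UNIV lin\<epsilon>, of \<Lambda>] by (simp add: \<epsilon>_\<Lambda>)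

lemma left_int_trace:
  assumes "linE Q" "\<And>\<phi> z. linF \<phi> \<Longrightarrow> Q (T' \<phi> z) = T' \<phi> (Q z)"
  shows "left_int (\<lambda>x. trace UNIV (\<lambda>y. Q (x * S (S y))))"
  unfolding left_int_def
proof (intro conjI allI)
  show "linF (\<lambda>x. trace UNIV (\<lambda>y. Q (x * S (S y))))"
    by (intro lin_trace lin_comp[OF assms(1)] lin_intros)
  fix x
  show "sw x (\<lambda>a b. scale (trace UNIV (\<lambda>y. Q (b * S (S y)))) a) = scale (trace UNIV (\<lambda>y. Q (x * S (S y)))) 1"
  proof (rule functional_eqI)
    fix f assume f: "linF f"
    show "f (sw x (\<lambda>a b. scale (trace UNIV (\<lambda>y. Q (b * S (S y)))) a)) = f (scale (trace UNIV (\<lambda>y. Q (x * S (S y)))) 1)"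
      using trace_left_integral[OF assms f, of x] by (simp add: sw_comp[OF f] lin_scale[OF f] mult.commute)
  qed
qed

lemma left_int_lam: "left_int lam"
  using left_int_trace[of "\<lambda>x. x"] by (simp add: lam_def[abs_def] lin_ident)

lemma left_int_unique:
  assumes "left_int \<mu>"
  shows "\<mu> x = \<mu> \<Lambda> * lam x"
  using left_int_zero[OF left_int_diff[OF assms left_int_lam, of "\<mu> \<Lambda>"], of x] by (simp add: lam_\<Lambda>)

text \<open>Both sides are left integrals in x, because \<open>T f\<close> commutes with every
  \<open>T'\<close>; it remains to compare them at \<Lambda>, where the operator has rank at most
  one.\<close>

lemma trace_T_mult_S2:
  assumes f: "linF f"
  shows "trace UNIV (\<lambda>y. T f (x * S (S y))) = f \<Lambda> * lam x"
proof -
  have "left_int (\<lambda>x. trace UNIV (\<lambda>y. T f (x * S (S y))))"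
    by (rule left_int_trace) (use T_T' linT f in auto)
  note left_int_unique[OF this, of x]
  moreover have "trace UNIV (\<lambda>y. T f (\<Lambda> * S (S y))) = trace UNIV (\<lambda>y. scale (\<epsilon> y) (T f \<Lambda>))"
    by (simp add: \<Lambda>_right counit_S lin_scale[OF linT[OF f]])
  moreover have "\<dots> = \<epsilon> (T f \<Lambda>)" by (rule trace_rank1[OF fdim_UNIV lin\<epsilon>]) simp
  moreover have "\<dots> = f \<Lambda>"
    using sw_counit_left[OF vector_space_mult f, of \<Lambda>]
    by (simp add: T_def sw_comp[OF lin\<epsilon>] lin_scale[OF lin\<epsilon>] mult.commute)
  ultimately show ?thesis by simp
qed

lemma lin_mult_S2: "linE (\<lambda>y. x * S (S y))"
  by (intro lin_intros)

text \<open>Cyclicity of the trace: S^2 is the Nakayama automorphism of the Frobenius form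
  \<open>lam\<close>.\<close>

lemma lam_twist: "lam (x * y) = lam (y * S (S x))"
proof -
  have "lam (x * y) = trace UNIV (\<lambda>z. x * (y * S (S z)))" by (simp add: lam_def mult.assoc)
  also have "\<dots> = trace UNIV (\<lambda>z. y * S (S (x * z)))"
    by (rule trace_cyc[OF fdim_UNIV lin_mult_left[OF lin_ident] _ lin_mult_S2]) auto
  also have "\<dots> = lam (y * S (S x))" by (simp add: lam_def S_mult mult.assoc)
  finally show ?thesis .
qed

lemma lam_nondeg_left:
  assumes "\<And>y. lam (x * y) = 0"
  shows "x = 0"
proof -
  have "S x = 0" using left_int_\<Lambda>[OF left_int_lam, of x] assms by (simp add: lam_\<Lambda> sw_def)
  then have "S x = S 0" by (simp add: lin_zero[OF linS])
  then show ?thesis by (rule injD[OF inj_S])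
qed

lemma lam_nondeg_right:
  assumes "\<And>x. lam (x * y) = 0"
  shows "y = 0"
proof -
  obtain u where u: "y = S (S u)" using surj_S by (metis surjD)
  have "u = 0" by (rule lam_nondeg_left) (simp add: lam_twist[of u] u[symmetric] assms)
  then show ?thesis using u lin_zero[OF linS] by simp
qed

text \<open>The dual bases coming from the integral give the representing element explicitly; the
  inverse antipode undoes the S in \<open>left_int_\<Lambda>\<close>.\<close>

lemma lam_representing:
  assumes f: "linF f"
  shows "\<exists>v. \<forall>x. f x = lam (x * v)"
proof -
  define Ri where "Ri = inv_into UNIV S"
  have R: "linE Ri" "\<And>x. Ri (S x) = x"
    using linear_lin[OF inj_linear_imp_inv_linear[OF antipode_linear inj_S]] inv_f_f[OF inj_S] by (simp_all add: Ri_def)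
  have fR: "linF (\<lambda>x. f (Ri x))" by (rule lin_comp[OF f R(1)])
  have "f x = lam (x * sw \<Lambda> (\<lambda>a b. scale (f (Ri a)) b))" for x
  proof -
    have "f x = f (Ri (sw \<Lambda> (\<lambda>a b. scale (lam (x * b)) a)))"
      using left_int_\<Lambda>[OF left_int_lam, of x] by (simp add: lam_\<Lambda> R)
    also have "\<dots> = sw \<Lambda> (\<lambda>a b. lam (x * b) * f (Ri a))"
      by (simp add: sw_comp[OF fR] lin_scale[OF fR])
    also have "\<dots> = lam (x * sw \<Lambda> (\<lambda>a b. scale (f (Ri a)) b))"
      by (simp only: sw_comp[OF lin_comp[OF lin_lam lin_mult_left[OF lin_ident]]]
          lin_scale[OF lin_comp[OF lin_lam lin_mult_left[OF lin_ident]]] mult.commute)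
    finally show ?thesis .
  qed
  then show ?thesis by blast
qed

end

section \<open>Grouplike elements and idempotents\<close>

context fd_hopf
begin

text \<open>The equation \<Delta>(g) = g \<otimes> g, tested by functionals on the second
  leg.\<close>

definition gl :: "'h \<Rightarrow> bool" where
  "gl g \<longleftrightarrow> \<epsilon> g = 1 \<and> (\<forall>f. linF f \<longrightarrow> T f g = scale (f g) g)"

lemma gl_T: "gl g \<Longrightarrow> linF f \<Longrightarrow> T f g = scale (f g) g" and gl_\<epsilon>: "gl g \<Longrightarrow> \<epsilon> g = 1"
  unfolding gl_def by blast+

lemma del_T: "del b h = T (\<lambda>y. representation Basis y b) h"
proof -
  have "bil scale (\<lambda>x y. scale (representation Basis y b) x)"
    by (intro bilE lin_intros' lin_rep)
  then show ?thesis unfolding del_def T_def by (rule lin_ext_sw)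
qed

lemma sw_T:
  assumes "bil s' F"
  shows "sw h F = (\<Sum>b\<in>Basis. F (T (\<lambda>y. representation Basis y b) h) b)"
  unfolding sw_def del_T ..

lemma sw_gl:
  assumes "gl g" "bil s' F"
  shows "sw g F = F g g"
proof -
  have l: "lin scale s' (\<lambda>x. F x y)" "lin scale s' (\<lambda>y. F x y)" for x y
    using assms by (auto simp: bil_def)
  show ?thesis
    unfolding sw_T[OF assms(2)] gl_T[OF assms(1) lin_rep] lin_scale[OF l(1)]
    by (rule lin_expand[OF l(2), symmetric])
qed

lemma glI:
  assumes "\<epsilon> g = 1" "\<And>f f'. linF f \<Longrightarrow> linF f' \<Longrightarrow> sw g (\<lambda>a b. f a * f' b) = f g * f' g"
  shows "gl g"
  unfolding gl_def
proof (intro conjI allI impI assms(1))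
  fix f assume f: "linF f"
  show "T f g = scale (f g) g"
  proof (rule functional_eqI)
    fix f' assume f': "linF f'"
    show "f' (T f g) = f' (scale (f g) g)"
      using assms(2)[OF f' f] by (simp add: T_def sw_comp[OF f'] lin_scale[OF f'] mult.commute)
  qed
qed

lemma bil_k: "linF f \<Longrightarrow> linF f' \<Longrightarrow> bil (*) (\<lambda>a b. f a * f' b)"
  by (intro bilF lin_k_left lin_k_right)

lemma gl_mult:
  assumes "gl g" "gl h"
  shows "gl (g * h)"
proof (rule glI)
  show "\<epsilon> (g * h) = 1" by (simp add: counit_mult gl_\<epsilon> assms)
  fix f f' assume f: "linF f" "linF f'"
  have l: "linF (\<lambda>x. f (x * c))" "linF (\<lambda>x. f' (x * c))" "linF (\<lambda>x. f (c * x))" "linF (\<lambda>x. f' (c * x))" for c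
    by (intro lin_comp[OF f(1)] lin_comp[OF f(2)] lin_intros)+
  have b: "bil (*) (\<lambda>c d. f (a * c) * f' (b * d))" "bil (*) (\<lambda>a b. f (a * h) * f' (b * h))" for a b
    by (intro bil_k l)+
  show "sw (g * h) (\<lambda>a b. f a * f' b) = f (g * h) * f' (g * h)"
    unfolding sw_mult[OF bil_k[OF f]] sw_gl[OF assms(2) b(1)] by (rule sw_gl[OF assms(1) b(2)])
qed

lemma gl_one: "gl 1"
  by (rule glI) (simp_all add: counit_one sw_one[OF bil_k])

lemma gl_power: "gl g \<Longrightarrow> gl (g ^ n)"
  by (induction n) (simp_all add: gl_one gl_mult)

lemma gl_inverse:
  assumes "gl g"
  shows "g * S g = 1" "S g * g = 1"
proof -
  have b: "bil scale (\<lambda>x y. x * S y)" "bil scale (\<lambda>x y. S x * y)" by (intro bilE lin_intros')+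
  show "g * S g = 1" "S g * g = 1"
    using sw_gl[OF assms b(1)] sw_gl[OF assms b(2)] sw_antipode_left[OF lin_ident, of g]
      sw_antipode_right[OF lin_ident, of g] by (simp_all add: gl_\<epsilon>[OF assms])
qed

lemma gl_S:
  assumes "gl g"
  shows "gl (S g)"
proof (rule glI)
  show "\<epsilon> (S g) = 1" by (simp add: counit_S gl_\<epsilon> assms)
  fix f f' assume f: "linF f" "linF f'"
  have "sw (S g) (\<lambda>a b. f a * f' b) = sw g (\<lambda>x y. f (S y) * f' (S x))"
    by (rule sw_S[OF bil_k[OF f]])
  also have "\<dots> = f (S g) * f' (S g)"
    by (rule sw_gl[OF assms, of "(*)"]) (intro bilF lin_k_left lin_k_right lin_comp[OF f(1)] lin_comp[OF f(2)] linS)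
  finally show "sw (S g) (\<lambda>a b. f a * f' b) = f (S g) * f' (S g)" .
qed

text \<open>Applying \<open>T f\<close> to an expansion of g and using independence of the smaller
  set gives f(h) = f(g) for all f whenever h occurs in the expansion, so h = g.\<close>

lemma gl_independent:
  assumes "finite F" "\<And>g. g \<in> F \<Longrightarrow> gl g"
  shows "independent F"
  using assms
proof (induction F rule: finite_induct)
  case (insert g F)
  have iF: "independent F" using insert by simp
  have gg: "gl g" using insert by simp
  have glF: "\<And>h. h \<in> F \<Longrightarrow> gl h" using insert by simp
  have "g \<notin> span F"
  proof
    assume "g \<in> span F"
    then obtain c where c: "(\<Sum>h\<in>F. scale (c h) h) = g" using span_finite[OF insert(1)] by auto
    have "c h = 0" if h: "h \<in> F" for h
    proof (rule ccontr)
      assume ch: "c h \<noteq> 0"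
      have "f h = f g" if f: "linF f" for f
      proof -
        have "T f g = (\<Sum>h\<in>F. scale (c h) (T f h))"
          unfolding c[symmetric] lin_sum[OF linT[OF f]] lin_scale[OF linT[OF f]] ..
        also have "\<dots> = (\<Sum>h\<in>F. scale (c h * f h) h)"
          using gl_T[OF glF f] by (intro sum.cong refl) (metis scale_scale)
        finally have "(\<Sum>h\<in>F. scale (c h * f h) h) = scale (f g) g" using gl_T[OF gg f] by metis
        also have "\<dots> = (\<Sum>h\<in>F. scale (f g * c h) h)" unfolding c[symmetric] scale_sum_right by simp
        finally have "(\<Sum>h\<in>F. scale (c h * f h - f g * c h) h) = 0"
          by (simp add: scale_left_diff_distrib sum_subtractf)
        from independentD[OF iF insert(1) order_refl this h] ch show ?thesis by simp
      qed
      then have "h = g" by (rule functional_eqI)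
      then show False using h insert(2) by simp
    qed
    then have "g = 0" using c by (metis (no_types, lifting) scale_zero_left sum.neutral)
    then show False using gl_\<epsilon>[OF gg] lin_zero[OF lin\<epsilon>] by simp
  qed
  then show ?case using iF by (rule independent_insertI)
qed (rule independent_empty)

lemma gl_finite_order:
  assumes "gl g"
  shows "\<exists>N>0. g ^ N = 1"
proof -
  have "\<not> inj_on (\<lambda>i. g ^ i) {..dimension}"
  proof
    assume inj: "inj_on (\<lambda>i. g ^ i) {..dimension}"
    have "independent ((\<lambda>i. g ^ i) ` {..dimension})"
      by (rule gl_independent) (auto intro: gl_power assms)
    then have "card ((\<lambda>i. g ^ i) ` {..dimension}) \<le> dim UNIV"
      by (intro independent_card_le_dim) auto
    then show False using card_image[OF inj] by (simp add: dimension_def)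
  qed
  then obtain i j where ij: "i < j" "g ^ i = g ^ j" unfolding inj_on_def by (metis linorder_neqE_nat)
  have c: "S g ^ i * g ^ i = 1" for i
  proof (induction i)
    case (Suc i)
    have "S g ^ Suc i * g ^ Suc i = S g ^ i * (S g * g) * g ^ i" by (simp only: power_Suc2[of "S g"] power_Suc[of g] mult.assoc)
    also have "\<dots> = 1" using Suc gl_inverse[OF assms] by simp
    finally show ?case .
  qed simp
  have "1 = S g ^ i * g ^ (i + (j - i))" using c[of i] ij by simp
  also have "\<dots> = g ^ (j - i)" unfolding power_add mult.assoc[symmetric] c by simp
  finally show ?thesis using ij(1) by (intro exI[of _ "j - i"]) simp
qed

section \<open>Orthogonal idempotents in regular subalgebras\<close>

definition subalg :: "'h set \<Rightarrow> bool" where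
  "subalg B \<longleftrightarrow> subspace B \<and> 1 \<in> B \<and> (\<forall>a\<in>B. \<forall>b\<in>B. a * b \<in> B)"

definition vnr :: "'h set \<Rightarrow> bool" where
  "vnr B \<longleftrightarrow> (\<forall>x\<in>B. \<exists>y\<in>B. x = x * y * x)"

definition orth :: "'h set \<Rightarrow> bool" where
  "orth E \<longleftrightarrow> finite E \<and> (\<forall>e\<in>E. e \<noteq> 0 \<and> e * e = e) \<and> (\<forall>e\<in>E. \<forall>f\<in>E. e \<noteq> f \<longrightarrow> e * f = 0) \<and> \<Sum>E = 1"

lemma subalgD: "subalg B \<Longrightarrow> subspace B" "subalg B \<Longrightarrow> 1 \<in> B" "subalg B \<Longrightarrow> a \<in> B \<Longrightarrow> b \<in> B \<Longrightarrow> a * b \<in> B"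
  by (simp_all add: subalg_def)

lemma orthD: "orth E \<Longrightarrow> finite E" "orth E \<Longrightarrow> e \<in> E \<Longrightarrow> e \<noteq> 0" "orth E \<Longrightarrow> e \<in> E \<Longrightarrow> e * e = e"
  "orth E \<Longrightarrow> e \<in> E \<Longrightarrow> f \<in> E \<Longrightarrow> e \<noteq> f \<Longrightarrow> e * f = 0" "orth E \<Longrightarrow> \<Sum>E = 1"
  by (simp_all add: orth_def)

lemma orth_card:
  assumes "orth E"
  shows "card E \<le> dimension"
proof -
  have "independent E"
  proof (rule independent_if_scalars_zero[OF orthD(1)[OF assms]])
    fix c f assume s: "(\<Sum>e\<in>E. scale (c e) e) = 0" and f: "f \<in> E"
    have "0 = (\<Sum>e\<in>E. scale (c e) e) * f" using s by simp
    also have "\<dots> = (\<Sum>e\<in>E. scale (c e) (e * f))" by (simp add: sum_distrib_right scale_mult_left)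
    also have "\<dots> = (\<Sum>e\<in>{f}. scale (c e) (e * f))"
      by (rule sum.mono_neutral_right) (use orthD[OF assms] f in auto)
    also have "\<dots> = scale (c f) f" using orthD(3)[OF assms f] by simp
    finally show "c f = 0" using orthD(2)[OF assms f] by simp
  qed
  then show ?thesis using independent_card_le_dim[of E UNIV] by (simp add: dimension_def)
qed

lemma orth_refine:
  assumes E: "orth E" and e: "e \<in> E" and p: "p * p = p" "e * p = p" "p * e = p" "p \<noteq> 0" "p \<noteq> e"
  shows "orth (insert p (insert (e - p) (E - {e})))" "card (insert p (insert (e - p) (E - {e}))) = Suc (card E)"
proof -
  note o = orthD[OF E]
  have pf: "p * f = 0" "f * p = 0" if "f \<in> E" "f \<noteq> e" for f
  proof -
    have "p * f = p * (e * f)" using p(3) by (simp add: mult.assoc[symmetric])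
    then show "p * f = 0" using o(4)[OF e that(1)] that by simp
    have "f * p = (f * e) * p" using p(2) by (simp add: mult.assoc)
    then show "f * p = 0" using o(4)[OF that(1) e] that by simp
  qed
  have q: "(e - p) * (e - p) = e - p" "p * (e - p) = 0" "(e - p) * p = 0" "e - p \<noteq> 0"
    using p o(3)[OF e] by (simp_all add: left_diff_distrib right_diff_distrib)
  have qf: "(e - p) * f = 0" "f * (e - p) = 0" if "f \<in> E" "f \<noteq> e" for f
    using pf[OF that] o(4)[OF e that(1)] o(4)[OF that(1) e] that by (simp_all add: left_diff_distrib right_diff_distrib)
  have pE: "p \<notin> E - {e}" using pf(1)[of p] p(1,4) by auto
  have qE: "e - p \<notin> E - {e}" using qf(1)[of "e - p"] q(1,4) by auto
  have pq: "p \<noteq> e - p" using q(2) p(1,4) by auto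
  show "card (insert p (insert (e - p) (E - {e}))) = Suc (card E)"
    unfolding card.remove[OF o(1) e]
    by (subst card_insert_disjoint, use pE pq o(1) in simp, use pE pq in blast,
        subst card_insert_disjoint, use qE o(1) in simp_all)
  have "\<Sum>(insert p (insert (e - p) (E - {e}))) = p + ((e - p) + \<Sum>(E - {e}))"
    using pE qE pq o(1) by simp
  also have "\<dots> = \<Sum>E" using sum.remove[OF o(1) e, of "\<lambda>x. x"] by simp
  finally have s: "\<Sum>(insert p (insert (e - p) (E - {e}))) = 1" using o(5) by simp
  show "orth (insert p (insert (e - p) (E - {e})))"
    unfolding orth_def using s o p(1,4) q pf qf by auto
qed

end

locale fd_hopf_ac = fd_hopf scale comult counit antipode Basis
  for scale :: "'k::{alg_closed_field, field_char_0} \<Rightarrow> 'h::ring_1 \<Rightarrow> 'h"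
    and comult counit antipode and Basis :: "'h set"
begin

text \<open>Orthogonal decompositions of 1 are independent sets, so one of maximal size exists, and
  its members cannot be split further. Over an algebraically closed field this makes each corner e B
  e consist of scalars.\<close>

lemma primitive_idempotents:
  assumes B: "subalg B" "vnr B"
  shows "\<exists>E. orth E \<and> E \<subseteq> B \<and> (\<forall>e\<in>E. \<forall>x\<in>B. \<exists>c. e * x * e = scale c e)"
proof -
  let ?P = "\<lambda>E. orth E \<and> E \<subseteq> B"
  have "?P {1}" unfolding orth_def using subalgD(2)[OF B(1)] by simp
  then have "\<exists>E. ?P E \<and> (\<forall>E'. ?P E' \<longrightarrow> card E' \<le> card E)"
    by (rule ex_has_greatest_nat[of ?P "{1}" card "Suc dimension"]) (use orth_card in \<open>auto simp: less_Suc_eq_le\<close>)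
  then obtain E where E: "orth E" "E \<subseteq> B" and max: "\<And>E'. orth E' \<Longrightarrow> E' \<subseteq> B \<Longrightarrow> card E' \<le> card E" by blast
  note o = orthD[OF E(1)]
  have prim: "p = 0 \<or> p = e" if "e \<in> E" "p \<in> B" "p * p = p" "e * p = p" "p * e = p" for e p
  proof (rule ccontr)
    assume "\<not> (p = 0 \<or> p = e)"
    then have n: "p \<noteq> 0" "p \<noteq> e" by auto
    let ?E = "insert p (insert (e - p) (E - {e}))"
    have "?E \<subseteq> B" using E(2) that subspace_diff[OF subalgD(1)[OF B(1)], of e p] by auto
    then have "card ?E \<le> card E" using max orth_refine(1)[OF E(1) that(1,3,4,5) n] by blast
    then show False using orth_refine(2)[OF E(1) that(1,3,4,5) n] by simp
  qed
  have "\<exists>c. e * x * e = scale c e" if e: "e \<in> E" and x: "x \<in> B" for e x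
  proof -
    define a where "a = e * x * e"
    have eB: "e \<in> B" using e E(2) by auto
    have ee: "e * e = e" using o(3)[OF e] .
    let ?W = "{y \<in> B. e * y * e = y}"
    have lw: "linE (\<lambda>y. e * y * e)" by (intro lin_intros)
    have sW: "subspace ?W"
      by (rule subspaceI) (auto simp: subspace_0[OF subalgD(1)[OF B(1)]] lin_add[OF lw] lin_scale[OF lw]
          subspace_add[OF subalgD(1)[OF B(1)]] subspace_scale[OF subalgD(1)[OF B(1)]])
    have aB: "a \<in> B" unfolding a_def using x eB subalgD(3)[OF B(1)] by blast
    have ea: "e * a = a" "a * e = a" unfolding a_def using ee by (simp_all add: mult.assoc) (simp add: mult.assoc[symmetric])
    have inv: "(\<lambda>y. a * y) ` ?W \<subseteq> ?W"
    proof
      fix z assume "z \<in> (\<lambda>y. a * y) ` ?W"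
      then obtain y where y: "y \<in> B" "e * y * e = y" "z = a * y" by auto
      have "y * e = y" using y(2) ee by (metis mult.assoc)
      then have "e * z * e = z" using ea(1) y(3) by (metis mult.assoc)
      then show "z \<in> ?W" using y(1,3) aB subalgD(3)[OF B(1)] by blast
    qed
    have eW: "e \<in> ?W" using eB ee by simp
    have "\<exists>c. \<exists>y\<in>?W. y \<noteq> 0 \<and> a * y = scale c y"
      by (rule eigenvector_exists[OF vector_space_axioms fdimI[OF sW] _ inv eW o(2)[OF e]]) (rule lin_eta)
    then obtain c y where y: "y \<in> B" "e * y * e = y" "y \<noteq> 0" "a * y = scale c y" by auto
    \<comment> \<open>Subtracting an eigenvalue \<open>c\<close> of left multiplication by
      \<open>a\<close> on the corner makes \<open>b\<close> kill a nonzero \<open>y\<close>.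
      Regularity gives an idempotent \<open>q\<close> with b q = b, which must be 0 or
      \<open>e\<close>; if it is \<open>e\<close>, then y = q y = 0.\<close>
    define b where "b = a - scale c e"
    have bB: "b \<in> B" unfolding b_def using aB eB B(1) by (auto intro: subspace_diff subspace_scale subalgD)
    have eb: "e * b = b" "b * e = b" unfolding b_def using ea ee
      by (simp_all add: left_diff_distrib right_diff_distrib scale_mult_left[symmetric] scale_mult_right[symmetric])
    have ey: "e * y = y" using y(2) ee by (metis mult.assoc)
    have by0: "b * y = 0" unfolding b_def using y(4) ey by (simp add: left_diff_distrib scale_mult_left[symmetric])
    obtain z where z: "z \<in> B" "b = b * z * b" using B(2) bB unfolding vnr_def by blast
    define q where "q = e * z * b"
    have bq: "b * q = b" unfolding q_def using z(2) eb(2) by (metis mult.assoc)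
    have q: "q \<in> B" "q * q = q" "e * q = q" "q * e = q"
    proof -
      show "q \<in> B" unfolding q_def using z(1) eB bB subalgD(3)[OF B(1)] by blast
      have "q * q = e * z * (b * q)" unfolding q_def by (simp add: mult.assoc)
      then show "q * q = q" unfolding bq by (simp add: q_def)
      show "e * q = q" unfolding q_def using ee by (simp add: mult.assoc[symmetric])
      show "q * e = q" unfolding q_def using eb(2) by (simp add: mult.assoc)
    qed
    have "b = 0"
    proof (rule disjE[OF prim[OF e q]])
      assume "q = 0"
      then show ?thesis using bq by simp
    next
      assume "q = e"
      then have "y = q * y" using ey by simp
      also have "\<dots> = e * z * (b * y)" unfolding q_def by (simp add: mult.assoc)
      finally show ?thesis using by0 y(3) by simp
    qed
    then show ?thesis unfolding b_def a_def by (intro exI[of _ c]) simp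
  qed
  then show ?thesis using E by blast
qed

end

section \<open>Sums of roots of unity\<close>

definition prim_root :: "nat \<Rightarrow> 'k::field \<Rightarrow> bool" where
  "prim_root m z \<longleftrightarrow> (\<forall>i. z ^ i = 1 \<longleftrightarrow> m dvd i)"

lemma alg_closed_nth_root:
  fixes c :: "'k::alg_closed_field"
  assumes "n > 0"
  shows "\<exists>x. x ^ n = c"
proof -
  let ?p = "monom 1 n - [:c:]"
  have "coeff [:c:] n = 0" using assms by (cases n) simp_all
  then have "n \<le> degree ?p" by (intro le_degree) simp
  then have "degree ?p > 0" using assms by simp
  then obtain x where "poly ?p x = 0" using alg_closed_imp_poly_has_root[of ?p] by blast
  then show ?thesis by (intro exI[of _ x]) (simp add: poly_monom)
qed

text \<open>A root of 1 + X + ... + X^(p-1) is not 1, because p is nonzero in characteristic zero;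
  Bezout excludes exponents prime to p.\<close>

lemma prim_root_prime:
  assumes "prime (p::nat)"
  shows "\<exists>w::'k::{alg_closed_field, field_char_0}. prim_root p w"
proof -
  have p: "p > 1" using assms prime_gt_1_nat by blast
  let ?p = "\<Sum>i<p. monom 1 i :: 'k poly"
  have c: "coeff ?p i = (if i < p then 1 else 0)" for i by (simp add: coeff_sum)
  have "degree ?p \<ge> p - 1" by (rule le_degree) (use c p in simp)
  then have "degree ?p > 0" using p by linarith
  then obtain w where "poly ?p w = 0" using alg_closed_imp_poly_has_root[of ?p] by blast
  then have w: "(\<Sum>i<p. w ^ i) = 0" by (simp add: poly_sum poly_monom)
  have w1: "w \<noteq> 1" using w p by auto
  have wp: "w ^ p = 1" using w w1 sum_gp_strict[of w p] by simp
  have "p dvd i" if i: "w ^ i = 1" for i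
  proof (rule ccontr)
    assume "\<not> p dvd i"
    then have "coprime i p" using assms prime_imp_coprime coprime_commute by blast
    moreover have "i \<noteq> 0" using \<open>\<not> p dvd i\<close> by (metis dvd_0_right)
    ultimately obtain x y where xy: "i * x = p * y + 1" using bezout_nat[of i p] by auto
    have "w ^ (i * x) = 1" using i by (simp add: power_mult)
    then show False using xy wp w1 by (simp add: power_add power_mult)
  qed
  then show ?thesis using wp unfolding prim_root_def by (intro exI[of _ w]) (auto simp: power_mult elim!: dvdE)
qed

text \<open>Strip a prime p from m = p n. If p still divides n, a p-th root of a primitive n-th root
  works; otherwise its product with a primitive p-th root does.\<close>

lemma prim_root_exists:
  "m > 0 \<Longrightarrow> \<exists>z::'k::{alg_closed_field, field_char_0}. prim_root m z"
proof (induction m rule: less_induct)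
  case (less m)
  show ?case
  proof (cases "m = 1")
    case True
    then show ?thesis by (intro exI[of _ 1]) (simp add: prim_root_def)
  next
    case False
    then obtain p where p: "prime p" "p dvd m" using prime_factor_nat by blast
    then obtain n where m: "m = p * n" by auto
    have "n < m" "n > 0" using m less(2) prime_gt_1_nat[OF p(1)] by auto
    then obtain z :: 'k where z: "prim_root n z" using less(1) by blast
    note zd = z[unfolded prim_root_def, rule_format]
    have p0: "p > 0" using p(1) prime_gt_0_nat by blast
    show ?thesis
    proof (cases "p dvd n")
      case True
      obtain x where x: "x ^ p = z" using alg_closed_nth_root[OF p0] by blast
      have "m dvd i" if i: "x ^ i = 1" for i
      proof -
        have "z ^ i = (x ^ i) ^ p" unfolding x[symmetric] by (simp add: power_mult[symmetric] mult.commute)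
        then have "n dvd i" using i zd by simp
        then obtain j where j: "i = p * j" using True dvd_trans by blast
        then have "z ^ j = 1" using i x by (simp add: power_mult)
        then show ?thesis using zd j m by simp
      qed
      moreover have "x ^ i = 1" if "m dvd i" for i
        using that zd[of n] x m by (auto simp: power_mult elim!: dvdE)
      ultimately show ?thesis unfolding prim_root_def by blast
    next
      case False
      then have cop: "coprime p n" using p(1) prime_imp_coprime by blast
      obtain w :: 'k where w: "prim_root p w" using prim_root_prime[OF p(1)] by blast
      note wd = w[unfolded prim_root_def, rule_format]
      have "m dvd i" if i: "(z * w) ^ i = 1" for i
      proof -
        have "1 = ((z * w) ^ i) ^ n" using i by simp
        also have "\<dots> = (z ^ n) ^ i * w ^ (n * i)"
          by (simp add: power_mult_distrib power_mult[symmetric] mult.commute)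
        finally have "w ^ (n * i) = 1" using zd[of n] by simp
        then have pi: "p dvd i" using wd cop coprime_dvd_mult_right_iff by blast
        then have "w ^ i = 1" using wd by simp
        then have "z ^ i = 1" using i by (simp add: power_mult_distrib)
        then have "n dvd i" using zd by simp
        then show ?thesis using pi cop m divides_mult by metis
      qed
      moreover have "(z * w) ^ i = 1" if "m dvd i" for i
      proof -
        have "p dvd i" "n dvd i" using that m dvd_mult_left dvd_mult_right by blast+
        then have "w ^ i = 1" "z ^ i = 1" using wd zd by simp_all
        then show ?thesis by (simp add: power_mult_distrib)
      qed
      ultimately show ?thesis unfolding prim_root_def by blast
    qed
  qed
qed

text \<open>The powers of z below m are m distinct roots of X^m - 1, hence all of them.\<close>

lemma prim_root_generates:
  fixes z :: "'k::field"
  assumes z: "prim_root m z" and m: "m > 0" and x: "x ^ m = 1"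
  shows "\<exists>a. x = z ^ a"
proof -
  note zd = z[unfolded prim_root_def, rule_format]
  let ?p = "monom 1 m - 1 :: 'k poly"
  have "coeff ?p m = 1" using m by simp
  then have p0: "?p \<noteq> 0" by force
  have roots: "poly ?p x = 0 \<longleftrightarrow> x ^ m = 1" for x by (simp add: poly_monom)
  have z0: "z \<noteq> 0" using zd[of m] m by (auto simp: zero_power)
  have inj: "inj_on (\<lambda>i. z ^ i) {..<m}"
  proof (rule linorder_inj_onI')
    fix i j assume ij: "i \<in> {..<m}" "j \<in> {..<m}" "i < j"
    show "z ^ i \<noteq> z ^ j"
    proof
      assume "z ^ i = z ^ j"
      then have "z ^ i * z ^ (j - i) = z ^ i * 1" using ij power_add[of z i "j - i"] by simp
      then have "z ^ (j - i) = 1" using z0 by simp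
      then have "m dvd j - i" using zd by simp
      then show False using ij by (auto dest: dvd_imp_le)
    qed
  qed
  have fin: "finite {x. poly ?p x = 0}" using poly_roots_finite[OF p0] .
  have sub: "(\<lambda>i. z ^ i) ` {..<m} \<subseteq> {x. poly ?p x = 0}"
  proof safe
    fix i
    have "(z ^ i) ^ m = (z ^ m) ^ i" by (simp add: power_mult[symmetric] mult.commute)
    then show "poly ?p (z ^ i) = 0" using zd[of m] roots by simp
  qed
  have "degree ?p \<le> m" by (intro degree_diff_le) (simp_all add: degree_monom_le)
  then have "card {x. poly ?p x = 0} \<le> card ((\<lambda>i. z ^ i) ` {..<m})"
    unfolding card_image[OF inj] using card_poly_roots_bound[OF p0] by simp
  then have "(\<lambda>i. z ^ i) ` {..<m} = {x. poly ?p x = 0}"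
    using card_seteq[OF fin sub] by simp
  then show ?thesis using x roots by (metis (mono_tags, lifting) imageE mem_Collect_eq)
qed

definition rat_eval :: "rat poly \<Rightarrow> 'k::field_char_0 \<Rightarrow> 'k" where
  "rat_eval p x = poly (map_poly of_rat p) x"

lemma rat_eval_pCons [simp]: "rat_eval (pCons a p) x = of_rat a + x * rat_eval p x"
  by (simp add: rat_eval_def map_poly_pCons)

lemma rat_eval_0 [simp]: "rat_eval 0 x = 0"
  by (simp add: rat_eval_def)

lemma rat_eval_add [simp]: "rat_eval (p + q) x = rat_eval p x + rat_eval q x"
  by (induction p q rule: poly_induct2) (simp_all add: of_rat_add algebra_simps)

lemma rat_eval_smult [simp]: "rat_eval (smult a p) x = of_rat a * rat_eval p x"
  by (induction p) (simp_all add: of_rat_mult algebra_simps)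

lemma rat_eval_mult [simp]: "rat_eval (p * q) x = rat_eval p x * rat_eval q x"
  by (induction p) (simp_all add: algebra_simps)

lemma rat_eval_monom: "rat_eval (monom 1 n) x = x ^ n"
  by (simp add: rat_eval_def map_poly_monom poly_monom)

lemma rat_eval_sum: "rat_eval (sum f A) x = (\<Sum>a\<in>A. rat_eval (f a) x)"
  by (induction A rule: infinite_finite_induct) simp_all

text \<open>A rational polynomial relation satisfied by a root of unity of \<open>'k\<close> is also satisfied by
  some complex root of unity: take a root of the gcd with \<open>X\<^sup>M - 1\<close>.\<close>

lemma root_of_unity_transfer:
  fixes z :: "'k::field_char_0" and q :: "rat poly"
  assumes "z ^ M = 1" "M > 0" "rat_eval q z = 0"
  shows "\<exists>w::complex. w ^ M = 1 \<and> rat_eval q w = 0"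
proof -
  define r :: "rat poly" where "r = monom 1 M - 1"
  have rr: "rat_eval r x = x ^ M - 1" for x :: "'b::field_char_0"
  proof -
    have "rat_eval (monom 1 M) x = rat_eval (r + 1) x" by (simp add: r_def)
    also have "\<dots> = rat_eval r x + 1" unfolding rat_eval_add one_pCons by simp
    finally show ?thesis by (simp add: rat_eval_monom)
  qed
  have "coeff r M = 1" using assms(2) by (simp add: r_def)
  then have r0: "r \<noteq> 0" by force
  have "r \<noteq> 0 \<and> rat_eval r z = 0" using r0 assms(1) by (simp add: rr)
  then obtain d where d: "d \<noteq> 0" "rat_eval d z = 0"
    and min: "\<And>d'. d' \<noteq> 0 \<Longrightarrow> rat_eval d' z = 0 \<Longrightarrow> degree d \<le> degree d'"
    using ex_has_least_nat[of "\<lambda>d. d \<noteq> 0 \<and> rat_eval d z = 0" r degree] by blast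
  have dvd: "\<exists>u. p = d * u" if "rat_eval p z = 0" for p
  proof -
    have p: "p = d * (p div d) + p mod d" by simp
    have "rat_eval p z = rat_eval d z * rat_eval (p div d) z + rat_eval (p mod d) z"
      by (subst p) (simp only: rat_eval_add rat_eval_mult)
    then have "rat_eval (p mod d) z = 0" using that d(2) by simp
    then have "p mod d = 0" using min[of "p mod d"] degree_mod_less[OF d(1), of p] by force
    then show ?thesis using p by (intro exI[of _ "p div d"]) simp
  qed
  have "degree d \<noteq> 0"
  proof
    assume "degree d = 0"
    then obtain c where c: "d = [:c:]" by (metis degree_eq_zeroE)
    then show False using d by simp
  qed
  moreover have "degree (map_poly of_rat d :: complex poly) = degree d"
    by (rule degree_map_poly) simp_all
  ultimately obtain w :: complex where "poly (map_poly of_rat d) w = 0"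
    using alg_closed_imp_poly_has_root[of "map_poly of_rat d :: complex poly"] by auto
  then have w: "rat_eval d w = 0" by (simp add: rat_eval_def)
  obtain u v where uv: "q = d * u" "r = d * v"
    using dvd[OF assms(3)] dvd[of r] assms(1) rr[of z] by auto
  have "rat_eval q w = 0" "rat_eval r w = 0" unfolding uv using w by simp_all
  then show ?thesis using rr[of w] by auto
qed

text \<open>Over the complex numbers the double sum over one class is the squared modulus of its
  class sum, since the inverse of a root of unity is its conjugate, and the singleton class of
  \<open>i0\<close> contributes 1. The identity for \<open>s\<close> is a rational polynomial
  relation in one primitive root, so it can be transferred there.\<close>

lemma sum_root_ratios_positive:
  fixes \<nu> :: "'i \<Rightarrow> 'k::{alg_closed_field, field_char_0}" and cl :: "'i \<Rightarrow> 'c"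
  assumes I: "finite I" and M: "M > 0" and \<nu>: "\<And>i. i \<in> I \<Longrightarrow> \<nu> i ^ M = 1"
    and i0: "i0 \<in> I" "\<And>i. i \<in> I \<Longrightarrow> cl i = cl i0 \<Longrightarrow> i = i0"
    and s: "of_int s = (\<Sum>i\<in>I. \<Sum>j | j \<in> I \<and> cl j = cl i. \<nu> i / \<nu> j)"
  shows "s \<ge> 1"
proof -
  obtain z :: 'k where z: "prim_root M z" using prim_root_exists[OF M] by blast
  have zM: "z ^ M = 1" using z by (simp add: prim_root_def)
  have "\<forall>i\<in>I. \<exists>a. \<nu> i = z ^ a" using prim_root_generates[OF z M] \<nu> by blast
  then obtain a where a: "\<And>i. i \<in> I \<Longrightarrow> \<nu> i = z ^ a i" by metis
  let ?J = "\<lambda>i. {j. j \<in> I \<and> cl j = cl i}"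
  \<comment> \<open>The exponent M - 1 stands for -1, so that each ratio becomes a power of z with
    natural exponent.\<close>
  define e where "e i j = a i + (M - 1) * a j" for i j
  have ratio: "\<nu> i / \<nu> j = z ^ e i j" if "i \<in> I" "j \<in> I" for i j
  proof -
    have "z ^ ((M - 1) * a j) * z ^ a j = z ^ (M * a j)" using M
      by (cases M) (simp_all add: power_add mult.commute)
    also have "\<dots> = 1" using zM by (simp add: power_mult)
    finally have "z ^ ((M - 1) * a j) = 1 / z ^ a j" using eq_divide_imp by (metis mult_eq_0_iff zero_neq_one)
    then show ?thesis using a that by (simp add: e_def power_add)
  qed
  define q :: "rat poly" where "q = (\<Sum>i\<in>I. \<Sum>j\<in>?J i. monom 1 (e i j)) + [:- of_int s:]"
  have rq: "rat_eval q x = (\<Sum>i\<in>I. \<Sum>j\<in>?J i. x ^ e i j) - of_int s" for x :: "'b::field_char_0"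
    unfolding q_def rat_eval_add by (simp add: rat_eval_sum rat_eval_monom of_rat_minus)
  have "(\<Sum>i\<in>I. \<Sum>j\<in>?J i. z ^ e i j) = of_int s"
    unfolding s by (intro sum.cong refl) (simp add: ratio)
  then have "rat_eval q z = 0" by (simp add: rq)
  then obtain w :: complex where w: "w ^ M = 1" "rat_eval q w = 0"
    using root_of_unity_transfer[OF zM M] by blast
  have "norm w ^ M = 1 ^ M" using w(1) by (simp add: norm_power[symmetric])
  then have nw: "norm w = 1" by (rule power_eq_imp_eq_base) (use M in simp_all)
  have ex: "w ^ e i j = w ^ a i * cnj (w ^ a j)" for i j
  proof -
    have c1: "w * cnj w = 1" using nw by (simp add: complex_norm_square[symmetric])
    have c2: "w * w ^ (M - 1) = 1" using w(1) M by (cases M) simp_all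
    have "w ^ (M - 1) = (w * cnj w) * w ^ (M - 1)" using c1 by simp
    also have "\<dots> = cnj w * (w * w ^ (M - 1))" by (simp only: ac_simps)
    also have "\<dots> = cnj w" using c2 by simp
    finally have "w ^ (M - 1) = cnj w" .
    then show ?thesis by (simp add: e_def power_add power_mult)
  qed
  have fC: "finite (cl ` I)" using I by simp
  have cls: "(\<Sum>i\<in>I. \<Sum>j\<in>?J i. w ^ e i j) = (\<Sum>c\<in>cl ` I. complex_of_real ((cmod (\<Sum>i | i \<in> I \<and> cl i = c. w ^ a i))\<^sup>2))"
  proof -
    have "(\<Sum>i\<in>I. \<Sum>j\<in>?J i. w ^ e i j) = (\<Sum>c\<in>cl ` I. \<Sum>i | i \<in> I \<and> cl i = c. \<Sum>j\<in>?J i. w ^ e i j)"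
      by (rule sum.image_gen[OF I])
    also have "\<dots> = (\<Sum>c\<in>cl ` I. \<Sum>i | i \<in> I \<and> cl i = c. \<Sum>j | j \<in> I \<and> cl j = c. w ^ a i * cnj (w ^ a j))"
      by (intro sum.cong refl) (simp_all add: ex)
    also have "\<dots> = (\<Sum>c\<in>cl ` I. (\<Sum>i | i \<in> I \<and> cl i = c. w ^ a i) * cnj (\<Sum>i | i \<in> I \<and> cl i = c. w ^ a i))"
      by (simp only: sum_product cnj_sum)
    finally show ?thesis by (simp only: complex_norm_square)
  qed
  have "complex_of_real (real_of_int s) = complex_of_real (\<Sum>c\<in>cl ` I. (cmod (\<Sum>i | i \<in> I \<and> cl i = c. w ^ a i))\<^sup>2)"
    using w(2) unfolding rq cls by simp
  then have "real_of_int s = (\<Sum>c\<in>cl ` I. (cmod (\<Sum>i | i \<in> I \<and> cl i = c. w ^ a i))\<^sup>2)"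
    by (rule of_real_eq_iff[THEN iffD1])
  also have "\<dots> \<ge> (cmod (\<Sum>i | i \<in> I \<and> cl i = cl i0. w ^ a i))\<^sup>2"
    by (rule member_le_sum) (use fC i0 in auto)
  also have "{i. i \<in> I \<and> cl i = cl i0} = {i0}" using i0 by auto
  finally have "real_of_int s \<ge> 1" using nw by (simp add: norm_power)
  then show ?thesis by simp
qed

section \<open>The antipode of a semisimple Hopf algebra is an involution\<close>

context ss_hopf
begin

sublocale fd_hopf_ac scale comult counit antipode Basis ..

text \<open>The distinguished grouplike element: it measures how far the left integral
  \<open>lam\<close> is from being a right integral.\<close>

definition gg where "gg = T' lam \<Lambda>"

lemma lin_kscale: "lin (*) scale (\<lambda>k. scale k v)"
  by (rule linI) (simp_all add: scale_left_distrib)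

text \<open>For each functional f, the composition of f with \<open>T' lam\<close> is again a left
  integral, hence proportional to \<open>lam\<close>.\<close>

lemma T'_lam: "T' lam x = scale (lam x) gg"
proof (rule functional_eqI)
  fix f assume f: "linF f"
  let ?\<mu> = "\<lambda>x. f (T' lam x)"
  have mu: "?\<mu> x = sw x (\<lambda>a b. lam a * f b)" for x
    by (simp add: T'_def sw_comp[OF f] lin_scale[OF f])
  have l: "linF ?\<mu>" by (rule lin_comp[OF f linT'[OF lin_lam]])
  have "left_int ?\<mu>"
    unfolding left_int_def
  proof (intro conjI allI l)
    fix x
    have "sw x (\<lambda>u v. scale (?\<mu> v) u) = sw x (\<lambda>u v. sw v (\<lambda>a b. scale (lam a * f b) u))"
      by (simp only: mu sw_comp[OF lin_kscale])
    also have "\<dots> = sw x (\<lambda>w b. sw w (\<lambda>u a. scale (lam a * f b) u))"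
      by (rule coassocE[symmetric]; intro lin_intros' f lin_lam)
    also have "\<dots> = sw x (\<lambda>w b. scale (f b) (sw w (\<lambda>u a. scale (lam a) u)))"
      by (simp only: smulE[symmetric] scale_scale mult.commute)
    also have "\<dots> = sw x (\<lambda>w b. scale (lam w * f b) 1)"
      by (simp only: left_int_sw[OF left_int_lam] scale_scale mult.commute)
    also have "\<dots> = scale (?\<mu> x) 1"
      by (simp only: mu sw_comp[OF lin_kscale])
    finally show "sw x (\<lambda>u v. scale (?\<mu> v) u) = scale (?\<mu> x) 1" .
  qed
  from left_int_unique[OF this, of x] show "f (T' lam x) = f (scale (lam x) gg)"
    by (simp add: gg_def lin_scale[OF f] mult.commute)
qed

lemma gl_gg: "gl gg"
proof (rule glI)
  show "\<epsilon> gg = 1"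
    using sw_counit_right[OF vector_space_mult lin_lam, of \<Lambda>]
    by (simp add: gg_def T'_def sw_comp[OF lin\<epsilon>] lin_scale[OF lin\<epsilon>] mult.commute lam_\<Lambda>)
  fix f f' assume f: "linF f" "linF f'"
  let ?L = "\<lambda>t. sw t (\<lambda>a b. f a * f' b)"
  have L: "linF ?L" by (rule sw_linear[OF bil_k[OF f]])
  have "?L gg = sw \<Lambda> (\<lambda>a b. sw b (\<lambda>c d. lam a * (f c * f' d)))"
    unfolding gg_def T'_def sw_comp[OF L] lin_scale[OF L] smulF[symmetric] ..
  also have "\<dots> = sw \<Lambda> (\<lambda>u d. sw u (\<lambda>a c. lam a * (f c * f' d)))"
    by (rule coassocF[symmetric]; intro lin_k_left lin_k_right f lin_lam)
  also have "\<dots> = sw \<Lambda> (\<lambda>u d. f' d * f (T' lam u))"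
    by (simp add: T'_def sw_comp[OF f(1)] lin_scale[OF f(1)] smulF[symmetric] ac_simps)
  also have "\<dots> = sw \<Lambda> (\<lambda>u d. f gg * (lam u * f' d))"
    by (simp add: T'_lam lin_scale[OF f(1)] ac_simps)
  also have "\<dots> = f gg * f' gg"
    by (simp add: smulF gg_def T'_def sw_comp[OF f(2)] lin_scale[OF f(2)])
  finally show "?L gg = f gg * f' gg" .
qed

lemma right_int_S:
  assumes "right_int \<mu>"
  shows "left_int (\<lambda>x. \<mu> (S x))"
  unfolding left_int_def
proof (intro conjI allI)
  have m: "linF \<mu>" using assms unfolding right_int_def by blast
  show l: "linF (\<lambda>x. \<mu> (S x))" by (rule lin_comp[OF m linS])
  fix x
  have "S (sw x (\<lambda>a b. scale (\<mu> (S b)) a)) = sw x (\<lambda>a b. scale (\<mu> (S b)) (S a))"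
    by (simp add: sw_comp[OF linS] lin_scale[OF linS])
  also have "\<dots> = sw (S x) (\<lambda>p q. scale (\<mu> p) q)"
    by (rule sw_S[of scale, symmetric]) (intro bilE lin_intros' m)
  also have "\<dots> = scale (\<mu> (S x)) 1" using assms unfolding right_int_def by (elim conjE) (erule spec)
  also have "\<dots> = S (scale (\<mu> (S x)) 1)" by (simp add: lin_scale[OF linS] S_one)
  finally show "sw x (\<lambda>a b. scale (\<mu> (S b)) a) = scale (\<mu> (S x)) 1" by (rule injD[OF inj_S])
qed

text \<open>Both sides are right integrals with value 1 at \<Lambda>; composed with S they become
  left integrals, for which uniqueness is known.\<close>

lemma lam_S: "lam (S x) = lam (x * gg)"
proof -
  have 1: "right_int (\<lambda>x. lam (S x))"
    unfolding right_int_def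
  proof (intro conjI allI)
    show "linF (\<lambda>x. lam (S x))" by (rule lin_comp[OF lin_lam linS])
    fix x
    have "S (sw x (\<lambda>a b. scale (lam (S a)) b)) = sw x (\<lambda>a b. scale (lam (S a)) (S b))"
      by (simp add: sw_comp[OF linS] lin_scale[OF linS])
    also have "\<dots> = sw (S x) (\<lambda>p q. scale (lam q) p)"
      by (rule sw_S[of scale, symmetric]) (intro bilE lin_intros' lin_lam)
    also have "\<dots> = S (scale (lam (S x)) 1)"
      by (simp add: left_int_sw[OF left_int_lam] lin_scale[OF linS] S_one)
    finally show "sw x (\<lambda>a b. scale (lam (S a)) b) = scale (lam (S x)) 1" by (rule injD[OF inj_S])
  qed
  have lg: "linF (\<lambda>x. lam (x * gg))" by (intro lin_comp[OF lin_lam] lin_intros)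
  have 2: "right_int (\<lambda>x. lam (x * gg))"
    unfolding right_int_def
  proof (intro conjI allI lg)
    fix x
    have b: "bil scale (\<lambda>a b. scale (lam a) b)" by (intro bilE lin_intros' lin_lam)
    have b': "bil scale (\<lambda>c d. scale (lam (a * c)) (b * d))" for a b
      by (intro bilE lin_intros' lin_comp[OF lin_lam])
    have "sw x (\<lambda>a b. scale (lam (a * gg)) b) = sw x (\<lambda>a b. scale (lam (a * gg)) (b * gg)) * S gg"
      by (simp add: sw_comp[OF lin_mult_right[OF lin_ident]] scale_mult_left[symmetric] mult.assoc gl_inverse[OF gl_gg])
    also have "sw x (\<lambda>a b. scale (lam (a * gg)) (b * gg)) = T' lam (x * gg)"
      unfolding T'_def sw_mult[OF b] sw_gl[OF gl_gg b'] ..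
    also have "T' lam (x * gg) * S gg = scale (lam (x * gg)) 1"
      by (simp add: T'_lam scale_mult_left[symmetric] gl_inverse[OF gl_gg])
    finally show "sw x (\<lambda>a b. scale (lam (a * gg)) b) = scale (lam (x * gg)) 1" .
  qed
  have e: "lam (\<Lambda> * gg) = 1" by (simp add: \<Lambda>_right gl_\<epsilon>[OF gl_gg] lam_\<Lambda>)
  obtain y where y: "x = S y" using surj_S by (metis surjD)
  have "lam (S (S y)) = lam y" using left_int_unique[OF right_int_S[OF 1], of y] by (simp add: S_\<Lambda> lam_\<Lambda>)
  moreover have "lam (S y * gg) = lam y" using left_int_unique[OF right_int_S[OF 2], of y] by (simp add: S_\<Lambda> e)
  ultimately show ?thesis using y by simp
qed

text \<open>Radford's formula for S^4; a single grouplike element appears because \<Lambda> is a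
  two-sided integral. Moving y around \<open>lam\<close> by \<open>lam_twist\<close> and
  \<open>lam_S\<close> gives the equation under \<open>lam\<close>, and nondegeneracy removes
  \<open>lam\<close>.\<close>

lemma S4: "S (S (S (S y))) = S gg * y * gg"
proof -
  have "lam (x * (y * gg - gg * S (S (S (S y))))) = 0" for x
  proof -
    have "lam (x * (y * gg)) = lam (S (x * y))" by (simp add: lam_S mult.assoc)
    also have "\<dots> = lam (S y * S x)" by (simp add: S_mult)
    also have "\<dots> = lam (S x * S (S (S y)))" by (rule lam_twist)
    also have "\<dots> = lam (S (S (S y) * x))" by (simp add: S_mult)
    also have "\<dots> = lam (S (S y) * (x * gg))" by (simp add: lam_S mult.assoc)
    also have "\<dots> = lam (x * gg * S (S (S (S y))))" by (rule lam_twist)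
    finally show ?thesis by (simp add: right_diff_distrib lin_diff[OF lin_lam] mult.assoc)
  qed
  then have "y * gg - gg * S (S (S (S y))) = 0" by (rule lam_nondeg_right)
  then have "S gg * y * gg = S gg * gg * S (S (S (S y)))" by (simp add: mult.assoc)
  then show ?thesis by (simp add: gl_inverse[OF gl_gg])
qed

lemma S2_finite_order: "\<exists>M>0. \<forall>y. ((\<lambda>x. S (S x)) ^^ M) y = y"
proof -
  obtain N where N: "N > 0" "gg ^ N = 1" using gl_finite_order[OF gl_gg] by blast
  have p: "((\<lambda>x. S (S x)) ^^ (2 * k)) y = S gg ^ k * y * gg ^ k" for k y
  proof (induction k)
    case (Suc k)
    have "((\<lambda>x. S (S x)) ^^ (2 * Suc k)) y = S (S (S (S (((\<lambda>x. S (S x)) ^^ (2 * k)) y))))" by simp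
    also have "\<dots> = S gg * (S gg ^ k * y * gg ^ k) * gg" unfolding Suc S4 ..
    also have "\<dots> = S gg ^ Suc k * y * gg ^ Suc k" by (simp only: power_Suc[of "S gg"] power_Suc2[of gg] mult.assoc)
    finally show ?case .
  qed simp
  have "S (gg ^ k) = S gg ^ k" for k by (induction k) (simp_all only: power_Suc S_mult S_one power_0 power_commutes)
  then have "S gg ^ N = 1" using N(2) S_one by metis
  then show ?thesis using N p[of N] by (intro exI[of _ "2 * N"]) simp
qed

section \<open>The regular character, and S^2 as an inner automorphism\<close>

definition rho where "rho x = trace UNIV (\<lambda>y. x * y)"

lemma lin_rho: "linF rho"
  unfolding rho_def by (intro lin_trace lin_intros)

lemma rho_commute: "rho (x * y) = rho (y * x)"
  unfolding rho_def mult.assoc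
  by (rule trace_cyc[OF fdim_UNIV]) (auto intro: lin_eta)

lemma rho_one: "rho 1 = of_nat (dim UNIV)"
  using trace_id[OF fdim_UNIV] by (simp add: rho_def)

lemma rho_\<Lambda>: "rho \<Lambda> = 1"
  unfolding rho_def \<Lambda>_right using trace_rank1[OF fdim_UNIV lin\<epsilon>, of \<Lambda>] by (simp add: \<epsilon>_\<Lambda>)

lemma idempotent_trace_0:
  assumes "linE F" "\<And>x. F (F x) = F x" "trace UNIV F = 0"
  shows "F x = 0"
proof -
  have "trace UNIV F = of_nat (dim (range F))"
    by (rule trace_idem[OF fdim_UNIV assms(1)]) (use assms(2) in auto)
  then have "dim (range F) = 0" using assms(3) by simp
  moreover have "subspace (range F)" using subspace_image_lin[OF assms(1) subspace_UNIV] .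
  ultimately have "range F = {0}" using fdim_dim_0 fdimI by blast
  then show ?thesis by blast
qed

text \<open>If x = x y x, then x y is an idempotent of trace 0, and in characteristic zero it has
  rank 0.\<close>

lemma rho_nondeg:
  assumes "\<And>y. rho (x * y) = 0"
  shows "x = 0"
proof -
  obtain y where y: "x = x * y * x" using von_neumann_regular by blast
  have "(x * y) * z = 0" for z
  proof (rule idempotent_trace_0[of "\<lambda>z. (x * y) * z"])
    show "linE (\<lambda>z. x * y * z)" by (rule lin_eta)
    show "x * y * (x * y * z) = x * y * z" for z
    proof -
      have "x * y * (x * y * z) = (x * y * x) * y * z" by (simp only: mult.assoc)
      also have "\<dots> = x * y * z" by (simp only: y[symmetric])
      finally show ?thesis .
    qed
    show "trace UNIV (\<lambda>z. x * y * z) = 0" using assms[of y] by (simp add: rho_def)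
  qed
  from this[of x] show ?thesis using y by (simp only: y[symmetric])
qed

text \<open>Two nondegenerate forms differ by a unit \<open>v\<close>. The form of
  \<open>rho\<close> is symmetric and that of \<open>lam\<close> is symmetric up to S^2, so
  conjugation by \<open>v\<close> accounts for S^2.\<close>

lemma S2_inner: "\<exists>u v. u * v = 1 \<and> v * u = 1 \<and> (\<forall>y. S (S y) = u * y * v)"
proof -
  obtain v where v: "\<And>x. rho x = lam (x * v)" using lam_representing[OF lin_rho] by blast
  have c: "v * S (S y) = y * v" for y
  proof -
    have "lam (x * (y * v - v * S (S y))) = 0" for x
    proof -
      have "lam (x * (y * v)) = rho (y * x)" using v[of "x * y"] by (simp add: mult.assoc rho_commute)
      also have "\<dots> = lam (y * (x * v))" by (simp add: v mult.assoc)
      also have "\<dots> = lam (x * v * S (S y))" by (rule lam_twist)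
      finally show ?thesis by (simp add: right_diff_distrib lin_diff[OF lin_lam] mult.assoc)
    qed
    then have "y * v - v * S (S y) = 0" by (rule lam_nondeg_right)
    then show ?thesis by simp
  qed
  have z: "y = 0" if "y * v = 0" for y
  proof (rule rho_nondeg)
    fix x
    have "rho (y * x) = rho (x * y)" by (rule rho_commute)
    also have "\<dots> = lam (x * (y * v))" by (simp add: v mult.assoc)
    finally show "rho (y * x) = 0" using that lin_zero[OF lin_lam] by simp
  qed
  have lv: "linE (\<lambda>y. y * v)" by (intro lin_intros)
  have "inj (\<lambda>y. y * v)"
  proof (rule injI)
    fix x y assume "x * v = y * v"
    then have "(x - y) * v = 0" by (simp add: left_diff_distrib)
    from z[OF this] show "x = y" by simp
  qed
  then have "surj (\<lambda>y. y * v)" using linear_inj_imp_surj lv linear_iff_lin by blast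
  then obtain u where u: "u * v = 1" by (metis surjD)
  have "(v * u - 1) * v = 0" using u by (simp add: left_diff_distrib mult.assoc)
  then have "v * u - 1 = 0" by (rule z)
  then have vu: "v * u = 1" by simp
  have "S (S y) = u * y * v" for y
  proof -
    have "u * y * v = (u * v) * S (S y)" by (simp only: mult.assoc c)
    then show ?thesis using u by simp
  qed
  then show ?thesis using u vu by blast
qed

abbreviation S2 where "S2 \<equiv> (\<lambda>x. S (S x))"

lemma lin_S2: "linE S2"
  by (intro lin_intros)

lemma S2_mult: "S2 (x * y) = S2 x * S2 y"
  by (simp add: S_mult)

lemma fixed_subalg: "subalg {x. S2 x = x}"
  unfolding subalg_def
  by (auto intro!: subspaceI simp: S_one S_mult lin_add[OF linS] lin_scale[OF linS] lin_zero[OF linS])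

text \<open>A quasi-inverse \<open>y\<close> in \<open>H\<close> is averaged over the finite cyclic
  group generated by S^2; each translate is still a quasi-inverse because x is fixed.\<close>

lemma fixed_vnr: "vnr {x. S2 x = x}"
  unfolding vnr_def
proof
  fix x assume "x \<in> {x. S2 x = x}"
  then have x: "S2 x = x" by simp
  obtain M where M: "M > 0" "\<And>y. (S2 ^^ M) y = y" using S2_finite_order by blast
  obtain y where y: "x = x * y * x" using von_neumann_regular by blast
  have xj: "x * (S2 ^^ j) y * x = x" for j
  proof (induction j)
    case 0
    then show ?case by (simp only: y[symmetric] funpow_0)
  next
    case (Suc j)
    have "x * (S2 ^^ Suc j) y * x = S2 (x * (S2 ^^ j) y * x)" by (simp only: S2_mult x funpow.simps comp_apply)
    then show ?case using Suc x by simp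
  qed
  define s where "s = (\<Sum>j<M. (S2 ^^ j) y)"
  have "S2 s = (\<Sum>j<M. (S2 ^^ Suc j) y)" unfolding s_def by (simp add: lin_sum[OF linS])
  also have "\<dots> = s"
  proof -
    have "s + (S2 ^^ M) y = (\<Sum>j<Suc M. (S2 ^^ j) y)" unfolding s_def by simp
    also have "\<dots> = (S2 ^^ 0) y + (\<Sum>j<M. (S2 ^^ Suc j) y)" by (rule sum.lessThan_Suc_shift)
    finally show ?thesis using M(2)[of y] by simp
  qed
  finally have s: "S2 s = s" .
  have "x * s * x = (\<Sum>j<M. x)" unfolding s_def sum_distrib_left sum_distrib_right xj ..
  then have xs: "x * s * x = scale (of_nat M) x" by (simp add: sum_constant_scale del: sum_constant)
  let ?z = "scale (1 / of_nat M) s"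
  have "S2 ?z = ?z" using s by (simp add: lin_scale[OF linS])
  moreover have "x * ?z * x = x"
    using xs M(1) by (simp add: scale_mult_left[symmetric] scale_mult_right[symmetric])
  ultimately show "\<exists>y\<in>{x. S2 x = x}. x = x * y * x" by (intro bexI[of _ ?z]) simp_all
qed

text \<open>Choose primitive idempotents fixed by \<open>S\<^sup>2 = Ad u\<close>. They are eigenvectors of \<open>u\<close>, and each
  \<open>e H f\<close> is at most one-dimensional, so the trace of \<open>S\<^sup>2\<close> is a sum of ratios of eigenvalues.\<close>

lemma trace_S2_positive:
  assumes s: "of_int s = trace UNIV S2"
  shows "s \<ge> 1"
proof -
  obtain M where M: "M > 0" "\<And>y. (S2 ^^ M) y = y" using S2_finite_order by blast
  obtain u v where uv: "u * v = 1" "v * u = 1" "\<And>y. S2 y = u * y * v" using S2_inner by blast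
  obtain E where E: "orth E" "E \<subseteq> {x. S2 x = x}"
    and sc: "\<And>e x. e \<in> E \<Longrightarrow> S2 x = x \<Longrightarrow> \<exists>c. e * x * e = scale c e"
    using primitive_idempotents[OF fixed_subalg fixed_vnr] by blast
  note o = orthD[OF E(1)]
  have Efix: "S2 e = e" if "e \<in> E" for e using E(2) that by auto
  have ufix: "S2 u = u" unfolding uv(3) by (simp add: mult.assoc uv(1))
  have comm: "u * e = e * u" if "e \<in> E" for e
  proof -
    have "e * u = u * e * v * u" using Efix[OF that] by (simp only: uv(3))
    then show ?thesis by (simp add: mult.assoc uv(2))
  qed
  have "\<exists>c. u * e = scale c e" if e: "e \<in> E" for e
  proof -
    obtain c where "e * u * e = scale c e" using sc[OF e ufix] by blast
    moreover have "e * u * e = u * (e * e)" unfolding comm[OF e, symmetric] by (rule mult.assoc)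
    ultimately show ?thesis unfolding o(3)[OF e] by metis
  qed
  then obtain om where om: "\<And>e. e \<in> E \<Longrightarrow> u * e = scale (om e) e" by metis
  have v: "e * v = scale (1 / om e) e" "om e \<noteq> 0" if e: "e \<in> E" for e
  proof -
    have "e = (e * u) * v" by (simp add: mult.assoc uv(1))
    also have "\<dots> = scale (om e) (e * v)" using comm[OF e] om[OF e] by (simp add: scale_mult_left)
    finally have ev: "e = scale (om e) (e * v)" .
    show nz: "om e \<noteq> 0"
    proof
      assume "om e = 0"
      with ev have "e = 0" by (metis scale_zero_left)
      with o(2)[OF e] show False by simp
    qed
    have "scale (1 / om e) e = scale (1 / om e) (scale (om e) (e * v))" using ev by metis
    also have "\<dots> = e * v" using nz by simp
    finally show "e * v = scale (1 / om e) e" ..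
  qed
  have S2ef: "S2 (e * x * f) = scale (om e / om f) (e * x * f)" if e: "e \<in> E" and f: "f \<in> E" for e f x
  proof -
    have "S2 (e * x * f) = (u * e) * x * (f * v)" unfolding uv(3) by (simp only: mult.assoc)
    also have "\<dots> = scale (om e / om f) (e * x * f)"
      unfolding om[OF e] v(1)[OF f] by (simp add: scale_mult_left[symmetric] scale_mult_right[symmetric])
    finally show ?thesis .
  qed
  \<comment> \<open>On the corner e H e the map S^2 is multiplication by om e / om e = 1, so the
    corner lies in the fixed algebra and \<open>e\<close> is primitive in all of
    \<open>H\<close>.\<close>
  have eHe: "\<exists>c. e * x * e = scale c e" if e: "e \<in> E" for e x
  proof -
    have "S2 (e * x * e) = e * x * e" unfolding S2ef[OF e e] using v(2)[OF e] by simp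
    from sc[OF e this] obtain c where "e * (e * x * e) * e = scale c e" by blast
    moreover have "e * (e * x * e) * e = (e * e) * x * (e * e)" by (simp only: mult.assoc)
    ultimately have "(e * e) * x * (e * e) = scale c e" by simp
    then show ?thesis unfolding o(3)[OF e] by blast
  qed
  \<comment> \<open>Regularity makes a nonzero element of e H f invertible between the two corners.
    Hence e H f is at most a line, and \<open>rel\<close> below is isomorphism of the left ideals of
    \<open>e\<close> and \<open>f\<close>.\<close>
  have inv: "\<exists>y. x * (f * y * e) = e \<and> (f * y * e) * x = f" if e: "e \<in> E" and f: "f \<in> E" and x: "x = e * x * f" "x \<noteq> 0" for e f x
  proof -
    obtain y where y: "x = x * y * x" using von_neumann_regular by blast
    have ex: "e * x = x" "x * f = x"
    proof -
      have "e * x = (e * e) * x * f" by (subst x(1)) (simp only: mult.assoc)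
      then show "e * x = x" unfolding o(3)[OF e] using x(1) by simp
      have "x * f = e * x * (f * f)" by (subst x(1)) (simp only: mult.assoc)
      then show "x * f = x" unfolding o(3)[OF f] using x(1) by simp
    qed
    let ?y = "f * y * e"
    have yx: "x * ?y * x = x"
    proof -
      have "x * ?y * x = (x * f) * y * (e * x)" by (simp only: mult.assoc)
      then show ?thesis unfolding ex by (simp only: y[symmetric])
    qed
    obtain c where c: "x * ?y = scale c e"
    proof -
      obtain c where "e * (x * f * y) * e = scale c e" using eHe[OF e] by blast
      then have "(e * x) * ?y = scale c e" by (simp only: mult.assoc)
      then show ?thesis unfolding ex using that by blast
    qed
    obtain d where d: "?y * x = scale d f"
    proof -
      obtain d where "f * (y * e * x) * f = scale d f" using eHe[OF f] by blast
      then have "?y * (x * f) = scale d f" by (simp only: mult.assoc)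
      then show ?thesis unfolding ex using that by blast
    qed
    have "scale c x = scale c e * x" using ex(1) by (simp add: scale_mult_left[symmetric])
    also have "\<dots> = x" unfolding c[symmetric] by (rule yx)
    finally have "c = 1" using x(2) scale_cancel_right[of c x 1] by simp
    have "scale d x = x * scale d f" using ex(2) by (simp add: scale_mult_right[symmetric])
    also have "\<dots> = x" unfolding d[symmetric] using yx by (simp only: mult.assoc)
    finally have "d = 1" using x(2) scale_cancel_right[of d x 1] by simp
    then show ?thesis using c d \<open>c = 1\<close> by (intro exI[of _ y]) simp
  qed
  define rel where "rel e f \<longleftrightarrow> (\<exists>x. x \<noteq> 0 \<and> x = e * x * f)" for e f :: 'h
  have rel_I: "rel e f" if "e * x * f \<noteq> 0" "e \<in> E" "f \<in> E" for e f x
  proof -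
    have "e * (e * x * f) * f = (e * e) * x * (f * f)" by (simp only: mult.assoc)
    then show ?thesis unfolding rel_def using that o(3) by (intro exI[of _ "e * x * f"]) simp
  qed
  have rel_refl: "rel e e" if "e \<in> E" for e
    unfolding rel_def using o(2,3)[OF that] by (intro exI[of _ e]) simp
  have rel_sym: "rel f e" if r: "rel e f" and e: "e \<in> E" and f: "f \<in> E" for e f
  proof -
    obtain x where x: "x = e * x * f" "x \<noteq> 0" using r unfolding rel_def by blast
    obtain y where y: "x * (f * y * e) = e" using inv[OF e f x] by blast
    then have "f * y * e \<noteq> 0" using o(2)[OF e] by auto
    then show ?thesis by (rule rel_I[OF _ f e])
  qed
  have rel_trans: "rel e g" if r: "rel e f" "rel f g" and e: "e \<in> E" and f: "f \<in> E" and g: "g \<in> E" for e f g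
  proof -
    obtain x where x: "x = e * x * f" "x \<noteq> 0" using r unfolding rel_def by blast
    obtain x' where x': "x' = f * x' * g" "x' \<noteq> 0" using r unfolding rel_def by blast
    obtain y where y: "(f * y * e) * x = f" using inv[OF e f x] by blast
    have "f * x' = x'"
    proof -
      have "f * x' = (f * f) * x' * g" by (subst x'(1)) (simp only: mult.assoc)
      then show ?thesis unfolding o(3)[OF f] using x'(1) by simp
    qed
    then have "(f * y * e) * (x * x') \<noteq> 0" using y x'(2) by (simp add: mult.assoc[symmetric])
    then have "x * x' \<noteq> 0" by auto
    moreover have "x * x' = e * (x * f * x') * g"
    proof -
      have "x * x' = (e * x * f) * (f * x' * g)" using x(1) x'(1) by simp
      also have "\<dots> = e * (x * (f * f) * x') * g" by (simp only: mult.assoc)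
      finally show ?thesis unfolding o(3)[OF f] .
    qed
    ultimately show ?thesis using rel_I[OF _ e g] by metis
  qed
  define cl where "cl e = {f \<in> E. rel e f}" for e
  have cl_eq: "cl e = cl f \<longleftrightarrow> rel e f" if e: "e \<in> E" and f: "f \<in> E" for e f
  proof
    assume "cl e = cl f"
    moreover have "f \<in> cl f" unfolding cl_def using rel_refl[OF f] f by simp
    ultimately show "rel e f" unfolding cl_def by blast
  next
    assume r: "rel e f"
    show "cl e = cl f" unfolding cl_def
      using rel_trans[OF r _ e f] rel_trans[OF rel_sym[OF r e f] _ f e] by blast
  qed
  \<comment> \<open>The eigenvalues \<open>om e\<close> need not be roots of unity, only their
    ratios inside a class; hence the division by the eigenvalue of a representative.\<close>
  define \<nu> where "\<nu> e = om e / om (SOME f. f \<in> cl e)" for e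
  have rep: "(SOME f. f \<in> cl e) \<in> cl e" if "e \<in> E" for e
    by (rule someI[of _ e]) (simp add: cl_def that rel_refl[OF that])
  have nuM: "\<nu> e ^ M = 1" if e: "e \<in> E" for e
  proof -
    define f where "f = (SOME f. f \<in> cl e)"
    have "f \<in> cl e" unfolding f_def by (rule rep[OF e])
    then have f: "f \<in> E" "rel e f" unfolding cl_def by blast+
    obtain x where x: "x = e * x * f" "x \<noteq> 0" using f(2) unfolding rel_def by blast
    have S2x: "S2 x = scale (om e / om f) x" using S2ef[OF e f(1), of x] by (simp only: x(1)[symmetric])
    have "(S2 ^^ k) x = scale ((om e / om f) ^ k) x" for k
      by (induction k) (simp_all only: funpow.simps comp_apply lin_scale[OF lin_S2] S2x scale_scale
          power_Suc power_0 scale_one id_apply mult.commute)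
    then have "scale ((om e / om f) ^ M) x = x" using M(2)[of x] by simp
    then have "(om e / om f) ^ M = 1" using x(2) scale_cancel_right[of _ x 1] by simp
    then show ?thesis unfolding \<nu>_def f_def[symmetric] .
  qed
  have tr: "trace UNIV (\<lambda>x. e * x * f) = (if rel e f then 1 else 0)" if e: "e \<in> E" and f: "f \<in> E" for e f
  proof (cases "rel e f")
    case True
    then obtain x where x: "x = e * x * f" "x \<noteq> 0" unfolding rel_def by blast
    obtain y where y: "x * (f * y * e) = e" using inv[OF e f x] by blast
    have "trace UNIV (\<lambda>x. e * x * f) = of_nat (dim (range (\<lambda>x. e * x * f)))"
    proof (rule trace_idem[OF fdim_UNIV])
      show "linE (\<lambda>x. e * x * f)" by (intro lin_intros)
      fix z
      have "e * (e * z * f) * f = (e * e) * z * (f * f)" by (simp only: mult.assoc)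
      then show "e * (e * z * f) * f = e * z * f" by (simp only: o(3)[OF e] o(3)[OF f])
    qed simp
    also have "range (\<lambda>x. e * x * f) = span {x}"
    proof (intro equalityI subsetI)
      fix z assume "z \<in> range (\<lambda>x. e * x * f)"
      then obtain w where w: "z = e * w * f" by blast
      obtain c where c: "f * (y * e * w) * f = scale c f" using eHe[OF f] by blast
      have "z = x * (f * y * e) * w * f" unfolding y w ..
      also have "\<dots> = x * (f * (y * e * w) * f)" by (simp only: mult.assoc)
      also have "\<dots> = scale c (x * f)" unfolding c scale_mult_right ..
      also have "x * f = e * x * (f * f)" by (subst x(1)) (simp only: mult.assoc)
      also have "\<dots> = x" unfolding o(3)[OF f] by (rule x(1)[symmetric])
      finally show "z \<in> span {x}" by (simp add: span_base span_scale)
    next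
      fix z assume "z \<in> span {x}"
      then obtain c where "z = scale c x" by (auto simp: span_singleton)
      also have "\<dots> = scale c (e * x * f)" using x(1) by simp
      finally have "z = e * scale c x * f" by (simp add: scale_mult_left[symmetric] scale_mult_right[symmetric])
      then show "z \<in> range (\<lambda>x. e * x * f)" by blast
    qed
    also have "dim (span {x}) = 1" using x(2) by simp
    finally show ?thesis using True by simp
  next
    case False
    then have "e * x * f = 0" for x using rel_I[OF _ e f] by blast
    then show ?thesis using False trace_scale[of UNIV 0 "\<lambda>x. x"] by simp
  qed
  have "trace UNIV S2 = trace UNIV (\<lambda>x. \<Sum>e\<in>E. \<Sum>f\<in>E. scale (om e / om f) (e * x * f))"
  proof (rule trace_cong)
    fix x
    have "x = \<Sum>E * x * \<Sum>E" by (simp add: o(5))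
    also have "\<dots> = (\<Sum>f\<in>E. \<Sum>e\<in>E. e * x * f)" by (simp only: sum_distrib_left sum_distrib_right)
    also have "\<dots> = (\<Sum>e\<in>E. \<Sum>f\<in>E. e * x * f)" by (rule sum.swap)
    finally have "S2 x = S2 (\<Sum>e\<in>E. \<Sum>f\<in>E. e * x * f)" by simp
    also have "\<dots> = (\<Sum>e\<in>E. \<Sum>f\<in>E. S2 (e * x * f))" unfolding lin_sum[OF lin_S2] ..
    also have "\<dots> = (\<Sum>e\<in>E. \<Sum>f\<in>E. scale (om e / om f) (e * x * f))"
      by (rule sum.cong[OF refl], rule sum.cong[OF refl], rule S2ef)
    finally show "S2 x = (\<Sum>e\<in>E. \<Sum>f\<in>E. scale (om e / om f) (e * x * f))" .
  qed
  also have "\<dots> = (\<Sum>e\<in>E. \<Sum>f\<in>E. om e / om f * (if rel e f then 1 else 0))"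
    unfolding trace_sum trace_scale by (rule sum.cong[OF refl], rule sum.cong[OF refl]) (simp add: tr)
  also have "\<dots> = (\<Sum>e\<in>E. \<Sum>f | f \<in> E \<and> cl f = cl e. \<nu> e / \<nu> f)"
  proof (rule sum.cong[OF refl])
    fix e assume e: "e \<in> E"
    have "(\<Sum>f\<in>E. om e / om f * (if rel e f then 1 else 0)) = (\<Sum>f\<in>E. if rel e f then om e / om f else 0)"
      by (intro sum.cong refl) simp
    also have "\<dots> = (\<Sum>f\<in>{f\<in>E. rel e f}. om e / om f)" using o(1) by (simp add: sum.inter_filter)
    also have "\<dots> = (\<Sum>f | f \<in> E \<and> cl f = cl e. \<nu> e / \<nu> f)"
    proof (rule sum.cong)
      show "{f \<in> E. rel e f} = {f. f \<in> E \<and> cl f = cl e}" using cl_eq[OF e] by blast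
      fix f assume "f \<in> {f. f \<in> E \<and> cl f = cl e}"
      then have f: "f \<in> E" "cl f = cl e" by auto
      have "om (SOME f. f \<in> cl e) \<noteq> 0" using rep[OF e] v(2) unfolding cl_def by blast
      then show "om e / om f = \<nu> e / \<nu> f" unfolding \<nu>_def f(2) by simp
    qed
    finally show "(\<Sum>f\<in>E. om e / om f * (if rel e f then 1 else 0)) = (\<Sum>f | f \<in> E \<and> cl f = cl e. \<nu> e / \<nu> f)" .
  qed
  finally have t: "of_int s = (\<Sum>e\<in>E. \<Sum>f | f \<in> E \<and> cl f = cl e. \<nu> e / \<nu> f)" using s by simp
  \<comment> \<open>An idempotent of nonzero counit belongs to the trivial module. This module is
    one-dimensional, so the class is a singleton, as the positivity of the sum of ratios
    requires.\<close>
  have "\<epsilon> (\<Sum>E) = 1" by (simp add: o(5) counit_one)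
  then have "(\<Sum>e\<in>E. \<epsilon> e) \<noteq> 0" by (simp add: lin_sum[OF lin\<epsilon>])
  then obtain e0 where e0: "e0 \<in> E" "\<epsilon> e0 \<noteq> 0" by (metis sum.neutral)
  have uniq: "e = e0" if e: "e \<in> E" "cl e = cl e0" for e
  proof (rule ccontr)
    assume "e \<noteq> e0"
    then have "\<epsilon> (e * e0) = 0" using o(4)[OF e(1) e0(1)] lin_zero[OF lin\<epsilon>] by simp
    then have ee: "\<epsilon> e = 0" using e0(2) by (simp add: counit_mult)
    have r: "rel e e0" using e cl_eq[OF e(1) e0(1)] by simp
    then obtain x where x: "x = e * x * e0" "x \<noteq> 0" unfolding rel_def by blast
    obtain y where "(e0 * y * e) * x = e0" using inv[OF e(1) e0(1) x] by blast
    then have "\<epsilon> e0 = \<epsilon> (e0 * y * e) * \<epsilon> x" by (metis counit_mult)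
    then show False using ee e0(2) by (simp add: counit_mult)
  qed
  show ?thesis by (rule sum_root_ratios_positive[OF o(1) M(1) nuM e0(1) uniq t])
qed

lemma lam_one: "lam 1 = trace UNIV S2"
  by (simp add: lam_def)

text \<open>The trace of S^2 is nonzero, so \<open>lam 1\<close> is nonzero; comparing two
  evaluations of \<open>T' lam 1\<close> shows that the distinguished grouplike element is
  1.\<close>

lemma S4_id: "S (S (S (S x))) = x"
proof -
  have "lam 1 \<noteq> 0" using trace_S2_positive[of 0] lam_one by auto
  moreover have "bil scale (\<lambda>a b. scale (lam a) b)" by (intro bilE lin_intros' lin_lam)
  then have "T' lam 1 = scale (lam 1) 1" unfolding T'_def by (rule sw_one)
  ultimately have "gg = 1" unfolding T'_lam by simp
  then show ?thesis unfolding S4 by (simp add: S_one)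
qed

lemma rho_S2: "rho (S2 x) = rho x"
proof -
  have "rho (S2 x) = trace UNIV (\<lambda>y. S2 (x * S2 y))" by (simp add: rho_def S_mult S4_id)
  also have "\<dots> = trace UNIV (\<lambda>y. x * S2 (S2 y))"
    by (rule trace_cyc[OF fdim_UNIV lin_S2]) (auto intro: lin_mult_S2)
  finally show ?thesis by (simp add: rho_def S4_id)
qed

lemma T_rho_S2: "T rho (S2 x) = S2 (T rho x)"
proof -
  have b: "bil scale (\<lambda>a b. scale (rho b) a)" "bil scale (\<lambda>a b. scale (rho (S a)) (S b))"
    by (intro bilE lin_intros' lin_rho lin_comp[OF lin_rho])+
  have "T rho (S2 x) = sw x (\<lambda>a b. scale (rho (S2 b)) (S2 a))"
    unfolding T_def sw_S[OF b(1)] sw_S[OF b(2)] ..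
  then show ?thesis by (simp add: rho_S2 T_def sw_comp[OF linS] lin_scale[OF linS])
qed

text \<open>As \<open>rho\<close> is a trace form, the weight in \<open>trace_right_leg\<close>
  becomes rho(S(z_2) z_3) and collapses by the antipode axiom.\<close>

lemma rho_rho: "sw x (\<lambda>a b. rho b * rho a) = rho 1 * rho x"
proof -
  have "sw z (\<lambda>p q. sw q (\<lambda>r s. scale (rho (s * S r)) p)) = scale (rho 1) z" for z
  proof -
    have "sw z (\<lambda>p q. sw q (\<lambda>r s. scale (rho (s * S r)) p)) = sw z (\<lambda>p q. sw q (\<lambda>r s. scale (rho (S r * s)) p))"
      by (simp only: rho_commute)
    also have "\<dots> = scale (rho 1) z"
      by (rule sw_cancel23(1)[of scale "\<lambda>p m. scale (rho m) p"]) (intro bilE lin_intros' lin_rho)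
    finally show ?thesis .
  qed
  then have "sw x (\<lambda>a b. rho b * rho a) = trace UNIV (\<lambda>z. x * scale (rho 1) z)"
    using trace_right_leg[OF lin_rho, of x] by (simp only: rho_def[symmetric])
  also have "\<dots> = rho 1 * rho x"
    unfolding scale_mult_right[symmetric] trace_scale rho_def[symmetric] ..
  finally show ?thesis .
qed

lemma T_rho_rho: "T rho (T rho x) = scale (rho 1) (T rho x)"
proof -
  have "T rho (T rho x) = sw x (\<lambda>w b. sw w (\<lambda>a c. scale (rho b * rho c) a))"
    unfolding T_def[of rho x] sw_comp[OF linT[OF lin_rho]] lin_scale[OF linT[OF lin_rho]]
    by (simp only: T_def smulE[symmetric] scale_scale)
  also have "\<dots> = sw x (\<lambda>a y. sw y (\<lambda>c b. scale (rho b * rho c) a))"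
    by (rule coassocE; intro lin_intros' lin_rho)
  also have "\<dots> = sw x (\<lambda>a y. scale (rho 1 * rho y) a)"
    by (simp only: sw_comp[OF lin_kscale, symmetric] rho_rho)
  also have "\<dots> = scale (rho 1) (T rho x)"
    by (simp only: T_def smulE[symmetric] scale_scale)
  finally show ?thesis .
qed

text \<open>\<open>T rho / n\<close> is an idempotent commuting with \<open>S\<^sup>2\<close>, and the trace of their product is
  \<open>tr(S\<^sup>2) / n\<close>. Hence \<open>n\<close> divides the integer \<open>tr(S\<^sup>2)\<close>, which lies between \<open>1\<close> and \<open>n\<close>.\<close>

theorem S2_id: "S (S x) = x"
proof -
  let ?n = "dim (UNIV :: 'h set)"
  \<comment> \<open>On the image of \<open>F\<close> the involution S^2 has eigenvalues 1 and -1;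
    \<open>p\<close> and \<open>q\<close> are their multiplicities, the ranks of the projections
    \<open>?P\<close> and \<open>?N\<close>.\<close>
  have split: "\<exists>p q. trace UNIV (\<lambda>x. F (S2 x)) = of_nat p - of_nat q \<and> trace UNIV F = of_nat p + of_nat q \<and>
      (q = 0 \<longrightarrow> (\<forall>x. F (S2 x) = F x))"
    if F: "linE F" "\<And>x. F (F x) = F x" "\<And>x. F (S2 x) = S2 (F x)" for F
  proof -
    let ?P = "\<lambda>x. scale (1/2) (F x + F (S2 x))" and ?N = "\<lambda>x. scale (1/2) (F x - F (S2 x))"
    have lF: "linE (\<lambda>x. F (S2 x))" by (rule lin_comp[OF F(1) lin_S2])
    have l: "linE ?P" "linE ?N" by (intro lin_scale_right lin_plus lin_minus' F(1) lF vector_space_axioms)+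
    have half: "scale (1/2) (x + x) = x" for x
      using scale_left_distrib[of "1/2" "1/2" x] by (simp add: scale_right_distrib)
    have FF: "F (F (S2 x)) = F (S2 x)" "F (S2 (F (S2 x))) = F x" "F (S2 (F x)) = F (S2 x)" for x
      by (simp_all only: F(2,3) S4_id)
    have "?P (?P x) = ?P x" for x
    proof -
      have "F (?P x) = ?P x" "F (S2 (?P x)) = ?P x"
        by (simp_all add: lin_add[OF F(1)] lin_scale[OF F(1)] lin_add[OF linS] lin_scale[OF linS] F(2) FF S4_id add.commute)
      then show ?thesis using half[of "?P x"] by simp
    qed
    then obtain p where p: "trace UNIV ?P = of_nat p"
      using trace_idem[OF fdim_UNIV l(1)] by auto
    have N: "?N (?N x) = ?N x" for x
    proof -
      have "F (?N x) = ?N x" "F (S2 (?N x)) = - ?N x"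
        by (simp_all add: lin_diff[OF F(1)] lin_scale[OF F(1)] lin_diff[OF linS] lin_scale[OF linS] F(2) FF S4_id
          scale_right_diff_distrib)
      then show ?thesis using half[of "?N x"] by simp
    qed
    then obtain q where q: "trace UNIV ?N = of_nat q"
      using trace_idem[OF fdim_UNIV l(2)] by auto
    have 1: "trace UNIV F = trace UNIV ?P + trace UNIV ?N" "trace UNIV (\<lambda>x. F (S2 x)) = trace UNIV ?P - trace UNIV ?N"
      unfolding trace_scale trace_add trace_diff by (simp_all add: field_simps)
    have "F (S2 x) = F x" if "q = 0" for x
      using idempotent_trace_0[OF l(2) N, of x] q that by simp
    then show ?thesis using 1 p q by (intro exI[of _ p] exI[of _ q]) simp
  qed
  have "\<exists>p q. trace UNIV S2 = of_nat p - of_nat q \<and> trace UNIV (\<lambda>x::'h. x) = of_nat p + of_nat q \<and> (q = 0 \<longrightarrow> (\<forall>x. S2 x = x))"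
    by (rule split[of "\<lambda>x. x"]) (simp_all add: lin_ident)
  then obtain p q where pq: "trace UNIV S2 = of_nat p - of_nat q" "trace UNIV (\<lambda>x::'h. x) = of_nat p + of_nat q"
    "q = 0 \<longrightarrow> (\<forall>x. S2 x = x)" by (elim exE conjE)
  have "(of_nat ?n :: 'k) = of_nat (p + q)" using pq(2) trace_id[OF fdim_UNIV] by simp
  then have n: "?n = p + q" by (simp only: of_nat_eq_iff)
  have pos: "int p - int q \<ge> 1" by (rule trace_S2_positive) (simp add: pq(1))
  have n0: "(of_nat ?n :: 'k) \<noteq> 0" using n pos by (subst of_nat_eq_0_iff) linarith
  define F where "F x = scale (1 / of_nat ?n) (T rho x)" for x
  have F: "linE F" "\<And>x. F (F x) = F x" "\<And>x. F (S2 x) = S2 (F x)"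
  proof -
    show "linE F" unfolding F_def by (intro lin_scale_right vector_space_axioms linT lin_rho)
    show "F (F x) = F x" for x
      unfolding F_def lin_scale[OF linT[OF lin_rho]] T_rho_rho rho_one using n0 by simp
    show "F (S2 x) = S2 (F x)" for x
      unfolding F_def T_rho_S2 by (simp add: lin_scale[OF linS])
  qed
  obtain p' q' where pq': "trace UNIV (\<lambda>x. F (S2 x)) = of_nat p' - of_nat q'" using split[OF F] by blast
  have "trace UNIV (\<lambda>x. F (S2 x)) = trace UNIV S2 / of_nat ?n"
    using trace_T_mult_S2[OF lin_rho, of 1] unfolding F_def trace_scale by (simp add: rho_\<Lambda> lam_one)
  then have "trace UNIV S2 = of_nat ?n * (of_nat p' - of_nat q')" using pq' n0 by (simp add: field_simps)
  then have "(of_int (int p - int q) :: 'k) = of_int (int ?n * (int p' - int q'))" using pq(1) by simp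
  then have "int p - int q = int ?n * (int p' - int q')" by (simp only: of_int_eq_iff)
  then have "int p - int q = (int p + int q) * (int p' - int q')" using n by simp
  moreover from this have "int p' - int q' \<ge> 1" using pos
    by (smt (verit) mult_nonneg_nonpos of_nat_0_le_iff)
  ultimately have "int p - int q \<ge> int p + int q"
    using mult_left_mono[of 1 "int p' - int q'" "int p + int q"] by simp
  then show ?thesis using pq(3) by simp
qed

end

section \<open>Integrals of Hopf subalgebras\<close>

locale inv_hopf = fd_hopf_ac scale comult counit antipode Basis
  for scale :: "'k::{alg_closed_field, field_char_0} \<Rightarrow> 'h::ring_1 \<Rightarrow> 'h"
    and comult counit antipode and Basis :: "'h set" +
  assumes SS: "antipode (antipode x) = x"
begin

abbreviation dH where "dH \<equiv> dim (UNIV :: 'h set)"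

lemma of_nat_dim_nonzero: "1 \<in> B \<Longrightarrow> subspace B \<Longrightarrow> (of_nat (dim B) :: 'k) \<noteq> 0"
  using fdim_dim_0[OF fdimI, of B] by (metis of_nat_eq_0_iff singletonD zero_neq_one)

lemma n0: "(of_nat dH :: 'k) \<noteq> 0"
  by (rule of_nat_dim_nonzero) simp_all

lemma sw_antipode_left':
  assumes "lin scale s' f"
  shows "sw h (\<lambda>x y. f (y * S x)) = s' (\<epsilon> h) (f 1)"
  using sw_antipode_right[OF lin_comp[OF assms linS], of h] by (simp add: S_mult SS S_one)

lemma sw_antipode_right':
  assumes "lin scale s' f"
  shows "sw h (\<lambda>x y. f (S y * x)) = s' (\<epsilon> h) (f 1)"
  using sw_antipode_left[OF lin_comp[OF assms linS], of h] by (simp add: S_mult SS S_one)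

lemma bil_S:
  assumes "bil s' F"
  shows "bil s' (\<lambda>m d. F (S m) d)" "bil s' (\<lambda>m d. F m (S d))"
proof -
  have l: "lin scale s' (\<lambda>x. F x y)" "lin scale s' (\<lambda>y. F x y)" and vs: "vector_space s'" for x y
    using assms by (auto simp: bil_def)
  show "bil s' (\<lambda>m d. F (S m) d)" "bil s' (\<lambda>m d. F m (S d))"
    by (intro bilI vs l lin_comp[OF l(1) linS] lin_comp[OF l(2) linS])+
qed

lemma sw_cancel12':
  assumes "bil s' F"
  shows "sw h (\<lambda>x y. sw y (\<lambda>a b. F (a * S x) b)) = F 1 h"
    and "sw h (\<lambda>x y. sw y (\<lambda>a b. F (S a * x) b)) = F 1 h"
  using sw_cancel12(2)[OF bil_S(1)[OF assms], of h] sw_cancel12(1)[OF bil_S(1)[OF assms], of h]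
  by (simp_all add: S_mult SS S_one)

lemma sw_cancel23':
  assumes "bil s' F"
  shows "sw h (\<lambda>x y. sw y (\<lambda>a b. F x (b * S a))) = F h 1"
    and "sw h (\<lambda>x y. sw y (\<lambda>a b. F x (S b * a))) = F h 1"
  using sw_cancel23(2)[OF bil_S(2)[OF assms], of h] sw_cancel23(1)[OF bil_S(2)[OF assms], of h]
  by (simp_all add: S_mult SS S_one)

text \<open>The regular character. Once S^2 = id it is both a trace form and, by the two trace
  identities, a two-sided integral of the dual algebra.\<close>

definition lm where "lm x = trace UNIV (\<lambda>y. x * y)"

lemma lin_traceF: "(\<And>y. linE (\<lambda>x. F x y)) \<Longrightarrow> linF (\<lambda>x. trace W (F x))"
  unfolding trace_def by (intro lin_SUM vector_space_mult lin_comp[OF lin_crd])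

lemma lin_lm: "linF lm"
  unfolding lm_def by (intro lin_traceF lin_intros)

lemma lm_one: "lm 1 = of_nat dH"
  using trace_id[OF fdim_UNIV] by (simp add: lm_def)

lemma lm_commute: "lm (x * y) = lm (y * x)"
  unfolding lm_def mult.assoc by (rule trace_cyc[OF fdim_UNIV]) (auto intro: lin_eta)

lemma trace_T_left_int:
  assumes "linF f" "linF g"
  shows "sw x (\<lambda>a b. g a * trace UNIV (\<lambda>y. T f (b * y))) = g 1 * trace UNIV (\<lambda>y. T f (x * y))"
proof -
  have "T f (T' \<phi> z) = T' \<phi> (T f z)" if "linF \<phi>" for \<phi> z using T_T' assms(1) that by blast
  from trace_left_integral[OF linT[OF assms(1)] this assms(2), of x] show ?thesis by (simp add: SS)
qed

lemma lm_left_int: "linF g \<Longrightarrow> sw x (\<lambda>a b. g a * lm b) = g 1 * lm x"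
  using trace_left_integral[of "\<lambda>x. x" g x] by (simp add: SS lin_ident lm_def)

lemma lm_left: "sw x (\<lambda>a b. scale (lm b) a) = scale (lm x) 1"
proof (rule functional_eqI)
  fix f assume f: "linF f"
  show "f (sw x (\<lambda>a b. scale (lm b) a)) = f (scale (lm x) 1)"
    using lm_left_int[OF f, of x] by (simp only: sw_comp[OF f] lin_scale[OF f] mult.commute)
qed

lemma lm_right_int:
  assumes g: "linF g"
  shows "sw x (\<lambda>a b. g b * lm a) = g 1 * lm x"
proof -
  have "sw z (\<lambda>p q. sw q (\<lambda>r s. scale (g (s * S r)) p)) = scale (g 1) z" for z
    by (rule sw_cancel23'(1)[of scale "\<lambda>p m. scale (g m) p"]) (intro bilE lin_intros' g)
  then have "sw x (\<lambda>a b. g b * lm a) = trace UNIV (\<lambda>z. x * scale (g 1) z)"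
    using trace_right_leg[OF g, of x] by (simp only: lm_def)
  also have "\<dots> = g 1 * lm x"
    unfolding scale_mult_right[symmetric] trace_scale lm_def ..
  finally show ?thesis .
qed

lemma lm_right: "T' lm x = scale (lm x) 1"
proof (rule functional_eqI)
  fix f assume f: "linF f"
  show "f (T' lm x) = f (scale (lm x) 1)"
    using lm_right_int[OF f, of x] by (simp only: T'_def sw_comp[OF f] lin_scale[OF f] mult.commute)
qed

subsection \<open>Coideals and Hopf subalgebras\<close>

text \<open>The condition \<Delta>(V) \<subseteq> H \<otimes> V, read off from functionals on the
  first leg.\<close>

definition lcoid :: "'h set \<Rightarrow> bool" where
  "lcoid V \<longleftrightarrow> subspace V \<and> (\<forall>x\<in>V. \<forall>f. linF f \<longrightarrow> T' f x \<in> V)"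

definition hsub :: "'h set \<Rightarrow> bool" where
  "hsub B \<longleftrightarrow> subalg B \<and> (\<forall>x\<in>B. S x \<in> B) \<and> (\<forall>x\<in>B. \<forall>f. linF f \<longrightarrow> T f x \<in> B \<and> T' f x \<in> B)"

lemma lcoidD: "lcoid V \<Longrightarrow> subspace V" "lcoid V \<Longrightarrow> x \<in> V \<Longrightarrow> linF f \<Longrightarrow> T' f x \<in> V"
  unfolding lcoid_def by blast+

lemma hsubD: "hsub B \<Longrightarrow> subalg B" "hsub B \<Longrightarrow> x \<in> B \<Longrightarrow> S x \<in> B"
  "hsub B \<Longrightarrow> x \<in> B \<Longrightarrow> linF f \<Longrightarrow> T f x \<in> B" "hsub B \<Longrightarrow> x \<in> B \<Longrightarrow> linF f \<Longrightarrow> T' f x \<in> B"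
  unfolding hsub_def by blast+

lemma hsub_lcoid: "hsub B \<Longrightarrow> lcoid B"
  unfolding lcoid_def using hsubD subalgD(1) by blast

lemma hsub_UNIV: "hsub UNIV"
  unfolding hsub_def subalg_def by simp

lemma sw_first_leg:
  assumes "bil s' F"
  shows "sw x F = (\<Sum>c\<in>Basis. F c (T' (\<lambda>y. representation Basis y c) x))"
proof -
  have l: "lin scale s' (\<lambda>x. F x y)" "lin scale s' (\<lambda>y. F x y)" for x y
    using assms by (auto simp: bil_def)
  have "sw x F = sw x (\<lambda>a b. \<Sum>c\<in>Basis. s' (representation Basis a c) (F c b))"
    by (rule sw_cong, rule lin_expand[OF l(1)])
  also have "\<dots> = (\<Sum>c\<in>Basis. F c (T' (\<lambda>y. representation Basis y c) x))"
    unfolding sw_sum T'_def by (simp only: sw_comp[OF l(2)] lin_scale[OF l(2)])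
  finally show ?thesis .
qed

lemma sw_lcoid_cong:
  assumes "lcoid V" "x \<in> V" "bil s' F" "bil s' G" "\<And>a b. b \<in> V \<Longrightarrow> F a b = G a b"
  shows "sw x F = sw x G"
  unfolding sw_first_leg[OF assms(3)] sw_first_leg[OF assms(4)]
  by (intro sum.cong refl assms(5) lcoidD(2)[OF assms(1,2)] lin_rep)

text \<open>A Sweedler sum whose second leg runs over a basis of \<open>B\<close>; for a Hopf
  subalgebra both legs then visibly lie in \<open>B\<close>, unlike those of
  \<open>sw\<close>.\<close>

definition sB :: "'h set \<Rightarrow> 'h \<Rightarrow> ('h \<Rightarrow> 'h \<Rightarrow> 'w::ab_group_add) \<Rightarrow> 'w" where
  "sB B x F = (\<Sum>b\<in>bas B. F (T (crd B b) x) b)"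

lemma sw_sB:
  assumes "lcoid B" "x \<in> B" "bil s' F"
  shows "sw x F = sB B x F"
proof -
  have l: "lin scale s' (\<lambda>x. F x y)" "lin scale s' (\<lambda>y. F x y)" and vs: "vector_space s'" for x y
    using assms(3) by (auto simp: bil_def)
  let ?p = "\<lambda>y. \<Sum>b\<in>bas B. scale (crd B b y) b"
  have lp: "linE ?p" by (intro lin_SUM vector_space_axioms lin_scale_left lin_crd)
  have "bil s' (\<lambda>a y. F a (?p y))" by (intro bilI vs l lin_comp[OF l(2) lp])
  then have "sw x F = sw x (\<lambda>a y. F a (?p y))"
    by (rule sw_lcoid_cong[OF assms(1,2,3)]) (simp add: crd_expand[OF fdimI[OF lcoidD(1)[OF assms(1)]]])
  also have "\<dots> = (\<Sum>b\<in>bas B. sw x (\<lambda>a y. s' (crd B b y) (F a b)))"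
    by (simp only: lin_sum[OF l(2)] lin_scale[OF l(2)] sw_sum)
  also have "\<dots> = sB B x F"
    unfolding sB_def T_def by (simp only: sw_comp[OF l(1)] lin_scale[OF l(1)])
  finally show ?thesis .
qed

lemma sB_cong:
  assumes "hsub B" "x \<in> B" "\<And>a b. a \<in> B \<Longrightarrow> b \<in> B \<Longrightarrow> F a b = G a b"
  shows "sB B x F = sB B x G"
  unfolding sB_def using assms hsubD(3)[OF assms(1,2) lin_crd] bas(1)[of B] by (intro sum.cong refl) blast

lemma sw_B_cong:
  assumes "hsub B" "x \<in> B" "bil s' F" "bil s' G" "\<And>a b. a \<in> B \<Longrightarrow> b \<in> B \<Longrightarrow> F a b = G a b"
  shows "sw x F = sw x G"
  unfolding sw_sB[OF hsub_lcoid[OF assms(1)] assms(2,3)] sw_sB[OF hsub_lcoid[OF assms(1)] assms(2,4)]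
  by (rule sB_cong[OF assms(1,2,5)])

lemma sw_B_mem:
  assumes "hsub B" "x \<in> B" "subspace W" "bil scale F" "\<And>a b. a \<in> B \<Longrightarrow> b \<in> B \<Longrightarrow> F a b \<in> W"
  shows "sw x F \<in> W"
  unfolding sw_sB[OF hsub_lcoid[OF assms(1)] assms(2,4)] sB_def
  using assms hsubD(3)[OF assms(1,2) lin_crd] bas(1)[of B] by (intro subspace_sum) blast+

subsection \<open>Integrals in a Hopf subalgebra\<close>

text \<open>The element on which every functional f takes the value tr(T f on B) / dim B, that is,
  the normalised regular character of the dual of \<open>B\<close>.\<close>

definition \<Lambda>B :: "'h set \<Rightarrow> 'h" where
  "\<Lambda>B B = scale (1 / of_nat (dim B)) (\<Sum>b\<in>bas B. scale (trace B (T (crd B b))) b)"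

lemma \<Lambda>B_mem: "subspace B \<Longrightarrow> \<Lambda>B B \<in> B"
  unfolding \<Lambda>B_def using bas(1) by (intro subspace_scale subspace_sum) blast+

lemma T_sum_crd:
  assumes "lcoid B" "x \<in> B" "linF f"
  shows "(\<Sum>b\<in>bas B. scale (f b) (T (crd B b) x)) = T f x"
proof -
  have "bil scale (\<lambda>a b. scale (f b) a)" by (intro bilE lin_intros' assms(3))
  from sw_sB[OF assms(1,2) this] show ?thesis by (simp add: T_def sB_def)
qed

lemma trace_T_\<Lambda>B:
  assumes "hsub B" "linF f"
  shows "trace B (T f) = of_nat (dim B) * f (\<Lambda>B B)"
proof -
  have "trace B (T f) = trace B (\<lambda>x. \<Sum>b\<in>bas B. scale (f b) (T (crd B b) x))"
    by (rule trace_cong) (simp add: T_sum_crd[OF hsub_lcoid[OF assms(1)] _ assms(2)])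
  also have "\<dots> = (\<Sum>b\<in>bas B. f b * trace B (T (crd B b)))"
    unfolding trace_sum trace_scale ..
  also have "\<dots> = f (\<Sum>b\<in>bas B. scale (trace B (T (crd B b))) b)"
    by (simp add: lin_sum[OF assms(2)] lin_scale[OF assms(2)] mult.commute)
  finally show ?thesis
    using of_nat_dim_nonzero[of B] hsubD(1)[OF assms(1)] subalgD(1,2)[of B]
    by (simp add: \<Lambda>B_def lin_scale[OF assms(2)])
qed

context
  fixes B assumes B: "hsub B"
begin

lemmas Bs = subalgD(1)[OF hsubD(1)[OF B]] and B1 = subalgD(2)[OF hsubD(1)[OF B]]
  and Bm = subalgD(3)[OF hsubD(1)[OF B]]

lemma dB0: "(of_nat (dim B) :: 'k) \<noteq> 0"
  by (rule of_nat_dim_nonzero[OF B1 Bs])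

lemma \<epsilon>_\<Lambda>B: "\<epsilon> (\<Lambda>B B) = 1"
proof -
  have "T \<epsilon> = (\<lambda>x. x)"
    unfolding T_def by (rule ext) (rule sw_counit_right[OF vector_space_axioms lin_ident])
  then have "trace B (T \<epsilon>) = of_nat (dim B)" using trace_id[OF fdimI[OF Bs]] by simp
  then show ?thesis using trace_T_\<Lambda>B[OF B lin\<epsilon>] dB0 by simp
qed

text \<open>Translating y by the functional f(x .) gives S(x_1) T f (x_2 y). Cyclicity of the trace
  puts S(x_1) behind x_2, and x_2 S(x_1) = \<epsilon>(x) holds because S^2 = id.\<close>

lemma \<Lambda>B_left:
  assumes x: "x \<in> B"
  shows "x * \<Lambda>B B = scale (\<epsilon> x) (\<Lambda>B B)"
proof (rule functional_eqI)
  fix f assume f: "linF f"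
  have lf: "linF (\<lambda>y. f (x * y))" by (intro lin_comp[OF f] lin_intros)
  note lT = lin_comp[OF linT[OF f]]
  have *: "T (\<lambda>y. f (x * y)) y = sw x (\<lambda>p q. S p * T f (q * y))" for y
  proof -
    define G where "G m d = sw y (\<lambda>a b. scale (f (d * b)) (m * a))" for m d
    have G: "bil scale G" unfolding G_def by (intro bilE lin_intros' lin_comp[OF f])
    have b: "bil scale (\<lambda>a b. scale (f b) a)" by (intro bilE lin_intros' f)
    have "T (\<lambda>y. f (x * y)) y = G 1 x" by (simp add: T_def G_def)
    also have "\<dots> = sw x (\<lambda>p q. sw q (\<lambda>c d. G (S p * c) d))"
      by (rule sw_cancel12(1)[OF G, symmetric])
    also have "\<dots> = sw x (\<lambda>p q. S p * sw q (\<lambda>c d. sw y (\<lambda>a b. scale (f (d * b)) (c * a))))"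
      by (simp only: G_def sw_comp[OF lin_eta(2)] scale_mult_right mult.assoc)
    also have "\<dots> = sw x (\<lambda>p q. S p * T f (q * y))"
      unfolding T_def sw_mult[OF b] ..
    finally show ?thesis .
  qed
  have lL: "linE (\<lambda>y. p * y)" for p by (rule lin_eta)
  have bT: "bil (*) (\<lambda>p q. trace B (\<lambda>y. S p * T f (q * y)))" "bil (*) (\<lambda>p q. trace B (\<lambda>y. T f (q * S p * y)))"
    by (intro bilF lin_traceF lin_intros' lT)+
  have "of_nat (dim B) * f (x * \<Lambda>B B) = trace B (\<lambda>y. sw x (\<lambda>p q. S p * T f (q * y)))"
    using trace_T_\<Lambda>B[OF B lf] by (simp only: *[abs_def])
  also have "\<dots> = sw x (\<lambda>p q. trace B (\<lambda>y. S p * T f (q * y)))"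
    by (simp add: sw_def trace_sum)
  also have "\<dots> = sw x (\<lambda>p q. trace B (\<lambda>y. T f (q * S p * y)))"
  proof (rule sw_B_cong[OF B x bT])
    fix p q assume pq: "p \<in> B" "q \<in> B"
    have "trace B (\<lambda>y. S p * T f (q * y)) = trace B (\<lambda>y. T f (q * (S p * y)))"
      by (rule trace_cyc[OF fdimI[OF Bs] lL _ lT[OF lL]])
        (use pq Bm hsubD(2,3)[OF B] f in \<open>auto\<close>)
    then show "trace B (\<lambda>y. S p * T f (q * y)) = trace B (\<lambda>y. T f (q * S p * y))" by (simp only: mult.assoc)
  qed
  also have "\<dots> = trace B (\<lambda>y. sw x (\<lambda>p q. T f (q * S p * y)))"
    by (simp add: sw_def trace_sum)
  also have "\<dots> = trace B (\<lambda>y. scale (\<epsilon> x) (T f y))"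
  proof (rule trace_cong)
    fix y
    have "linE (\<lambda>m. T f (m * y))" by (intro lT lin_intros)
    from sw_antipode_left'[OF this, of x] show "sw x (\<lambda>p q. T f (q * S p * y)) = scale (\<epsilon> x) (T f y)" by simp
  qed
  also have "\<dots> = of_nat (dim B) * f (scale (\<epsilon> x) (\<Lambda>B B))"
    by (simp add: trace_scale trace_T_\<Lambda>B[OF B f] lin_scale[OF f])
  finally show "f (x * \<Lambda>B B) = f (scale (\<epsilon> x) (\<Lambda>B B))" using dB0 by simp
qed

text \<open>S(\<Lambda>_B) is a right integral and \<Lambda>_B a left one, both of counit 1, so
  their product equals either of them.\<close>

lemma S_\<Lambda>B: "S (\<Lambda>B B) = \<Lambda>B B"
proof -
  have "S (\<Lambda>B B) * x = scale (\<epsilon> x) (S (\<Lambda>B B))" if "x \<in> B" for x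
  proof -
    have "S (\<Lambda>B B) * x = S (S x * \<Lambda>B B)" by (simp add: S_mult SS)
    also have "\<dots> = scale (\<epsilon> x) (S (\<Lambda>B B))"
      unfolding \<Lambda>B_left[OF hsubD(2)[OF B that]] by (simp add: counit_S lin_scale[OF linS])
    finally show ?thesis .
  qed
  from this[OF \<Lambda>B_mem[OF Bs]] \<Lambda>B_left[OF hsubD(2)[OF B \<Lambda>B_mem[OF Bs]]]
  show ?thesis by (simp add: counit_S \<epsilon>_\<Lambda>B)
qed

lemma \<Lambda>B_right:
  assumes x: "x \<in> B"
  shows "\<Lambda>B B * x = scale (\<epsilon> x) (\<Lambda>B B)"
proof -
  have "\<Lambda>B B * x = S (S x * S (\<Lambda>B B))" by (simp add: S_mult SS)
  also have "\<dots> = scale (\<epsilon> x) (\<Lambda>B B)"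
    unfolding S_\<Lambda>B \<Lambda>B_left[OF hsubD(2)[OF B x]] by (simp add: counit_S lin_scale[OF linS] S_\<Lambda>B)
  finally show ?thesis .
qed

lemma sw_\<Lambda>B:
  assumes F: "bil s' F" and x: "x \<in> B"
  shows "sw (\<Lambda>B B) (\<lambda>a b. F a (x * b)) = sw (\<Lambda>B B) (\<lambda>a b. F (S x * a) b)"
proof -
  have l: "lin scale s' (\<lambda>x. F x y)" "lin scale s' (\<lambda>y. F x y)" and vs: "vector_space s'" for x y
    using F by (auto simp: bil_def)
  note li = vs lin_intros lin_comp[OF l(1)] lin_comp[OF l(2)]
  define G where "G m d = sw (\<Lambda>B B) (\<lambda>a b. F (m * a) (d * b))" for m d
  have G: "bil s' G" unfolding G_def by (intro bilI li)
  have L: "lin scale s' (\<lambda>t. sw t (\<lambda>a b. F (S p * a) b))" for p by (intro li bilI l)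
  have "sw (\<Lambda>B B) (\<lambda>a b. F a (x * b)) = G 1 x" by (simp add: G_def)
  also have "\<dots> = sw x (\<lambda>p q. sw q (\<lambda>c d. G (S p * c) d))"
    by (rule sw_cancel12(1)[OF G, symmetric])
  also have "\<dots> = sw x (\<lambda>p q. sw (q * \<Lambda>B B) (\<lambda>a b. F (S p * a) b))"
  proof (rule sw_cong)
    fix p q
    show "sw q (\<lambda>c d. G (S p * c) d) = sw (q * \<Lambda>B B) (\<lambda>a b. F (S p * a) b)"
      unfolding G_def mult.assoc by (rule sw_mult[of s', symmetric]) (intro bilI li l)
  qed
  also have "\<dots> = sw x (\<lambda>p q. s' (\<epsilon> q) (sw (\<Lambda>B B) (\<lambda>a b. F (S p * a) b)))"
  proof (rule sw_B_cong[OF B x])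
    show "bil s' (\<lambda>p q. sw (q * \<Lambda>B B) (\<lambda>a b. F (S p * a) b))"
      by (intro bilI vs lin_comp[OF L] lin_intros lin_sw_arg lin_comp[OF l(1)])
    show "bil s' (\<lambda>p q. s' (\<epsilon> q) (sw (\<Lambda>B B) (\<lambda>a b. F (S p * a) b)))"
      by (intro bilI vs lin_scale_right lin_scale_gen lin\<epsilon> lin_sw_arg lin_comp[OF l(1)] lin_intros)
    fix p q assume q: "q \<in> B"
    show "sw (q * \<Lambda>B B) (\<lambda>a b. F (S p * a) b) = s' (\<epsilon> q) (sw (\<Lambda>B B) (\<lambda>a b. F (S p * a) b))"
      unfolding \<Lambda>B_left[OF q] by (rule lin_scale[OF L])
  qed
  also have "\<dots> = sw (\<Lambda>B B) (\<lambda>a b. F (S x * a) b)"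
    by (rule sw_counit_right; intro li)
  finally show ?thesis .
qed

text \<open>Dual bases of \<open>B\<close> for the form given by \<open>lm\<close>: multiplication
  by x crosses the integral, and \<open>lm\<close> absorbs the first leg.\<close>

lemma lm_\<Lambda>B_expand:
  assumes x: "x \<in> B"
  shows "sw (\<Lambda>B B) (\<lambda>a b. scale (lm (x * a)) (S b)) = scale (lm (\<Lambda>B B)) x"
proof -
  have b: "bil scale (\<lambda>a b. scale (lm a) (S b))" by (intro bilE lin_intros' lin_lm)
  have "sw (\<Lambda>B B) (\<lambda>a b. scale (lm (x * a)) (S b)) = sw (\<Lambda>B B) (\<lambda>a b. scale (lm a) (S (S x * b)))"
    using sw_\<Lambda>B[OF b hsubD(2)[OF B x]] by (simp add: SS)
  also have "\<dots> = S (T' lm (\<Lambda>B B)) * x"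
    by (simp only: S_mult SS T'_def sw_comp[OF linS] lin_scale[OF linS] sw_comp[OF lin_mult_right[OF lin_ident]] scale_mult_left)
  also have "\<dots> = scale (lm (\<Lambda>B B)) x"
    unfolding lm_right by (simp add: lin_scale[OF linS] S_one scale_mult_left[symmetric])
  finally show ?thesis .
qed

lemma lm_\<Lambda>B_nat: "\<exists>k. lm (\<Lambda>B B) = of_nat k \<and> k > 0"
proof -
  let ?L = "\<lambda>y. \<Lambda>B B * y"
  have id: "\<Lambda>B B * \<Lambda>B B = \<Lambda>B B" using \<Lambda>B_left[OF \<Lambda>B_mem[OF Bs]] by (simp add: \<epsilon>_\<Lambda>B)
  have t: "lm (\<Lambda>B B) = of_nat (dim (range ?L))"
    unfolding lm_def by (rule trace_idem[OF fdim_UNIV]) (auto intro: lin_eta simp: mult.assoc[symmetric] id)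
  have "dim (range ?L) \<noteq> 0"
  proof
    assume "dim (range ?L) = 0"
    then have "range ?L = {0}"
      using fdim_dim_0[OF fdimI[OF subspace_image_lin[OF lin_eta(2) subspace_UNIV]]] by blast
    then have "\<Lambda>B B * 1 = 0" by blast
    then show False using \<epsilon>_\<Lambda>B lin_zero[OF lin\<epsilon>] by simp
  qed
  then show ?thesis using t by blast
qed

text \<open>The dual bases from the integral form a frame of \<open>B\<close> after division by
  \<open>lm (\<Lambda>B B)\<close>, which is nonzero, being the rank of a nonzero
  idempotent.\<close>

lemma trace_B:
  assumes "linE F" "F ` B \<subseteq> B"
  shows "lm (\<Lambda>B B) * trace B F = sw (\<Lambda>B B) (\<lambda>a b. lm (F (S b) * a))"
proof -
  obtain k where k: "lm (\<Lambda>B B) = of_nat k" "k > 0" using lm_\<Lambda>B_nat by blast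
  let ?c = "lm (\<Lambda>B B)"
  have c0: "?c \<noteq> 0" using k by simp
  let ?f = "\<lambda>b x. (1 / ?c) * lm (x * T (crd B b) (\<Lambda>B B))"
  have "frame B (bas B) ?f S"
    unfolding frame_def
  proof (intro conjI ballI)
    show "finite (bas B)" by (rule finite_bas[OF fdimI[OF Bs]])
    show "linF (?f b)" for b by (intro lin_k_left lin_comp[OF lin_lm] lin_intros)
    show "b \<in> bas B \<Longrightarrow> S b \<in> B" for b using bas(1)[of B] hsubD(2)[OF B] by blast
    fix x assume x: "x \<in> B"
    have b: "bil scale (\<lambda>a b. scale (lm (x * a)) (S b))" by (intro bilE lin_intros' lin_comp[OF lin_lm])
    have "(\<Sum>b\<in>bas B. scale (?f b x) (S b)) = scale (1 / ?c) (sB B (\<Lambda>B B) (\<lambda>a b. scale (lm (x * a)) (S b)))"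
      by (simp add: sB_def scale_sum_right)
    also have "\<dots> = x"
      unfolding sw_sB[OF hsub_lcoid[OF B] \<Lambda>B_mem[OF Bs] b, symmetric] lm_\<Lambda>B_expand[OF x] using c0 by simp
    finally show "(\<Sum>b\<in>bas B. scale (?f b x) (S b)) = x" .
  qed
  from trace_frame[OF this fdimI[OF Bs] assms]
  have "?c * trace B F = sB B (\<Lambda>B B) (\<lambda>a b. lm (F (S b) * a))"
    using c0 by (simp add: sB_def sum_distrib_left)
  moreover have "bil (*) (\<lambda>a b. lm (F (S b) * a))"
    by (intro bilF lin_comp[OF lin_lm] lin_mult_left lin_mult_right lin_comp[OF assms(1)] linS lin_ident)
  ultimately show ?thesis using sw_sB[OF hsub_lcoid[OF B] \<Lambda>B_mem[OF Bs]] by metis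
qed

text \<open>The trace formula for the identity map. Since \<open>lm (\<Lambda>B B)\<close> is a
  rank, this is a Lagrange theorem for Hopf subalgebras.\<close>

lemma dim_lm_\<Lambda>B: "lm (\<Lambda>B B) * of_nat (dim B) = of_nat dH"
proof -
  have "lm (\<Lambda>B B) * trace B (\<lambda>x. x) = sw (\<Lambda>B B) (\<lambda>a b. lm (S b * a))"
    by (rule trace_B[OF lin_ident]) simp
  also have "\<dots> = of_nat dH" unfolding sw_antipode_right'[OF lin_lm] by (simp add: \<epsilon>_\<Lambda>B lm_one)
  finally show ?thesis using trace_id[OF fdimI[OF Bs]] by simp
qed

lemma trace_B_biaction:
  assumes "a \<in> B" "c \<in> B"
  shows "lm (\<Lambda>B B) * trace B (\<lambda>x. a * x * S c) = lm (sw (\<Lambda>B B) (\<lambda>p q. p * a * S q) * S c)"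
proof -
  have "lm (\<Lambda>B B) * trace B (\<lambda>x. a * x * S c) = sw (\<Lambda>B B) (\<lambda>p q. lm (a * S q * S c * p))"
  proof (rule trace_B)
    show "linE (\<lambda>x. a * x * S c)" by (intro lin_intros)
    show "(\<lambda>x. a * x * S c) ` B \<subseteq> B" using assms Bm hsubD(2)[OF B] by blast
  qed
  also have "\<dots> = sw (\<Lambda>B B) (\<lambda>p q. lm (p * a * S q * S c))"
  proof (rule sw_cong)
    fix p q
    show "lm (a * S q * S c * p) = lm (p * a * S q * S c)"
      using lm_commute[of "a * S q * S c" p] by (simp only: mult.assoc)
  qed
  also have "\<dots> = lm (sw (\<Lambda>B B) (\<lambda>p q. p * a * S q) * S c)"
    by (simp only: sw_comp[OF lin_comp[OF lin_lm lin_mult_right[OF lin_ident]]])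
  finally show ?thesis .
qed

text \<open>Maschke averaging: a linear projection \<open>p\<close> onto the left ideal B x is made
  B-linear with the integral, and then x = P(x) = x P(1) with P(1) in B x.\<close>

lemma vnr_B: "vnr B"
  unfolding vnr_def
proof
  fix x assume x: "x \<in> B"
  let ?W = "(\<lambda>b. b * x) ` B"
  have sW: "subspace ?W" by (rule subspace_image_lin[OF lin_mult_right[OF lin_ident] Bs])
  define p where "p y = (\<Sum>b\<in>bas ?W. scale (crd ?W b y) b)" for y
  have lp: "linE p" unfolding p_def by (intro lin_SUM vector_space_axioms lin_scale_left lin_crd)
  have pW: "p y \<in> ?W" for y
    unfolding p_def using bas(1)[of ?W] by (intro subspace_sum[OF sW] subspace_scale[OF sW]) blast
  have pid: "p y = y" if "y \<in> ?W" for y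
    unfolding p_def by (rule crd_expand[OF fdimI[OF sW] that])
  have WB: "b * w \<in> ?W" if "b \<in> B" "w \<in> ?W" for b w
    using that Bm by (auto simp: mult.assoc[symmetric])
  define P where "P y = sw (\<Lambda>B B) (\<lambda>a b. a * p (S b * y))" for y
  have bP: "bil scale (\<lambda>a b. a * p (S b * y))" for y
    by (intro bilE lin_mult_left lin_mult_right lin_comp[OF lp] linS lin_ident)
  have bP': "bil scale (\<lambda>a b. a * (S b * y))" for y by (intro bilE lin_intros')
  have "P 1 \<in> ?W" unfolding P_def
  proof (rule sw_B_mem[OF B \<Lambda>B_mem[OF Bs] sW bP])
    fix a b assume "a \<in> B" "b \<in> B"
    show "a * p (S b * 1) \<in> ?W" by (rule WB[OF \<open>a \<in> B\<close> pW])
  qed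
  then obtain y where y: "y \<in> B" "P 1 = y * x" by (elim imageE)
  have "P x = sw (\<Lambda>B B) (\<lambda>a b. a * (S b * x))"
    unfolding P_def
  proof (rule sw_B_cong[OF B \<Lambda>B_mem[OF Bs] bP bP'])
    fix a b assume "a \<in> B" and b: "b \<in> B"
    show "a * p (S b * x) = a * (S b * x)"
      by (rule arg_cong[where f = "(*) a"], rule pid, rule imageI, rule hsubD(2)[OF B b])
  qed
  also have "\<dots> = x"
    using sw_antipode_right[OF lin_mult_right[OF lin_ident, of x], of "\<Lambda>B B"] by (simp add: mult.assoc \<epsilon>_\<Lambda>B)
  finally have Px: "P x = x" .
  have "P x = sw (\<Lambda>B B) (\<lambda>a b. a * p (S (S x * b) * 1))" by (simp add: P_def S_mult SS)
  also have "\<dots> = sw (\<Lambda>B B) (\<lambda>a b. S (S x) * a * p (S b * 1))"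
    by (rule sw_\<Lambda>B[OF bP[of 1] hsubD(2)[OF B x]])
  also have "\<dots> = x * P 1"
    by (simp only: P_def SS mult.assoc sw_comp[OF lin_eta(2)])
  finally have "P x = x * P 1" .
  then have "x = x * y * x" unfolding Px y(2) by (simp only: mult.assoc)
  then show "\<exists>y\<in>B. x = x * y * x" using y(1) by (rule bexI)
qed

text \<open>Corners of primitive idempotents are scalar, and for distinct e and f the element y = e
  x f has square 0, so that e + y is again idempotent.\<close>

lemma span_idempotents: "x \<in> B \<Longrightarrow> x \<in> span {e \<in> B. e * e = e}"
proof -
  assume x: "x \<in> B"
  obtain E where E: "orth E" "E \<subseteq> B" and sc: "\<And>e x. e \<in> E \<Longrightarrow> x \<in> B \<Longrightarrow> \<exists>c. e * x * e = scale c e"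
    using primitive_idempotents[OF hsubD(1)[OF B] vnr_B] by blast
  note o = orthD[OF E(1)]
  let ?I = "{e \<in> B. e * e = e}"
  have eI: "e \<in> span ?I" if "e \<in> E" for e using o(3)[OF that] E(2) that by (intro span_base) auto
  have ef: "e * x * f \<in> span ?I" if e: "e \<in> E" and f: "f \<in> E" for e f
  proof (cases "e = f")
    case True
    then show ?thesis using sc[OF e x] span_scale[OF eI[OF e]] by auto
  next
    case False
    have z: "f * e = 0" "e * f = 0" using o(4) e f False by blast+
    let ?y = "e * x * f"
    have 1: "e * ?y = ?y" using o(3)[OF e] by (simp add: mult.assoc[symmetric])
    have 2: "?y * e = 0" using z(1) by (simp add: mult.assoc)
    have "?y * ?y = e * x * (f * e) * x * f" by (simp only: mult.assoc)
    then have 3: "?y * ?y = 0" using z(1) by simp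
    have "(e + ?y) * (e + ?y) = e * e + e * ?y + (?y * e + ?y * ?y)" by (simp only: distrib_left distrib_right add_ac)
    also have "\<dots> = e + ?y" unfolding 1 2 3 o(3)[OF e] by simp
    finally have id: "(e + ?y) * (e + ?y) = e + ?y" .
    have eB: "e \<in> B" "f \<in> B" using e f E(2) by blast+
    have "e + ?y \<in> B" by (intro subspace_add[OF Bs] Bm eB x)
    with id have "e + ?y \<in> ?I" by blast
    then have "(e + ?y) - e \<in> span ?I" by (rule span_diff[OF span_base eI[OF e]])
    then show ?thesis by simp
  qed
  have "x = \<Sum>E * x * \<Sum>E" by (simp add: o(5))
  also have "\<dots> = (\<Sum>f\<in>E. \<Sum>e\<in>E. e * x * f)" by (simp only: sum_distrib_left sum_distrib_right)
  finally have x_eq: "x = (\<Sum>f\<in>E. \<Sum>e\<in>E. e * x * f)" .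
  have "(\<Sum>f\<in>E. \<Sum>e\<in>E. e * x * f) \<in> span ?I" by (intro span_sum ef)
  then show ?thesis by (simp only: x_eq[symmetric])
qed

end

end

section \<open>The class equation\<close>

lemma rational_functional: "\<exists>\<phi>::'k::field_char_0 \<Rightarrow> rat. (\<forall>x y. \<phi> (x + y) = \<phi> x + \<phi> y) \<and> (\<forall>r x. \<phi> (of_rat r * x) = r * \<phi> x) \<and> \<phi> 1 = 1"
proof -
  interpret v: vector_space "\<lambda>r (x::'k). of_rat r * x"
    by unfold_locales (simp_all add: algebra_simps of_rat_add of_rat_mult)
  interpret p: vector_space_pair "\<lambda>r (x::'k). of_rat r * x" "(*) :: rat \<Rightarrow> rat \<Rightarrow> rat"
    by unfold_locales (simp_all add: algebra_simps)
  have "v.independent {1 :: 'k}" by (simp add: v.dependent_single)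
  from p.linear_independent_extend[OF this, of "\<lambda>_. 1"]
  obtain g where g: "Vector_Spaces.linear (\<lambda>r (x::'k). of_rat r * x) (*) g" "g 1 = 1" by auto
  then show ?thesis by (intro exI[of _ g]) (simp add: Vector_Spaces.linear_iff)
qed

lemma common_denominator:
  fixes f :: "'i \<Rightarrow> rat"
  assumes "finite J"
  shows "\<exists>D::nat. D > 0 \<and> (\<forall>i\<in>J. \<exists>z::int. of_nat D * f i = of_int z)"
  using assms
proof (induction J rule: finite_induct)
  case (insert i J)
  then obtain D :: nat where D: "D > 0" "\<And>j. j \<in> J \<Longrightarrow> \<exists>z::int. of_nat D * f j = of_int z" by blast
  obtain a b where ab: "quotient_of (f i) = (a, b)" by fastforce
  have b: "b > 0" using quotient_of_denom_pos[OF ab] .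
  have fi: "f i = of_int a / of_int b" using quotient_of_div[OF ab] .
  have "\<exists>z::int. of_nat (D * nat b) * f j = of_int z" if j: "j \<in> insert i J" for j
  proof (cases "j = i")
    case True
    have "of_nat (D * nat b) * f i = of_int (int D * a)" using b by (simp add: fi)
    then show ?thesis using True by blast
  next
    case False
    then obtain z where "of_nat D * f j = of_int z" using D(2) j by blast
    then have "of_nat (D * nat b) * f j = of_int (z * b)" using b by (simp add: algebra_simps)
    then show ?thesis by blast
  qed
  then show ?case using D(1) b by (intro exI[of _ "D * nat b"]) auto
qed (intro exI[of _ 1], simp)

text \<open>A rational-linear map fixing 1 shows that all powers of m/d have one common denominator
  \<open>D\<close>. In reduced form m'/d', every power of d' then divides \<open>D\<close>, so d' =
  1.\<close>

lemma dvd_if_powers_in_fg_subgroup: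
  fixes u :: "'i \<Rightarrow> 'k::field_char_0" and m d :: nat
  assumes J: "finite J" and d: "d > 0"
    and N: "\<And>k. \<exists>N::'i \<Rightarrow> nat. (of_nat m / of_nat d) ^ k = (\<Sum>i\<in>J. of_nat (N i) * u i)"
  shows "d dvd m"
proof -
  obtain \<phi> :: "'k \<Rightarrow> rat" where \<phi>: "\<And>x y. \<phi> (x + y) = \<phi> x + \<phi> y" "\<And>r x. \<phi> (of_rat r * x) = r * \<phi> x" "\<phi> 1 = 1"
    using rational_functional by blast
  have \<phi>0: "\<phi> 0 = 0" using \<phi>(2)[of 0 0] by simp
  have \<phi>s: "\<phi> (sum g A) = (\<Sum>i\<in>A. \<phi> (g i))" for g :: "'i \<Rightarrow> 'k" and A
    by (induction A rule: infinite_finite_induct) (simp_all add: \<phi>0 \<phi>(1))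
  obtain D :: nat where D: "D > 0" "\<And>i. i \<in> J \<Longrightarrow> \<exists>z::int. of_nat D * \<phi> (u i) = of_int z"
    using common_denominator[OF J, of "\<lambda>i. \<phi> (u i)"] by blast
  obtain z where z: "\<And>i. i \<in> J \<Longrightarrow> of_nat D * \<phi> (u i) = of_int (z i)" using D(2) by metis
  have *: "d ^ k dvd D * m ^ k" for k
  proof -
    obtain N where N: "(of_nat m / of_nat d) ^ k = (\<Sum>i\<in>J. of_nat (N i) * u i)" using N by blast
    have "\<phi> (of_rat ((of_nat m / of_nat d) ^ k) * 1) = (of_nat m / of_nat d) ^ k" unfolding \<phi>(2) \<phi>(3) by simp
    moreover have "(of_rat ((of_nat m / of_nat d) ^ k) :: 'k) = (\<Sum>i\<in>J. of_rat (of_nat (N i)) * u i)"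
      using N by (simp add: of_rat_power of_rat_divide)
    ultimately have "(of_nat m / of_nat d) ^ k = (\<Sum>i\<in>J. of_nat (N i) * \<phi> (u i))"
      by (simp add: \<phi>s \<phi>(2) del: of_rat_of_nat_eq)
    then have "of_nat D * (of_nat m / of_nat d) ^ k = (\<Sum>i\<in>J. of_nat (N i) * (of_nat D * \<phi> (u i)))"
      by (simp add: sum_distrib_left algebra_simps)
    also have "\<dots> = of_int (\<Sum>i\<in>J. int (N i) * z i)" by (simp add: z)
    finally have "(of_nat (D * m ^ k) :: rat) = of_int (\<Sum>i\<in>J. int (N i) * z i) * of_nat (d ^ k)"
      using d by (simp add: field_simps power_divide)
    then have "(of_int (int (D * m ^ k)) :: rat) = of_int ((\<Sum>i\<in>J. int (N i) * z i) * int (d ^ k))" by simp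
    then have "int (D * m ^ k) = (\<Sum>i\<in>J. int (N i) * z i) * int (d ^ k)" by (simp only: of_int_eq_iff)
    then have "int (d ^ k) dvd int (D * m ^ k)" by (metis dvd_triv_right)
    then show ?thesis by (simp only: int_dvd_int_iff)
  qed
  define g where "g = gcd m d"
  have g: "g > 0" using d by (simp add: g_def)
  obtain m' d' where md: "m = m' * g" "d = d' * g" "coprime m' d'"
    using gcd_coprime_exists[of m d] g unfolding g_def by auto
  have dd: "d' ^ k dvd D" for k
  proof -
    have "d' ^ k * g ^ k dvd (D * m' ^ k) * g ^ k" using *[of k] unfolding md by (simp add: power_mult_distrib mult.assoc)
    then have "d' ^ k dvd D * m' ^ k" using g by simp
    moreover have "coprime (d' ^ k) (m' ^ k)" using md(3) by (simp add: coprime_commute)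
    ultimately show ?thesis using coprime_dvd_mult_left_iff by blast
  qed
  have "d' = 1"
  proof (rule ccontr)
    assume "d' \<noteq> 1"
    moreover have "d' \<noteq> 0" using md(2) d by auto
    ultimately have "2 \<le> d'" by simp
    then have "(2::nat) ^ D \<le> d' ^ D" by (rule power_mono) simp
    moreover have "d' ^ D \<le> D" using dvd_imp_le[OF dd D(1)] .
    ultimately show False using less_exp[of D] by simp
  qed
  then show ?thesis using md by simp
qed

text \<open>Column vectors are modelled by finitely supported functions vanishing off
  \<open>I\<close>; the trace of the resulting projection is its rank.\<close>

lemma idempotent_matrix_trace:
  fixes A :: "'i \<Rightarrow> 'i \<Rightarrow> 'k::field"
  assumes I: "finite I" and A: "\<And>i l. i \<in> I \<Longrightarrow> l \<in> I \<Longrightarrow> (\<Sum>j\<in>I. A i j * A j l) = A i l"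
  shows "\<exists>n. (\<Sum>i\<in>I. A i i) = of_nat n"
proof -
  interpret vec_space "free_scale :: 'k \<Rightarrow> ('i \<Rightarrow>\<^sub>0 'k) \<Rightarrow> _"
    by (intro vec_space.intro vector_space_free_scale)
  let ?l = "Poly_Mapping.lookup" and ?u = "\<lambda>i. Poly_Mapping.single i (1::'k)"
  let ?W = "{t :: 'i \<Rightarrow>\<^sub>0 'k. \<forall>i. i \<notin> I \<longrightarrow> ?l t i = 0}"
  have sW: "subspace ?W" by (rule subspaceI) (auto simp: lookup_add)
  have lsum: "?l (sum g K) j = (\<Sum>i\<in>K. ?l (g i) j)" for g :: "'i \<Rightarrow> 'i \<Rightarrow>\<^sub>0 'k" and K j
    by (induction K rule: infinite_finite_induct) (simp_all add: lookup_add)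
  have su: "(\<Sum>i\<in>I. c i * ?l (?u i) j) = (if j \<in> I then c j else 0)" for c j
    using I by (simp add: lookup_single when_def if_distrib cong: if_cong)
  have ex: "(\<Sum>i\<in>I. free_scale (?l f i) (?u i)) = f" if "f \<in> ?W" for f
    by (rule poly_mapping_eqI) (use that in \<open>simp add: lsum su\<close>)
  have fr: "frame ?W I (\<lambda>i f. ?l f i) ?u"
    unfolding frame_def using I ex by (auto simp: lin_def lookup_add lookup_single when_def)
  have "?W \<subseteq> span (?u ` I)"
  proof
    fix f assume f: "f \<in> ?W"
    have "(\<Sum>i\<in>I. free_scale (?l f i) (?u i)) \<in> span (?u ` I)" by (intro span_sum span_scale span_base) auto
    then show "f \<in> span (?u ` I)" using ex[OF f] by simp
  qed
  then have fd: "fdim ?W" unfolding fdim_def using sW I by blast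
  define F where "F f = (\<Sum>i\<in>I. free_scale (\<Sum>j\<in>I. A i j * ?l f j) (?u i))" for f :: "'i \<Rightarrow>\<^sub>0 'k"
  have Fl: "?l (F f) i = (if i \<in> I then \<Sum>j\<in>I. A i j * ?l f j else 0)" for f i
    unfolding F_def by (simp add: lsum su)
  have lF: "linE F"
  proof (rule linI; rule poly_mapping_eqI)
    show "?l (F (x + y)) i = ?l (F x + F y) i" for x y i
      by (simp add: Fl lookup_add sum.distrib distrib_left)
    show "?l (F (free_scale c x)) i = ?l (free_scale c (F x)) i" for c x i
      by (simp add: Fl sum_distrib_left mult.left_commute[of c])
  qed
  have FW: "F ` ?W \<subseteq> ?W" by (auto simp: Fl)
  have FF: "F (F f) = F f" for f
  proof (rule poly_mapping_eqI)
    fix i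
    show "?l (F (F f)) i = ?l (F f) i"
    proof (cases "i \<in> I")
      case True
      have "?l (F (F f)) i = (\<Sum>j\<in>I. A i j * (\<Sum>l\<in>I. A j l * ?l f l))" using True by (simp add: Fl)
      also have "\<dots> = (\<Sum>j\<in>I. \<Sum>l\<in>I. A i j * A j l * ?l f l)" by (simp add: sum_distrib_left mult.assoc)
      also have "\<dots> = (\<Sum>l\<in>I. (\<Sum>j\<in>I. A i j * A j l) * ?l f l)" by (subst sum.swap) (simp add: sum_distrib_right)
      also have "\<dots> = ?l (F f) i" using True by (simp add: Fl A)
      finally show ?thesis .
    qed (simp add: Fl)
  qed
  have "trace ?W F = (\<Sum>i\<in>I. ?l (F (?u i)) i)" by (rule trace_frame[OF fr fd lF FW])
  also have "\<dots> = (\<Sum>i\<in>I. A i i)"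
  proof (rule sum.cong[OF refl])
    fix i assume i: "i \<in> I"
    then show "?l (F (?u i)) i = A i i" using I by (simp add: Fl lookup_single when_def if_distrib cong: if_cong)
  qed
  finally have "(\<Sum>i\<in>I. A i i) = of_nat (dim (F ` ?W))" unfolding trace_idem[OF fd lF FW FF] ..
  then show ?thesis by (rule exI)
qed

context inv_hopf
begin

text \<open>The entry at (xs, ys) of the matrix of a \<otimes> c on the k-th tensor power of
  \<open>B\<close>, where a \<otimes> c acts on \<open>B\<close> by x \<mapsto> a x S(c) and on
  tensor products through the coproduct. Lists of basis elements as indices replace the tensor
  powers themselves.\<close>

primrec Phi :: "'h set \<Rightarrow> nat \<Rightarrow> 'h \<Rightarrow> 'h \<Rightarrow> 'h list \<Rightarrow> 'h list \<Rightarrow> 'k" where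
  "Phi B 0 = (\<lambda>a c xs ys. \<epsilon> a * \<epsilon> c)"
| "Phi B (Suc k) = (\<lambda>a c xs ys. sB B a (\<lambda>a1 a2. sB B c (\<lambda>c1 c2.
      crd B (hd xs) (a1 * hd ys * S c1) * Phi B k a2 c2 (tl xs) (tl ys))))"

definition Idx :: "'h set \<Rightarrow> nat \<Rightarrow> 'h list set" where
  "Idx B k = {xs. set xs \<subseteq> bas B \<and> length xs = k}"

lemma Idx_0: "Idx B 0 = {[]}"
  by (auto simp: Idx_def)

lemma sum_Idx_Suc: "(\<Sum>xs\<in>Idx B (Suc k). f xs) = (\<Sum>x\<in>bas B. \<Sum>xs\<in>Idx B k. f (x # xs))"
proof -
  have 1: "Idx B (Suc k) = (\<lambda>(x, xs). x # xs) ` (bas B \<times> Idx B k)"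
    by (auto simp: Idx_def length_Suc_conv image_iff)
  have 2: "inj_on (\<lambda>(x, xs). x # xs) (bas B \<times> Idx B k)" by (auto simp: inj_on_def)
  show ?thesis unfolding 1 sum.reindex[OF 2] by (simp add: sum.cartesian_product case_prod_unfold)
qed

lemma finite_Idx: "subspace B \<Longrightarrow> finite (Idx B k)"
  unfolding Idx_def by (rule finite_lists_length_eq) (rule finite_bas[OF fdimI])

lemma lin_sB_arg: "(\<And>b. linF (\<lambda>a. F a b)) \<Longrightarrow> linF (\<lambda>x. sB B x F)"
  unfolding sB_def by (rule lin_SUM[OF vector_space_mult], rule lin_comp[of scale "(*)"], assumption, rule linT[OF lin_crd])

lemma lin_sB_body: "(\<And>a b. linF (\<lambda>x. F x a b)) \<Longrightarrow> linF (\<lambda>x. sB B c (F x))"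
  unfolding sB_def by (rule lin_SUM[OF vector_space_mult])

lemma lin_Phi: "linF (\<lambda>a. Phi B k a c xs ys)" "linF (\<lambda>c. Phi B k a c xs ys)"
proof (induction k arbitrary: a c xs ys)
  case 0
  {
    case 1
    show ?case by (simp add: lin_k_right lin\<epsilon>)
  next
    case 2
    show ?case by (simp add: lin_k_left lin\<epsilon>)
  }
next
  case (Suc k)
  have l: "linF (\<lambda>a. crd B x (a * y * S c))" "linF (\<lambda>c. crd B x (a * y * S c))" for x y a c
    by (intro lin_comp[OF lin_crd] lin_intros)+
  {
    case 1
    show ?case by (simp, intro lin_sB_arg lin_sB_body lin_k_right l)
  next
    case 2
    show ?case by (simp, intro lin_sB_body lin_sB_arg lin_k_right l)
  }
qed

lemma sB_mult:
  assumes "hsub B" "a \<in> B" "b \<in> B" "bil (*) G"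
  shows "sB B (a * b) G = sB B a (\<lambda>a1 a2. sB B b (\<lambda>b1 b2. G (a1 * b1) (a2 * b2)))"
proof -
  have l: "linF (\<lambda>x. G x y)" "linF (\<lambda>y. G x y)" for x y using assms(4) by (auto simp: bil_def)
  note li = vector_space_mult lin_intros lin_comp[OF l(1)] lin_comp[OF l(2)]
  have b: "bil (*) (\<lambda>b1 b2. G (a1 * b1) (a2 * b2))" for a1 a2 by (intro bilF li)
  have b': "bil (*) (\<lambda>a1 a2. sw b (\<lambda>b1 b2. G (a1 * b1) (a2 * b2)))" by (intro bilF li)
  note B = hsub_lcoid[OF assms(1)]
  have ab: "a * b \<in> B" using assms subalgD(3) hsubD(1) by blast
  have "sB B (a * b) G = sw (a * b) G" by (rule sw_sB[OF B ab assms(4), symmetric])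
  also have "\<dots> = sw a (\<lambda>a1 a2. sw b (\<lambda>b1 b2. G (a1 * b1) (a2 * b2)))" by (rule sw_mult[OF assms(4)])
  also have "\<dots> = sB B a (\<lambda>a1 a2. sw b (\<lambda>b1 b2. G (a1 * b1) (a2 * b2)))" by (rule sw_sB[OF B assms(2) b'])
  finally show ?thesis unfolding sw_sB[OF B assms(3) b] .
qed

lemma sum_sum_Times: "(\<Sum>a\<in>A. \<Sum>b\<in>B. h a b) = (\<Sum>x\<in>A \<times> B. h (fst x) (snd x))"
  by (simp only: sum.cartesian_product case_prod_unfold)

lemma sum_four_swap:
  fixes f g f' g' :: "_ \<Rightarrow> _ \<Rightarrow> 'k"
  shows "(\<Sum>y\<in>Y. \<Sum>z\<in>Z. (\<Sum>p\<in>P. f p y * g p z) * (\<Sum>q\<in>Q. f' q y * g' q z)) =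
    (\<Sum>p\<in>P. \<Sum>q\<in>Q. (\<Sum>y\<in>Y. f p y * f' q y) * (\<Sum>z\<in>Z. g p z * g' q z))"
proof -
  let ?F = "\<lambda>p q y z. (f p y * f' q y) * (g p z * g' q z)"
  have "(\<Sum>y\<in>Y. \<Sum>z\<in>Z. (\<Sum>p\<in>P. f p y * g p z) * (\<Sum>q\<in>Q. f' q y * g' q z)) =
      (\<Sum>y\<in>Y. \<Sum>z\<in>Z. \<Sum>p\<in>P. \<Sum>q\<in>Q. ?F p q y z)"
    unfolding sum_product by (rule sum.cong[OF refl])+ (simp only: ac_simps)
  also have "\<dots> = (\<Sum>x\<in>Y \<times> Z. \<Sum>p\<in>P. \<Sum>q\<in>Q. ?F p q (fst x) (snd x))"
    by (rule sum_sum_Times)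
  also have "\<dots> = (\<Sum>x\<in>Y \<times> Z. \<Sum>w\<in>P \<times> Q. ?F (fst w) (snd w) (fst x) (snd x))"
    by (rule sum.cong[OF refl], rule sum_sum_Times)
  also have "\<dots> = (\<Sum>w\<in>P \<times> Q. \<Sum>x\<in>Y \<times> Z. ?F (fst w) (snd w) (fst x) (snd x))"
    by (rule sum.swap)
  also have "\<dots> = (\<Sum>w\<in>P \<times> Q. \<Sum>y\<in>Y. \<Sum>z\<in>Z. ?F (fst w) (snd w) y z)"
    by (rule sum.cong[OF refl], rule sum_sum_Times[symmetric])
  also have "\<dots> = (\<Sum>p\<in>P. \<Sum>q\<in>Q. \<Sum>y\<in>Y. \<Sum>z\<in>Z. ?F p q y z)"
    by (rule sum_sum_Times[symmetric])
  finally show ?thesis by (simp only: sum_product)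
qed

text \<open>Tensor powers of a module are modules because the coproduct is multiplicative; on the
  right, the reversal by S makes c and c' compose in the stated order.\<close>

lemma Phi_mult:
  assumes B: "hsub B"
  shows "a \<in> B \<Longrightarrow> a' \<in> B \<Longrightarrow> c \<in> B \<Longrightarrow> c' \<in> B \<Longrightarrow> xs \<in> Idx B k \<Longrightarrow> zs \<in> Idx B k \<Longrightarrow>
    (\<Sum>ys\<in>Idx B k. Phi B k a c xs ys * Phi B k a' c' ys zs) = Phi B k (a * a') (c * c') xs zs"
proof (induction k arbitrary: a a' c c' xs zs)
  case 0
  then show ?case by (simp add: Idx_0 counit_mult)
next
  case (Suc k)
  note Bs = subalgD(1)[OF hsubD(1)[OF B]] and Bm = subalgD(3)[OF hsubD(1)[OF B]]
  obtain x xs' where xs: "xs = x # xs'" "x \<in> bas B" "xs' \<in> Idx B k"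
    using Suc(6) by (auto simp: Idx_def length_Suc_conv)
  obtain z zs' where zs: "zs = z # zs'" "z \<in> bas B" "zs' \<in> Idx B k"
    using Suc(7) by (auto simp: Idx_def length_Suc_conv)
  let ?b = "bas B"
  let ?T = "\<lambda>a b. T (crd B b) a"
  have TB: "?T a b \<in> B" if "a \<in> B" for a b by (rule hsubD(3)[OF B that lin_crd])
  have bB: "b \<in> B" if "b \<in> ?b" for b using bas(1) that by blast
  let ?f = "\<lambda>p y. crd B x (?T a (fst p) * y * S (?T c (snd p)))"
  let ?g = "\<lambda>p ys. Phi B k (fst p) (snd p) xs' ys"
  let ?f' = "\<lambda>q y. crd B y (?T a' (fst q) * z * S (?T c' (snd q)))"
  let ?g' = "\<lambda>q ys. Phi B k (fst q) (snd q) ys zs'"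
  define K where "K u1 u2 w1 w2 = crd B x (u1 * z * S w1) * Phi B k u2 w2 xs' zs'" for u1 u2 w1 w2
  have K: "linF (\<lambda>u1. K u1 u2 w1 w2)" "linF (\<lambda>u2. K u1 u2 w1 w2)" "linF (\<lambda>w1. K u1 u2 w1 w2)" "linF (\<lambda>w2. K u1 u2 w1 w2)"
    for u1 u2 w1 w2
    unfolding K_def by (intro lin_k_left lin_k_right lin_Phi lin_comp[OF lin_crd] lin_intros)+
  have "(\<Sum>ys\<in>Idx B (Suc k). Phi B (Suc k) a c xs ys * Phi B (Suc k) a' c' ys zs) =
      (\<Sum>y\<in>?b. \<Sum>ys\<in>Idx B k. (\<Sum>p\<in>?b \<times> ?b. ?f p y * ?g p ys) * (\<Sum>q\<in>?b \<times> ?b. ?f' q y * ?g' q ys))"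
    unfolding sum_Idx_Suc xs(1) zs(1) Phi.simps sB_def list.sel sum_sum_Times[where A = ?b and B = ?b] ..
  also have "\<dots> = (\<Sum>p\<in>?b \<times> ?b. \<Sum>q\<in>?b \<times> ?b. (\<Sum>y\<in>?b. ?f p y * ?f' q y) * (\<Sum>ys\<in>Idx B k. ?g p ys * ?g' q ys))"
    by (rule sum_four_swap)
  also have "\<dots> = (\<Sum>p\<in>?b \<times> ?b. \<Sum>q\<in>?b \<times> ?b.
      K (?T a (fst p) * ?T a' (fst q)) (fst p * fst q) (?T c (snd p) * ?T c' (snd q)) (snd p * snd q))"
  proof (rule sum.cong[OF refl], rule sum.cong[OF refl])
    fix p q assume pq: "p \<in> ?b \<times> ?b" "q \<in> ?b \<times> ?b"
    let ?w = "?T a' (fst q) * z * S (?T c' (snd q))"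
    have w: "?w \<in> B" by (intro Bm TB Suc bB zs hsubD(2)[OF B])
    have l: "linF (\<lambda>w. crd B x (?T a (fst p) * w * S (?T c (snd p))))"
      by (intro lin_comp[OF lin_crd] lin_intros)
    have "(\<Sum>y\<in>?b. ?f p y * ?f' q y) = (\<Sum>y\<in>?b. crd B y ?w * ?f p y)" by (simp only: mult.commute)
    also have "\<dots> = ?f p ?w" by (rule frame_expand[OF frame_bas[OF fdimI[OF Bs]] w l, symmetric])
    also have "\<dots> = crd B x (?T a (fst p) * ?T a' (fst q) * z * S (?T c (snd p) * ?T c' (snd q)))"
      by (simp only: S_mult mult.assoc)
    finally have 1: "(\<Sum>y\<in>?b. ?f p y * ?f' q y) = \<dots>" .
    have 2: "(\<Sum>ys\<in>Idx B k. ?g p ys * ?g' q ys) = Phi B k (fst p * fst q) (snd p * snd q) xs' zs'"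
      by (rule Suc(1)) (use pq bB xs(3) zs(3) in auto)
    show "(\<Sum>y\<in>?b. ?f p y * ?f' q y) * (\<Sum>ys\<in>Idx B k. ?g p ys * ?g' q ys) =
        K (?T a (fst p) * ?T a' (fst q)) (fst p * fst q) (?T c (snd p) * ?T c' (snd q)) (snd p * snd q)"
      unfolding 1 2 K_def ..
  qed
  also have "\<dots> = (\<Sum>p\<in>?b \<times> ?b. \<Sum>b'\<in>?b. \<Sum>d'\<in>?b.
      K (?T a (fst p) * ?T a' b') (fst p * b') (?T c (snd p) * ?T c' d') (snd p * d'))"
    by (rule sum.cong[OF refl], rule sum_sum_Times[symmetric])
  also have "\<dots> = (\<Sum>b\<in>?b. \<Sum>d\<in>?b. \<Sum>b'\<in>?b. \<Sum>d'\<in>?b. K (?T a b * ?T a' b') (b * b') (?T c d * ?T c' d') (d * d'))"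
    by (rule sum_sum_Times[symmetric])
  also have "\<dots> = (\<Sum>b\<in>?b. \<Sum>b'\<in>?b. \<Sum>d\<in>?b. \<Sum>d'\<in>?b. K (?T a b * ?T a' b') (b * b') (?T c d * ?T c' d') (d * d'))"
    by (rule sum.cong[OF refl], rule sum.swap)
  also have "\<dots> = sB B a (\<lambda>a1 a2. sB B a' (\<lambda>b1 b2. sB B c (\<lambda>c1 c2. sB B c' (\<lambda>d1 d2. K (a1 * b1) (a2 * b2) (c1 * d1) (c2 * d2)))))"
    by (simp only: sB_def)
  also have "\<dots> = sB B a (\<lambda>a1 a2. sB B a' (\<lambda>b1 b2. sB B (c * c') (\<lambda>w1 w2. K (a1 * b1) (a2 * b2) w1 w2)))"
    by (simp only: sB_mult[OF B Suc(4,5) bilF[OF K(3,4)]])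
  also have "\<dots> = sB B (a * a') (\<lambda>u1 u2. sB B (c * c') (\<lambda>w1 w2. K u1 u2 w1 w2))"
  proof (rule sB_mult[OF B Suc(2,3), symmetric])
    show "bil (*) (\<lambda>u1 u2. sB B (c * c') (\<lambda>w1 w2. K u1 u2 w1 w2))"
      by (intro bilF lin_sB_body K)
  qed
  also have "\<dots> = Phi B (Suc k) (a * a') (c * c') xs zs"
    unfolding K_def xs(1) zs(1) Phi.simps list.sel ..
  finally show ?case .
qed

text \<open>The character of the k-th tensor power of the bimodule \<open>B\<close>; by
  \<open>QQ_Suc\<close> it is a convolution power of the first one.\<close>

definition QQ :: "'h set \<Rightarrow> nat \<Rightarrow> 'h \<Rightarrow> 'h \<Rightarrow> 'k" where
  "QQ B k a c = (\<Sum>xs\<in>Idx B k. Phi B k a c xs xs)"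

lemma lin_QQ: "linF (\<lambda>a. QQ B k a c)" "linF (\<lambda>c. QQ B k a c)"
  unfolding QQ_def by (intro lin_SUM vector_space_mult lin_Phi)+

lemma QQ_0: "QQ B 0 a c = \<epsilon> a * \<epsilon> c"
  by (simp add: QQ_def Idx_0)

lemma QQ_Suc: "QQ B (Suc k) a c = sB B a (\<lambda>a1 a2. sB B c (\<lambda>c1 c2. trace B (\<lambda>x. a1 * x * S c1) * QQ B k a2 c2))"
proof -
  let ?b = "bas B" and ?T = "\<lambda>a b. T (crd B b) a"
  let ?h = "\<lambda>p x. crd B x (?T a (fst p) * x * S (?T c (snd p)))" and ?i = "\<lambda>p xs. Phi B k (fst p) (snd p) xs xs"
  have "QQ B (Suc k) a c = (\<Sum>x\<in>?b. \<Sum>xs\<in>Idx B k. \<Sum>p\<in>?b \<times> ?b. ?h p x * ?i p xs)"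
    unfolding QQ_def sum_Idx_Suc Phi.simps sB_def list.sel sum_sum_Times[where A = ?b and B = ?b] ..
  also have "\<dots> = (\<Sum>w\<in>?b \<times> Idx B k. \<Sum>p\<in>?b \<times> ?b. ?h p (fst w) * ?i p (snd w))"
    by (rule sum_sum_Times)
  also have "\<dots> = (\<Sum>p\<in>?b \<times> ?b. \<Sum>w\<in>?b \<times> Idx B k. ?h p (fst w) * ?i p (snd w))"
    by (rule sum.swap)
  also have "\<dots> = (\<Sum>p\<in>?b \<times> ?b. \<Sum>x\<in>?b. \<Sum>xs\<in>Idx B k. ?h p x * ?i p xs)"
    by (rule sum.cong[OF refl], rule sum_sum_Times[symmetric])
  also have "\<dots> = (\<Sum>p\<in>?b \<times> ?b. trace B (\<lambda>x. ?T a (fst p) * x * S (?T c (snd p))) * QQ B k (fst p) (snd p))"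
    unfolding trace_def QQ_def sum_product ..
  also have "\<dots> = (\<Sum>b\<in>?b. \<Sum>d\<in>?b. trace B (\<lambda>x. ?T a b * x * S (?T c d)) * QQ B k b d)"
    by (rule sum_sum_Times[symmetric])
  finally show ?thesis unfolding sB_def .
qed

lemma QQ_idempotent:
  assumes B: "hsub B" and e: "e \<in> B" "e * e = e" and f: "f \<in> B" "f * f = f"
  shows "\<exists>N. QQ B k e f = of_nat N"
  unfolding QQ_def
proof (rule idempotent_matrix_trace[OF finite_Idx[OF subalgD(1)[OF hsubD(1)[OF B]]], where A = "Phi B k e f"])
  fix i l assume "i \<in> Idx B k" "l \<in> Idx B k"
  from Phi_mult[OF B e(1) e(1) f(1) f(1) this]
  show "(\<Sum>j\<in>Idx B k. Phi B k e f i j * Phi B k e f j l) = Phi B k e f i l" unfolding e(2) f(2) .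
qed

lemma lin_biaction: "linF (\<lambda>a. trace B (\<lambda>x. a * x * S c))" "linF (\<lambda>c. trace B (\<lambda>x. a * x * S c))"
  by (intro lin_traceF lin_intros)+

text \<open>The bimodule character \<open>(a, c) \<mapsto> tr(x \<mapsto> a x S(c))\<close> of \<open>B\<close> is a multiple \<open>r\<close> of
  \<open>\<epsilon> \<otimes> \<epsilon>\<close> on a coideal; its convolution powers take natural values on pairs of idempotents,
  so \<open>r\<close> is integral.\<close>

lemma biaction_eigenvalue_integral:
  assumes B: "hsub B" and V: "lcoid V" "V \<subseteq> B" "z \<in> V" "\<epsilon> z = 1"
    and r: "\<And>a c. a \<in> V \<Longrightarrow> c \<in> V \<Longrightarrow> trace B (\<lambda>x. a * x * S c) = of_nat m / of_nat d * (\<epsilon> a * \<epsilon> c)"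
    and d: "d > 0"
  shows "d dvd m"
proof -
  let ?r = "of_nat m / of_nat d :: 'k"
  note Bl = hsub_lcoid[OF B]
  have Q: "a \<in> V \<Longrightarrow> c \<in> V \<Longrightarrow> QQ B k a c = ?r ^ k * (\<epsilon> a * \<epsilon> c)" for a c k
  proof (induction k arbitrary: a c)
    case (Suc k)
    let ?q = "\<lambda>a c. trace B (\<lambda>x. a * x * S c)"
    have b1: "bil (*) (\<lambda>c1 c2. ?q a1 c1 * QQ B k a2 c2)" for a1 a2
      by (intro bilF lin_k_left lin_k_right lin_biaction lin_QQ)
    have b2: "bil (*) (\<lambda>a1 a2. sw c (\<lambda>c1 c2. ?q a1 c1 * QQ B k a2 c2))"
      by (intro bilF lin_sw_arg vector_space_mult lin_k_left lin_k_right lin_biaction lin_QQ)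
    have b3: "bil (*) (\<lambda>c1 c2. ?r ^ k * \<epsilon> a2 * (\<epsilon> c2 * ?q a1 c1))" for a1 a2
      by (intro bilF lin_k_left lin_k_right lin_biaction lin\<epsilon>)
    have b4: "bil (*) (\<lambda>a1 a2. ?r ^ k * (\<epsilon> a2 * ?q a1 c))"
      by (intro bilF lin_k_left lin_k_right lin_biaction lin\<epsilon>)
    have aB: "a \<in> B" "c \<in> B" using Suc(2,3) V(2) by blast+
    have "QQ B (Suc k) a c = sw a (\<lambda>a1 a2. sw c (\<lambda>c1 c2. ?q a1 c1 * QQ B k a2 c2))"
      unfolding QQ_Suc sw_sB[OF Bl aB(2) b1, symmetric] sw_sB[OF Bl aB(1) b2] ..
    also have "\<dots> = sw a (\<lambda>a1 a2. ?r ^ k * (\<epsilon> a2 * ?q a1 c))"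
    proof (rule sw_lcoid_cong[OF V(1) Suc(2) b2 b4])
      fix a1 a2 assume a2: "a2 \<in> V"
      have "sw c (\<lambda>c1 c2. ?q a1 c1 * QQ B k a2 c2) = sw c (\<lambda>c1 c2. ?r ^ k * \<epsilon> a2 * (\<epsilon> c2 * ?q a1 c1))"
        by (rule sw_lcoid_cong[OF V(1) Suc(3) b1 b3]) (simp add: Suc(1)[OF a2])
      also have "\<dots> = ?r ^ k * \<epsilon> a2 * ?q a1 c"
        unfolding smulF sw_counit_right[OF vector_space_mult lin_biaction(2)] ..
      finally show "sw c (\<lambda>c1 c2. ?q a1 c1 * QQ B k a2 c2) = ?r ^ k * (\<epsilon> a2 * ?q a1 c)" by simp
    qed
    also have "\<dots> = ?r ^ k * ?q a c"
      unfolding smulF sw_counit_right[OF vector_space_mult lin_biaction(1)] ..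
    finally show ?case by (simp add: r[OF Suc(2,3)])
  qed (simp add: QQ_0)
  \<comment> \<open>On pairs of idempotents the convolution powers are ranks. Writing z through
    idempotents puts all powers of \<open>?r\<close> into the subgroup generated by finitely many
    products of coefficients, which do not depend on k.\<close>
  have "z \<in> span {e \<in> B. e * e = e}" using span_idempotents[OF B] V(2,3) by blast
  then obtain F c where F: "finite F" "F \<subseteq> {e \<in> B. e * e = e}" "z = (\<Sum>e\<in>F. scale (c e) e)"
    unfolding span_explicit by blast
  show ?thesis
  proof (rule dvd_if_powers_in_fg_subgroup[of "F \<times> F" d m "\<lambda>p. c (fst p) * c (snd p)"])
    show "finite (F \<times> F)" using F(1) by simp
    fix k
    have "\<exists>N. \<forall>p\<in>F \<times> F. QQ B k (fst p) (snd p) = of_nat (N p)"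
    proof (rule bchoice, rule ballI)
      fix p assume "p \<in> F \<times> F"
      then have "fst p \<in> {e \<in> B. e * e = e}" "snd p \<in> {e \<in> B. e * e = e}" using F(2) by auto
      then show "\<exists>N. QQ B k (fst p) (snd p) = of_nat N" by (intro QQ_idempotent[OF B]) simp_all
    qed
    then obtain N where N: "\<And>p. p \<in> F \<times> F \<Longrightarrow> QQ B k (fst p) (snd p) = of_nat (N p)" by blast
    have "?r ^ k = QQ B k z z" using Q[OF V(3,3)] V(4) by simp
    also have "\<dots> = (\<Sum>e\<in>F. c e * QQ B k e z)"
      by (subst F(3)) (simp only: lin_sum[OF lin_QQ(1)] lin_scale[OF lin_QQ(1)])
    also have "\<dots> = (\<Sum>e\<in>F. \<Sum>f\<in>F. c e * (c f * QQ B k e f))"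
      by (subst F(3)) (simp only: lin_sum[OF lin_QQ(2)] lin_scale[OF lin_QQ(2)] sum_distrib_left)
    also have "\<dots> = (\<Sum>p\<in>F \<times> F. of_nat (N p) * (c (fst p) * c (snd p)))"
      unfolding sum_sum_Times by (rule sum.cong[OF refl]) (simp add: N ac_simps)
    finally show "\<exists>N. ?r ^ k = (\<Sum>p\<in>F \<times> F. of_nat (N p) * (c (fst p) * c (snd p)))" by (rule exI[of _ N])
  qed (rule d)
qed

lemma lin_kscale: "lin (*) scale (\<lambda>k. scale k v)"
  by (rule linI) (simp_all add: scale_left_distrib)

section \<open>The adjoint action\<close>

definition ad :: "'h \<Rightarrow> 'h \<Rightarrow> 'h" where
  "ad h v = sw h (\<lambda>p q. p * v * S q)"

lemma bil_ad: "bil scale (\<lambda>p q. p * v * S q)"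
  by (intro bilE lin_intros')

lemma lin_ad: "linE (\<lambda>h. ad h v)" "linE (ad h)"
  unfolding ad_def by (intro lin_intros bilE)+

lemma counit_ad: "\<epsilon> (ad h v) = \<epsilon> h * \<epsilon> v"
proof -
  have "\<epsilon> (ad h v) = sw h (\<lambda>p q. \<epsilon> v * (\<epsilon> q * \<epsilon> p))"
    by (simp add: ad_def sw_comp[OF lin\<epsilon>] counit_mult counit_S ac_simps)
  then show ?thesis by (simp add: smulF sw_counit_right[OF vector_space_mult lin\<epsilon>])
qed

lemma ad_one: "ad 1 v = v"
  using sw_one[OF bil_ad, of v] by (simp add: ad_def S_one)

lemma ad_mult: "ad (h * k) v = ad h (ad k v)"
proof -
  have "ad (h * k) v = sw h (\<lambda>a b. sw k (\<lambda>c d. a * (c * v * S d) * S b))"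
    unfolding ad_def sw_mult[OF bil_ad] by (simp only: S_mult mult.assoc)
  also have "\<dots> = ad h (ad k v)"
    by (simp only: ad_def sw_comp[OF lin_mult_right[OF lin_mult_left[OF lin_ident]]])
  finally show ?thesis .
qed

lemma mult_ad: "h * v = sw h (\<lambda>p q. ad p v * q)"
proof -
  have "sw h (\<lambda>p q. ad p v * q) = sw h (\<lambda>p q. sw p (\<lambda>a b. a * v * S b * q))"
    by (simp only: ad_def sw_comp[OF lin_mult_right[OF lin_ident]])
  also have "\<dots> = sw h (\<lambda>a y. sw y (\<lambda>b q. a * v * (S b * q)))"
    unfolding mult.assoc[of _ "S _"] by (rule coassocE; intro lin_intros)
  also have "\<dots> = h * v * 1"
    by (rule sw_cancel23(1)[of scale "\<lambda>a m. a * v * m"]) (intro bilE lin_intros')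
  finally show ?thesis by simp
qed

lemma trace_right_mult: "trace UNIV (\<lambda>y. y * x) = lm x"
proof -
  have 1: "lm (\<Lambda>B UNIV) = 1" using dim_lm_\<Lambda>B[OF hsub_UNIV] n0 by simp
  have "sw (\<Lambda>B UNIV) (\<lambda>p q. p * 1 * S q) = 1"
    using sw_antipode_right[OF lin_ident, of "\<Lambda>B UNIV"] by (simp add: \<epsilon>_\<Lambda>B[OF hsub_UNIV])
  then show ?thesis using trace_B_biaction[OF hsub_UNIV UNIV_I UNIV_I, of 1 "S x"] by (simp add: 1 SS)
qed

lemma lm_S: "lm (S x) = lm x"
proof -
  have "lm (S x) = trace UNIV (\<lambda>y. S (S y * x))" by (simp add: lm_def S_mult SS)
  also have "\<dots> = trace UNIV (\<lambda>y. S (S y) * x)"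
    by (rule trace_cyc[OF fdim_UNIV linS _ lin_mult_right[OF linS]]) auto
  also have "\<dots> = lm x" by (simp add: SS trace_right_mult)
  finally show ?thesis .
qed

text \<open>Rebracketing the fourfold coproduct so that the two middle legs come from a single
  element.\<close>

lemma sw_middle:
  assumes "vector_space s'" "\<And>b c d. lin scale s' (\<lambda>a. H a b c d)" "\<And>a c d. lin scale s' (\<lambda>b. H a b c d)"
    "\<And>a b d. lin scale s' (\<lambda>c. H a b c d)" "\<And>a b c. lin scale s' (\<lambda>d. H a b c d)"
  shows "sw h (\<lambda>p q. sw p (\<lambda>a b. sw q (\<lambda>c d. H a b c d))) = sw h (\<lambda>a w. sw w (\<lambda>m d. sw m (\<lambda>b c. H a b c d)))"
proof -
  have b: "bil s' (\<lambda>c d. H a b c d)" for a b by (intro bilI assms)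
  have "sw h (\<lambda>p q. sw p (\<lambda>a b. sw q (\<lambda>c d. H a b c d))) = sw h (\<lambda>a w. sw w (\<lambda>b q. sw q (\<lambda>c d. H a b c d)))"
    by (rule sw_coassoc[of s' "\<lambda>a b q. sw q (\<lambda>c d. H a b c d)"]; intro assms lin_sw_arg sw_linear b)
  also have "\<dots> = sw h (\<lambda>a w. sw w (\<lambda>m d. sw m (\<lambda>b c. H a b c d)))"
    by (rule sw_cong, rule sw_coassoc[of s' "H a" for a, symmetric]; intro assms)
  finally show ?thesis .
qed

text \<open>The Yetter--Drinfeld condition: in the fourfold coproduct of h, the middle legs surround
  y_2 and form an adjoint action, which the invariant f absorbs; the outer legs surround y_1 and
  reassemble to ad.\<close>

lemma T_ad:
  assumes B: "hsub B" and h: "h \<in> B" and f: "linF f" and inv: "\<And>m y. m \<in> B \<Longrightarrow> f (ad m y) = \<epsilon> m * f y"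
  shows "T f (ad h y) = ad h (T f y)"
proof -
  have lf: "linF (\<lambda>x. f (x * c))" "linF (\<lambda>x. f (c * x))" "linF (\<lambda>x. f (c * S x))" for c
    by (intro lin_comp[OF f] lin_intros)+
  note li = lin_intros' f lf lin_comp[OF f] lin_sw_arg
  have bT: "bil scale (\<lambda>a b. scale (f b) a)" by (intro bilE lin_intros' f)
  let ?H = "\<lambda>a b c d. sw y (\<lambda>y1 y2. scale (f (b * y2 * S c)) (a * y1 * S d))"
  have H: "linE (\<lambda>a. ?H a b c d)" "linE (\<lambda>b. ?H a b c d)" "linE (\<lambda>c. ?H a b c d)" "linE (\<lambda>d. ?H a b c d)" for a b c d
    by (intro li)+
  have "T f (ad h y) = sw h (\<lambda>p q. T f (p * y * S q))"
    by (simp only: ad_def sw_comp[OF linT[OF f]])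
  also have "\<dots> = sw h (\<lambda>p q. sw p (\<lambda>a b. sw q (\<lambda>c d. ?H a b c d)))"
  proof (rule sw_cong)
    fix p q
    have b1: "bil scale (\<lambda>u v. scale (f (m * v)) (l * u))" for m l by (intro bilE li)
    have b2: "bil scale (\<lambda>u v. sw (S q) (\<lambda>s t. scale (f (u' * v * t)) (l * u * s)))" for u' l by (intro bilE li)
    have "T f (p * y * S q) = sw p (\<lambda>a b. sw (y * S q) (\<lambda>u v. scale (f (b * v)) (a * u)))"
      unfolding T_def mult.assoc by (rule sw_mult[OF bT])
    also have "\<dots> = sw p (\<lambda>a b. sw y (\<lambda>y1 y2. sw (S q) (\<lambda>s t. scale (f (b * (y2 * t))) (a * (y1 * s)))))"
      by (rule sw_cong, rule sw_mult[OF b1])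
    also have "\<dots> = sw p (\<lambda>a b. sw y (\<lambda>y1 y2. sw q (\<lambda>c d. scale (f (b * (y2 * S c))) (a * (y1 * S d)))))"
    proof (rule sw_cong, rule sw_cong)
      fix a b y1 y2
      show "sw (S q) (\<lambda>s t. scale (f (b * (y2 * t))) (a * (y1 * s))) = sw q (\<lambda>c d. scale (f (b * (y2 * S c))) (a * (y1 * S d)))"
        by (rule sw_S[of scale]) (intro bilE li)
    qed
    also have "\<dots> = sw p (\<lambda>a b. sw q (\<lambda>c d. ?H a b c d))"
      unfolding mult.assoc by (rule sw_cong, rule sw_swap)
    finally show "T f (p * y * S q) = sw p (\<lambda>a b. sw q (\<lambda>c d. ?H a b c d))" .
  qed
  also have "\<dots> = sw h (\<lambda>a w. sw w (\<lambda>m d. sw m (\<lambda>b c. ?H a b c d)))"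
    by (rule sw_middle[OF vector_space_axioms H])
  also have "\<dots> = sw h (\<lambda>a w. sw w (\<lambda>m d. sw y (\<lambda>y1 y2. scale (f (ad m y2)) (a * y1 * S d))))"
  proof (rule sw_cong, rule sw_cong)
    fix a w m d
    have "sw m (\<lambda>b c. ?H a b c d) = sw y (\<lambda>y1 y2. sw m (\<lambda>b c. scale (f (b * y2 * S c)) (a * y1 * S d)))"
      by (rule sw_swap)
    also have "\<dots> = sw y (\<lambda>y1 y2. scale (f (ad m y2)) (a * y1 * S d))"
      by (simp only: ad_def sw_comp[OF f] sw_comp[OF lin_kscale])
    finally show "sw m (\<lambda>b c. ?H a b c d) = sw y (\<lambda>y1 y2. scale (f (ad m y2)) (a * y1 * S d))" .
  qed
  also have "\<dots> = sw h (\<lambda>a w. sw w (\<lambda>m d. scale (\<epsilon> m) (sw y (\<lambda>y1 y2. scale (f y2) (a * y1 * S d)))))"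
  proof (rule sw_B_cong[OF B h])
    show "bil scale (\<lambda>a w. sw w (\<lambda>m d. sw y (\<lambda>y1 y2. scale (f (ad m y2)) (a * y1 * S d))))"
      by (intro bilE li lin_ad)
    show "bil scale (\<lambda>a w. sw w (\<lambda>m d. scale (\<epsilon> m) (sw y (\<lambda>y1 y2. scale (f y2) (a * y1 * S d)))))"
      by (intro bilE li)
    fix a w assume w: "w \<in> B"
    show "sw w (\<lambda>m d. sw y (\<lambda>y1 y2. scale (f (ad m y2)) (a * y1 * S d))) =
        sw w (\<lambda>m d. scale (\<epsilon> m) (sw y (\<lambda>y1 y2. scale (f y2) (a * y1 * S d))))"
    proof (rule sw_B_cong[OF B w])
      show "bil scale (\<lambda>m d. sw y (\<lambda>y1 y2. scale (f (ad m y2)) (a * y1 * S d)))" by (intro bilE li lin_ad)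
      show "bil scale (\<lambda>m d. scale (\<epsilon> m) (sw y (\<lambda>y1 y2. scale (f y2) (a * y1 * S d))))" by (intro bilE li)
      fix m d assume m: "m \<in> B"
      show "sw y (\<lambda>y1 y2. scale (f (ad m y2)) (a * y1 * S d)) = scale (\<epsilon> m) (sw y (\<lambda>y1 y2. scale (f y2) (a * y1 * S d)))"
        by (simp only: inv[OF m] scale_scale[symmetric] smulE)
    qed
  qed
  also have "\<dots> = sw h (\<lambda>a w. sw y (\<lambda>y1 y2. scale (f y2) (a * y1 * S w)))"
    by (rule sw_cong, rule sw_counit_left[OF vector_space_axioms]) (intro li)
  also have "\<dots> = ad h (T f y)"
    unfolding ad_def T_def sw_comp[OF lin_mult_right[OF lin_mult_left[OF lin_ident]]]
    by (simp only: scale_mult_left[symmetric] scale_mult_right[symmetric])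
  finally show ?thesis .
qed

subsection \<open>Yetter--Drinfeld submodules\<close>

text \<open>Submodules of \<open>B\<close> for the adjoint action and the coaction by \<Delta>. If
  \<open>B\<close> is a Hopf subalgebra, stability under all functionals on \<open>H\<close> is the
  same as under those on \<open>B\<close>.\<close>

definition ydsub :: "'h set \<Rightarrow> 'h set \<Rightarrow> bool" where
  "ydsub B V \<longleftrightarrow> lcoid V \<and> V \<subseteq> B \<and> (\<forall>h\<in>B. \<forall>v\<in>V. ad h v \<in> V)"

definition ydsimple :: "'h set \<Rightarrow> 'h set \<Rightarrow> bool" where
  "ydsimple B V \<longleftrightarrow> ydsub B V \<and> V \<noteq> {0} \<and> (\<forall>W. ydsub B W \<and> W \<subseteq> V \<and> W \<noteq> {0} \<longrightarrow> W = V)"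

lemma ydsubD: "ydsub B V \<Longrightarrow> lcoid V" "ydsub B V \<Longrightarrow> V \<subseteq> B" "ydsub B V \<Longrightarrow> h \<in> B \<Longrightarrow> v \<in> V \<Longrightarrow> ad h v \<in> V"
  "ydsub B V \<Longrightarrow> subspace V"
  unfolding ydsub_def lcoid_def by blast+

lemma ydsimpleD: "ydsimple B V \<Longrightarrow> ydsub B V" "ydsimple B V \<Longrightarrow> V \<noteq> {0}"
  "ydsimple B V \<Longrightarrow> ydsub B W \<Longrightarrow> W \<subseteq> V \<Longrightarrow> W \<noteq> {0} \<Longrightarrow> W = V"
  unfolding ydsimple_def by blast+

lemma dim_pos: "subspace V \<Longrightarrow> V \<noteq> {0} \<Longrightarrow> dim V > 0"
  using fdim_dim_0[OF fdimI] by blast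

lemma ydsimple_exists:
  assumes "ydsub B W" "W \<noteq> {0}"
  shows "\<exists>V. ydsimple B V \<and> V \<subseteq> W"
  using assms
proof (induction "dim W" arbitrary: W rule: less_induct)
  case less
  show ?case
  proof (cases "ydsimple B W")
    case False
    then obtain U where U: "ydsub B U" "U \<subseteq> W" "U \<noteq> {0}" "U \<noteq> W"
      unfolding ydsimple_def using less.prems by blast
    have "dim U < dim W"
      using fdim_dim_eq[OF fdimI[OF ydsubD(4)[OF less.prems(1)]] ydsubD(4)[OF U(1)] U(2)] U(4) by (meson not_le)
    from less.hyps[OF this U(1,3)] show ?thesis using U(2) by blast
  qed blast
qed

text \<open>Since f(v) = \<epsilon>(T' f v), a left coideal inside the kernel of the counit is
  zero.\<close>

lemma lcoid_counit:
  assumes V: "lcoid V" "V \<noteq> {0}"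
  shows "\<exists>v\<in>V. \<epsilon> v = 1"
proof -
  have "\<exists>v\<in>V. \<epsilon> v \<noteq> 0"
  proof (rule ccontr)
    assume n: "\<not> ?thesis"
    have "v = 0" if v: "v \<in> V" for v
    proof (rule functional_eqI)
      fix f assume f: "linF f"
      have "f v = sw v (\<lambda>a b. \<epsilon> b * f a)" by (rule sw_counit_right[OF vector_space_mult f, symmetric])
      also have "\<dots> = \<epsilon> (T' f v)" by (simp only: T'_def sw_comp[OF lin\<epsilon>] lin_scale[OF lin\<epsilon>] mult.commute)
      also have "\<dots> = 0" using n lcoidD(2)[OF V(1) v f] by blast
      finally show "f v = f 0" by (simp add: lin_zero[OF f])
    qed
    then show False using V(2) subspace_0[OF lcoidD(1)[OF V(1)]] by blast
  qed
  then obtain v where v: "v \<in> V" "\<epsilon> v \<noteq> 0" by blast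
  have "\<epsilon> (scale (1 / \<epsilon> v) v) = 1" using v(2) by (simp add: lin_scale[OF lin\<epsilon>])
  then show ?thesis using subspace_scale[OF lcoidD(1)[OF V(1)] v(1)] by blast
qed

lemma ad_\<Lambda>_central:
  assumes B: "hsub B" and h: "h \<in> B"
  shows "h * ad (\<Lambda>B B) v = ad (\<Lambda>B B) v * h"
proof -
  have "sw (\<Lambda>B B) (\<lambda>a b. a * v * S (S h * b)) = sw (\<Lambda>B B) (\<lambda>a b. S (S h) * a * v * S b)"
    by (rule sw_\<Lambda>B[OF B bil_ad hsubD(2)[OF B h]])
  then show ?thesis
    by (simp only: S_mult SS ad_def sw_comp[OF lin_mult_right[OF lin_ident]] sw_comp[OF lin_eta(2)] mult.assoc)
qed

section \<open>Invariant functionals, Schur's lemma and complete reducibility\<close>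

definition ph :: "'h \<Rightarrow> 'h \<Rightarrow> 'k" where
  "ph z y = lm (z * S y)"

lemma lin_ph: "linF (ph z)"
  unfolding ph_def by (intro lin_comp[OF lin_lm] lin_intros)

text \<open>The integral property of \<open>lm\<close> trades the coproduct of h for that of z: h_1
  lm(z S(h_2)) = z_2 lm(z_1 S(h)). Hence the operator maps all of \<open>H\<close> into every left
  coideal containing z.\<close>

lemma T_ph: "T (ph z) h = T' (\<lambda>a. lm (a * S h)) z"
proof -
  let ?G = "\<lambda>m d. sw z (\<lambda>z1 z2. scale (lm (z1 * S d)) (z2 * m))"
  have G: "bil scale ?G" by (intro bilE lin_intros' lin_comp[OF lin_lm])
  have b: "bil scale (\<lambda>a b. scale (lm a) b)" by (intro bilE lin_intros' lin_lm)
  have b2: "bil scale (\<lambda>c d. scale (lm (a * c)) (b * d))" for a b by (intro bilE lin_intros' lin_comp[OF lin_lm])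
  have "T (ph z) h = sw h (\<lambda>x y. scale (lm (z * S y)) 1 * x)"
    by (simp add: T_def ph_def scale_mult_left[symmetric])
  also have "\<dots> = sw h (\<lambda>x y. sw y (\<lambda>c d. ?G (S c * x) d))"
  proof (rule sw_cong)
    fix x y
    have "scale (lm (z * S y)) 1 = sw z (\<lambda>a b. sw (S y) (\<lambda>c d. scale (lm (a * c)) (b * d)))"
      unfolding lm_right[symmetric] T'_def by (rule sw_mult[OF b])
    also have "\<dots> = sw z (\<lambda>a b. sw y (\<lambda>c d. scale (lm (a * S d)) (b * S c)))"
      by (rule sw_cong, rule sw_S[OF b2])
    also have "\<dots> = sw y (\<lambda>c d. sw z (\<lambda>a b. scale (lm (a * S d)) (b * S c)))" by (rule sw_swap)
    finally show "scale (lm (z * S y)) 1 * x = sw y (\<lambda>c d. ?G (S c * x) d)"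
      by (simp only: sw_comp[OF lin_mult_right[OF lin_ident]] scale_mult_left[symmetric] mult.assoc)
  qed
  also have "\<dots> = ?G 1 h" by (rule sw_cancel12'(2)[OF G])
  finally show ?thesis by (simp add: T'_def)
qed

lemma ph_ad:
  assumes B: "hsub B" and z: "\<And>h. h \<in> B \<Longrightarrow> h * z = z * h" and h: "h \<in> B"
  shows "ph z (ad h y) = \<epsilon> h * ph z y"
proof -
  have bb: "bil (*) (\<lambda>p q. lm (z * S (p * y * S q)))" "bil (*) (\<lambda>p q. lm (z * (S p * q) * S y))"
    by (intro bilF lin_comp[OF lin_lm] lin_intros)+
  have "ph z (ad h y) = sw h (\<lambda>p q. lm (z * S (p * y * S q)))"
    unfolding ad_def sw_comp[OF lin_ph] by (simp only: ph_def)
  also have "\<dots> = sw h (\<lambda>p q. lm (z * (S p * q) * S y))"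
  proof (rule sw_B_cong[OF B h bb])
    fix p q assume p: "p \<in> B"
    have "lm (z * S (p * y * S q)) = lm (z * q * S y * S p)" by (simp only: S_mult SS mult.assoc)
    also have "\<dots> = lm (S p * z * q * S y)" using lm_commute[of "z * q * S y" "S p"] by (simp only: mult.assoc)
    also have "\<dots> = lm (z * (S p * q) * S y)" using z[OF hsubD(2)[OF B p]] by (simp only: mult.assoc)
    finally show "lm (z * S (p * y * S q)) = lm (z * (S p * q) * S y)" .
  qed
  also have "\<dots> = \<epsilon> h * lm (z * 1 * S y)"
    by (rule sw_antipode_left) (intro lin_comp[OF lin_lm] lin_intros)
  finally show ?thesis by (simp add: ph_def)
qed

context
  fixes B V assumes B: "hsub B" and V: "ydsimple B V"
begin

lemmas Vyd = ydsimpleD(1)[OF V]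
lemmas Vs = ydsubD(4)[OF Vyd]

lemma dV0: "(of_nat (dim V) :: 'k) \<noteq> 0"
  using dim_pos[OF Vs ydsimpleD(2)[OF V]] by (simp only: of_nat_eq_0_iff neq0_conv)

text \<open>By \<open>T_ad\<close> and \<open>T_T'\<close> the operator respects action and
  coaction, so an eigenspace is all of \<open>V\<close>. Its scalar follows from the trace, which
  may be taken on \<open>B\<close> because the image lies in \<open>V\<close>, and there equals dim
  B lm(z \<Lambda>_B).\<close>

lemma schur:
  assumes z: "z \<in> V" "\<And>h. h \<in> B \<Longrightarrow> h * z = z * h" and y: "y \<in> V"
  shows "T (ph z) y = scale (of_nat dH / of_nat (dim V) * \<epsilon> z) y"
proof -
  let ?F = "T (ph z)"
  have TF: "?F x \<in> V" for x
    unfolding T_ph by (rule lcoidD(2)[OF ydsubD(1)[OF Vyd] z(1)]) (intro lin_comp[OF lin_lm] lin_intros)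
  obtain v where v: "v \<in> V" "v \<noteq> 0" using ydsimpleD(2)[OF V] subspace_0[OF Vs] by blast
  have FV: "?F ` V \<subseteq> V" using TF by blast
  obtain c x where x: "x \<in> V" "x \<noteq> 0" "?F x = scale c x"
    using eigenvector_exists[OF vector_space_axioms fdimI[OF Vs] linT[OF lin_ph] FV v] by blast
  let ?G = "\<lambda>x. ?F x - scale c x"
  have lG: "linE ?G" by (intro lin_minus' vector_space_axioms linT lin_ph lin_eta)
  let ?W = "{x \<in> V. ?G x = 0}"
  have "ydsub B ?W"
    unfolding ydsub_def lcoid_def
  proof (intro conjI ballI allI impI)
    show "subspace ?W" using lin_kernel_subspace[OF lG _ Vs] by simp
    show "?W \<subseteq> B" using ydsubD(2)[OF Vyd] by blast
    fix x assume x: "x \<in> ?W"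
    then have xx: "x \<in> V" "?F x = scale c x" by auto
    { fix f assume f: "linF f"
      have "?F (T' f x) = T' f (?F x)" by (rule T_T'[OF lin_ph f])
      then have "?F (T' f x) = scale c (T' f x)" unfolding xx(2) lin_scale[OF linT'[OF f]] .
      then show "T' f x \<in> ?W" using lcoidD(2)[OF ydsubD(1)[OF Vyd] xx(1) f] by simp }
    { fix h assume h: "h \<in> B"
      have "?F (ad h x) = ad h (?F x)" by (rule T_ad[OF B h lin_ph ph_ad[OF B z(2)]])
      then have "?F (ad h x) = scale c (ad h x)" unfolding xx(2) lin_scale[OF lin_ad(2)] .
      then show "ad h x \<in> ?W" using ydsubD(3)[OF Vyd h xx(1)] by simp }
  qed
  moreover have "?W \<noteq> {0}" using x by auto
  ultimately have "?W = V" by (intro ydsimpleD(3)[OF V]) auto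
  then have Fc: "?F y = scale c y" if "y \<in> V" for y using that by auto
  have "c * of_nat (dim V) = trace V ?F"
    using trace_cong[of V ?F "scale c"] Fc trace_scale[of V c "\<lambda>x. x"] trace_id[OF fdimI[OF Vs]] by simp
  also have "\<dots> = trace B ?F"
    using TF by (intro trace_subspace[symmetric] fdimI subalgD(1)[OF hsubD(1)[OF B]] linT lin_ph Vs ydsubD(2)[OF Vyd]) blast
  also have "\<dots> = of_nat (dim B) * lm (z * \<Lambda>B B)"
    unfolding trace_T_\<Lambda>B[OF B lin_ph] by (simp add: ph_def S_\<Lambda>B[OF B])
  also have "z * \<Lambda>B B = scale (\<epsilon> z) (\<Lambda>B B)" using ydsubD(2)[OF Vyd] z(1) by (intro \<Lambda>B_left[OF B]) blast
  also have "of_nat (dim B) * lm (scale (\<epsilon> z) (\<Lambda>B B)) = of_nat dH * \<epsilon> z"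
    by (simp only: dim_lm_\<Lambda>B[OF B, symmetric] lin_scale[OF lin_lm] ac_simps)
  finally have "c = of_nat dH / of_nat (dim V) * \<epsilon> z" using dV0 by (simp add: field_simps)
  then show ?thesis using Fc[OF y] by simp
qed

lemma ph_simple:
  assumes z: "z \<in> V" "\<And>h. h \<in> B \<Longrightarrow> h * z = z * h" and y: "y \<in> V"
  shows "ph z y = of_nat dH / of_nat (dim V) * \<epsilon> z * \<epsilon> y"
proof -
  have "ph z y = sw y (\<lambda>a b. \<epsilon> a * ph z b)" by (rule sw_counit_left[OF vector_space_mult lin_ph, symmetric])
  also have "\<dots> = \<epsilon> (T (ph z) y)" by (simp only: T_def sw_comp[OF lin\<epsilon>] lin_scale[OF lin\<epsilon>] mult.commute)
  also have "\<dots> = of_nat dH / of_nat (dim V) * \<epsilon> z * \<epsilon> y" by (simp only: schur[OF z y] lin_scale[OF lin\<epsilon>])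
  finally show ?thesis .
qed

lemma ad_\<Lambda>_mem: "v \<in> V \<Longrightarrow> ad (\<Lambda>B B) v \<in> V" and counit_ad_\<Lambda>: "\<epsilon> (ad (\<Lambda>B B) v) = \<epsilon> v"
  using ydsubD(3)[OF Vyd \<Lambda>B_mem[OF subalgD(1)[OF hsubD(1)[OF B]]]] by (simp_all add: counit_ad \<epsilon>_\<Lambda>B[OF B])

text \<open>Averaging an element of counit 1 by the adjoint action of the integral keeps the counit
  and lands in the centralizer.\<close>

lemma simple_central_element: "\<exists>z\<in>V. \<epsilon> z = 1 \<and> (\<forall>h\<in>B. h * z = z * h)"
proof -
  obtain v where "v \<in> V" "\<epsilon> v = 1" using lcoid_counit[OF ydsubD(1)[OF Vyd] ydsimpleD(2)[OF V]] by blast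
  then show ?thesis using ad_\<Lambda>_mem[of v] counit_ad_\<Lambda>[of v] ad_\<Lambda>_central[OF B, of _ v] by metis
qed

text \<open>This is a form of the Kac--Zhu class equation.\<close>

lemma dim_simple_dvd: "dim V dvd dim B"
proof -
  obtain z where z: "z \<in> V" "\<epsilon> z = 1" using simple_central_element by blast
  show ?thesis
  proof (rule biaction_eigenvalue_integral[OF B ydsubD(1,2)[OF Vyd] z])
    show "dim V > 0" by (rule dim_pos[OF Vs ydsimpleD(2)[OF V]])
    fix a c assume ac: "a \<in> V" "c \<in> V"
    let ?l = "lm (\<Lambda>B B)" and ?t = "trace B (\<lambda>x. a * x * S c)"
    have acB: "a \<in> B" "c \<in> B" using ac ydsubD(2)[OF Vyd] by blast+
    have "?l * ?t = ph (ad (\<Lambda>B B) a) c"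
      unfolding trace_B_biaction[OF B acB] ph_def ad_def ..
    also have "\<dots> = of_nat dH / of_nat (dim V) * \<epsilon> a * \<epsilon> c"
      by (simp only: ph_simple[OF ad_\<Lambda>_mem[OF ac(1)] ad_\<Lambda>_central[OF B] ac(2)] counit_ad_\<Lambda>)
    also have "\<dots> = ?l * (of_nat (dim B) / of_nat (dim V) * (\<epsilon> a * \<epsilon> c))"
      unfolding dim_lm_\<Lambda>B[OF B, symmetric] by simp
    finally have "?l * ?t = ?l * (of_nat (dim B) / of_nat (dim V) * (\<epsilon> a * \<epsilon> c))" .
    moreover have "?l \<noteq> 0" using dim_lm_\<Lambda>B[OF B] n0 by (metis mult_zero_left)
    ultimately show "?t = of_nat (dim B) / of_nat (dim V) * (\<epsilon> a * \<epsilon> c)"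
      by (simp only: mult_cancel_left) simp
  qed
qed

text \<open>By Schur's lemma a multiple of \<open>T (ph z)\<close> is the identity on
  \<open>V\<close>, and its image is \<open>V\<close>. It is thus a projection compatible with
  action and coaction, and its kernel in \<open>W\<close> is the complement.\<close>

lemma simple_complement:
  assumes W: "ydsub B W" "V \<subseteq> W"
  shows "\<exists>W'. ydsub B W' \<and> W' \<subseteq> W \<and> dim W = dim V + dim W'"
proof -
  obtain z where z: "z \<in> V" "\<epsilon> z = 1" "\<And>h. h \<in> B \<Longrightarrow> h * z = z * h" using simple_central_element by blast
  let ?k = "of_nat dH / of_nat (dim V) :: 'k"
  have k0: "?k \<noteq> 0" using n0 dV0 by simp
  let ?F = "T (ph z)"
  let ?E = "\<lambda>x. scale (1 / ?k) (?F x)"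
  have TF: "?F x \<in> V" for x
    unfolding T_ph by (rule lcoidD(2)[OF ydsubD(1)[OF Vyd] z(1)]) (intro lin_comp[OF lin_lm] lin_intros)
  have EV: "?E x \<in> V" for x by (rule subspace_scale[OF Vs TF])
  have E1: "?E y = y" if "y \<in> V" for y using schur[OF z(1,3) that] z(2) k0 by simp
  have lE: "linE ?E" by (intro lin_scale_right vector_space_axioms linT lin_ph)
  have im: "?E ` W = V"
  proof (intro equalityI subsetI)
    fix x assume "x \<in> V"
    then have "x = ?E x" "x \<in> W" using E1 W(2) by auto
    then show "x \<in> ?E ` W" by blast
  qed (use EV in blast)
  have EW: "?E ` W \<subseteq> W" using im W(2) by blast
  have "?E (?E x) = ?E x" for x by (rule E1[OF EV])
  from dim_direct_sum[OF vector_space_axioms fdimI[OF ydsubD(4)[OF W(1)]] lE EW this]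
  have d: "dim V + dim {x \<in> W. ?E x = 0} = dim W" unfolding im .
  have "ydsub B {x \<in> W. ?E x = 0}"
    unfolding ydsub_def lcoid_def
  proof (intro conjI ballI allI impI)
    show "subspace {x \<in> W. ?E x = 0}" using lin_kernel_subspace[OF lE _ ydsubD(4)[OF W(1)]] by simp
    show "{x \<in> W. ?E x = 0} \<subseteq> B" using ydsubD(2)[OF W(1)] by blast
    fix x assume "x \<in> {x \<in> W. ?E x = 0}"
    then have xx: "x \<in> W" "?F x = 0" using k0 by auto
    { fix f assume f: "linF f"
      have "?F (T' f x) = T' f (?F x)" by (rule T_T'[OF lin_ph f])
      then have "?F (T' f x) = 0" unfolding xx(2) lin_zero[OF linT'[OF f]] .
      then show "T' f x \<in> {x \<in> W. ?E x = 0}" using lcoidD(2)[OF ydsubD(1)[OF W(1)] xx(1) f] by simp }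
    { fix h assume h: "h \<in> B"
      have "?F (ad h x) = ad h (?F x)" by (rule T_ad[OF B h lin_ph ph_ad[OF B z(3)]])
      then have "?F (ad h x) = 0" unfolding xx(2) lin_zero[OF lin_ad(2)] .
      then show "ad h x \<in> {x \<in> W. ?E x = 0}" using ydsubD(3)[OF W(1) h xx(1)] by simp }
  qed
  then show ?thesis using d by (intro exI[of _ "{x \<in> W. ?E x = 0}"]) auto
qed

end

lemma dvd_dim_if_dvd_simple:
  assumes B: "hsub B" and W: "ydsub B W" and p: "\<And>V. ydsimple B V \<Longrightarrow> V \<subseteq> W \<Longrightarrow> p dvd dim V"
  shows "p dvd dim W"
  using W p
proof (induction "dim W" arbitrary: W rule: less_induct)
  case less
  show ?case
  proof (cases "W = {0}")
    case False
    then obtain V where V: "ydsimple B V" "V \<subseteq> W" using ydsimple_exists[OF less.prems(1)] by blast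
    obtain W' where W': "ydsub B W'" "W' \<subseteq> W" "dim W = dim V + dim W'"
      using simple_complement[OF B V(1) less.prems(1) V(2)] by blast
    have "dim V > 0" by (rule dim_pos[OF ydsubD(4)[OF ydsimpleD(1)[OF V(1)]] ydsimpleD(2)[OF V(1)]])
    then have "dim W' < dim W" using W'(3) by linarith
    then have "p dvd dim W'" by (rule less.hyps[OF _ W'(1)]) (use W'(2) less.prems(2) in blast)
    then show ?thesis unfolding W'(3) by (rule dvd_add[OF less.prems(2)[OF V]])
  qed simp
qed

text \<open>The regular character is ad-invariant and an integral, so its kernel is stable under
  action and coaction. The kernel is complementary to the line of 1 because lm 1 = dim H is
  nonzero.\<close>

lemma lm_kernel: "ydsub UNIV {x. lm x = 0}" "Suc (dim {x. lm x = 0}) = dH"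
proof -
  let ?W = "{x. lm x = 0}"
  have ad: "lm (ad h x) = \<epsilon> h * lm x" for h x
    using ph_ad[OF hsub_UNIV, of 1 h "S x"] sw_comp[OF linS, of h "\<lambda>p q. p * S x * S q"] ph_ad[OF hsub_UNIV, of 1 h x]
    by (simp add: ph_def lm_S)
  show "ydsub UNIV ?W"
    unfolding ydsub_def lcoid_def
  proof (intro conjI ballI allI impI)
    show "subspace ?W" using lin_kernel_subspace[OF lin_lm _ subspace_UNIV] by simp
    fix x assume "x \<in> ?W"
    then have x: "lm x = 0" by simp
    { fix f assume f: "linF f"
      have "lm (T' f x) = sw x (\<lambda>a b. f a * lm b)" by (simp only: T'_def sw_comp[OF lin_lm] lin_scale[OF lin_lm])
      then show "T' f x \<in> ?W" using lm_left_int[OF f] x by simp }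
    show "ad h x \<in> ?W" for h using ad x by simp
  qed simp
  let ?E = "\<lambda>x. scale (lm x / of_nat dH) 1"
  have lE: "linE ?E" by (intro lin_scale_left) (simp add: divide_inverse lin_k_right lin_lm)
  have 1: "?E (?E x) = ?E x" for x using n0 by (simp add: lin_scale[OF lin_lm] lm_one)
  have "?E ` UNIV = span {1}"
  proof (intro equalityI subsetI)
    fix x assume "x \<in> span {1::'h}"
    then obtain k where "x = scale k 1" unfolding span_singleton by blast
    then have "x = ?E x" using n0 by (simp add: lin_scale[OF lin_lm] lm_one)
    then show "x \<in> ?E ` UNIV" by blast
  qed (auto simp: span_singleton)
  then have "dim (?E ` UNIV) = 1" by (simp add: dim_eq_card_independent)
  moreover have "{x \<in> UNIV. ?E x = 0} = ?W" using n0 by auto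
  ultimately show "Suc (dim ?W) = dH"
    using dim_direct_sum[OF vector_space_axioms fdim_UNIV lE _ 1] by simp
qed

end

section \<open>Normal Hopf subalgebras\<close>

lemma tensor2_congruence:
  fixes scale :: "'k::field \<Rightarrow> 'v::ab_group_add \<Rightarrow> 'v"
  shows "tensor2_eq scale t t" "tensor2_eq scale t u \<Longrightarrow> tensor2_eq scale u t"
    "tensor2_eq scale t u \<Longrightarrow> tensor2_eq scale u v \<Longrightarrow> tensor2_eq scale t v"
    "tensor2_eq scale t u \<Longrightarrow> tensor2_eq scale t' u' \<Longrightarrow> tensor2_eq scale (t + t') (u + u')"
    "tensor2_eq scale t u \<Longrightarrow> tensor2_eq scale (free_scale c t) (free_scale c u)"
proof -
  interpret F: vector_space "free_scale :: 'k \<Rightarrow> ('v \<times> 'v \<Rightarrow>\<^sub>0 'k) \<Rightarrow> _" by (rule vector_space_free_scale)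
  show "tensor2_eq scale t t" by (simp add: tensor2_eq_def F.span_zero)
  show "tensor2_eq scale u t" if "tensor2_eq scale t u"
    using F.span_neg[OF that[unfolded tensor2_eq_def]] by (simp add: tensor2_eq_def)
  show "tensor2_eq scale t v" if "tensor2_eq scale t u" "tensor2_eq scale u v"
    using F.span_add[OF that[unfolded tensor2_eq_def]] by (simp add: tensor2_eq_def)
  show "tensor2_eq scale (t + t') (u + u')" if "tensor2_eq scale t u" "tensor2_eq scale t' u'"
    using F.span_add[OF that[unfolded tensor2_eq_def]] by (simp add: tensor2_eq_def algebra_simps)
  show "tensor2_eq scale (free_scale c t) (free_scale c u)" if "tensor2_eq scale t u"
    using F.span_scale[OF that[unfolded tensor2_eq_def], of c] by (simp add: tensor2_eq_def F.scale_right_diff_distrib)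
qed

lemma tensor2_eq_sum:
  assumes "\<And>i. i \<in> I \<Longrightarrow> tensor2_eq scale (f i) (g i)"
  shows "tensor2_eq scale (sum f I) (sum g I)"
  using assms by (induction I rule: infinite_finite_induct) (auto intro: tensor2_congruence(1,4))

lemma tensor2_eq_pure2:
  fixes scale :: "'k::field \<Rightarrow> 'v::ab_group_add \<Rightarrow> 'v"
  shows "tensor2_eq scale (pure2 (x + x') y) (pure2 x y + pure2 x' y)"
    "tensor2_eq scale (pure2 x (y + y')) (pure2 x y + pure2 x y')"
    "tensor2_eq scale (pure2 (scale c x) y) (free_scale c (pure2 x y))"
    "tensor2_eq scale (pure2 x (scale c y)) (free_scale c (pure2 x y))"
proof -
  interpret F: vector_space "free_scale :: 'k \<Rightarrow> ('v \<times> 'v \<Rightarrow>\<^sub>0 'k) \<Rightarrow> _" by (rule vector_space_free_scale)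
  show "tensor2_eq scale (pure2 (x + x') y) (pure2 x y + pure2 x' y)"
    "tensor2_eq scale (pure2 x (y + y')) (pure2 x y + pure2 x y')"
    "tensor2_eq scale (pure2 (scale c x) y) (free_scale c (pure2 x y))"
    "tensor2_eq scale (pure2 x (scale c y)) (free_scale c (pure2 x y))"
    unfolding tensor2_eq_def tensor2_rels_def by (rule F.span_base, blast)+
qed

lemma (in vector_space) tensor2_eq_pure2_zero:
  "tensor2_eq scale (pure2 0 y) 0" "tensor2_eq scale (pure2 x 0) 0"
proof -
  have "free_scale 0 t = 0" for t :: "'b \<times> 'b \<Rightarrow>\<^sub>0 'a" by (rule poly_mapping_eqI) simp
  then show "tensor2_eq scale (pure2 0 y) 0" "tensor2_eq scale (pure2 x 0) 0"
    using tensor2_eq_pure2(3)[of scale 0 0 y] tensor2_eq_pure2(4)[of scale x 0 0] by simp_all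
qed

lemma (in vector_space) tensor2_eq_pure2_sum:
  "tensor2_eq scale (pure2 (sum f I) y) (\<Sum>i\<in>I. pure2 (f i) y)"
  "tensor2_eq scale (pure2 x (sum f I)) (\<Sum>i\<in>I. pure2 x (f i))"
proof -
  note c = tensor2_congruence(1,4) tensor2_congruence(3)[OF tensor2_eq_pure2(1)]
    tensor2_congruence(3)[OF tensor2_eq_pure2(2)]
  show "tensor2_eq scale (pure2 (sum f I) y) (\<Sum>i\<in>I. pure2 (f i) y)"
    "tensor2_eq scale (pure2 x (sum f I)) (\<Sum>i\<in>I. pure2 x (f i))"
    by (induction I rule: infinite_finite_induct) (auto intro: c simp: tensor2_eq_pure2_zero)
qed

context fd_hopf
begin

abbreviation cof :: "'h \<Rightarrow> ('h \<times> 'h \<Rightarrow>\<^sub>0 'k) \<Rightarrow> 'h" where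
  "cof b t \<equiv> lin_ext scale (\<lambda>(x, y). scale (representation Basis y b) x) t"

lemma cof_add: "cof b (t + u) = cof b t + cof b u"
  by (rule module_hom.add[OF Vector_Spaces.linear.axioms(3)[OF linear_lin_ext[OF vector_space_axioms]]])

lemma cof_scale: "cof b (free_scale c t) = scale c (cof b t)"
  by (rule module_hom.scale[OF Vector_Spaces.linear.axioms(3)[OF linear_lin_ext[OF vector_space_axioms]]])

lemma cof_pure2: "cof b (pure2 x y) = scale (representation Basis y b) x"
  by (simp add: pure2_def lin_ext_single[OF vector_space_axioms])

text \<open>Second legs are expanded in \<open>Basis\<close>. Formal tensors with equal coefficients
  \<open>cof b\<close> are therefore congruent, the converse of testing them by functionals.\<close>

lemma tensor2_normal_form: "tensor2_eq scale t (\<Sum>b\<in>Basis. pure2 (cof b t) b)"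
proof (induction t rule: update_induct)
  case const
  have 0: "cof b 0 = 0" for b by (simp add: lin_ext_def)
  have "tensor2_eq scale (\<Sum>b\<in>Basis. pure2 0 b) (\<Sum>b\<in>Basis. 0)"
    by (rule tensor2_eq_sum) (rule tensor2_eq_pure2_zero)
  from tensor2_congruence(2)[OF this] show ?case unfolding 0 by (simp only: sum.neutral_const)
next
  case (update t k v)
  obtain x y where k: "k = (x, y)" by (cases k)
  let ?r = "\<lambda>b. representation Basis y b"
  have "Poly_Mapping.lookup t (x, y) = 0" using update(1) by (simp add: k in_keys_iff)
  then have s: "Poly_Mapping.update k v t = t + free_scale v (pure2 x y)"
    by (intro poly_mapping_eqI) (auto simp: k pure2_def lookup_single lookup_update lookup_add when_def)
  note tr = tensor2_congruence(3)
  have "tensor2_eq scale (pure2 x (\<Sum>b\<in>Basis. scale (?r b) b)) (\<Sum>b\<in>Basis. pure2 x (scale (?r b) b))"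
    by (rule tensor2_eq_pure2_sum)
  then have "tensor2_eq scale (pure2 x y) (\<Sum>b\<in>Basis. pure2 x (scale (?r b) b))"
    by (simp only: rep_sum)
  moreover have "tensor2_eq scale (\<Sum>b\<in>Basis. pure2 x (scale (?r b) b)) (\<Sum>b\<in>Basis. pure2 (scale (?r b) x) b)"
    by (rule tensor2_eq_sum) (rule tr[OF tensor2_eq_pure2(4) tensor2_congruence(2)[OF tensor2_eq_pure2(3)]])
  ultimately have "tensor2_eq scale (pure2 x y) (\<Sum>b\<in>Basis. pure2 (scale (?r b) x) b)"
    by (rule tr)
  then have 1: "tensor2_eq scale (free_scale v (pure2 x y)) (free_scale v (\<Sum>b\<in>Basis. pure2 (scale (?r b) x) b))"
    by (rule tensor2_congruence(5))
  have 2: "free_scale v (\<Sum>b\<in>Basis. pure2 (scale (?r b) x) b) = (\<Sum>b\<in>Basis. free_scale v (pure2 (scale (?r b) x) b))"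
    by (rule module.scale_sum_right) (simp add: module_iff_vector_space vector_space_free_scale)
  have 3: "tensor2_eq scale (\<Sum>b\<in>Basis. free_scale v (pure2 (scale (?r b) x) b)) (\<Sum>b\<in>Basis. pure2 (scale v (scale (?r b) x)) b)"
    by (rule tensor2_eq_sum) (rule tensor2_congruence(2)[OF tensor2_eq_pure2(3)])
  have "tensor2_eq scale (free_scale v (pure2 x y)) (\<Sum>b\<in>Basis. pure2 (scale v (scale (?r b) x)) b)"
    by (rule tr[OF 1[unfolded 2] 3])
  then have "tensor2_eq scale (Poly_Mapping.update k v t)
      ((\<Sum>b\<in>Basis. pure2 (cof b t) b) + (\<Sum>b\<in>Basis. pure2 (scale v (scale (?r b) x)) b))"
    unfolding s by (rule tensor2_congruence(4)[OF update(3)])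
  moreover have "tensor2_eq scale ((\<Sum>b\<in>Basis. pure2 (cof b t) b) + (\<Sum>b\<in>Basis. pure2 (scale v (scale (?r b) x)) b))
     (\<Sum>b\<in>Basis. pure2 (cof b (Poly_Mapping.update k v t)) b)"
    unfolding sum.distrib[symmetric] s cof_add cof_scale cof_pure2
    by (rule tensor2_eq_sum) (rule tensor2_congruence(2)[OF tensor2_eq_pure2(1)])
  ultimately show ?case by (rule tr)
qed

end

context inv_hopf
begin

text \<open>The formal tensor \<open>?t\<close> over a basis of \<open>B\<close> has the same
  coefficients as \<open>comult a\<close>, so the two normal forms agree.\<close>

lemma hsub_hopf_subalgebra:
  assumes B: "hsub B"
  shows "hopf_subalgebra B"
  unfolding hopf_subalgebra_def
proof (intro conjI ballI)
  note Bs = subalgD[OF hsubD(1)[OF B]]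
  show "subspace B" "1 \<in> B" using Bs by blast+
  show "a \<in> B \<Longrightarrow> b \<in> B \<Longrightarrow> a * b \<in> B" for a b by (rule Bs(3))
  show "a \<in> B \<Longrightarrow> S a \<in> B" for a by (rule hsubD(2)[OF B])
  fix a assume a: "a \<in> B"
  let ?t = "\<Sum>c\<in>bas B. pure2 (T (crd B c) a) c :: 'h \<times> 'h \<Rightarrow>\<^sub>0 'k"
  have "Poly_Mapping.keys ?t \<subseteq> (\<Union>c\<in>bas B. Poly_Mapping.keys (pure2 (T (crd B c) a) c :: _ \<Rightarrow>\<^sub>0 'k))"
    by (rule keys_sum)
  also have "\<dots> \<subseteq> B \<times> B"
    using bas(1)[of B] hsubD(3)[OF B a lin_crd] by (auto simp: pure2_def)
  finally have 1: "Poly_Mapping.keys ?t \<subseteq> B \<times> B" .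
  have "cof b ?t = cof b (comult a)" for b
  proof -
    have "cof b ?t = (\<Sum>c\<in>bas B. scale (representation Basis c b) (T (crd B c) a))"
      by (simp only: cof_pure2 module_hom.sum[OF Vector_Spaces.linear.axioms(3)[OF linear_lin_ext[OF vector_space_axioms]]])
    also have "\<dots> = T (\<lambda>y. representation Basis y b) a" by (rule T_sum_crd[OF hsub_lcoid[OF B] a lin_rep])
    finally show ?thesis unfolding del_T[symmetric] del_def .
  qed
  then have "tensor2_eq scale (comult a) (\<Sum>b\<in>Basis. pure2 (cof b ?t) b)"
    using tensor2_normal_form[of "comult a"] by (simp only:)
  then have "tensor2_eq scale (comult a) ?t"
    by (rule tensor2_congruence(3)[OF _ tensor2_congruence(2)[OF tensor2_normal_form[of ?t]]])
  with 1 show "\<exists>t. Poly_Mapping.keys t \<subseteq> B \<times> B \<and> tensor2_eq scale (comult a) t" by blast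
qed

definition has_normal :: bool where
  "has_normal \<longleftrightarrow> (\<exists>B. hsub B \<and> (\<forall>h. \<forall>a\<in>B. ad h a \<in> B) \<and> B \<noteq> range (\<lambda>c. scale c 1) \<and> B \<noteq> UNIV)"

lemma proper_normal_hopf_subalgebra_exists:
  assumes has_normal
  shows "\<exists>A. proper_hopf_subalgebra A \<and> normal_hopf_subalgebra A"
proof -
  have "adjoint_action h a = ad h a" for h a
    unfolding adjoint_action_def ad_def by (rule lin_ext_sw[OF bil_ad])
  moreover obtain B where "hsub B" "\<forall>h. \<forall>a\<in>B. ad h a \<in> B" "B \<noteq> range (\<lambda>c. scale c 1)" "B \<noteq> UNIV"
    using assms unfolding has_normal_def by blast
  ultimately show ?thesis
    unfolding proper_hopf_subalgebra_def normal_hopf_subalgebra_def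
    using hsub_hopf_subalgebra[of B] by (intro exI[of _ B]) simp
qed

section \<open>Subalgebras generated by a set\<close>

definition alg :: "'h set \<Rightarrow> 'h set" where
  "alg X = \<Inter>{A. subalg A \<and> X \<subseteq> A}"

lemma subalg_alg: "subalg (alg X)"
  unfolding alg_def subalg_def by (auto intro: subspace_Inter)

lemma alg_superset: "X \<subseteq> alg X"
  unfolding alg_def by blast

lemma alg_least: "subalg A \<Longrightarrow> X \<subseteq> A \<Longrightarrow> alg X \<subseteq> A"
  unfolding alg_def by blast

text \<open>Closure of a generated subalgebra under translations thus need only be checked on
  generators; \<open>subalg_S\<close> and \<open>subalg_ad_stable\<close> serve the antipode and the
  adjoint action in the same way.\<close>

lemma subalg_T:
  assumes A: "subalg A"
  shows "subalg {x. \<forall>f. linF f \<longrightarrow> T f x \<in> A}" "subalg {x. \<forall>f. linF f \<longrightarrow> T' f x \<in> A}"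
proof -
  note As = subalgD[OF A]
  have 1: "T f 1 \<in> A" "T' f 1 \<in> A" if "linF f" for f
  proof -
    have b: "bil scale (\<lambda>a b. scale (f b) a)" "bil scale (\<lambda>a b. scale (f a) b)" by (intro bilE lin_intros' that)+
    show "T f 1 \<in> A" "T' f 1 \<in> A" unfolding T_def T'_def sw_one[OF b(1)] sw_one[OF b(2)]
      by (intro subspace_scale As)+
  qed
  have m: "T f (x * y) \<in> A" if f: "linF f" and x: "\<And>f. linF f \<Longrightarrow> T f x \<in> A" and y: "\<And>f. linF f \<Longrightarrow> T f y \<in> A" for f x y
  proof -
    have b: "bil scale (\<lambda>a b. scale (f b) a)" by (intro bilE lin_intros' f)
    have lf: "linF (\<lambda>d. f (b * d))" for b by (intro lin_comp[OF f] lin_intros')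
    have "T f (x * y) = sw x (\<lambda>a b. a * T (\<lambda>d. f (b * d)) y)"
      unfolding T_def sw_mult[OF b] by (simp only: sw_comp[OF lin_eta(2)] scale_mult_right)
    also have "\<dots> = (\<Sum>b\<in>Basis. T (\<lambda>y. representation Basis y b) x * T (\<lambda>d. f (b * d)) y)"
      by (simp only: sw_def del_T)
    also have "\<dots> \<in> A" by (intro subspace_sum As x y lin_rep lf)
    finally show ?thesis .
  qed
  have m': "T' f (x * y) \<in> A" if f: "linF f" and x: "\<And>f. linF f \<Longrightarrow> T' f x \<in> A" and y: "\<And>f. linF f \<Longrightarrow> T' f y \<in> A" for f x y
  proof -
    have b: "bil scale (\<lambda>a b. scale (f a) b)" by (intro bilE lin_intros' f)
    have lf: "linF (\<lambda>d. f (b * d))" for b by (intro lin_comp[OF f] lin_intros')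
    have b2: "bil scale (\<lambda>a b. b * T' (\<lambda>d. f (a * d)) y)"
      unfolding T'_def by (intro bilE lin_intros' lin_comp[OF f])
    have "T' f (x * y) = sw x (\<lambda>a b. b * T' (\<lambda>d. f (a * d)) y)"
      unfolding T'_def sw_mult[OF b] by (simp only: sw_comp[OF lin_eta(2)] scale_mult_right)
    also have "\<dots> = (\<Sum>c\<in>Basis. T' (\<lambda>y. representation Basis y c) x * T' (\<lambda>d. f (c * d)) y)"
      by (rule sw_first_leg[OF b2])
    also have "\<dots> \<in> A" by (intro subspace_sum As x y lin_rep lf)
    finally show ?thesis .
  qed
  show "subalg {x. \<forall>f. linF f \<longrightarrow> T f x \<in> A}"
    unfolding subalg_def subspace_def
    using 1 m by (auto simp: lin_zero[OF linT] lin_add[OF linT] lin_scale[OF linT] subspace_0[OF As(1)] subspace_add[OF As(1)] subspace_scale[OF As(1)])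
  show "subalg {x. \<forall>f. linF f \<longrightarrow> T' f x \<in> A}"
    unfolding subalg_def subspace_def
    using 1 m' by (auto simp: lin_zero[OF linT'] lin_add[OF linT'] lin_scale[OF linT'] subspace_0[OF As(1)] subspace_add[OF As(1)] subspace_scale[OF As(1)])
qed

lemma subalg_S: "subalg A \<Longrightarrow> subalg {x. S x \<in> A}"
  unfolding subalg_def subspace_def
  by (auto simp: lin_zero[OF linS] lin_add[OF linS] lin_scale[OF linS] S_one S_mult)

lemma hsub_alg:
  assumes "\<And>x. x \<in> X \<Longrightarrow> S x \<in> alg X" "\<And>x f. x \<in> X \<Longrightarrow> linF f \<Longrightarrow> T f x \<in> alg X"
    "\<And>x f. x \<in> X \<Longrightarrow> linF f \<Longrightarrow> T' f x \<in> alg X"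
  shows "hsub (alg X)"
  unfolding hsub_def
  using alg_least[OF subalg_S[OF subalg_alg[of X]], of X] alg_least[OF subalg_T(1)[OF subalg_alg[of X]], of X]
    alg_least[OF subalg_T(2)[OF subalg_alg[of X]], of X] subalg_alg assms by blast

text \<open>\<open>H\<close> is a module algebra under ad: the inner factors S(h_2) h_3
  contract.\<close>

lemma ad_prod: "ad h (x * y) = sw h (\<lambda>p q. ad p x * ad q y)"
proof -
  have "sw h (\<lambda>p q. ad p x * ad q y) = sw h (\<lambda>p q. sw p (\<lambda>a b. sw q (\<lambda>c d. a * x * (S b * c) * y * S d)))"
    unfolding ad_def sw_comp[OF lin_mult_right[OF lin_ident]] by (simp only: sw_comp[OF lin_eta(2)] mult.assoc)
  also have "\<dots> = sw h (\<lambda>a w. sw w (\<lambda>m d. sw m (\<lambda>b c. a * x * (S b * c) * y * S d)))"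
    by (rule sw_middle[OF vector_space_axioms]; intro lin_intros')
  also have "\<dots> = sw h (\<lambda>a w. sw w (\<lambda>m d. scale (\<epsilon> m) (a * x * y * S d)))"
  proof (rule sw_cong, rule sw_cong)
    fix a w m d
    have "linE (\<lambda>t. a * x * t * y * S d)" by (intro lin_intros)
    from sw_antipode_left[OF this, of m]
    show "sw m (\<lambda>b c. a * x * (S b * c) * y * S d) = scale (\<epsilon> m) (a * x * y * S d)" by simp
  qed
  also have "\<dots> = sw h (\<lambda>a w. a * x * y * S w)"
    by (rule sw_cong, rule sw_counit_left[OF vector_space_axioms]) (intro lin_intros)
  finally show ?thesis by (simp only: ad_def mult.assoc)
qed

lemma subalg_ad_stable:
  assumes A: "subalg A"
  shows "subalg {x. \<forall>h. ad h x \<in> A}"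
proof -
  note As = subalgD[OF A]
  have "ad h 1 = scale (\<epsilon> h) 1" for h
    using sw_antipode_right[OF lin_ident, of h] by (simp add: ad_def)
  moreover have "ad h (x * y) \<in> A" if "\<And>h. ad h x \<in> A" "\<And>h. ad h y \<in> A" for h x y
    unfolding ad_prod sw_def by (intro subspace_sum As that)
  ultimately show ?thesis
    unfolding subalg_def subspace_def
    by (auto simp: lin_zero[OF lin_ad(2)] lin_add[OF lin_ad(2)] lin_scale[OF lin_ad(2)] subspace_0[OF As(1)]
        subspace_add[OF As(1)] subspace_scale[OF As(1)] As(2))
qed

lemma ad_stable_alg:
  assumes "\<And>x h. x \<in> X \<Longrightarrow> ad h x \<in> alg X" "x \<in> alg X"
  shows "ad h x \<in> alg X"
  using alg_least[OF subalg_ad_stable[OF subalg_alg[of X]], of X] assms by blast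

lemma subalg_centralizer: "subalg {x. \<forall>y\<in>Y. x * y = y * x}"
  unfolding subalg_def subspace_def
  by (auto simp: distrib_left distrib_right scale_mult_left[symmetric] scale_mult_right[symmetric])
     (metis mult.assoc)

lemma alg_commute:
  assumes "\<And>x y. x \<in> X \<Longrightarrow> y \<in> Y \<Longrightarrow> x * y = y * x" "x \<in> alg X" "y \<in> Y"
  shows "x * y = y * x"
  using alg_least[OF subalg_centralizer[of Y], of X] assms by blast

lemma central_iff_ad: "(\<forall>h. h * z = z * h) \<longleftrightarrow> (\<forall>h. ad h z = scale (\<epsilon> h) z)"
proof
  assume z: "\<forall>h. h * z = z * h"
  show "\<forall>h. ad h z = scale (\<epsilon> h) z"
  proof
    fix h
    have "ad h z = sw h (\<lambda>p q. z * (p * S q))" unfolding ad_def using z by (intro sw_cong) (simp add: mult.assoc)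
    then show "ad h z = scale (\<epsilon> h) z" using sw_antipode_right[OF lin_eta(2), of h z] by simp
  qed
next
  assume z: "\<forall>h. ad h z = scale (\<epsilon> h) z"
  show "\<forall>h. h * z = z * h"
  proof
    fix h
    have "h * z = sw h (\<lambda>p q. scale (\<epsilon> p) (z * q))" by (simp add: mult_ad[of h z] z scale_mult_left)
    also have "\<dots> = z * h" by (rule sw_counit_left[OF vector_space_axioms lin_eta(2)])
    finally show "h * z = z * h" .
  qed
qed

section \<open>Grouplike elements, one-dimensional coideals and normality\<close>

lemma counit_T': "linF f \<Longrightarrow> \<epsilon> (T' f x) = f x"
  using sw_counit_right[OF vector_space_mult, of f x]
  by (simp only: T'_def sw_comp[OF lin\<epsilon>] lin_scale[OF lin\<epsilon>] mult.commute)

lemma gl_T': "gl g \<Longrightarrow> linF f \<Longrightarrow> T' f g = scale (f g) g"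
  unfolding T'_def by (rule sw_gl) (auto intro!: bilE lin_intros')

lemma gl_of_T':
  assumes "\<epsilon> z = 1" "\<And>f. linF f \<Longrightarrow> \<exists>c. T' f z = scale c z"
  shows "gl z"
proof (rule glI[OF assms(1)])
  fix f f' assume f: "linF f" "linF f'"
  obtain c where c: "T' f z = scale c z" using assms(2)[OF f(1)] by blast
  have "f z = c" using counit_T'[OF f(1), of z] unfolding c lin_scale[OF lin\<epsilon>] assms(1) by simp
  then have "T' f z = scale (f z) z" using c by simp
  then have "f' (T' f z) = f z * f' z" by (simp only: lin_scale[OF f(2)])
  then show "sw z (\<lambda>a b. f a * f' b) = f z * f' z"
    by (simp only: T'_def sw_comp[OF f(2)] lin_scale[OF f(2)])
qed

lemma span_singleton_dim1:
  assumes "subspace K" "dim K = 1" "k \<in> K" "k \<noteq> 0"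
  shows "K = span {k}"
proof -
  have s: "span {k} \<subseteq> K" using assms(1,3) by (intro span_minimal) auto
  have "dim (span {k}) = 1" using assms(4) by (simp add: dim_eq_card_independent)
  then show ?thesis using fdim_dim_eq[OF fdimI[OF assms(1)] subspace_span s] assms(2) by simp
qed

lemma lcoid_dim1_gl:
  assumes "lcoid K" "dim K = 1"
  shows "\<exists>k\<in>K. gl k"
proof -
  have "K \<noteq> {0}" using assms(2) by auto
  then obtain k where k: "k \<in> K" "\<epsilon> k = 1" using lcoid_counit[OF assms(1)] by blast
  have "k \<noteq> 0" using k(2) lin_zero[OF lin\<epsilon>] by auto
  then have K: "K = span {k}" by (intro span_singleton_dim1 lcoidD(1)[OF assms(1)] assms(2) k(1))
  have "gl k"
  proof (rule gl_of_T'[OF k(2)])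
    fix f assume f: "linF f"
    show "\<exists>c. T' f k = scale c k" using lcoidD(2)[OF assms(1) k(1) f] unfolding K span_singleton by blast
  qed
  then show ?thesis using k(1) by blast
qed

lemma dim_kernel_functional:
  assumes f: "linF f" and W: "subspace W" "g \<in> W" "f g = 1"
  shows "Suc (dim {x \<in> W. f x = 0}) = dim W"
proof -
  let ?E = "\<lambda>x. scale (f x) g"
  have lE: "linE ?E" by (intro lin_scale_left f)
  have g0: "g \<noteq> 0" using W(3) lin_zero[OF f] by auto
  have 1: "?E (?E x) = ?E x" for x by (simp add: lin_scale[OF f] W(3))
  have "?E ` W = span {g}"
  proof (intro equalityI subsetI)
    fix x assume "x \<in> span {g}"
    then obtain k where k: "x = scale k g" unfolding span_singleton by blast
    then have "x = ?E x" by (simp add: lin_scale[OF f] W(3))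
    moreover have "x \<in> W" unfolding k by (rule subspace_scale[OF W(1,2)])
    ultimately show "x \<in> ?E ` W" by (rule image_eqI)
  qed (auto simp: span_singleton)
  then have "dim (?E ` W) = 1" using g0 by (simp add: dim_eq_card_independent)
  moreover have "?E ` W \<subseteq> W" using subspace_scale[OF W(1,2)] by blast
  moreover have "{x \<in> W. ?E x = 0} = {x \<in> W. f x = 0}" using g0 by auto
  ultimately show ?thesis
    using dim_direct_sum[OF vector_space_axioms fdimI[OF W(1)] lE _ 1] by simp
qed

lemma gl_scale_one: "gl g \<Longrightarrow> g \<in> range (\<lambda>c. scale c 1) \<Longrightarrow> g = 1"
  using gl_\<epsilon>[of g] by (auto simp: lin_scale[OF lin\<epsilon>] counit_one)

lemma hsub_alg_gl:
  assumes "\<And>g. g \<in> X \<Longrightarrow> gl g"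
  shows "hsub (alg X)"
proof (rule hsub_alg)
  note A = subalgD[OF subalg_alg[of X]]
  fix g assume g: "g \<in> X"
  then have gA: "g \<in> alg X" using alg_superset by blast
  have pw: "g ^ n \<in> alg X" for n by (induction n) (auto intro: A(2,3) gA)
  obtain N where N: "N > 0" "g ^ N = 1" using gl_finite_order[OF assms[OF g]] by blast
  have "S g = g ^ (N - 1) * g * S g" using N by (metis One_nat_def Suc_pred mult_1 power_Suc2)
  also have "\<dots> = g ^ (N - 1)" by (simp add: mult.assoc gl_inverse[OF assms[OF g]])
  finally show "S g \<in> alg X" using pw by (simp only:)
  fix f assume "linF f"
  then show "T f g \<in> alg X" "T' f g \<in> alg X"
    using gl_T[OF assms[OF g]] gl_T'[OF assms[OF g]] subspace_scale[OF A(1) gA] by simp_all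
qed

lemma ad_stable_central:
  assumes "\<And>x h. x \<in> X \<Longrightarrow> h * x = x * h" "x \<in> alg X"
  shows "ad h x \<in> alg X"
proof -
  have "h * x = x * h" for h using alg_commute[of X UNIV x h] assms by simp
  then have "ad h x = scale (\<epsilon> h) x" using central_iff_ad[of x] by blast
  then show ?thesis using subspace_scale[OF subalgD(1)[OF subalg_alg] assms(2)] by simp
qed

text \<open>The powers of a central grouplike element span a normal Hopf subalgebra. It can fill
  \<open>H\<close> only if the order is 54, and then the square, of order 27, is used
  instead.\<close>

lemma has_normal_central_gl:
  assumes g: "gl g" "g \<noteq> 1" "\<And>h. h * g = g * h" and dH: "dH = 54"
  shows has_normal
proof -
  obtain N0 where N0: "N0 > 0 \<and> g ^ N0 = 1" using gl_finite_order[OF g(1)] by blast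
  define N where "N = (LEAST n. n > 0 \<and> g ^ n = 1)"
  have N: "N > 0" "g ^ N = 1" using LeastI[of "\<lambda>n. n > 0 \<and> g ^ n = 1", OF N0] unfolding N_def by blast+
  have min: "g ^ n \<noteq> 1" if "0 < n" "n < N" for n
    using not_less_Least[of n "\<lambda>n. n > 0 \<and> g ^ n = 1"] that unfolding N_def by blast
  have inj: "inj_on (\<lambda>i. g ^ i) {..<N}"
  proof (rule linorder_inj_onI')
    fix i j assume ij: "i \<in> {..<N}" "j \<in> {..<N}" "i < j"
    show "g ^ i \<noteq> g ^ j"
    proof
      assume e: "g ^ i = g ^ j"
      have "S (g ^ i) * g ^ j = S (g ^ i) * g ^ i * g ^ (j - i)"
        using ij by (simp add: mult.assoc power_add[symmetric])
      then have "g ^ (j - i) = 1" using e gl_inverse(2)[OF gl_power[OF g(1), of i]] by simp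
      moreover have "0 < j - i" "j - i < N" using ij by (auto intro: less_imp_diff_less)
      ultimately show False using min by blast
    qed
  qed
  have "independent ((\<lambda>i. g ^ i) ` {..<N})"
    by (rule gl_independent) (auto intro: gl_power[OF g(1)])
  then have "card ((\<lambda>i. g ^ i) ` {..<N}) \<le> dim (UNIV :: 'h set)" by (rule independent_card_le_dim[OF subset_UNIV])
  then have N54: "N \<le> 54" unfolding dH by (simp add: card_image[OF inj])
  obtain h M where h: "h = g ^ 1 \<or> h = g ^ 2" "h \<noteq> 1" "h ^ M = 1" "0 < M" "M < 54"
  proof (cases "N = 54")
    case True
    have "(g ^ 2) ^ 27 = 1" unfolding power_mult[symmetric] using N(2) True by simp
    then show ?thesis using that[of "g ^ 2" 27] min[of 2] True by simp
  next
    case False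
    then show ?thesis using that[of g N] N g(2) N54 by simp
  qed
  have hg: "gl h" using h(1) gl_power[OF g(1)] by metis
  have gg: "k * (g * g) = g * g * k" for k
  proof -
    have "k * (g * g) = k * g * g" by (rule mult.assoc[symmetric])
    also have "\<dots> = g * k * g" unfolding g(3)[of k] ..
    also have "\<dots> = g * (k * g)" by (rule mult.assoc)
    also have "\<dots> = g * g * k" unfolding g(3)[of k] by (rule mult.assoc[symmetric])
    finally show ?thesis .
  qed
  have hc: "k * h = h * k" for k
    using h(1)
  proof
    assume "h = g ^ 1"
    then show ?thesis using g(3)[of k] by simp
  next
    assume "h = g ^ 2"
    then show ?thesis using gg[of k] by (simp only: power2_eq_square)
  qed
  let ?P = "(\<lambda>i. h ^ i) ` {..<M}"
  have pw: "h ^ i \<in> ?P" for i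
  proof -
    have "h ^ i = h ^ (M * (i div M)) * h ^ (i mod M)" by (simp only: power_add[symmetric] mult_div_mod_eq)
    then have "h ^ i = h ^ (i mod M)" by (simp add: power_mult h(3))
    then show ?thesis using h(4) by auto
  qed
  have "subalg (span ?P)"
    unfolding subalg_def
  proof (intro conjI ballI subspace_span)
    show "1 \<in> span ?P" using span_base[OF pw[of 0]] by simp
    fix a b assume a: "a \<in> span ?P" and b: "b \<in> span ?P"
    have 1: "x * b \<in> span ?P" if x: "x \<in> ?P" for x
    proof (rule lin_span[OF lin_eta(2) _ subspace_span b], rule image_subsetI)
      fix y assume "y \<in> ?P"
      then obtain i j where "x = h ^ i" "y = h ^ j" using x by auto
      then have "x * y = h ^ (i + j)" by (simp add: power_add)
      then show "x * y \<in> span ?P" using span_base[OF pw] by simp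
    qed
    show "a * b \<in> span ?P"
      by (rule lin_span[OF lin_mult_right[OF lin_ident] _ subspace_span a]) (use 1 in blast)
  qed
  then have "alg {h} \<subseteq> span ?P" using span_base[OF pw[of 1]] by (intro alg_least) auto
  then have "dim (alg {h}) \<le> card ?P" by (rule dim_le_card) simp
  also have "\<dots> \<le> M" using card_image_le[of "{..<M}" "\<lambda>i. h ^ i"] by simp
  finally have "alg {h} \<noteq> UNIV" using h(5) dH by auto
  moreover have "h \<in> alg {h}" using alg_superset by blast
  then have "alg {h} \<noteq> range (\<lambda>c. scale c 1)" using gl_scale_one[OF hg] h(2) by blast
  moreover have "hsub (alg {h})" by (rule hsub_alg_gl) (simp add: hg)
  moreover have "ad k x \<in> alg {h}" if "x \<in> alg {h}" for k x
    by (rule ad_stable_central[OF _ that]) (simp add: hc)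
  ultimately show ?thesis unfolding has_normal_def by blast
qed

text \<open>The line of \<open>g\<close> has a complementary coideal in \<open>V\<close>, spanned by
  a second grouplike \<open>g'\<close>. Conjugation by \<open>g\<close> preserves the grouplikes of
  \<open>V\<close>, hence fixes \<open>g'\<close>. The two generate an ad-stable algebra; if it is
  all of \<open>H\<close>, then \<open>H\<close> is commutative and one of them is central and
  different from 1.\<close>

lemma has_normal_gl_dim2:
  assumes V: "ydsub UNIV V" "dim V = 2" and g: "g \<in> V" "gl g" and dH: "dH = 54"
  shows has_normal
proof -
  note Vs = ydsubD(4)[OF V(1)]
  \<comment> \<open>Normalised to be 1 at \<open>g\<close>; translation by this functional is the
    projection onto the line of \<open>g\<close>, so its kernel in \<open>V\<close> is a
    coideal.\<close>
  let ?\<phi> = "\<lambda>y. (1 / of_nat dH) * lm (S g * y)"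
  have l\<phi>: "linF ?\<phi>" by (intro lin_k_left lin_comp[OF lin_lm] lin_eta)
  have \<phi>g: "?\<phi> g = 1" using n0 by (simp only: gl_inverse[OF g(2)] lm_one) simp
  have T\<phi>: "T ?\<phi> y = scale (?\<phi> y) g" for y
  proof -
    have b: "bil scale (\<lambda>a b. scale (lm b) a)" by (intro bilE lin_intros' lin_lm)
    have b2: "bil scale (\<lambda>a b. sw y (\<lambda>c d. scale (lm (b * d)) (a * c)))" by (intro bilE lin_intros' lin_comp[OF lin_lm])
    have "sw y (\<lambda>c d. scale (lm (S g * d)) (S g * c)) = scale (lm (S g * y)) 1"
      unfolding lm_left[symmetric] sw_mult[OF b] sw_gl[OF gl_S[OF g(2)] b2] ..
    then have "g * sw y (\<lambda>c d. scale (lm (S g * d)) (S g * c)) = scale (lm (S g * y)) g"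
      by (simp add: scale_mult_right[symmetric])
    then have "sw y (\<lambda>c d. scale (lm (S g * d)) c) = scale (lm (S g * y)) g"
      by (simp only: sw_comp[OF lin_eta(2)] scale_mult_right[symmetric] mult.assoc[symmetric] gl_inverse[OF g(2)] mult_1)
    then show ?thesis unfolding T_def scale_scale[symmetric] smulE by (rule arg_cong)
  qed
  let ?K = "{y \<in> V. ?\<phi> y = 0}"
  have K: "lcoid ?K"
    unfolding lcoid_def
  proof (intro conjI ballI allI impI)
    show "subspace ?K" using lin_kernel_subspace[OF l\<phi> _ Vs] by simp
    fix x f assume x: "x \<in> ?K" and f: "linF f"
    have "scale (?\<phi> (T' f x)) g = T' f (T ?\<phi> x)" unfolding T\<phi>[symmetric] by (rule T_T'[OF l\<phi> f])
    also have "\<dots> = scale (?\<phi> x) (T' f g)" unfolding T\<phi> by (rule lin_scale[OF linT'[OF f]])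
    also have "\<dots> = 0" using x by simp
    finally have "?\<phi> (T' f x) = 0" using \<phi>g lin_zero[OF l\<phi>] by (metis scale_eq_0_iff zero_neq_one)
    then show "T' f x \<in> ?K" using lcoidD(2)[OF ydsubD(1)[OF V(1)] _ f] x by blast
  qed
  have "dim ?K = 1" using dim_kernel_functional[OF l\<phi> Vs g(1) \<phi>g] V(2) by simp
  then obtain g' where g': "g' \<in> V" "?\<phi> g' = 0" "gl g'" using lcoid_dim1_gl[OF K] by blast
  have ne: "g \<noteq> g'" using \<phi>g g'(2) by auto
  have only: "u = g \<or> u = g'" if u: "u \<in> V" "gl u" for u
  proof (rule ccontr)
    assume n: "\<not> ?thesis"
    have "independent {u, g, g'}" by (rule gl_independent) (use u g g' in auto)
    then have "card {u, g, g'} \<le> dim V" by (rule independent_card_le_dim[rotated]) (use u g g' in auto)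
    then show False using n ne V(2) by simp
  qed
  have ad: "ad g g' = g * g' * S g" unfolding ad_def by (rule sw_gl[OF g(2) bil_ad])
  have adV: "ad g g' \<in> V" by (rule ydsubD(3)[OF V(1) UNIV_I g'(1)])
  have "gl (ad g g')" unfolding ad by (intro gl_mult gl_S g g')
  with adV have "ad g g' = g \<or> ad g g' = g'" by (rule only)
  then have comm: "g * g' = g' * g"
  proof
    have e: "ad g g' * g = g * g'" unfolding ad by (simp add: mult.assoc gl_inverse[OF g(2)])
    { assume "ad g g' = g'" then show ?thesis using e by simp }
    assume "ad g g' = g"
    then have "S g * (g * g) = S g * (g * g')" using e by simp
    then have "g = g'" by (simp add: mult.assoc[symmetric] gl_inverse[OF g(2)])
    then show ?thesis using ne by blast
  qed
  let ?A = "alg {g, g'}"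
  have gA: "g \<in> ?A" "g' \<in> ?A" using alg_superset by blast+
  have VA: "V \<subseteq> ?A"
  proof -
    have i: "independent {g, g'}" by (rule gl_independent) (use g g' in auto)
    have "card {g, g'} = dim V" using ne V(2) by simp
    then have "V = span {g, g'}" using i g(1) g'(1) Vs V(2)
      by (metis card_ge_dim_independent empty_subsetI insert_subset order_refl span_minimal subset_antisym)
    also have "\<dots> \<subseteq> ?A" using gA by (intro span_minimal subalgD(1)[OF subalg_alg]) auto
    finally show ?thesis .
  qed
  show ?thesis
  proof (cases "?A = UNIV")
    case True
    have c1: "x * y = y * x" if "y \<in> {g, g'}" for x y
    proof (rule alg_commute[of "{g, g'}" "{g, g'}"])
      show "x \<in> ?A" using True by blast
    qed (use comm that in auto)
    obtain u where u: "u \<in> {g, g'}" "u \<noteq> 1" using ne by auto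
    then have "gl u" using g(2) g'(3) by blast
    then show ?thesis using u(2) c1[OF u(1)] dH by (rule has_normal_central_gl)
  next
    case False
    have "hsub ?A" by (rule hsub_alg_gl) (use g g' in auto)
    moreover have "ad h x \<in> ?A" if "x \<in> ?A" for h x
      by (rule ad_stable_alg[OF _ that]) (use ydsubD(3)[OF V(1) UNIV_I] VA g(1) g'(1) in blast)
    moreover have "?A \<noteq> range (\<lambda>c. scale c 1)" using gl_scale_one[OF g(2)] gl_scale_one[OF g'(3)] gA ne by metis
    ultimately show ?thesis using False unfolding has_normal_def by blast
  qed
qed

subsection \<open>Characters\<close>

definition chars :: "('h \<Rightarrow> 'k) set" where
  "chars = {f. linF f \<and> (\<forall>x y. f (x * y) = f x * f y) \<and> f 1 = 1}"

definition char_group :: "('h \<Rightarrow> 'k) monoid" where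
  "char_group = \<lparr>carrier = chars, mult = (\<lambda>f g x. sw x (\<lambda>a b. f a * g b)), one = \<epsilon>\<rparr>"

lemma charsD: "f \<in> chars \<Longrightarrow> linF f" "f \<in> chars \<Longrightarrow> f (x * y) = f x * f y" "f \<in> chars \<Longrightarrow> f 1 = 1"
  unfolding chars_def by blast+

lemma chars_mult:
  assumes "f \<in> chars" "g \<in> chars"
  shows "(\<lambda>x. sw x (\<lambda>a b. f a * g b)) \<in> chars"
  unfolding chars_def
proof (intro CollectI conjI allI)
  note b = bil_k[OF charsD(1)[OF assms(1)] charsD(1)[OF assms(2)]]
  show "linF (\<lambda>x. sw x (\<lambda>a b. f a * g b))" by (rule sw_linear[OF b])
  show "sw 1 (\<lambda>a b. f a * g b) = 1" by (simp add: sw_one[OF b] charsD(3)[OF assms(1)] charsD(3)[OF assms(2)])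
  fix x y
  have "sw (x * y) (\<lambda>a b. f a * g b) = sw x (\<lambda>a b. sw y (\<lambda>c d. (f a * g b) * (f c * g d)))"
    unfolding sw_mult[OF b] charsD(2)[OF assms(1)] charsD(2)[OF assms(2)] by (simp only: ac_simps)
  also have "\<dots> = sw x (\<lambda>a b. f a * g b) * sw y (\<lambda>a b. f a * g b)"
    unfolding smulF by (simp only: mult.commute[of _ "sw y F" for F] smulF)
  finally show "sw (x * y) (\<lambda>a b. f a * g b) = sw x (\<lambda>a b. f a * g b) * sw y (\<lambda>a b. f a * g b)" .
qed

lemma group_char_group:
  assumes comm: "\<And>x y :: 'h. x * y = y * x"
  shows "group char_group"
proof (rule groupI)
  show "\<And>x y. x \<in> carrier char_group \<Longrightarrow> y \<in> carrier char_group \<Longrightarrow> x \<otimes>\<^bsub>char_group\<^esub> y \<in> carrier char_group"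
    by (simp add: char_group_def chars_mult)
  show "\<one>\<^bsub>char_group\<^esub> \<in> carrier char_group"
    by (simp add: char_group_def chars_def lin\<epsilon> counit_mult counit_one)
  fix f assume "f \<in> carrier char_group"
  then have f: "f \<in> chars" by (simp add: char_group_def)
  note lf = charsD(1)[OF f]
  show "\<one>\<^bsub>char_group\<^esub> \<otimes>\<^bsub>char_group\<^esub> f = f"
    unfolding char_group_def by (simp add: sw_counit_left[OF vector_space_mult lf])
  have "(\<lambda>x. f (S x)) \<in> chars"
    unfolding chars_def using lin_comp[OF lf linS] charsD(2,3)[OF f] by (simp add: S_mult S_one mult.commute)
  moreover have "sw x (\<lambda>a b. f (S a) * f b) = \<epsilon> x" for x
    using sw_antipode_left[OF lf, of x] by (simp add: charsD(2,3)[OF f])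
  ultimately show "\<exists>y\<in>carrier char_group. y \<otimes>\<^bsub>char_group\<^esub> f = \<one>\<^bsub>char_group\<^esub>"
    unfolding char_group_def by (intro bexI[of _ "\<lambda>x. f (S x)"]) simp_all
  fix g h assume "g \<in> carrier char_group" "h \<in> carrier char_group"
  then have gh: "g \<in> chars" "h \<in> chars" by (simp_all add: char_group_def)
  note l = lf charsD(1)[OF gh(1)] charsD(1)[OF gh(2)]
  have "sw x (\<lambda>p b. sw p (\<lambda>a c. f a * g c) * h b) = sw x (\<lambda>a q. f a * sw q (\<lambda>c b. g c * h b))" for x
  proof -
    have "sw x (\<lambda>p b. sw p (\<lambda>a c. f a * g c) * h b) = sw x (\<lambda>p b. sw p (\<lambda>a c. f a * g c * h b))"
      by (simp only: sw_comp[OF lin_smul[OF vector_space_mult]] mult.commute[of _ "h _"])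
    also have "\<dots> = sw x (\<lambda>a q. sw q (\<lambda>c b. f a * g c * h b))"
      by (rule coassocF[of "\<lambda>a c b. f a * g c * h b"]; intro lin_k_left lin_k_right l)
    finally show ?thesis by (simp only: mult.assoc smulF)
  qed
  then show "f \<otimes>\<^bsub>char_group\<^esub> g \<otimes>\<^bsub>char_group\<^esub> h = f \<otimes>\<^bsub>char_group\<^esub> (g \<otimes>\<^bsub>char_group\<^esub> h)"
    by (simp add: char_group_def)
qed

text \<open>A commutative \<open>H\<close> is the algebra of functions on its characters: the
  primitive idempotents are the delta functions, and each of them reads off one character.\<close>

lemma commutative_chars:
  assumes comm: "\<And>x y :: 'h. x * y = y * x"
  obtains E \<chi> where "finite E" "bij_betw \<chi> E chars" "card E = dH" "\<And>x. x = (\<Sum>e\<in>E. scale (\<chi> e x) e)"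
    "\<And>e f. e \<in> E \<Longrightarrow> f \<in> E \<Longrightarrow> \<chi> e f = (if e = f then 1 else 0)"
proof -
  obtain E where E: "orth E" and sc: "\<And>e x. e \<in> E \<Longrightarrow> \<exists>c. e * x * e = scale c e"
    using primitive_idempotents[OF hsubD(1)[OF hsub_UNIV] vnr_B[OF hsub_UNIV]] by blast
  note o = orthD[OF E]
  have "\<exists>c. e * x = scale c e" if e: "e \<in> E" for e x
    using sc[OF e, of x] comm[of x e] o(3)[OF e] by (metis mult.assoc)
  then obtain \<chi> where \<chi>: "\<And>e x. e \<in> E \<Longrightarrow> e * x = scale (\<chi> e x) e" by metis
  have uniq: "c = \<chi> e x" if "e \<in> E" "e * x = scale c e" for c e x
    using \<chi>[OF that(1), of x] that(2) o(2)[OF that(1)] by (metis scale_cancel_right)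
  have \<chi>c: "\<chi> e \<in> chars" if e: "e \<in> E" for e
    unfolding chars_def
  proof (intro CollectI conjI allI linI)
    fix x y c
    show "\<chi> e (x + y) = \<chi> e x + \<chi> e y"
      by (rule uniq[OF e, symmetric]) (simp add: distrib_left \<chi>[OF e] scale_left_distrib)
    show "\<chi> e (scale c x) = c * \<chi> e x"
      by (rule uniq[OF e, symmetric]) (simp add: scale_mult_right[symmetric] \<chi>[OF e])
    have "e * (x * y) = scale (\<chi> e x) e * y" by (simp only: mult.assoc[symmetric] \<chi>[OF e])
    also have "\<dots> = scale (\<chi> e x * \<chi> e y) e" by (simp add: scale_mult_left[symmetric] \<chi>[OF e])
    finally show "\<chi> e (x * y) = \<chi> e x * \<chi> e y" by (rule uniq[OF e, symmetric])
    show "\<chi> e 1 = 1" by (rule uniq[OF e, symmetric]) simp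
  qed
  have expand: "x = (\<Sum>e\<in>E. scale (\<chi> e x) e)" for x
  proof -
    have "x = \<Sum>E * x" by (simp add: o(5))
    also have "\<dots> = (\<Sum>e\<in>E. scale (\<chi> e x) e)" unfolding sum_distrib_right by (rule sum.cong[OF refl \<chi>])
    finally show ?thesis .
  qed
  have delta: "\<chi> e f = (if e = f then 1 else 0)" if "e \<in> E" "f \<in> E" for e f
    by (rule uniq[OF that(1), symmetric]) (use o(3,4) that in simp)
  have "bij_betw \<chi> E chars"
    unfolding bij_betw_def
  proof (intro conjI inj_onI equalityI subsetI)
    show "e = f" if "e \<in> E" "f \<in> E" "\<chi> e = \<chi> f" for e f
      using delta[OF that(1,1)] delta[OF that(2,1)] that(3) by (metis zero_neq_one)
    show "f \<in> chars" if "f \<in> \<chi> ` E" for f using that \<chi>c by blast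
    fix f assume f: "f \<in> chars"
    have "(\<Sum>e\<in>E. f e) \<noteq> 0"
      using lin_sum[OF charsD(1)[OF f], of "\<lambda>x. x" E] o(5) charsD(3)[OF f] by simp
    then obtain e where e: "e \<in> E" "f e \<noteq> 0" by (meson sum.not_neutral_contains_not_neutral)
    have "f = \<chi> e"
    proof
      fix x
      have "f e * f x = \<chi> e x * f e"
        using arg_cong[OF \<chi>[OF e(1), of x], of f] by (simp only: charsD(2)[OF f] lin_scale[OF charsD(1)[OF f]])
      then show "f x = \<chi> e x" using e(2) by simp
    qed
    then show "f \<in> \<chi> ` E" using e(1) by blast
  qed
  moreover have "card E = dH"
  proof -
    have ind: "independent E"
      unfolding independent_explicit_module
    proof (intro allI impI)
      fix t u v assume t: "finite t" "t \<subseteq> E" "(\<Sum>v\<in>t. scale (u v) v) = 0" "v \<in> t"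
      have v: "v \<in> E" using t by blast
      note lv = charsD(1)[OF \<chi>c[OF v]]
      have "0 = (\<Sum>w\<in>t. u w * \<chi> v w)"
        using arg_cong[OF t(3), of "\<chi> v"] by (simp only: lin_sum[OF lv] lin_scale[OF lv] lin_zero[OF lv])
      also have "\<dots> = (\<Sum>w\<in>t. if v = w then u w else 0)"
        by (rule sum.cong[OF refl]) (use delta[OF v] t(2) in auto)
      also have "\<dots> = u v" using t by simp
      finally show "u v = 0" by simp
    qed
    have "x \<in> span E" for x
      by (subst expand) (intro span_sum span_scale span_base)
    then have "span E = UNIV" by blast
    then show ?thesis using dim_eq_card[OF _ ind, of UNIV] by simp
  qed
  ultimately show thesis using that[of E \<chi>] o(1) expand delta by blast
qed

text \<open>The group of characters has order 54, so a Sylow 3-subgroup has index two and the sign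
  character of the quotient is a grouplike element.\<close>

lemma commutative_nontrivial_gl:
  assumes comm: "\<And>x y :: 'h. x * y = y * x" and dH: "dH = 54"
  shows "\<exists>g. gl g \<and> g \<noteq> 1"
proof -
  obtain E \<chi> where E: "finite E" "bij_betw \<chi> E chars" "card E = dH" "\<And>x. x = (\<Sum>e\<in>E. scale (\<chi> e x) e)"
    "\<And>e f. e \<in> E \<Longrightarrow> f \<in> E \<Longrightarrow> \<chi> e f = (if e = f then 1 else 0)"
    using commutative_chars[OF comm] by blast
  interpret G: group char_group by (rule group_char_group[OF comm])
  let ?G = "char_group"
  have car: "carrier ?G = chars" by (simp add: char_group_def)
  have fin: "finite chars" using E(1,2) bij_betw_finite by blast
  have card: "card chars = 54" using bij_betw_same_card[OF E(2)] E(3) dH by simp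
  have "\<exists>K. subgroup K ?G \<and> card K = 3 ^ 3"
    by (rule sylow_thm[OF _ G.group_axioms, of 3 3 2]) (simp_all add: car fin card order_def)
  then obtain K where K: "subgroup K ?G" "card K = 27" by auto
  have Ks: "K \<subseteq> chars" using subgroup.subset[OF K(1)] car by simp
  \<comment> \<open>The coset of \<open>K\<close> by the inverse of f is disjoint from
    \<open>K\<close> and consists of the other 27 characters, so it contains h.\<close>
  have index2: "f \<otimes>\<^bsub>?G\<^esub> h \<in> K" if f: "f \<in> chars - K" and h: "h \<in> chars - K" for f h
  proof -
    let ?f = "m_inv ?G f"
    let ?L = "(\<lambda>k. ?f \<otimes>\<^bsub>?G\<^esub> k) ` K"
    have fc: "f \<in> carrier ?G" "?f \<in> carrier ?G" using f G.inv_closed by (simp_all add: car)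
    have kc: "k \<in> carrier ?G" if "k \<in> K" for k using that Ks car by blast
    have L: "?L \<subseteq> chars" using G.m_closed[OF fc(2) kc] car by auto
    have "inj_on (\<lambda>k. ?f \<otimes>\<^bsub>?G\<^esub> k) K" by (rule inj_onI) (use G.Units_l_cancel[of "?f"] fc kc in auto)
    then have cL: "card ?L = 27" using K(2) by (simp add: card_image)
    have dis: "K \<inter> ?L = {}"
    proof (rule ccontr)
      assume "K \<inter> ?L \<noteq> {}"
      then obtain k where k: "k \<in> K" "?f \<otimes>\<^bsub>?G\<^esub> k \<in> K" by blast
      have "?f \<otimes>\<^bsub>?G\<^esub> k \<otimes>\<^bsub>?G\<^esub> m_inv ?G k \<in> K"
        by (rule subgroup.m_closed[OF K(1) k(2) subgroup.m_inv_closed[OF K(1) k(1)]])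
      moreover have "?f \<otimes>\<^bsub>?G\<^esub> k \<otimes>\<^bsub>?G\<^esub> m_inv ?G k = ?f" using fc(2) kc[OF k(1)] by (simp add: G.m_assoc)
      ultimately have "?f \<in> K" by (simp only:)
      then have "m_inv ?G ?f \<in> K" by (rule subgroup.m_inv_closed[OF K(1)])
      then show False using f G.inv_inv[OF fc(1)] by simp
    qed
    have "card (K \<union> ?L) = 54"
      using dis K(2) cL Ks L fin by (subst card_Un_disjoint) (auto intro: finite_subset)
    then have "K \<union> ?L = chars" using card fin Ks L by (intro card_subset_eq) auto
    then obtain k where k: "k \<in> K" "h = ?f \<otimes>\<^bsub>?G\<^esub> k" using h by blast
    have "f \<otimes>\<^bsub>?G\<^esub> h = f \<otimes>\<^bsub>?G\<^esub> ?f \<otimes>\<^bsub>?G\<^esub> k" unfolding k(2) by (rule G.m_assoc[symmetric]) (use fc kc[OF k(1)] in auto)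
    also have "\<dots> = k" using fc kc[OF k(1)] by simp
    finally show ?thesis using k(1) by simp
  qed
  define \<sigma> where "\<sigma> f = (if f \<in> K then 1 else - 1 :: 'k)" for f
  have mixed: "f \<otimes>\<^bsub>?G\<^esub> h \<notin> K" if fh: "f \<in> chars" "h \<in> chars" "f \<in> K \<longleftrightarrow> h \<notin> K" for f h
  proof
    assume k: "f \<otimes>\<^bsub>?G\<^esub> h \<in> K"
    have c: "f \<in> carrier ?G" "h \<in> carrier ?G" using fh car by auto
    show False
    proof (cases "f \<in> K")
      case True
      then have "m_inv ?G f \<otimes>\<^bsub>?G\<^esub> (f \<otimes>\<^bsub>?G\<^esub> h) \<in> K"
        by (rule subgroup.m_closed[OF K(1) subgroup.m_inv_closed[OF K(1)] k])
      then show False using True fh(3) c by (simp add: G.m_assoc[symmetric])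
    next
      case False
      then have "h \<in> K" using fh(3) by blast
      then have "f \<otimes>\<^bsub>?G\<^esub> h \<otimes>\<^bsub>?G\<^esub> m_inv ?G h \<in> K"
        by (rule subgroup.m_closed[OF K(1) k subgroup.m_inv_closed[OF K(1)]])
      then show False using False c by (simp add: G.m_assoc)
    qed
  qed
  have \<sigma>m: "\<sigma> (f \<otimes>\<^bsub>?G\<^esub> h) = \<sigma> f * \<sigma> h" if fh: "f \<in> chars" "h \<in> chars" for f h
    unfolding \<sigma>_def using index2[of f h] mixed[of f h] subgroup.m_closed[OF K(1), of f h] fh by (auto split: if_splits)
  \<comment> \<open>The sign function on the group of characters, seen as an element of
    \<open>H\<close>.\<close>
  define g where "g = (\<Sum>e\<in>E. scale (\<sigma> (\<chi> e)) e)"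
  have \<chi>c: "\<chi> e \<in> chars" if "e \<in> E" for e by (rule bij_betw_apply[OF E(2) that])
  have val: "f g = \<sigma> f" if f: "f \<in> chars" for f
  proof -
    obtain e where e: "e \<in> E" "f = \<chi> e" using imageE[OF f[folded bij_betw_imp_surj_on[OF E(2)]]] by metis
    note l = charsD(1)[OF f]
    have "f g = (\<Sum>a\<in>E. \<sigma> (\<chi> a) * f a)" by (simp only: g_def lin_sum[OF l] lin_scale[OF l])
    also have "\<dots> = (\<Sum>a\<in>E. if e = a then \<sigma> (\<chi> a) else 0)"
    proof (rule sum.cong[OF refl])
      fix a assume a: "a \<in> E"
      show "\<sigma> (\<chi> a) * f a = (if e = a then \<sigma> (\<chi> a) else 0)"
        unfolding e(2) E(5)[OF e(1) a] by (simp split: if_split)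
    qed
    also have "\<dots> = \<sigma> (\<chi> e)" using e(1) E(1) by (simp only: sum.delta' if_True)
    also have "\<dots> = \<sigma> f" unfolding e(2) ..
    finally show ?thesis .
  qed
  have expandF: "f x = (\<Sum>e\<in>E. f e * \<chi> e x)" if f: "linF f" for f x
  proof -
    have "f x = f (\<Sum>e\<in>E. scale (\<chi> e x) e)" by (rule arg_cong[OF E(4)])
    also have "\<dots> = (\<Sum>e\<in>E. f e * \<chi> e x)"
      unfolding lin_sum[OF f] lin_scale[OF f] by (rule sum.cong[OF refl], rule mult.commute)
    finally show ?thesis .
  qed
  have "gl g"
  proof (rule glI)
    have "\<epsilon> \<in> chars" using G.one_closed by (simp add: car) (simp add: char_group_def)
    moreover have "\<epsilon> \<in> K" using subgroup.one_closed[OF K(1)] by (simp add: char_group_def)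
    ultimately show "\<epsilon> g = 1" using val[of \<epsilon>] by (simp add: \<sigma>_def)
    fix f f' assume f: "linF f" and f': "linF f'"
    have "sw g (\<lambda>a b. f a * f' b) = sw g (\<lambda>a b. \<Sum>i\<in>E. \<Sum>j\<in>E. f i * f' j * (\<chi> i a * \<chi> j b))"
    proof (rule sw_cong)
      fix a b
      show "f a * f' b = (\<Sum>i\<in>E. \<Sum>j\<in>E. f i * f' j * (\<chi> i a * \<chi> j b))"
        unfolding expandF[OF f, of a] expandF[OF f', of b] sum_product by (simp only: ac_simps)
    qed
    also have "\<dots> = (\<Sum>i\<in>E. \<Sum>j\<in>E. f i * f' j * sw g (\<lambda>a b. \<chi> i a * \<chi> j b))"
      by (simp only: sw_sum smulF)
    also have "\<dots> = (\<Sum>i\<in>E. \<Sum>j\<in>E. f i * f' j * (\<chi> i g * \<chi> j g))"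
    proof (intro sum.cong refl)
      fix i j assume ij: "i \<in> E" "j \<in> E"
      have "sw g (\<lambda>a b. \<chi> i a * \<chi> j b) = (\<chi> i \<otimes>\<^bsub>?G\<^esub> \<chi> j) g" by (simp add: char_group_def)
      also have "\<dots> = \<sigma> (\<chi> i \<otimes>\<^bsub>?G\<^esub> \<chi> j)"
        by (rule val) (use G.m_closed[of "\<chi> i" "\<chi> j"] \<chi>c ij car in simp)
      finally show "f i * f' j * sw g (\<lambda>a b. \<chi> i a * \<chi> j b) = f i * f' j * (\<chi> i g * \<chi> j g)"
        using \<sigma>m[OF \<chi>c[OF ij(1)] \<chi>c[OF ij(2)]] val[OF \<chi>c[OF ij(1)]] val[OF \<chi>c[OF ij(2)]] by simp
    qed
    also have "\<dots> = f g * f' g"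
      unfolding expandF[OF f, of g] expandF[OF f', of g] sum_product by (simp only: ac_simps)
    finally show "sw g (\<lambda>a b. f a * f' b) = f g * f' g" .
  qed
  moreover have "g \<noteq> 1"
  proof
    assume g1: "g = 1"
    have "K \<noteq> chars" using K(2) card by auto
    then obtain f where f: "f \<in> chars" "f \<notin> K" using Ks by blast
    then have "(1::'k) = - 1" using val[OF f(1)] charsD(3)[OF f(1)] by (simp add: g1 \<sigma>_def)
    then show False by (simp add: eq_neg_iff_add_eq_0)
  qed
  ultimately show ?thesis by blast
qed

section \<open>Translation by a character\<close>

lemma T_T:
  assumes "linF f" "linF g"
  shows "T f (T g x) = T (\<lambda>x. sw x (\<lambda>a b. f a * g b)) x"
proof -
  have "T f (T g x) = sw x (\<lambda>p c. sw p (\<lambda>a b. scale (f b * g c) a))"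
    unfolding T_def[of g] sw_comp[OF linT[OF assms(1)]]
  proof (rule sw_cong)
    fix p c
    have "T f (scale (g c) p) = sw p (\<lambda>a b. scale (g c) (scale (f b) a))"
      unfolding lin_scale[OF linT[OF assms(1)]] smulE by (simp only: T_def)
    then show "T f (scale (g c) p) = sw p (\<lambda>a b. scale (f b * g c) a)"
      by (simp only: scale_scale mult.commute)
  qed
  also have "\<dots> = sw x (\<lambda>a q. sw q (\<lambda>b c. scale (f b * g c) a))"
    by (rule coassocE; intro lin_intros' assms)
  also have "\<dots> = T (\<lambda>x. sw x (\<lambda>a b. f a * g b)) x"
    unfolding T_def by (simp only: sw_comp[OF lin_kscale])
  finally show ?thesis .
qed

lemma T_\<epsilon>: "T \<epsilon> x = x"
  unfolding T_def by (rule sw_counit_right[OF vector_space_axioms lin_ident])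

lemma counit_T: "linF f \<Longrightarrow> \<epsilon> (T f x) = f x"
  using sw_counit_left[OF vector_space_mult, of f x]
  by (simp only: T_def sw_comp[OF lin\<epsilon>] lin_scale[OF lin\<epsilon>] mult.commute)

lemma T_char_mult:
  assumes f: "f \<in> chars"
  shows "T f (x * y) = T f x * T f y"
proof -
  have b: "bil scale (\<lambda>a b. scale (f b) a)" by (intro bilE lin_intros' charsD(1)[OF f])
  have "T f (x * y) = sw x (\<lambda>a b. sw y (\<lambda>c d. scale (f b) a * scale (f d) c))"
    unfolding T_def sw_mult[OF b] charsD(2)[OF f]
    by (simp only: scale_mult_left[symmetric] scale_mult_right[symmetric] scale_scale mult.commute)
  then show ?thesis
    unfolding T_def sw_comp[OF lin_mult_right[OF lin_ident]] by (simp only: sw_comp[OF lin_eta(2)])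
qed

lemma T_char_one: "f \<in> chars \<Longrightarrow> T f 1 = 1"
  using sw_one[OF bilE, of "\<lambda>a b. scale (f b) a"] charsD(1,3)[of f]
  by (simp add: T_def lin_intros')

lemma subalg_fixed: "f \<in> chars \<Longrightarrow> subalg {x. T f x = x}"
  unfolding subalg_def subspace_def
  by (auto simp: T_char_mult T_char_one lin_zero[OF linT] lin_add[OF linT] lin_scale[OF linT] charsD(1))

lemma \<epsilon>_chars: "\<epsilon> \<in> chars"
  by (simp add: chars_def lin\<epsilon> counit_mult counit_one)

lemma char_\<Lambda>:
  assumes f: "f \<in> chars" "f \<noteq> \<epsilon>"
  shows "f (\<Lambda>B UNIV) = 0"
proof -
  obtain h where h: "f h \<noteq> \<epsilon> h" using f(2) by blast
  have "f h * f (\<Lambda>B UNIV) = \<epsilon> h * f (\<Lambda>B UNIV)"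
    using arg_cong[OF \<Lambda>B_left[OF hsub_UNIV UNIV_I, of h], of f]
    by (simp only: charsD(2)[OF f(1)] lin_scale[OF charsD(1)[OF f(1)]])
  then show ?thesis using h by simp
qed

text \<open>Pair \<Lambda>_1 \<otimes> x \<Lambda>_2 = S(x) \<Lambda>_1 \<otimes> \<Lambda>_2 with
  \<open>lm\<close> and \<open>?m\<close>. On the left \<open>lm\<close> absorbs the first leg; on
  the right the integral property of \<open>?m\<close> applies.\<close>

lemma trace_T_mult:
  assumes f: "linF f"
  shows "trace UNIV (\<lambda>y. T f (x * y)) = f (\<Lambda>B UNIV) * lm x"
proof -
  let ?m = "\<lambda>x. trace UNIV (\<lambda>y. T f (x * y))" and ?L = "\<Lambda>B UNIV"
  have lmu: "linF ?m" by (intro lin_traceF lin_comp[OF linT[OF f]] lin_intros)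
  have L1: "lm ?L = 1" using dim_lm_\<Lambda>B[OF hsub_UNIV] n0 by simp
  have mL: "?m ?L = f ?L"
  proof -
    have "?m ?L = trace UNIV (\<lambda>y. scale (\<epsilon> y) (T f ?L))"
      by (rule trace_cong) (simp only: \<Lambda>B_right[OF hsub_UNIV] lin_scale[OF linT[OF f]])
    also have "\<dots> = f ?L" by (simp add: trace_rank1[OF fdim_UNIV lin\<epsilon>] counit_T[OF f])
    finally show ?thesis .
  qed
  have b: "bil (*) (\<lambda>a b. lm a * ?m b)" by (rule bil_k[OF lin_lm lmu])
  have "sw ?L (\<lambda>a b. lm a * ?m (x * b)) = sw ?L (\<lambda>a b. lm (S x * a) * ?m b)"
    by (rule sw_\<Lambda>B[OF hsub_UNIV b UNIV_I])
  moreover have "sw ?L (\<lambda>a b. lm a * ?m (x * b)) = ?m x"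
  proof -
    have "sw ?L (\<lambda>a b. lm a * ?m (x * b)) = ?m (x * T' lm ?L)"
      by (simp only: T'_def sw_comp[OF lin_eta(2)] sw_comp[OF lmu] scale_mult_right[symmetric] lin_scale[OF lmu])
    then show ?thesis unfolding lm_right L1 by simp
  qed
  moreover have "sw ?L (\<lambda>a b. lm (S x * a) * ?m b) = lm x * ?m ?L"
  proof -
    have "sw ?L (\<lambda>a b. lm (S x * a) * ?m b) = lm (S x * 1) * ?m ?L"
      by (rule trace_T_left_int[OF f]) (intro lin_comp[OF lin_lm] lin_eta)
    then show ?thesis by (simp only: mult_1_right lm_S)
  qed
  ultimately show ?thesis using mL by (simp only: mult.commute)
qed

context
  fixes \<alpha> assumes \<alpha>: "\<alpha> \<in> chars"
begin

lemma T_char_power: "\<exists>f\<in>chars. (T \<alpha> ^^ j) = T f"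
proof (induction j)
  case 0
  show ?case by (rule bexI[OF _ \<epsilon>_chars]) (simp add: T_\<epsilon> id_def fun_eq_iff)
next
  case (Suc j)
  then obtain f where f: "f \<in> chars" "(T \<alpha> ^^ j) = T f" by blast
  show ?case
    by (rule bexI[OF _ chars_mult[OF \<alpha> f(1)]]) (simp add: fun_eq_iff f(2) T_T[OF charsD(1)[OF \<alpha>] charsD(1)[OF f(1)]])
qed

lemma T_char_inj: "T \<alpha> x = T \<alpha> y \<Longrightarrow> x = y"
proof -
  assume e: "T \<alpha> x = T \<alpha> y"
  have lS: "linF (\<lambda>x. \<alpha> (S x))" by (rule lin_comp[OF charsD(1)[OF \<alpha>] linS])
  have "sw x (\<lambda>a b. \<alpha> (S a) * \<alpha> b) = \<epsilon> x" for x
    using sw_antipode_left[OF charsD(1)[OF \<alpha>], of x] by (simp add: charsD(2,3)[OF \<alpha>])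
  then have "T (\<lambda>x. \<alpha> (S x)) (T \<alpha> x) = x" for x
    by (simp add: T_T[OF lS charsD(1)[OF \<alpha>]] T_\<epsilon>)
  from this[of x] this[of y] show "x = y" unfolding e by simp
qed

lemma lin_T_char_power: "linE (T \<alpha> ^^ j)"
  by (rule lin_funpow[OF linT[OF charsD(1)[OF \<alpha>]]])

lemma T_char_power_mult: "(T \<alpha> ^^ j) (x * y) = (T \<alpha> ^^ j) x * (T \<alpha> ^^ j) y"
  by (induction j) (simp_all add: T_char_mult[OF \<alpha>])

lemma T_char_power_\<Lambda>:
  assumes "T \<alpha> ^^ j \<noteq> id" "(T \<alpha> ^^ j) = T f" "f \<in> chars"
  shows "f (\<Lambda>B UNIV) = 0"
proof (rule char_\<Lambda>[OF assms(3)])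
  show "f \<noteq> \<epsilon>"
  proof
    assume "f = \<epsilon>"
    then have "(T \<alpha> ^^ j) x = id x" for x unfolding assms(2) by (simp only: T_\<epsilon> id_apply)
    then have "T \<alpha> ^^ j = id" by (rule ext)
    then show False using assms(1) by blast
  qed
qed

text \<open>The translates of the integral by distinct powers of the character are orthogonal
  idempotents, hence the character has finite order.\<close>

lemma T_char_finite_order: "\<exists>d>0. T \<alpha> ^^ d = id"
proof (rule ccontr)
  assume n: "\<not> ?thesis"
  let ?L = "\<Lambda>B UNIV"
  define e where "e j = (T \<alpha> ^^ j) ?L" for j
  have LL: "?L * ?L = ?L" using \<Lambda>B_left[OF hsub_UNIV UNIV_I, of ?L] by (simp add: \<epsilon>_\<Lambda>B[OF hsub_UNIV])
  have L0: "?L \<noteq> 0" using \<epsilon>_\<Lambda>B[OF hsub_UNIV] lin_zero[OF lin\<epsilon>] by auto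
  have eps: "\<epsilon> (e k) = 0" if "k > 0" for k
  proof -
    obtain f where f: "f \<in> chars" "(T \<alpha> ^^ k) = T f" using T_char_power by blast
    have "f ?L = 0" using T_char_power_\<Lambda>[OF _ f(2,1)] n that by blast
    then show ?thesis by (simp add: e_def f(2) counit_T[OF charsD(1)[OF f(1)]])
  qed
  have ee: "e i * e i = e i" for i unfolding e_def T_char_power_mult[symmetric] LL ..
  have lt: "e i * e j = 0" "e j * e i = 0" if ij: "i < j" for i j
  proof -
    have "T \<alpha> ^^ j = (T \<alpha> ^^ i) \<circ> (T \<alpha> ^^ (j - i))" using ij by (simp only: funpow_add[symmetric]) simp
    then have ej: "e j = (T \<alpha> ^^ i) (e (j - i))" unfolding e_def by (simp only: comp_apply)
    have z: "?L * e (j - i) = 0" "e (j - i) * ?L = 0"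
      using ij by (simp_all add: \<Lambda>B_left[OF hsub_UNIV UNIV_I] \<Lambda>B_right[OF hsub_UNIV UNIV_I] eps)
    show "e i * e j = 0" "e j * e i = 0"
      unfolding ej by (simp_all add: e_def[of i] T_char_power_mult[symmetric] z lin_zero[OF lin_T_char_power])
  qed
  have e0: "e i \<noteq> 0" for i
  proof
    assume z: "e i = 0"
    have "(T \<alpha> ^^ i) x = 0 \<Longrightarrow> x = 0" for x
    proof (induction i)
      case (Suc i)
      then show ?case using T_char_inj[of "(T \<alpha> ^^ i) x" 0] by (simp add: lin_zero[OF linT[OF charsD(1)[OF \<alpha>]]])
    qed simp
    then show False using z L0 by (simp add: e_def)
  qed
  have orth: "i \<noteq> j \<Longrightarrow> e i * e j = 0" for i j using lt[of i j] lt[of j i] by (meson linorder_neqE_nat)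
  have inj: "inj e"
  proof (rule injI)
    fix i j assume "e i = e j"
    then have "e i * e j = e i" using ee[of i] by (simp only:)
    then show "i = j" using orth[of i j] e0[of i] by (cases "i = j") simp_all
  qed
  have "independent (e ` {..dH})"
    unfolding independent_explicit_module
  proof (intro allI impI)
    fix t u v assume t: "finite t" "t \<subseteq> e ` {..dH}" "(\<Sum>v\<in>t. scale (u v) v) = 0" "v \<in> t"
    then obtain i where i: "v = e i" by blast
    have "0 = v * (\<Sum>w\<in>t. scale (u w) w)" using t(3) by simp
    also have "\<dots> = (\<Sum>w\<in>t. scale (u w) (v * w))" by (simp add: sum_distrib_left scale_mult_right)
    also have "\<dots> = (\<Sum>w\<in>t. if v = w then scale (u w) w else 0)"
    proof (rule sum.cong[OF refl])
      fix w assume "w \<in> t"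
      then obtain j where j: "w = e j" using t(2) by blast
      show "scale (u w) (v * w) = (if v = w then scale (u w) w else 0)"
        using orth[of i j] ee[of i] by (cases "i = j") (simp_all add: i j inj_eq[OF inj])
    qed
    also have "\<dots> = scale (u v) v" using t(1,4) by simp
    finally show "u v = 0" using e0[of i] i by (metis scale_eq_0_iff)
  qed
  then have "card (e ` {..dH}) \<le> dim (UNIV :: 'h set)" by (rule independent_card_le_dim[OF subset_UNIV])
  moreover have "card (e ` {..dH}) = Suc dH" using card_image[OF inj_on_subset[OF inj subset_UNIV], of "{..dH}"] by simp
  ultimately show False by simp
qed

text \<open>With \<open>P\<close> the average over the powers of the translation, x \<mapsto> P(c x)
  is a projection onto c times the fixed algebra. In its trace only the power j = 0 survives,
  because a nontrivial character vanishes on the integral.\<close>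

lemma T_char_average:
  assumes d: "d > 0" "T \<alpha> ^^ d = id" "\<And>j. 0 < j \<Longrightarrow> j < d \<Longrightarrow> T \<alpha> ^^ j \<noteq> id"
    and c: "T \<alpha> c = c" "c * c = c"
  shows "of_nat (d * dim {c * x | x. T \<alpha> x = x}) = lm c"
proof -
  define P where "P x = scale (1 / of_nat d) (\<Sum>j<d. (T \<alpha> ^^ j) x)" for x
  have lP: "linE P"
    unfolding P_def by (intro lin_scale_right vector_space_axioms lin_SUM lin_T_char_power)
  have AP: "T \<alpha> (P x) = P x" for x
  proof -
    have "T \<alpha> (\<Sum>j<d. (T \<alpha> ^^ j) x) + x = (\<Sum>j<Suc d. (T \<alpha> ^^ j) x)"
      unfolding sum.lessThan_Suc_shift by (simp add: lin_sum[OF linT[OF charsD(1)[OF \<alpha>]]] add.commute)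
    then have "T \<alpha> (\<Sum>j<d. (T \<alpha> ^^ j) x) = (\<Sum>j<d. (T \<alpha> ^^ j) x)" by (simp add: d(2))
    then show ?thesis by (simp add: P_def lin_scale[OF linT[OF charsD(1)[OF \<alpha>]]])
  qed
  have fixp: "(T \<alpha> ^^ j) x = x" if "T \<alpha> x = x" for x j using that by (induction j) simp_all
  have Pfix: "P x = x" if "T \<alpha> x = x" for x
    using d(1) by (simp add: P_def fixp[OF that] sum_constant_scale del: sum_constant)
  have Pc: "P (c * x) = c * P x" for x
    by (simp only: P_def T_char_power_mult fixp[OF c(1)] sum_distrib_left[symmetric] scale_mult_right)
  let ?E = "\<lambda>x. P (c * x)"
  have lE: "linE ?E" by (rule lin_comp[OF lP lin_eta(2)])
  have idem: "?E (?E x) = ?E x" for x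
  proof -
    have "?E (?E x) = c * c * P (P x)" by (simp only: Pc mult.assoc)
    then show ?thesis by (simp add: c(2) Pfix[OF AP] Pc)
  qed
  have "?E ` UNIV = {c * x | x. T \<alpha> x = x}"
  proof (intro equalityI subsetI)
    fix y assume "y \<in> {c * x | x. T \<alpha> x = x}"
    then obtain x where x: "y = c * x" "T \<alpha> x = x" by blast
    then have "y = ?E x" by (simp add: Pc Pfix)
    then show "y \<in> ?E ` UNIV" by blast
  next
    fix y assume "y \<in> ?E ` UNIV"
    then show "y \<in> {c * x | x. T \<alpha> x = x}" using AP Pc by auto
  qed
  then have "of_nat (dim {c * x | x. T \<alpha> x = x}) = trace UNIV ?E"
    using trace_idem[OF fdim_UNIV lE _ idem] by simp
  also have "\<dots> = 1 / of_nat d * (\<Sum>j<d. trace UNIV (\<lambda>x. (T \<alpha> ^^ j) (c * x)))"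
    unfolding P_def trace_scale trace_sum ..
  also have "(\<Sum>j<d. trace UNIV (\<lambda>x. (T \<alpha> ^^ j) (c * x))) = (\<Sum>j<d. if j = 0 then lm c else 0)"
  proof (rule sum.cong[OF refl])
    fix j assume j: "j \<in> {..<d}"
    show "trace UNIV (\<lambda>x. (T \<alpha> ^^ j) (c * x)) = (if j = 0 then lm c else 0)"
    proof (cases "j = 0")
      case True
      then show ?thesis by (simp add: lm_def)
    next
      case False
      obtain f where f: "f \<in> chars" "(T \<alpha> ^^ j) = T f" using T_char_power by blast
      have "f (\<Lambda>B UNIV) = 0" using T_char_power_\<Lambda>[OF _ f(2,1)] d(3)[of j] False j by simp
      then show ?thesis using False by (simp add: f(2) trace_T_mult[OF charsD(1)[OF f(1)]])
    qed
  qed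
  also have "\<dots> = lm c" using d(1) by simp
  finally show ?thesis using d(1) by simp
qed

text \<open>Both conclusions come from \<open>T_char_average\<close>: for c = \<Lambda>_B its right
  side is dim H / dim B, and for c = 1 it is dim H.\<close>

lemma char_order:
  assumes B: "hsub B" and fixB: "\<And>x. x \<in> B \<Longrightarrow> T \<alpha> x = x"
  obtains d where "d > 0" "T \<alpha> ^^ d = id" "\<And>j. 0 < j \<Longrightarrow> j < d \<Longrightarrow> T \<alpha> ^^ j \<noteq> id"
    "d * dim B dvd dH" "d * dim {x. T \<alpha> x = x} = dH"
proof -
  obtain d0 where d0: "d0 > 0 \<and> T \<alpha> ^^ d0 = id" using T_char_finite_order by blast
  define d where "d = (LEAST n. n > 0 \<and> T \<alpha> ^^ n = id)"
  have d: "d > 0" "T \<alpha> ^^ d = id"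
    using LeastI[of "\<lambda>n. n > 0 \<and> T \<alpha> ^^ n = id", OF d0] unfolding d_def by blast+
  have min: "T \<alpha> ^^ j \<noteq> id" if "0 < j" "j < d" for j
    using not_less_Least[of j "\<lambda>n. n > 0 \<and> T \<alpha> ^^ n = id"] that unfolding d_def by blast
  note avg = T_char_average[OF d min]
  have LB: "\<Lambda>B B \<in> B" by (rule \<Lambda>B_mem[OF subalgD(1)[OF hsubD(1)[OF B]]])
  have idem: "\<Lambda>B B * \<Lambda>B B = \<Lambda>B B" using \<Lambda>B_left[OF B LB] by (simp add: \<epsilon>_\<Lambda>B[OF B])
  let ?k = "dim {\<Lambda>B B * x | x. T \<alpha> x = x}"
  have "of_nat (d * ?k) = lm (\<Lambda>B B)" by (rule avg[OF _ _ fixB[OF LB] idem]) simp_all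
  then have "(of_nat (d * ?k * dim B) :: 'k) = of_nat dH"
    unfolding of_nat_mult[of "d * ?k"] using dim_lm_\<Lambda>B[OF B] by (simp only:)
  then have "d * ?k * dim B = dH" by (simp only: of_nat_eq_iff)
  then have "dH = d * dim B * ?k" by (simp only: ac_simps)
  then have 1: "d * dim B dvd dH" by (rule dvdI)
  have "of_nat (d * dim {1 * x | x. T \<alpha> x = x}) = lm 1"
    by (rule avg[OF _ _ T_char_one[OF \<alpha>]]) simp_all
  then have "(of_nat (d * dim {x. T \<alpha> x = x}) :: 'k) = of_nat dH" by (simp only: lm_one mult_1) simp
  then have 2: "d * dim {x. T \<alpha> x = x} = dH" by (simp only: of_nat_eq_iff)
  show thesis by (rule that[OF d min 1 2])
qed

end

subsection \<open>Two-dimensional Yetter--Drinfeld submodules without grouplike elements\<close>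

lemma sw_T:
  assumes F: "bil s' F" and f: "linF f"
  shows "sw (T f x) F = sw x (\<lambda>a y. F a (T f y))"
proof -
  have l: "lin scale s' (\<lambda>x. F x y)" "lin scale s' (\<lambda>y. F x y)" and vs: "vector_space s'" for x y
    using F by (auto simp: bil_def)
  have "sw (T f x) F = sw x (\<lambda>p c. sw p (\<lambda>a b. s' (f c) (F a b)))"
    unfolding T_def sw_comp[OF sw_linear[OF F]] lin_scale[OF sw_linear[OF F]] sw_smul[OF vs] ..
  also have "\<dots> = sw x (\<lambda>a q. sw q (\<lambda>b c. s' (f c) (F a b)))"
    by (rule sw_coassoc[OF vs]; intro lin_scale_right lin_scale_gen vs l f)
  also have "\<dots> = sw x (\<lambda>a y. F a (T f y))"
    unfolding T_def by (simp only: sw_comp[OF l(2)] lin_scale[OF l(2)])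
  finally show ?thesis .
qed

lemma sw_T':
  assumes F: "bil s' F" and f: "linF f"
  shows "sw (T' f x) F = sw x (\<lambda>a y. F (T' f a) y)"
proof -
  have l: "lin scale s' (\<lambda>x. F x y)" "lin scale s' (\<lambda>y. F x y)" and vs: "vector_space s'" for x y
    using F by (auto simp: bil_def)
  have "sw (T' f x) F = sw x (\<lambda>c q. sw q (\<lambda>a b. s' (f c) (F a b)))"
    unfolding T'_def sw_comp[OF sw_linear[OF F]] lin_scale[OF sw_linear[OF F]] sw_smul[OF vs] ..
  also have "\<dots> = sw x (\<lambda>p b. sw p (\<lambda>c a. s' (f c) (F a b)))"
    by (rule sw_coassoc[OF vs, symmetric]; intro lin_scale_right lin_scale_gen vs l f)
  also have "\<dots> = sw x (\<lambda>a y. F (T' f a) y)"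
    unfolding T'_def by (simp only: sw_comp[OF l(1)] lin_scale[OF l(1)])
  finally show ?thesis .
qed

text \<open>The product x_1 x_3 S(x_2) collapses because S^2 = id. The identity ties the adjoint
  action to the coaction and computes \<alpha> on coefficients below.\<close>

lemma sw_ad_self: "sw x ad = x"
proof -
  have "sw x (\<lambda>p q. ad p q) = sw x (\<lambda>a y. sw y (\<lambda>c q. a * (q * S c)))"
    unfolding ad_def mult.assoc by (rule coassocE; intro lin_intros')
  also have "\<dots> = x * 1"
    by (rule sw_cancel23'(1)[of scale "\<lambda>x m. x * m"]) (intro bilE lin_intros')
  finally show ?thesis by simp
qed

lemma ad_prod_weights:
  assumes "\<And>h. ad h x = scale (f h) x" "\<And>h. ad h y = scale (g h) y"
  shows "ad h (x * y) = scale (sw h (\<lambda>a b. f a * g b)) (x * y)"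
  unfolding ad_prod assms
  by (simp only: scale_mult_left[symmetric] scale_mult_right[symmetric] scale_scale sw_comp[OF lin_kscale] mult.commute)

lemma bil_ad': "bil scale ad"
  by (intro bilE lin_ad)

lemma char_S_right: "\<alpha> \<in> chars \<Longrightarrow> sw h (\<lambda>a b. \<alpha> a * \<alpha> (S b)) = \<epsilon> h"
  using sw_antipode_right[OF charsD(1), of \<alpha> h] by (simp add: charsD(2,3))

text \<open>If \<open>ad\<close> acts on \<open>w\<close> by \<open>\<alpha>\<close>, then \<open>h\<^sub>1 b \<otimes> h\<^sub>2 w = b h\<^sub>1 \<otimes> w h\<^sub>2\<close> becomes a commutation rule after
  multiplying the second leg by \<open>S(h\<^sub>3)\<close>.\<close>

lemma cancel_weight:
  assumes w: "\<And>h. ad h w = scale (\<alpha> h) w" and \<alpha>: "linF \<alpha>" and \<omega>: "linF \<omega>" "\<omega> w = 1" and l: "linE \<psi>" "linE \<phi>"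
    and eq: "\<And>F h. bil scale F \<Longrightarrow> sw h (\<lambda>p q. F (\<psi> p) (q * w)) = sw h (\<lambda>p q. F (\<phi> p) (w * q))"
  shows "\<psi> (T \<alpha> h) = \<phi> h"
proof -
  note lo = lin_comp[OF \<omega>(1)]
  have b: "bil scale (\<lambda>u v. scale (\<omega> (v * S y)) u)" for y by (intro bilE lin_intros' lo)
  have "\<psi> (T \<alpha> h) = sw h (\<lambda>p t. scale (\<omega> (ad t w)) (\<psi> p))"
    by (simp only: T_def sw_comp[OF l(1)] lin_scale[OF l(1)] w lin_scale[OF \<omega>(1)] \<omega>(2) mult_1_right)
  also have "\<dots> = sw h (\<lambda>p t. sw t (\<lambda>q y. scale (\<omega> (q * w * S y)) (\<psi> p)))"
    by (simp only: ad_def sw_comp[OF \<omega>(1)] sw_comp[OF lin_kscale])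
  also have "\<dots> = sw h (\<lambda>x y. sw x (\<lambda>p q. scale (\<omega> (q * w * S y)) (\<psi> p)))"
    by (rule sw_coassoc[OF vector_space_axioms, symmetric]; intro lin_intros' lo l)
  also have "\<dots> = sw h (\<lambda>x y. sw x (\<lambda>p q. scale (\<omega> (w * q * S y)) (\<phi> p)))"
    by (rule sw_cong) (rule eq[OF b])
  also have "\<dots> = sw h (\<lambda>p t. sw t (\<lambda>q y. scale (\<omega> (w * (q * S y))) (\<phi> p)))"
    unfolding mult.assoc by (rule sw_coassoc[OF vector_space_axioms]; intro lin_intros' lo l)
  also have "\<dots> = sw h (\<lambda>p t. scale (\<epsilon> t) (\<phi> p))"
  proof (rule sw_cong)
    fix p t
    have "linE (\<lambda>m. scale (\<omega> (w * m)) (\<phi> p))" by (intro lin_intros' lo)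
    from sw_antipode_right[OF this, of t]
    show "sw t (\<lambda>q y. scale (\<omega> (w * (q * S y))) (\<phi> p)) = scale (\<epsilon> t) (\<phi> p)" by (simp add: \<omega>(2))
  qed
  also have "\<dots> = \<phi> h" by (rule sw_counit_right[OF vector_space_axioms l(2)])
  finally show ?thesis .
qed

end

text \<open>\<open>V\<close> has the basis \<open>z, w\<close>, with \<open>z\<close> central and \<open>w\<close> an eigenvector of \<open>ad\<close>. Its coalgebra
  of coefficients is spanned by \<open>z, w\<close> and \<open>b = T \<omega> z\<close>, \<open>d = T \<omega> w\<close>.\<close>

locale yd_pair = inv_hopf scale comult counit antipode Basis
  for scale :: "'k::{alg_closed_field, field_char_0} \<Rightarrow> 'h::ring_1 \<Rightarrow> 'h"
    and comult counit antipode and Basis :: "'h set" +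
  fixes V :: "'h set" and z w :: 'h and \<alpha> \<omega> :: "'h \<Rightarrow> 'k"
  assumes V: "ydsimple UNIV V" "dim V = 2" "\<And>x. x \<in> V \<Longrightarrow> lm x = 0" "\<And>g. g \<in> V \<Longrightarrow> \<not> gl g"
    and z: "z \<in> V" "\<epsilon> z = 1" "\<And>h. h * z = z * h"
    and w: "w \<in> V" "\<epsilon> w = 0" "w \<noteq> 0" "\<And>h. ad h w = scale (\<alpha> h) w"
    and \<omega>: "linF \<omega>" "\<omega> z = 0" "\<omega> w = 1" "\<And>y. y \<in> V \<Longrightarrow> y = scale (\<epsilon> y) z + scale (\<omega> y) w"
    and \<alpha>: "\<alpha> \<in> chars" and dH: "dH = 54" and nn: "\<not> has_normal"
begin

section \<open>The coefficient matrix of \<open>V\<close> and the values of \<alpha>\<close>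

abbreviation "bb \<equiv> T \<omega> z"
abbreviation "dd \<equiv> T \<omega> w"

lemmas l\<alpha> = charsD(1)[OF \<alpha>]
lemmas \<alpha>m = charsD(2)[OF \<alpha>]
lemmas \<alpha>1 = charsD(3)[OF \<alpha>]

lemma Vlc: "lcoid V" by (rule ydsubD(1)[OF ydsimpleD(1)[OF V(1)]])

text \<open>The second leg stays in \<open>V\<close> and expands in z, w. With \<open>sw_T_V\<close>
  this says that the coproduct of each entry of the matrix ((z, bb), (w, dd)) is given by matrix
  multiplication.\<close>

lemma sw_V:
  assumes x: "x \<in> V" and F: "bil s' F"
  shows "sw x F = F x z + F (T \<omega> x) w"
proof -
  have l: "lin scale s' (\<lambda>x. F x y)" "lin scale s' (\<lambda>y. F x y)" and vs: "vector_space s'" for x y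
    using F by (auto simp: bil_def)
  have "bil s' (\<lambda>a y. s' (\<epsilon> y) (F a z) + s' (\<omega> y) (F a w))"
    by (intro bilI vs lin_plus lin_scale_gen lin_scale_right l lin\<epsilon> \<omega>(1))
  then have "sw x F = sw x (\<lambda>a y. s' (\<epsilon> y) (F a z) + s' (\<omega> y) (F a w))"
  proof (rule sw_lcoid_cong[OF Vlc x F])
    fix a y assume "y \<in> V"
    from \<omega>(4)[OF this] have "F a y = F a (scale (\<epsilon> y) z + scale (\<omega> y) w)" by (rule arg_cong)
    then show "F a y = s' (\<epsilon> y) (F a z) + s' (\<omega> y) (F a w)"
      by (simp only: lin_add[OF l(2)] lin_scale[OF l(2)])
  qed
  also have "\<dots> = F x z + F (T \<omega> x) w"
    unfolding sw_add sw_counit_right[OF vs l(1)] T_def by (simp only: sw_comp[OF l(1)] lin_scale[OF l(1)])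
  finally show ?thesis .
qed

lemma sw_T_V:
  assumes x: "x \<in> V" and F: "bil s' F"
  shows "sw (T \<omega> x) F = F x bb + F (T \<omega> x) dd"
proof -
  have l: "lin scale s' (\<lambda>x. F x y)" "lin scale s' (\<lambda>y. F x y)" and vs: "vector_space s'" for x y
    using F by (auto simp: bil_def)
  have b: "bil s' (\<lambda>a y. F a (T \<omega> y))" by (intro bilI vs l lin_comp[OF l(2) linT[OF \<omega>(1)]])
  show ?thesis unfolding sw_T[OF F \<omega>(1)] sw_V[OF x b] ..
qed

lemmas sw_C = sw_V[OF z(1)] sw_V[OF w(1)] sw_T_V[OF z(1)] sw_T_V[OF w(1)]

lemma sw_SC:
  assumes F: "bil s' F"
  shows "sw (S z) F = F (S z) (S z) + F (S w) (S bb)" "sw (S w) F = F (S z) (S w) + F (S w) (S dd)"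
    "sw (S bb) F = F (S bb) (S z) + F (S dd) (S bb)" "sw (S dd) F = F (S bb) (S w) + F (S dd) (S dd)"
proof -
  have l: "lin scale s' (\<lambda>x. F x y)" "lin scale s' (\<lambda>y. F x y)" and vs: "vector_space s'" for x y
    using F by (auto simp: bil_def)
  have b: "bil s' (\<lambda>x y. F (S y) (S x))" by (intro bilI vs lin_comp[OF l(1) linS] lin_comp[OF l(2) linS])
  show "sw (S z) F = F (S z) (S z) + F (S w) (S bb)" "sw (S w) F = F (S z) (S w) + F (S w) (S dd)"
    "sw (S bb) F = F (S bb) (S z) + F (S dd) (S bb)" "sw (S dd) F = F (S bb) (S w) + F (S dd) (S dd)"
    unfolding sw_S[OF F] sw_C[OF b] by (rule refl)+
qed

lemma \<epsilon>_bd: "\<epsilon> bb = 0" "\<epsilon> dd = 1"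
  using \<omega>(1-3) by (simp_all add: counit_T)

lemma ad_z: "ad h z = scale (\<epsilon> h) z"
  using central_iff_ad[of z] z(3) by blast

text \<open>Apply x = ad(x_1)(x_2) to z and to w and compare the coefficients of w.\<close>

lemma \<alpha>_bd: "\<alpha> bb = 0" "\<alpha> dd = 1"
proof -
  have "ad z z + ad bb w = z" using sw_ad_self[of z] unfolding sw_C(1)[OF bil_ad'] .
  then show "\<alpha> bb = 0" using w(3) by (simp add: ad_z w(4) z(2))
  have "ad w z + ad dd w = w" using sw_ad_self[of w] unfolding sw_C(2)[OF bil_ad'] .
  then have "scale (\<alpha> dd) w = scale 1 w" by (simp add: ad_z w(4) w(2))
  then show "\<alpha> dd = 1" using w(3) by (simp only: scale_cancel_right) simp
qed

lemma mult_w: "h * w = w * T' \<alpha> h"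
proof -
  have "h * w = sw h (\<lambda>p q. scale (\<alpha> p) w * q)" unfolding mult_ad[of h w] w(4) ..
  also have "\<dots> = w * T' \<alpha> h"
    by (simp only: T'_def sw_comp[OF lin_eta(2)] scale_mult_left[symmetric] scale_mult_right[symmetric])
  finally show ?thesis .
qed

text \<open>If \<alpha>(w) is nonzero, \<alpha> applied to \<open>mult_w\<close> makes \<alpha>
  idempotent under convolution. Translation by \<alpha> is then idempotent and injective, hence
  trivial, so that \<alpha>(w) = \<epsilon>(w) = 0.\<close>

lemma \<alpha>_w: "\<alpha> w = 0"
proof (rule ccontr)
  assume a: "\<alpha> w \<noteq> 0"
  have "\<alpha> h = sw h (\<lambda>a b. \<alpha> a * \<alpha> b)" for h
  proof -
    have "\<alpha> h * \<alpha> w = \<alpha> w * \<alpha> (T' \<alpha> h)" using arg_cong[OF mult_w[of h], of \<alpha>] by (simp only: \<alpha>m)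
    then have "\<alpha> h = \<alpha> (T' \<alpha> h)" using a by simp
    then show ?thesis by (simp only: T'_def sw_comp[OF l\<alpha>] lin_scale[OF l\<alpha>])
  qed
  then have "(\<lambda>h. sw h (\<lambda>a b. \<alpha> a * \<alpha> b)) = \<alpha>" by (intro ext) (rule sym)
  then have "T \<alpha> (T \<alpha> x) = T \<alpha> x" for x by (simp only: T_T[OF l\<alpha> l\<alpha>])
  then have "T \<alpha> w = w" by (rule T_char_inj[OF \<alpha>])
  then have "\<alpha> w = \<epsilon> w" using counit_T[OF l\<alpha>, of w] by (simp only:)
  then show False using a w(2) by simp
qed

text \<open>Compare the coproducts of h z and z h. The terms ending in z cancel by centrality and
  leave h_1 bb \<otimes> h_2 w = bb h_1 \<otimes> w h_2, to which \<open>cancel_weight\<close>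
  applies; \<open>mult_d\<close> follows likewise from \<open>mult_w\<close>.\<close>

lemma mult_b: "T \<alpha> h * bb = bb * h"
proof (rule cancel_weight[OF w(4) l\<alpha> \<omega>(1,3), where \<psi> = "\<lambda>p. p * bb" and \<phi> = "\<lambda>p. bb * p"])
  fix F :: "'h \<Rightarrow> 'h \<Rightarrow> 'h" and h assume F: "bil scale F"
  have l: "linE (\<lambda>x. F x y)" "linE (\<lambda>y. F x y)" for x y using F by (auto simp: bil_def)
  note lF = lin_comp[OF l(1)] lin_comp[OF l(2)]
  have b: "bil scale (\<lambda>c d. F (p * c) (q * d))" "bil scale (\<lambda>p q. sw h (\<lambda>c d. F (p * c) (q * d)))" for p q
    by (intro bilE lF lin_intros')+
  have "sw h (\<lambda>p q. F (p * z) (q * z)) + sw h (\<lambda>p q. F (p * bb) (q * w)) = sw (h * z) F"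
    unfolding sw_mult[OF F] sw_C(1)[OF b(1)] sw_add ..
  also have "\<dots> = sw (z * h) F" unfolding z(3)[of h] ..
  also have "\<dots> = sw h (\<lambda>p q. F (z * p) (z * q)) + sw h (\<lambda>p q. F (bb * p) (w * q))"
    unfolding sw_mult[OF F] sw_C(1)[OF b(2)] ..
  finally show "sw h (\<lambda>p q. F (p * bb) (q * w)) = sw h (\<lambda>p q. F (bb * p) (w * q))" by (simp only: z(3) add_left_cancel)
qed (intro lin_intros')+

lemma mult_d: "T \<alpha> h * dd = dd * T' \<alpha> h"
proof (rule cancel_weight[OF w(4) l\<alpha> \<omega>(1,3), where \<psi> = "\<lambda>p. p * dd" and \<phi> = "\<lambda>p. dd * T' \<alpha> p"])
  fix F :: "'h \<Rightarrow> 'h \<Rightarrow> 'h" and h assume F: "bil scale F"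
  have l: "linE (\<lambda>x. F x y)" "linE (\<lambda>y. F x y)" for x y using F by (auto simp: bil_def)
  note lF = lin_comp[OF l(1)] lin_comp[OF l(2)]
  have b: "bil scale (\<lambda>c d. F (p * c) (q * d))" "bil scale (\<lambda>p q. sw h (\<lambda>c d. F (p * c) (q * d)))"
    "bil scale (\<lambda>c d. F (p * c) (q * d))" for p q h
    by (intro bilE lF lin_intros')+
  have "sw h (\<lambda>p q. F (p * w) (q * z)) + sw h (\<lambda>p q. F (p * dd) (q * w)) = sw (h * w) F"
    unfolding sw_mult[OF F] sw_C(2)[OF b(1)] sw_add ..
  also have "\<dots> = sw (w * T' \<alpha> h) F" unfolding mult_w[of h] ..
  also have "\<dots> = sw (T' \<alpha> h) (\<lambda>p q. F (w * p) (z * q)) + sw (T' \<alpha> h) (\<lambda>p q. F (dd * p) (w * q))"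
    unfolding sw_mult[OF F] sw_C(2)[OF b(2)] ..
  also have "\<dots> = sw h (\<lambda>p q. F (w * T' \<alpha> p) (z * q)) + sw h (\<lambda>p q. F (dd * T' \<alpha> p) (w * q))"
    unfolding sw_T'[OF b(3) l\<alpha>] ..
  finally show "sw h (\<lambda>p q. F (p * dd) (q * w)) = sw h (\<lambda>p q. F (dd * T' \<alpha> p) (w * q))"
    by (simp only: mult_w[symmetric] z(3) add_left_cancel)
qed (intro lin_intros' lin_comp[OF lin_eta(2) linT'] l\<alpha>)+

lemma antipode_relations:
  "z * S z + bb * S w = 1" "w * S z + dd * S w = 0" "z * S bb + bb * S dd = 0" "w * S bb + dd * S dd = 1"
proof -
  have b: "bil scale (\<lambda>p q. p * S q)" by (intro bilE lin_intros')
  show "z * S z + bb * S w = 1" "w * S z + dd * S w = 0" "z * S bb + bb * S dd = 0" "w * S bb + dd * S dd = 1"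
    unfolding sw_C[OF b, symmetric] sw_antipode_right[OF lin_ident]
    by (simp_all add: z(2) w(2) \<epsilon>_bd)
qed

lemma \<alpha>_S: "\<alpha> z * \<alpha> (S z) = 1" "\<alpha> (S w) = 0" "\<alpha> (S bb) = 0" "\<alpha> (S dd) = 1"
proof -
  have z0: "\<alpha> 0 = 0" by (rule lin_zero[OF l\<alpha>])
  have z1: "\<alpha> z * \<alpha> (S z) = 1"
    using arg_cong[OF antipode_relations(1), of \<alpha>] by (simp add: lin_add[OF l\<alpha>] \<alpha>m \<alpha>1 \<alpha>_bd)
  then show "\<alpha> z * \<alpha> (S z) = 1" .
  show "\<alpha> (S w) = 0"
    using arg_cong[OF antipode_relations(2), of \<alpha>] by (simp add: lin_add[OF l\<alpha>] \<alpha>m z0 \<alpha>_bd \<alpha>_w)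
  have "\<alpha> z * \<alpha> (S bb) = 0"
    using arg_cong[OF antipode_relations(3), of \<alpha>] by (simp add: lin_add[OF l\<alpha>] \<alpha>m z0 \<alpha>_bd)
  then show "\<alpha> (S bb) = 0" using z1 by auto
  show "\<alpha> (S dd) = 1"
    using arg_cong[OF antipode_relations(4), of \<alpha>] by (simp add: lin_add[OF l\<alpha>] \<alpha>m \<alpha>1 \<alpha>_bd \<alpha>_w)
qed

lemma Sz_central: "h * S z = S z * h"
  using arg_cong[OF z(3)[of "S h"], of S] by (simp add: S_mult SS)

lemma ad_Sz: "ad h (S z) = scale (\<epsilon> h) (S z)"
  using central_iff_ad[of "S z"] Sz_central by blast

text \<open>Applying S to \<open>mult_b\<close> gives a commutation rule for S bb, and this makes it
  an eigenvector of ad for the inverse character.\<close>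

lemma ad_Sb: "ad h (S bb) = scale (\<alpha> (S h)) (S bb)"
proof -
  have lS: "linF (\<lambda>x. \<alpha> (S x))" by (rule lin_comp[OF l\<alpha> linS])
  have 1: "p * S bb = S bb * T' (\<lambda>x. \<alpha> (S x)) p" for p
  proof -
    have "bil scale (\<lambda>a b. scale (\<alpha> b) a)" by (intro bilE lin_intros' l\<alpha>)
    from sw_S[OF this, of p] have "S (T \<alpha> (S p)) = T' (\<lambda>x. \<alpha> (S x)) p"
      by (simp only: T_def T'_def sw_comp[OF linS] lin_scale[OF linS] SS)
    then show ?thesis using arg_cong[OF mult_b[of "S p"], of S] by (simp only: S_mult SS)
  qed
  have "ad h (S bb) = sw h (\<lambda>p q. sw p (\<lambda>x y. scale (\<alpha> (S x)) (S bb * (y * S q))))"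
    unfolding ad_def 1 T'_def
    by (simp only: sw_comp[OF lin_eta(2)] sw_comp[OF lin_mult_right[OF lin_ident]] scale_mult_left[symmetric]
        scale_mult_right[symmetric] mult.assoc)
  also have "\<dots> = sw h (\<lambda>x t. sw t (\<lambda>y q. scale (\<alpha> (S x)) (S bb * (y * S q))))"
    by (rule coassocE; intro lin_intros' lS)
  also have "\<dots> = sw h (\<lambda>x t. scale (\<epsilon> t) (scale (\<alpha> (S x)) (S bb)))"
  proof (rule sw_cong)
    fix x t
    have "linE (\<lambda>m. scale (\<alpha> (S x)) (S bb * m))" by (intro lin_intros')
    from sw_antipode_right[OF this, of t]
    show "sw t (\<lambda>y q. scale (\<alpha> (S x)) (S bb * (y * S q))) = scale (\<epsilon> t) (scale (\<alpha> (S x)) (S bb))" by simp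
  qed
  also have "\<dots> = scale (\<alpha> (S h)) (S bb)"
    by (rule sw_counit_right[OF vector_space_axioms]) (intro lin_intros' lS)
  finally show ?thesis .
qed

lemma ad_y:
  "ad h (z * S z) = scale (\<epsilon> h) (z * S z)" "ad h (z * S bb) = scale (\<alpha> (S h)) (z * S bb)"
  "ad h (w * S z) = scale (\<alpha> h) (w * S z)" "ad h (w * S bb) = scale (\<epsilon> h) (w * S bb)"
proof -
  have lS: "linF (\<lambda>x. \<alpha> (S x))" by (rule lin_comp[OF l\<alpha> linS])
  show "ad h (z * S z) = scale (\<epsilon> h) (z * S z)"
    unfolding ad_prod_weights[OF ad_z ad_Sz] sw_counit_left[OF vector_space_mult lin\<epsilon>] ..
  show "ad h (z * S bb) = scale (\<alpha> (S h)) (z * S bb)"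
    unfolding ad_prod_weights[OF ad_z ad_Sb] sw_counit_left[OF vector_space_mult lS] ..
  have "sw h (\<lambda>a b. \<alpha> a * \<epsilon> b) = \<alpha> h"
    using sw_counit_right[OF vector_space_mult l\<alpha>, of h] by (simp only: mult.commute)
  then show "ad h (w * S z) = scale (\<alpha> h) (w * S z)"
    unfolding ad_prod_weights[OF w(4) ad_Sz] by (simp only:)
  show "ad h (w * S bb) = scale (\<epsilon> h) (w * S bb)"
    unfolding ad_prod_weights[OF w(4) ad_Sb] char_S_right[OF \<alpha>] ..
qed

lemma sw_products:
  assumes F: "bil s' F"
  shows "sw (z * S z) F = F (z * S z) (z * S z) + F (z * S w) (z * S bb) + (F (bb * S z) (w * S z) + F (bb * S w) (w * S bb))"
    "sw (w * S z) F = F (w * S z) (z * S z) + F (w * S w) (z * S bb) + (F (dd * S z) (w * S z) + F (dd * S w) (w * S bb))"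
    "sw (z * S bb) F = F (z * S bb) (z * S z) + F (z * S dd) (z * S bb) + (F (bb * S bb) (w * S z) + F (bb * S dd) (w * S bb))"
    "sw (w * S bb) F = F (w * S bb) (z * S z) + F (w * S dd) (z * S bb) + (F (dd * S bb) (w * S z) + F (dd * S dd) (w * S bb))"
proof -
  have l: "lin scale s' (\<lambda>x. F x y)" "lin scale s' (\<lambda>y. F x y)" and vs: "vector_space s'" for x y
    using F by (auto simp: bil_def)
  note lF = lin_comp[OF l(1)] lin_comp[OF l(2)]
  have b: "bil s' (\<lambda>c d. F (p * c) (q * d))" for p q
    by (intro bilI vs lF lin_intros')
  have b2: "bil s' (\<lambda>p q. F (p * t) (q * t') + F (p * r) (q * r'))" for t t' r r'
    by (intro bilI vs lin_plus lF lin_intros')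
  show "sw (z * S z) F = F (z * S z) (z * S z) + F (z * S w) (z * S bb) + (F (bb * S z) (w * S z) + F (bb * S w) (w * S bb))"
    "sw (w * S z) F = F (w * S z) (z * S z) + F (w * S w) (z * S bb) + (F (dd * S z) (w * S z) + F (dd * S w) (w * S bb))"
    "sw (z * S bb) F = F (z * S bb) (z * S z) + F (z * S dd) (z * S bb) + (F (bb * S bb) (w * S z) + F (bb * S dd) (w * S bb))"
    "sw (w * S bb) F = F (w * S bb) (z * S z) + F (w * S dd) (z * S bb) + (F (dd * S bb) (w * S z) + F (dd * S dd) (w * S bb))"
    unfolding sw_mult[OF F] sw_SC[OF b] sw_C[OF b2] by (simp_all only: ac_simps)
qed

text \<open>The products of z, w with S z, S bb are eigenvectors of ad and span a left coideal.
  Applying x = ad(x_1)(x_2) to two of them, every term but one vanishes, and the remaining one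
  carries the factor \<alpha>(S z).\<close>

lemma \<alpha>_Sz_fix: "scale (\<alpha> (S z)) (w * S z) = w * S z" "scale (\<alpha> (S z)) (z * S bb) = z * S bb"
proof -
  have "w * S z = sw (w * S z) ad" by (rule sw_ad_self[symmetric])
  then show "scale (\<alpha> (S z)) (w * S z) = w * S z"
    unfolding sw_products[OF bil_ad'] ad_y
    by (simp add: counit_mult w(2) counit_S \<epsilon>_bd S_mult SS \<alpha>m \<alpha>_w \<alpha>_bd)
  have "z * S bb = sw (z * S bb) ad" by (rule sw_ad_self[symmetric])
  then show "scale (\<alpha> (S z)) (z * S bb) = z * S bb"
    unfolding sw_products[OF bil_ad'] ad_y
    by (simp add: counit_mult counit_S \<epsilon>_bd S_mult SS \<alpha>m \<alpha>_w \<alpha>_bd)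
qed

text \<open>Otherwise \<open>u = z S(z) - w S(b)\<close> is a central grouplike element. If it is 1, then \<open>e = z S(z)\<close>
  is idempotent with \<open>\<Delta>(e) = e \<otimes> e - f \<otimes> f\<close>, \<open>f = 1 - e\<close>; comparing with \<open>\<Delta>(e)\<^sup>2\<close> gives \<open>f = 0\<close>.\<close>

lemma \<alpha>_z: "\<alpha> z = 1"
proof (rule ccontr)
  assume c: "\<alpha> z \<noteq> 1"
  then have c': "\<alpha> (S z) \<noteq> 1" using \<alpha>_S(1) by auto
  have wz: "w * S z = 0"
  proof (rule ccontr)
    assume n: "w * S z \<noteq> 0"
    have "scale (\<alpha> (S z)) (w * S z) = scale 1 (w * S z)" using \<alpha>_Sz_fix(1) by simp
    then show False using n c' by (simp only: scale_cancel_right) simp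
  qed
  have zb: "z * S bb = 0"
  proof (rule ccontr)
    assume n: "z * S bb \<noteq> 0"
    have "scale (\<alpha> (S z)) (z * S bb) = scale 1 (z * S bb)" using \<alpha>_Sz_fix(2) by simp
    then show False using n c' by (simp only: scale_cancel_right) simp
  qed
  define e where "e = z * S z"
  define y where "y = w * S bb"
  define u where "u = e - y"
  have bw: "bb * S w = 1 - e" using antipode_relations(1) by (simp add: e_def algebra_simps)
  have ddS: "dd * S dd = 1 - y" using antipode_relations(4) by (simp add: y_def algebra_simps)
  have l: "lin scale s' (\<lambda>x. F x y)" "lin scale s' (\<lambda>y. F x y)" if "bil s' F" for s' and F :: "'h \<Rightarrow> 'h \<Rightarrow> 'w::ab_group_add" and x y
    using that by (auto simp: bil_def)
  have swe: "sw e F = F e e + F (1 - e) y" and swy: "sw y F = F y e + F (1 - y) y" if F: "bil (*) F" for F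
    using sw_products(1,4)[OF F] unfolding wz zb bw ddS e_def[symmetric] y_def[symmetric]
    by (simp_all add: lin_zero[OF l(2)[OF F]])
  have glu: "gl u"
  proof (rule glI)
    show "\<epsilon> u = 1" by (simp add: u_def e_def y_def lin_diff[OF lin\<epsilon>] counit_mult counit_S z(2) w(2))
    fix f f' assume f: "linF f" and f': "linF f'"
    note b = bil_k[OF f f']
    show "sw u (\<lambda>a b. f a * f' b) = f u * f' u"
      unfolding u_def lin_diff[OF sw_linear[OF b]] swe[OF b] swy[OF b] lin_diff[OF f] lin_diff[OF f']
      by (simp add: algebra_simps)
  qed
  have "ad h u = scale (\<epsilon> h) u" for h
    unfolding u_def e_def y_def lin_diff[OF lin_ad(2)] ad_y scale_right_diff_distrib ..
  then have cu: "h * u = u * h" for h using central_iff_ad[of u] by blast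
  have u1: "u = 1"
  proof (rule ccontr)
    assume "u \<noteq> 1"
    from has_normal_central_gl[OF glu this cu dH] show False using nn by blast
  qed
  have yf: "y = - (1 - e)" using u1 unfolding u_def by (simp add: algebra_simps)
  have "y * z = w * (z * S bb)" unfolding y_def mult.assoc z(3)[of "S bb"] ..
  then have "y * z = 0" unfolding zb by simp
  moreover have "(e - y) * z = z" using u1 unfolding u_def by simp
  ultimately have ez: "e * z = z" by (simp add: left_diff_distrib)
  have ee: "e * e = e"
  proof -
    have "e * e = e * z * S z" unfolding mult.assoc by (simp only: e_def)
    then show ?thesis unfolding ez by (simp only: e_def)
  qed
  define f where "f = 1 - e"
  have ef: "e * f = 0" "f * e = 0" "f * f = f" unfolding f_def by (simp_all add: left_diff_distrib right_diff_distrib ee)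
  have swe': "sw e F = F e e - F f f" if F: "bil (*) F" for F
    unfolding swe[OF F] yf f_def lin_minus[OF l(2)[OF F]] by simp
  have "g f = 0" if g: "linF g" for g
  proof -
    note b = bil_k[OF g g]
    note lg = lin_comp[OF g]
    have b2: "bil (*) (\<lambda>c d. g (p * c) * g (q * d))" "bil (*) (\<lambda>p q. sw e (\<lambda>c d. g (p * c) * g (q * d)))" for p q
      by (intro bilF lg lin_intros')+
    have "sw e (\<lambda>a b. g a * g b) = sw (e * e) (\<lambda>a b. g a * g b)" unfolding ee ..
    also have "\<dots> = sw e (\<lambda>p q. sw e (\<lambda>c d. g (p * c) * g (q * d)))" by (rule sw_mult[OF b])
    also have "\<dots> = sw e (\<lambda>c d. g (e * c) * g (e * d)) - sw e (\<lambda>c d. g (f * c) * g (f * d))"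
      by (rule swe'[OF b2(2)])
    also have "\<dots> = g e * g e + g f * g f"
      unfolding swe'[OF b2(1)] ee ef lin_zero[OF g] by simp
    finally have "g e * g e - g f * g f = g e * g e + g f * g f" unfolding swe'[OF b] .
    then have "2 * (g f * g f) = 0" by (simp add: algebra_simps)
    then show ?thesis by simp
  qed
  then have "f = 0" by (intro functional_eqI) (simp add: lin_zero)
  then have "e = 1" unfolding f_def by simp
  then have "w = w * (z * S z)" unfolding e_def by simp
  also have "\<dots> = z * (w * S z)" unfolding mult.assoc[symmetric] z(3)[of w] ..
  also have "\<dots> = 0" unfolding wz by simp
  finally show False using w(3) by simp
qed

section \<open>The Hopf subalgebra generated by the coefficients\<close>

abbreviation "XX \<equiv> {z, w, bb, dd, S z, S w, S bb, S dd}"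
abbreviation "BB \<equiv> alg XX"

lemma \<alpha>_Sz: "\<alpha> (S z) = 1"
  using \<alpha>_S(1) \<alpha>_z by simp

lemmas \<alpha>_simps = \<alpha>_z \<alpha>_w \<alpha>_bd \<alpha>_Sz \<alpha>_S(2-4)

text \<open>The character \<alpha> sends the coefficient matrix and its image under S to the
  identity matrix.\<close>

lemma T_XX: "x \<in> XX \<Longrightarrow> T \<alpha> x = x" and T'_XX: "x \<in> XX \<Longrightarrow> T' \<alpha> x = x"
proof -
  have b: "bil scale (\<lambda>a b. scale (\<alpha> b) a)" "bil scale (\<lambda>a b. scale (\<alpha> a) b)" by (intro bilE lin_intros' l\<alpha>)+
  show "x \<in> XX \<Longrightarrow> T \<alpha> x = x"
    unfolding T_def[of \<alpha>] by (elim insertE emptyE; simp only: sw_C[OF b(1)] sw_SC[OF b(1)] \<alpha>_simps; simp)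
  show "x \<in> XX \<Longrightarrow> T' \<alpha> x = x"
    unfolding T'_def[of \<alpha>] by (elim insertE emptyE; simp only: sw_C[OF b(2)] sw_SC[OF b(2)] \<alpha>_simps; simp)
qed

lemma S_XX: "x \<in> XX \<Longrightarrow> S x \<in> XX"
  by (elim insertE emptyE; simp only: SS; blast)

text \<open>On \<open>XX\<close> both translations by \<alpha> are trivial, so
  \<open>mult_w\<close>, \<open>mult_b\<close> and \<open>mult_d\<close> become plain commutation
  rules; S carries them to the other generators.\<close>

lemma XX_commute:
  assumes "x \<in> XX" "y \<in> XX"
  shows "x * y = y * x"
proof -
  have 0: "h * y = y * h" if h: "h \<in> XX" and y: "y \<in> {z, w, bb, dd}" for h y
  proof -
    have "h * w = w * h" "h * bb = bb * h" "h * dd = dd * h"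
      using mult_w[of h] mult_b[of h] mult_d[of h] unfolding T_XX[OF h] T'_XX[OF h] by blast+
    then show ?thesis using y z(3)[of h] by blast
  qed
  show ?thesis
  proof (cases "y \<in> {z, w, bb, dd}")
    case False
    then have "S y \<in> {z, w, bb, dd}" using assms(2) by (elim insertE emptyE; simp only: SS; blast)
    from arg_cong[OF 0[OF S_XX[OF assms(1)] this], of S] show ?thesis by (simp only: S_mult SS)
  qed (rule 0[OF assms(1)])
qed

lemma XX_BB: "x \<in> XX \<Longrightarrow> x \<in> BB"
  by (rule subsetD[OF alg_superset])

lemmas BBD = subalgD[OF subalg_alg[of XX]]

lemma hsub_BB: "hsub BB"
proof (rule hsub_alg)
  fix x assume x: "x \<in> XX"
  show "S x \<in> BB" by (rule XX_BB[OF S_XX[OF x]])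
  fix f assume f: "linF f"
  have b: "bil scale (\<lambda>a b. scale (f b) a)" "bil scale (\<lambda>a b. scale (f a) b)" by (intro bilE lin_intros' f)+
  have 1: "scale a x + scale c y \<in> BB" if "x \<in> XX" "y \<in> XX" for a c x y
    by (intro subspace_add[OF BBD(1)] subspace_scale[OF BBD(1)] XX_BB that)
  show "T f x \<in> BB" unfolding T_def[of f]
    using x by (elim insertE emptyE; simp only: sw_C[OF b(1)] sw_SC[OF b(1)]; intro 1; simp)
  show "T' f x \<in> BB" unfolding T'_def[of f]
    using x by (elim insertE emptyE; simp only: sw_C[OF b(2)] sw_SC[OF b(2)]; intro 1; simp)
qed

lemma BB_commute: "x \<in> BB \<Longrightarrow> y \<in> BB \<Longrightarrow> x * y = y * x"
proof -
  have 1: "x * y = y * x" if "x \<in> BB" "y \<in> XX" for x y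
    by (rule alg_commute[OF XX_commute that])
  show "x \<in> BB \<Longrightarrow> y \<in> BB \<Longrightarrow> x * y = y * x"
    by (rule alg_commute[OF 1[symmetric], of XX])
qed

lemma T_BB: "x \<in> BB \<Longrightarrow> T \<alpha> x = x"
proof -
  have "BB \<subseteq> {x. T \<alpha> x = x}" by (rule alg_least[OF subalg_fixed[OF \<alpha>]], rule subsetI, rule CollectI, rule T_XX)
  then show "x \<in> BB \<Longrightarrow> T \<alpha> x = x" by blast
qed

lemma BB_nontrivial: "BB \<noteq> range (\<lambda>c. scale c 1)"
proof
  assume "BB = range (\<lambda>c. scale c 1)"
  then obtain c where c: "z = scale c 1" using XX_BB[of z] by blast
  have "c * of_nat dH = 0" using V(3)[OF z(1)] unfolding c lin_scale[OF lin_lm] lm_one .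
  then have "c = 0" using n0 by simp
  then show False using z(2) c lin_zero[OF lin\<epsilon>] by simp
qed

lemma not_ad_stable: "BB \<noteq> UNIV \<Longrightarrow> \<not> (\<forall>h. \<forall>x\<in>BB. ad h x \<in> BB)"
  using nn hsub_BB BB_nontrivial unfolding has_normal_def by blast

text \<open>A trivial \<alpha> would make all generators central in \<open>H\<close>. Then
  \<open>BB\<close> would be stable under ad, hence equal to \<open>H\<close>, and a commutative
  \<open>H\<close> has a nontrivial central grouplike element.\<close>

lemma \<alpha>_nontrivial: "\<alpha> \<noteq> \<epsilon>"
proof
  assume e: "\<alpha> = \<epsilon>"
  have T: "T \<alpha> h = h" "T' \<alpha> h = h" for h
    unfolding e by (rule T_\<epsilon>) (simp only: T'_def sw_counit_left[OF vector_space_axioms lin_ident])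
  have 0: "h * y = y * h" if y: "y \<in> {z, w, bb, dd}" for h y
  proof -
    have "h * w = w * h" "h * bb = bb * h" "h * dd = dd * h"
      using mult_w[of h] mult_b[of h] mult_d[of h] unfolding T by blast+
    then show ?thesis using y z(3)[of h] by blast
  qed
  have c: "h * y = y * h" if y: "y \<in> XX" for h y
  proof (cases "y \<in> {z, w, bb, dd}")
    case False
    then have "S y \<in> {z, w, bb, dd}" using y by (elim insertE emptyE; simp only: SS; blast)
    from arg_cong[OF 0[OF this, of "S h"], of S] show ?thesis by (simp only: S_mult SS)
  qed (rule 0)
  have "BB = UNIV"
  proof (rule ccontr)
    assume "BB \<noteq> UNIV"
    moreover have "ad h x \<in> BB" if "x \<in> BB" for h x by (rule ad_stable_central[OF c that])
    ultimately show False using not_ad_stable by blast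
  qed
  then have comm: "x * y = y * x" for x y :: 'h using BB_commute[of x y] by blast
  obtain g where "gl g" "g \<noteq> 1" using commutative_nontrivial_gl[OF comm dH] by blast
  from has_normal_central_gl[OF this comm dH] show False using nn by blast
qed

section \<open>Dimensions and left coideals in \<open>BB\<close>\<close>

lemma V_BB: "V \<subseteq> BB"
proof
  fix y assume y: "y \<in> V"
  have "scale (\<epsilon> y) z + scale (\<omega> y) w \<in> BB"
    by (intro subspace_add[OF BBD(1)] subspace_scale[OF BBD(1)] XX_BB) simp_all
  then show "y \<in> BB" unfolding \<omega>(4)[OF y, symmetric] .
qed

lemmas V_subspace = lcoidD(1)[OF Vlc]

lemma no_gl_dim:
  assumes "lcoid W" "W \<noteq> {0}" "\<And>g. g \<in> W \<Longrightarrow> \<not> gl g"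
  shows "2 \<le> dim W"
proof -
  have "dim W > 0" by (rule dim_pos[OF lcoidD(1)[OF assms(1)] assms(2)])
  moreover have "dim W \<noteq> 1" using lcoid_dim1_gl[OF assms(1)] assms(3) by blast
  ultimately show ?thesis by linarith
qed

text \<open>A proper nonzero subobject would be one-dimensional and so contain a grouplike element.
  Simplicity over \<open>BB\<close> makes the class equation for \<open>BB\<close>
  available.\<close>

lemma ydsimple_BB_V: "ydsimple BB V"
  unfolding ydsimple_def
proof (intro conjI allI impI)
  show "ydsub BB V"
    using V_BB ydsubD(1,3)[OF ydsimpleD(1)[OF V(1)]] unfolding ydsub_def by blast
  show "V \<noteq> {0}" by (rule ydsimpleD(2)[OF V(1)])
  fix W assume W: "ydsub BB W \<and> W \<subseteq> V \<and> W \<noteq> {0}"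
  then have "2 \<le> dim W" using V(4) by (intro no_gl_dim ydsubD(1)) blast+
  then show "W = V" using W V(2) by (intro fdim_dim_eq[OF fdimI[OF V_subspace]] ydsubD(4)) auto
qed

lemma dim_BB: "2 dvd dim BB" "dim BB \<noteq> 2"
proof -
  show "2 dvd dim BB" using dim_simple_dvd[OF hsub_BB ydsimple_BB_V] V(2) by simp
  show "dim BB \<noteq> 2"
  proof
    assume "dim BB = 2"
    then have "V = BB" using V(2) by (intro fdim_dim_eq[OF fdimI[OF BBD(1)] V_subspace V_BB]) simp
    then have "lm 1 = 0" using V(3) BBD(2) by blast
    then show False using n0 by (simp only: lm_one)
  qed
qed

text \<open>For x in \<open>V\<close> the integral property reads lm(x_1) x_2 = 0, and its
  coefficient at w is the value of \<open>lm\<close> on \<open>T \<omega> x\<close>.\<close>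

lemma lm_C: "x \<in> XX \<Longrightarrow> lm x = 0"
proof -
  have b: "bil scale (\<lambda>a b. scale (lm a) b)" by (intro bilE lin_intros' lin_lm)
  have 1: "lm (T \<omega> y) = 0" if y: "y \<in> V" for y
  proof -
    have "T' lm y = 0" unfolding lm_right using V(3)[OF y] by simp
    then have "scale (lm y) z + scale (lm (T \<omega> y)) w = 0" unfolding T'_def sw_V[OF y b] .
    then show ?thesis using V(3)[OF y] w(3) by simp
  qed
  show "x \<in> XX \<Longrightarrow> lm x = 0"
    by (elim insertE emptyE; simp only: lm_S 1[OF z(1)] 1[OF w(1)] V(3)[OF z(1)] V(3)[OF w(1)])
qed

lemma T'_gl:
  assumes u: "gl u"
  shows "T' (\<lambda>y. lm (S u * y)) y = scale (lm (S u * y)) u"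
proof -
  have b: "bil scale (\<lambda>a b. scale (lm a) b)" by (intro bilE lin_intros' lin_lm)
  have b2: "bil scale (\<lambda>a b. sw y (\<lambda>c d. scale (lm (a * c)) (b * d)))" by (intro bilE lin_intros' lin_comp[OF lin_lm])
  have "sw y (\<lambda>c d. scale (lm (S u * c)) (S u * d)) = scale (lm (S u * y)) 1"
    unfolding lm_right[symmetric] T'_def sw_mult[OF b] sw_gl[OF gl_S[OF u] b2] ..
  then have "u * sw y (\<lambda>c d. scale (lm (S u * c)) (S u * d)) = scale (lm (S u * y)) u"
    by (simp add: scale_mult_right[symmetric])
  then show ?thesis
    by (simp only: T'_def sw_comp[OF lin_eta(2)] scale_mult_right[symmetric] mult.assoc[symmetric] gl_inverse[OF u] mult_1)
qed

text \<open>For a grouplike \<open>u\<close> in the coefficient coalgebra, \<open>\<phi>(y) = lm(S(u) y)\<close> satisfies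
  \<open>\<phi>(y\<^sub>1) y\<^sub>2 = \<phi>(y) u\<close>; on \<open>V\<close> this lies in \<open>V\<close>, so \<open>\<phi>\<close> vanishes, although \<open>\<phi>(u) \<noteq> 0\<close>.\<close>

lemma no_gl_C:
  assumes u: "u \<in> span {z, w, bb, dd}"
  shows "\<not> gl u"
proof
  assume g: "gl u"
  let ?p = "\<lambda>y. lm (S u * y)"
  have lp: "linF ?p" by (intro lin_comp[OF lin_lm] lin_eta)
  have b: "bil scale (\<lambda>a b. scale (?p a) b)" by (intro bilE lin_intros' lp)
  have 1: "?p y = 0 \<and> ?p (T \<omega> y) = 0" if y: "y \<in> V" for y
  proof -
    have eq: "scale (?p y) z + scale (?p (T \<omega> y)) w = scale (?p y) u"
      using T'_gl[OF g, of y] unfolding T'_def sw_V[OF y b] .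
    have "scale (?p y) z + scale (?p (T \<omega> y)) w \<in> V"
      by (intro subspace_add[OF V_subspace] subspace_scale[OF V_subspace] z(1) w(1))
    then have "scale (?p y) u \<in> V" unfolding eq .
    then have "scale (1 / ?p y) (scale (?p y) u) \<in> V" by (rule subspace_scale[OF V_subspace])
    then have p0: "?p y = 0" using V(4)[of u] g by (cases "?p y = 0") simp_all
    then have "scale (?p (T \<omega> y)) w = 0" using eq by simp
    then show ?thesis using p0 w(3) by simp
  qed
  have "?p u = 0"
    by (rule lin_eq_on_span[OF lp lin_k_left[OF lin\<epsilon>, of 0], simplified, OF _ u]) (use 1[OF z(1)] 1[OF w(1)] in auto)
  then show False using n0 by (simp only: gl_inverse[OF g] lm_one)
qed

lemma no_gl_SC:
  assumes u: "u \<in> span {S z, S w, S bb, S dd}"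
  shows "\<not> gl u"
proof
  assume "gl u"
  then have "gl (S u)" by (rule gl_S)
  moreover have "S u \<in> span {z, w, bb, dd}"
    by (rule lin_span[OF linS _ subspace_span u]) (auto simp: SS intro: span_base)
  ultimately show False using no_gl_C by blast
qed

lemma lcoid_span2:
  assumes "\<And>f. linF f \<Longrightarrow> T' f x \<in> span {x, y}" "\<And>f. linF f \<Longrightarrow> T' f y \<in> span {x, y}"
  shows "lcoid (span {x, y})"
  unfolding lcoid_def
proof (intro conjI ballI allI impI subspace_span)
  fix v f assume v: "v \<in> span {x, y}" and f: "linF f"
  show "T' f v \<in> span {x, y}"
    by (rule lin_span[OF linT'[OF f] _ subspace_span v]) (use assms f in auto)
qed

text \<open>\<open>V2\<close> and \<open>W2\<close> are spanned by the images under S of the rows of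
  the coefficient matrix, \<open>W1\<close> by its second column; \<open>V\<close> is spanned by the
  first column.\<close>

abbreviation "V2 \<equiv> span {S z, S bb}"
abbreviation "W1 \<equiv> span {bb, dd}"
abbreviation "W2 \<equiv> span {S w, S dd}"

lemma span2_mem: "scale a x + scale c y \<in> span {x, y}" "scale a y + scale c x \<in> span {x, y}"
  by (intro span_add span_scale span_base; simp)+

lemma lcoid_V2: "lcoid V2" and lcoid_W1: "lcoid W1" and lcoid_W2: "lcoid W2"
proof -
  have b: "bil scale (\<lambda>a b. scale (f a) b)" if "linF f" for f by (intro bilE lin_intros' that)
  show "lcoid V2" by (rule lcoid_span2) (simp_all only: T'_def sw_SC[OF b] span2_mem)
  show "lcoid W1" by (rule lcoid_span2) (simp_all only: T'_def sw_C[OF b] span2_mem)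
  show "lcoid W2" by (rule lcoid_span2) (simp_all only: T'_def sw_SC[OF b] span2_mem)
qed

end

text \<open>After removal of the factor 2, d and m/2 are powers of 3 greater than 1 whose product
  divides 27; only the pairs (3, 3), (3, 9) and (9, 3) remain.\<close>

lemma order_times_dimension:
  fixes d m :: nat
  assumes "d * m dvd 54" "2 dvd m" "m \<noteq> 2" "d > 1"
  shows "d * m = 54 \<or> d = 3 \<and> m = 6"
proof -
  obtain n where m: "m = 2 * n" using assms(2) by (rule dvdE)
  obtain k where k: "54 = d * m * k" using assms(1) by (rule dvdE)
  have "2 * 3 ^ 3 = 2 * (d * n * k)" using k unfolding m by simp
  then have "3 ^ 3 = d * n * k" by (simp only: mult_cancel1) simp
  then have dn: "d * n dvd 3 ^ 3" by (rule dvdI)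
  have p: "prime (3::nat)" by simp
  obtain i where i: "d = 3 ^ i" using dvd_mult_left[OF dn] divides_primepow_nat[OF p] by metis
  obtain j where j: "n = 3 ^ j" using dvd_mult_right[OF dn] divides_primepow_nat[OF p] by metis
  have "i \<noteq> 0" using assms(4) i by (intro notI) simp
  moreover have "j \<noteq> 0" using assms(3) j m by (intro notI) simp
  moreover have "i + j \<le> 3"
  proof (rule power_dvd_imp_le)
    show "(3::nat) ^ (i + j) dvd 3 ^ 3" using dn unfolding i j power_add .
  qed simp
  ultimately have "i = 1 \<and> j = 1 \<or> i = 1 \<and> j = 2 \<or> i = 2 \<and> j = 1" by linarith
  then show ?thesis unfolding m i j by (elim disjE conjE) simp_all
qed

context yd_pair
begin

lemma lm_span: "X \<subseteq> XX \<Longrightarrow> x \<in> span X \<Longrightarrow> lm x = 0"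
proof -
  assume X: "X \<subseteq> XX"
  have "subspace {x. lm x = 0}" using lin_kernel_subspace[OF lin_lm _ subspace_UNIV] by simp
  moreover have "X \<subseteq> {x. lm x = 0}" by (rule subsetI, rule CollectI, rule lm_C) (rule subsetD[OF X])
  ultimately have "span X \<subseteq> {x. lm x = 0}" by (intro span_minimal)
  then show "x \<in> span X \<Longrightarrow> lm x = 0" by blast
qed

lemma span_BB: "X \<subseteq> XX \<Longrightarrow> span X \<subseteq> BB"
  by (rule span_minimal[OF subset_trans[OF _ alg_superset] BBD(1)])

text \<open>Here the simple comodules \<open>V\<close> and \<open>V2\<close> fill up four of the five dimensions of \<open>BB \<inter> ker lm\<close>,
  so every other simple comodule in it without grouplike elements lies in \<open>V + V2\<close>.\<close>

lemma dim_BB_6: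
  assumes m: "dim BB = 6" and sq: "T \<alpha> ^^ 2 \<noteq> id"
  shows False
proof -
  have yV: "ydsub UNIV V" by (rule ydsimpleD(1)[OF V(1)])
  have sSC: "span {S z, S bb} \<subseteq> span {S z, S w, S bb, S dd}" "span {S w, S dd} \<subseteq> span {S z, S w, S bb, S dd}"
    "span {bb, dd} \<subseteq> span {z, w, bb, dd}" by (intro span_mono; blast)+
  have ne: "V2 \<noteq> {0}" "W1 \<noteq> {0}" "W2 \<noteq> {0}"
  proof -
    have "x \<noteq> 0" if "\<alpha> x = 1" for x using that lin_zero[OF l\<alpha>] by auto
    then have "S z \<noteq> 0" "dd \<noteq> 0" "S dd \<noteq> 0" using \<alpha>_simps by blast+
    moreover have "S z \<in> V2" "dd \<in> W1" "S dd \<in> W2" by (simp_all add: span_base)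
    ultimately show "V2 \<noteq> {0}" "W1 \<noteq> {0}" "W2 \<noteq> {0}" by blast+
  qed
  have dV2: "2 \<le> dim V2" by (rule no_gl_dim[OF lcoid_V2 ne(1)]) (use no_gl_SC sSC(1) in blast)
  have adV2: "ad h v \<in> V2" if v: "v \<in> V2" for h v
  proof (rule lin_span[OF lin_ad(2) _ subspace_span v], rule image_subsetI)
    fix x assume "x \<in> {S z, S bb}"
    then show "ad h x \<in> V2" by (elim insertE emptyE; simp only: ad_Sz ad_Sb; intro span_scale span_base; simp)
  qed
  \<comment> \<open>If the simple \<open>V\<close> met \<open>V2\<close> it would be contained in
    it, and w would be proportional to S bb. Their eigencharacters would then agree, so the square
    of \<alpha> would be trivial.\<close>
  have int: "V \<inter> V2 = {0}"
  proof (rule ccontr)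
    assume n: "V \<inter> V2 \<noteq> {0}"
    have "ydsub UNIV (V \<inter> V2)"
      unfolding ydsub_def lcoid_def
    proof (intro conjI ballI allI impI IntI subspace_inter V_subspace subspace_span subset_UNIV)
      fix x f h assume x: "x \<in> V \<inter> V2"
      show "ad h x \<in> V" by (rule ydsubD(3)[OF yV UNIV_I IntD1[OF x]])
      show "ad h x \<in> V2" by (rule adV2[OF IntD2[OF x]])
      assume f: "linF f"
      show "T' f x \<in> V" by (rule lcoidD(2)[OF Vlc IntD1[OF x] f])
      show "T' f x \<in> V2" by (rule lcoidD(2)[OF lcoid_V2 IntD2[OF x] f])
    qed
    then have "V \<inter> V2 = V" by (rule ydsimpleD(3)[OF V(1) _ _ n]) blast
    then have "w \<in> V2" using w(1) by blast
    then obtain s where "w - scale s (S z) \<in> span {S bb}" unfolding span_breakdown_eq[of w "S z"] by blast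
    then obtain t where "w - scale s (S z) = scale t (S bb)" unfolding span_singleton by blast
    then have st: "w = scale s (S z) + scale t (S bb)" by (simp only: diff_eq_eq add.commute)
    have "\<epsilon> w = s" unfolding st lin_add[OF lin\<epsilon>] lin_scale[OF lin\<epsilon>] by (simp add: counit_S z(2) \<epsilon>_bd)
    then have "s = 0" using w(2) by simp
    then have wt: "w = scale t (S bb)" using st by simp
    have "\<alpha> h = \<alpha> (S h)" for h
    proof -
      have "scale (\<alpha> h) w = scale t (ad h (S bb))" unfolding w(4)[symmetric] by (subst wt) (rule lin_scale[OF lin_ad(2)])
      also have "\<dots> = scale (\<alpha> (S h)) (scale t (S bb))" unfolding ad_Sb by (rule scale_left_commute)
      also have "\<dots> = scale (\<alpha> (S h)) w" unfolding wt[symmetric] ..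
      finally show ?thesis using w(3) by simp
    qed
    then have "(\<lambda>h. sw h (\<lambda>a b. \<alpha> a * \<alpha> b)) = \<epsilon>"
      using char_S_right[OF \<alpha>] by (intro ext) (simp only:)
    then have "T \<alpha> (T \<alpha> x) = x" for x unfolding T_T[OF l\<alpha> l\<alpha>] by (simp only: T_\<epsilon>)
    then have "T \<alpha> ^^ 2 = id" by (intro ext) (simp add: numeral_2_eq_2)
    then show False using sq by blast
  qed
  let ?U = "{x + y | x y. x \<in> V \<and> y \<in> V2}"
  have sU: "subspace ?U" by (rule subspace_sums[OF V_subspace subspace_span])
  have dU: "4 \<le> dim ?U"
    using dim_sums_Int[OF V_subspace subspace_span[of "{S z, S bb}"]] dV2 V(2) int by simp
  have V2B: "V2 \<subseteq> BB" by (rule span_BB) blast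
  have UB: "?U \<subseteq> BB" using V_BB V2B subspace_add[OF BBD(1)] by blast
  have lmU: "lm u = 0" if e: "u \<in> ?U" for u
  proof -
    obtain x y where u: "u = x + y" "x \<in> V" "y \<in> V2" using e by blast
    have "lm y = 0" by (rule lm_span[OF _ u(3)]) blast
    then show ?thesis unfolding u(1) lin_add[OF lin_lm] using V(3)[OF u(2)] by simp
  qed
  have U: "lcoid ?U"
    unfolding lcoid_def
  proof (intro conjI ballI allI impI sU)
    fix u f assume "u \<in> ?U" and f: "linF f"
    then obtain x y where u: "u = x + y" "x \<in> V" "y \<in> V2" by blast
    have "T' f u = T' f x + T' f y" unfolding u(1) by (rule lin_add[OF linT'[OF f]])
    then show "T' f u \<in> ?U" using lcoidD(2)[OF Vlc u(2) f] lcoidD(2)[OF lcoid_V2 u(3) f] by blast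
  qed
  have adU: "ad h u \<in> ?U" if e: "u \<in> ?U" for h u
  proof -
    obtain x y where u: "u = x + y" "x \<in> V" "y \<in> V2" using e by blast
    have "ad h u = ad h x + ad h y" unfolding u(1) by (rule lin_add[OF lin_ad(2)])
    then show ?thesis using ydsubD(3)[OF yV UNIV_I u(2)] adV2[OF u(3)] by blast
  qed
  \<comment> \<open>A coideal without grouplike elements has dimension 0 or at least 2, and this
    applies to the intersection with \<open>?U\<close>. If that were 0, the sum would fill
    \<open>BB\<close> and contain 1, where \<open>lm\<close> does not vanish.\<close>
  have sub: "W \<subseteq> ?U" if W: "lcoid W" "W \<noteq> {0}" "W \<subseteq> BB" "dim W \<le> 2" "\<And>x. x \<in> W \<Longrightarrow> lm x = 0" "\<And>g. g \<in> W \<Longrightarrow> \<not> gl g"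
    for W
  proof -
    note sW = lcoidD(1)[OF W(1)]
    have dW: "2 \<le> dim W" by (rule no_gl_dim[OF W(1,2,6)])
    have i: "lcoid (W \<inter> ?U)"
      unfolding lcoid_def
    proof (intro conjI ballI allI impI IntI subspace_inter sW sU)
      fix x f assume x: "x \<in> W \<inter> ?U" and f: "linF f"
      show "T' f x \<in> W" by (rule lcoidD(2)[OF W(1) IntD1[OF x] f])
      show "T' f x \<in> ?U" by (rule lcoidD(2)[OF U IntD2[OF x] f])
    qed
    have "W \<inter> ?U \<noteq> {0}"
    proof
      assume z0: "W \<inter> ?U = {0}"
      let ?X = "{x + y | x y. x \<in> W \<and> y \<in> ?U}"
      have "6 \<le> dim ?X" using dim_sums_Int[OF sW sU] dW dU z0 by simp
      moreover have "?X \<subseteq> BB" using W(3) UB subspace_add[OF BBD(1)] by blast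
      ultimately have "?X = BB" using m by (intro fdim_dim_eq[OF fdimI[OF BBD(1)] subspace_sums[OF sW sU]]) simp_all
      then obtain x y where xy: "1 = x + y" "x \<in> W" "y \<in> ?U" using BBD(2) by blast
      have "lm 1 = 0" unfolding xy(1) lin_add[OF lin_lm] using W(5)[OF xy(2)] lmU[OF xy(3)] by simp
      then show False using n0 by (simp only: lm_one)
    qed
    then have "2 \<le> dim (W \<inter> ?U)" by (rule no_gl_dim[OF i]) (erule IntE, rule W(6))
    then have "W \<inter> ?U = W" using W(4) by (intro fdim_dim_eq[OF fdimI[OF sW] lcoidD(1)[OF i]]) auto
    then show ?thesis by blast
  qed
  have d2: "dim (span {x, y}) \<le> 2" for x y :: 'h
  proof -
    have "dim (span {x, y}) \<le> card {x, y}" by (rule dim_le_card) simp_all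
    also have "\<dots> \<le> 2" by (simp add: card_insert_if)
    finally show ?thesis .
  qed
  have W1U: "W1 \<subseteq> ?U"
  proof (rule sub[OF lcoid_W1 ne(2) span_BB d2 lm_span])
    fix g assume "g \<in> W1"
    then show "\<not> gl g" by (rule no_gl_C[OF subsetD[OF sSC(3)]])
  qed auto
  have W2U: "W2 \<subseteq> ?U"
  proof (rule sub[OF lcoid_W2 ne(3) span_BB d2 lm_span])
    fix g assume "g \<in> W2"
    then show "\<not> gl g" by (rule no_gl_SC[OF subsetD[OF sSC(2)]])
  qed auto
  have VU: "x \<in> ?U" if x: "x \<in> V" for x
  proof -
    have "x + 0 \<in> ?U" using x span_zero[of "{S z, S bb}"] by blast
    then show ?thesis by simp
  qed
  have V2U: "x \<in> ?U" if x: "x \<in> V2" for x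
  proof -
    have "0 + x \<in> ?U" using x subspace_0[OF V_subspace] by blast
    then show ?thesis by simp
  qed
  have s2: "x \<in> span {x, y}" "y \<in> span {x, y}" for x y :: 'h by (simp_all add: span_base)
  \<comment> \<open>All generators lie in \<open>?U\<close>, which is ad-stable and contained in
    \<open>BB\<close>; this makes \<open>BB\<close> ad-stable.\<close>
  have XU: "XX \<subseteq> ?U"
    by (intro insert_subsetI empty_subsetI VU z(1) w(1) V2U s2 subsetD[OF W1U] subsetD[OF W2U])
  have "ad h x \<in> BB" if "x \<in> BB" for h x
  proof (rule ad_stable_alg[OF _ that])
    fix x h assume "x \<in> XX"
    then show "ad h x \<in> BB" by (rule subsetD[OF UB adU[OF subsetD[OF XU]]])
  qed
  moreover have "BB \<noteq> UNIV"
  proof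
    assume "BB = UNIV"
    then show False using m dH by simp
  qed
  ultimately show False using not_ad_stable by blast
qed

lemma contradiction: False
proof -
  obtain d where d: "d > 0" "T \<alpha> ^^ d = id" "\<And>j. 0 < j \<Longrightarrow> j < d \<Longrightarrow> T \<alpha> ^^ j \<noteq> id"
    "d * dim BB dvd dH" "d * dim {x. T \<alpha> x = x} = dH"
    using char_order[OF \<alpha> hsub_BB T_BB] by blast
  have nid: "\<not> (\<forall>x. T \<alpha> x = x)"
  proof
    assume "\<forall>x. T \<alpha> x = x"
    then have "\<alpha> = \<epsilon>" using counit_T[OF l\<alpha>] by (intro ext) simp
    then show False using \<alpha>_nontrivial by blast
  qed
  have "d \<noteq> 1"
  proof
    assume "d = 1"
    then have "T \<alpha> = id" using d(2) by simp
    then show False using nid by simp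
  qed
  then have d1: "d > 1" using d(1) by simp
  have "d * dim BB dvd 54" using d(4) dH by (simp only:)
  from order_times_dimension[OF this dim_BB d1] show False
  proof
    assume "d = 3 \<and> dim BB = 6"
    then show False using dim_BB_6 d(3)[of 2] by simp
  next
    \<comment> \<open>Equality of dimensions makes \<open>BB\<close> the whole fixed algebra of
      translation by \<alpha>, and this translation commutes with ad because \<alpha> is
      ad-invariant.\<close>
    assume e: "d * dim BB = 54"
    let ?R = "{x. T \<alpha> x = x}"
    have "d * dim BB = d * dim ?R" using e d(5) dH by (simp only:)
    then have "dim ?R = dim BB" using d(1) by (simp only: mult_cancel1) simp
    moreover have "subspace ?R" using subalg_fixed[OF \<alpha>] subalgD(1) by blast
    moreover have "BB \<subseteq> ?R" using T_BB by blast
    ultimately have R: "BB = ?R" by (intro fdim_dim_eq[OF fdimI] BBD(1)) simp_all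
    have inv: "\<alpha> (ad m y) = \<epsilon> m * \<alpha> y" for m y
    proof -
      have "\<alpha> (ad m y) = sw m (\<lambda>p q. \<alpha> y * (\<alpha> p * \<alpha> (S q)))"
        unfolding ad_def sw_comp[OF l\<alpha>] \<alpha>m by (simp only: ac_simps)
      then show ?thesis unfolding smulF char_S_right[OF \<alpha>] by simp
    qed
    have "ad h x \<in> BB" if x: "x \<in> BB" for h x
    proof -
      have "T \<alpha> (ad h x) = ad h (T \<alpha> x)" by (rule T_ad[OF hsub_UNIV UNIV_I l\<alpha> inv])
      then have "T \<alpha> (ad h x) = ad h x" unfolding T_BB[OF x] .
      then show ?thesis unfolding R by blast
    qed
    moreover have "BB \<noteq> UNIV" using nid R by blast
    ultimately show False using not_ad_stable by blast
  qed
qed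

end

section \<open>Dimension 54\<close>

context inv_hopf
begin

lemma has_normal_54:
  assumes dH: "dH = 54"
  shows has_normal
proof (rule ccontr)
  assume nn: "\<not> has_normal"
  let ?W = "{x. lm x = 0}"
  have "dim ?W = 53" using lm_kernel(2) dH by simp
  then have "\<not> 3 dvd dim ?W" by simp
  then obtain V where V: "ydsimple UNIV V" "V \<subseteq> ?W" "\<not> 3 dvd dim V"
    using dvd_dim_if_dvd_simple[OF hsub_UNIV lm_kernel(1)] by blast
  note yV = ydsimpleD(1)[OF V(1)]
  note Vs = ydsubD(4)[OF yV]
  have "prime (3::nat)" by simp
  from prime_imp_coprime[OF this V(3)] have "coprime (dim V) 3" by (simp only: coprime_commute)
  then have "coprime (dim V) (3 ^ 3)" by (simp only: coprime_power_right_iff) simp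
  moreover have "dim V dvd 2 * 3 ^ 3" using dim_simple_dvd[OF hsub_UNIV V(1)] dH by simp
  ultimately have "dim V dvd 2" using coprime_dvd_mult_left_iff by blast
  then have "dim V \<le> 2" by (rule dvd_imp_le) simp
  then have d: "dim V = 1 \<or> dim V = 2" using dim_pos[OF Vs ydsimpleD(2)[OF V(1)]] by linarith
  obtain z where z: "z \<in> V" "\<epsilon> z = 1" "\<And>h. h * z = z * h"
    using simple_central_element[OF hsub_UNIV V(1)] by blast
  have lmV: "lm x = 0" if "x \<in> V" for x using V(2) that by blast
  show False
  proof (cases "dim V = 1")
    case True
    obtain g where g: "g \<in> V" "gl g" using lcoid_dim1_gl[OF ydsubD(1)[OF yV] True] by blast
    have "z \<noteq> 0" using z(2) lin_zero[OF lin\<epsilon>] by auto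
    then have "V = span {z}" by (rule span_singleton_dim1[OF Vs True z(1)])
    then obtain c where c: "g = scale c z" using g(1) unfolding span_singleton by blast
    have "c = 1" using gl_\<epsilon>[OF g(2)] unfolding c lin_scale[OF lin\<epsilon>] z(2) by simp
    then have gz: "gl z" using g(2) c by simp
    have "z \<noteq> 1" using lmV[OF z(1)] lm_one n0 by auto
    from has_normal_central_gl[OF gz this z(3) dH] show False using nn by blast
  next
    case False
    then have d2: "dim V = 2" using d by blast
    have ngl: "\<not> gl g" if "g \<in> V" for g using has_normal_gl_dim2[OF yV d2 that _ dH] nn by blast
    let ?K = "{x \<in> V. \<epsilon> x = 0}"
    have K1: "dim ?K = 1" using dim_kernel_functional[OF lin\<epsilon> Vs z(1,2)] d2 by simp
    have sK: "subspace ?K" using lin_kernel_subspace[OF lin\<epsilon> _ Vs] by simp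
    have "?K \<noteq> {0}" using K1 by auto
    then obtain w where w: "w \<in> V" "\<epsilon> w = 0" "w \<noteq> 0" using subspace_0[OF sK] by blast
    have K: "?K = span {w}" by (rule span_singleton_dim1[OF sK K1 _ w(3)]) (use w in blast)
    \<comment> \<open>The counit is multiplicative for ad, so ad preserves the line
      \<open>?K\<close>, and w is a common eigenvector.\<close>
    have "\<exists>c. ad h w = scale c w" for h
    proof -
      have "ad h w \<in> ?K" using ydsubD(3)[OF yV UNIV_I w(1)] by (simp add: counit_ad w(2))
      then show ?thesis unfolding K span_singleton by blast
    qed
    then obtain \<alpha> where \<alpha>: "\<And>h. ad h w = scale (\<alpha> h) w" by metis
    have uniq: "a = c" if "scale a w = scale c w" for a c using that w(3) by simp
    have \<alpha>c: "\<alpha> \<in> chars"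
      unfolding chars_def
    proof (intro CollectI conjI allI linI)
      fix x y c
      show "\<alpha> (x + y) = \<alpha> x + \<alpha> y"
        by (rule uniq) (simp only: \<alpha>[symmetric] scale_left_distrib lin_add[OF lin_ad(1)])
      show "\<alpha> (scale c x) = c * \<alpha> x"
        by (rule uniq) (simp only: \<alpha>[symmetric] scale_scale[symmetric] lin_scale[OF lin_ad(1)])
      show "\<alpha> (x * y) = \<alpha> x * \<alpha> y"
      proof (rule uniq)
        have "scale (\<alpha> (x * y)) w = ad x (scale (\<alpha> y) w)" unfolding \<alpha>[symmetric] by (rule ad_mult)
        also have "\<dots> = scale (\<alpha> x * \<alpha> y) w" unfolding lin_scale[OF lin_ad(2)] \<alpha> by (simp add: mult.commute)
        finally show "scale (\<alpha> (x * y)) w = scale (\<alpha> x * \<alpha> y) w" .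
      qed
      show "\<alpha> 1 = 1" by (rule uniq) (simp only: \<alpha>[symmetric] ad_one scale_one)
    qed
    obtain f where f: "linF f" "f w \<noteq> 0" using functional_eqI[of w 0] w(3) lin_zero by metis
    \<comment> \<open>The coordinate at w, extended to a functional on all of \<open>H\<close> by
      correcting and rescaling \<open>f\<close>.\<close>
    define \<omega> where "\<omega> x = 1 / f w * (f x - f z * \<epsilon> x)" for x
    have l\<omega>: "linF \<omega>" unfolding \<omega>_def by (intro lin_k_left lin_minus' vector_space_mult f(1) lin\<epsilon>)
    have \<omega>1: "\<omega> z = 0" "\<omega> w = 1" using f(2) by (simp_all add: \<omega>_def z(2) w(2))
    have \<omega>V: "y = scale (\<epsilon> y) z + scale (\<omega> y) w" if y: "y \<in> V" for y
    proof -
      have "y - scale (\<epsilon> y) z \<in> ?K"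
        using subspace_diff[OF Vs y subspace_scale[OF Vs z(1)]] by (simp add: lin_diff[OF lin\<epsilon>] lin_scale[OF lin\<epsilon>] z(2))
      then obtain c where c: "y - scale (\<epsilon> y) z = scale c w" unfolding K span_singleton by blast
      have "\<omega> y = c" using arg_cong[OF c, of \<omega>] by (simp add: lin_diff[OF l\<omega>] lin_scale[OF l\<omega>] \<omega>1)
      then show ?thesis using c by (simp add: algebra_simps)
    qed
    interpret yd_pair scale comult counit antipode Basis V z w \<alpha> \<omega>
      by unfold_locales (fact V(1) d2 lmV ngl z w \<alpha> l\<omega> \<omega>1 \<omega>V \<alpha>c dH nn)+
    show False by (rule contradiction)
  qed
qed

end

theorem theorem12p2p1:
  fixes scale :: "'k::{alg_closed_field, field_char_0} \<Rightarrow> 'h::ring_1 \<Rightarrow> 'h"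
    and comult :: "'h \<Rightarrow> ('h \<times> 'h \<Rightarrow>\<^sub>0 'k)"
    and counit :: "'h \<Rightarrow> 'k"
    and antipode :: "'h \<Rightarrow> 'h"
  assumes "hopf_algebra scale comult counit antipode"
    and "algebra_over.semisimple_algebra scale"
    and "vector_space.dim scale (UNIV :: 'h set) = 54"
  shows "\<exists>A. hopf_algebra.proper_hopf_subalgebra scale comult antipode A \<and>
             hopf_algebra.normal_hopf_subalgebra scale comult antipode A"
proof -
  interpret hopf_algebra scale comult counit antipode by (rule assms(1))
  obtain Basis :: "'h set" where B: "independent Basis" "UNIV \<subseteq> span Basis" "card Basis = 54"
    using basis_exists[of UNIV] assms(3) by metis
  have "finite Basis" using B(3) card.infinite by fastforce
  then interpret finite_dimensional_vector_space scale Basis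
    using B by unfold_locales auto
  interpret ss_hopf scale comult counit antipode Basis
    by unfold_locales (rule assms(2))
  interpret inv_hopf scale comult counit antipode Basis
    by unfold_locales (rule S2_id)
  show ?thesis by (rule proper_normal_hopf_subalgebra_exists[OF has_normal_54[OF assms(3)]])
qed

end
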